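(* Let $\omega>0$ (cutoff frequency) and $\rho>0$ be fixed, with $\rho\tau\le 1$. Let $r\ge 0$ be an integer such that $f\in C^r_{\rm b}(J;L^2(\Omega))$. Let $e:=u-w_{h\tau}$ be the error, where $u$ is the solution of the wave equation and $w_{h\tau}$ is the $C^2$-in-time reconstruction of the leapfrog solution. Then $$\int_0^{+\infty}\Big\{\|\dot e(t)\|_\Omega^2+\|\nabla e(t)\|_\Omega^2\Big\}e^{-2\rho t}\,dt \le \int_0^{+\infty}\Bigg\{\|\mathcal R(t)\|_{V'}^2+\frac{20}{\rho^2}\|\nabla\dot\delta_{h\tau}(t)\|_\Omega^2+40\,\gamma_{\rho,\omega}(h)^2\|\mathcal R(t)\|_{V'}^2+\frac{11}{\rho^2}\|\eta_f(t)\|_\Omega^2+\frac{8}{\rho^2}\frac{1}{\omega^{2r}}\|f^{(r)}(t)\|_\Omega^2\Bigg\}e^{-2\rho t}\,dt .$$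
   Context: Continuous problem. $\Omega\subset\mathbb R^d$, $d\ge1$, is an open bounded Lipschitz polyhedron, $J:=[0,+\infty)$, $V:=H^1_0(\Omega)$, $(\cdot,\cdot)_\Omega$ and $\|\cdot\|_\Omega$ are the $L^2(\Omega)$ inner product and norm (same notation for vector-valued functions). Dots (or superscripts $(r)$) denote time derivatives. For a Banach space $Y$, $C^r_{\rm b}(J;Y):=\{v\in C^r(J;Y): v^{(r)}\in L^\infty(J;Y)\}$ and $C^2_{0,}(J;Y):=\{v\in C^2(J;Y): v(0)=\dot v(0)=0\}$. The source $f\in H^1(J;L^2(\Omega))\cap L^\infty(J;L^2(\Omega))$ is supported away from zero, i.e. it vanishes for $t$ in a neighborhood of $0$ in $J$. The solution $u\in C^2_{0,}(J;L^2(\Omega))\cap C^0(J;V)$ satisfies $(\ddot u(t),v)_\Omega+(\nabla u(t),\nabla v)_\Omega=(f(t),v)_\Omega$ for all $t\in J$, $v\in V$. Discrete problem. $\mathcal T_h$ is an affine simplicial mesh covering $\Omega$ exactly, and $V_h\subset V$ is the space of continuous, piecewise polynomial functions of degree at most $k\ge1$ on $\mathcal T_h$ vanishing on $\partial\Omega$ (Lagrange finite elements). $\tau>0$ is a constant time step, $t^n:=n\tau$ and $J_n:=[t^n,t^{n+1})$ for $n\in\mathbb N$ ($0\in\mathbb N$). The leapfrog solution $U=(U^n)_{n\in\mathbb N}\subset V_h$ satisfies $U^0=U^1=0$ and $\frac1{\tau^2}(U^{n+1}-2U^n+U^{n-1},v_h)_\Omega+(\nabla U^n,\nabla v_h)_\Omega=(f(t^n),v_h)_\Omega$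 for all $n\ge1$, $v_h\in V_h$. Time reconstructions. Sequences are extended by zero to negative indices. For a sequence $W=(W^n)_{n\in\mathbb N}$ and $t\in J_n$, $$R(W)(t):=W^n+\frac{W^{n+1}-W^{n-1}}{2\tau}(t-t^n)+\frac{W^{n+1}-2W^n+W^{n-1}}{\tau^2}\frac12(t-t^n)^2,$$ $$L(W)(t):=\alpha^n+\beta^n(t-t^n)+\gamma^n\tfrac12(t-t^n)^2+\vartheta^n\tfrac16(t-t^n)^3+\epsilon^n\tfrac1{24}(t-t^n)^4,$$ with $\alpha^n=\frac{3W^{n+1}+17W^n+5W^{n-1}-W^{n-2}}{24}$, $\beta^n=\frac{5W^{n+1}+3W^n-9W^{n-1}+W^{n-2}}{12\tau}$, $\gamma^n=\frac{W^{n+1}-2W^n+W^{n-1}}{\tau^2}$, $\vartheta^n=\frac{W^{n+2}-2W^{n+1}+2W^{n-1}-W^{n-2}}{2\tau^3}$, $\epsilon^n=\frac{W^{n+2}-4W^{n+1}+6W^n-4W^{n-1}+W^{n-2}}{\tau^4}$. Set $u_{h\tau}:=R(U)$, $w_{h\tau}:=L(U)$, $f_\tau:=R((f(t^n))_{n\in\mathbb N})$, $\delta_{h\tau}:=u_{h\tau}-w_{h\tau}$ (whose time derivative is computed on each $J_n$), $\eta_f:=f-f_\tau$. The reconstructions $u_{h\tau}$ and $w_{h\tau}$ are taken in broken polynomial spaces in time that are subspaces of $L^\infty(J;V_h)$, i.e. they are bounded in time. Residual. $\mathcal R(t)\in V'$ is $\langle\mathcal R(t),v\rangle:=(f_\tau(t),v)_\Omega-(\ddot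 w_{h\tau}(t),v)_\Omega-(\nabla w_{h\tau}(t),\nabla v)_\Omega$, $v\in V$, and $\|\mathcal R(t)\|_{V'}:=\sup_{v\in V,\ \|\nabla v\|_\Omega=1}|\langle\mathcal R(t),v\rangle|$. Approximation factor. Let $\hat V:=H^1_0(\Omega;\mathbb C)$ and $\hat V_h$ the complex-valued version of $V_h$; $(\cdot,\cdot)_\Omega$ is antilinear in its second argument on complex functions. For $s\in\mathbb C$, $b_s(\hat\phi,\hat v):=s^2(\hat\phi,\hat v)_\Omega+(\nabla\hat\phi,\nabla\hat v)_\Omega$. For $\Re(s)>0$ and $\hat g\in L^2(\Omega;\mathbb C)$, $\hat\chi_g\in\hat V$ solves $b_s(\hat w,\hat\chi_g)=|s|^2(\hat w,\hat g)_\Omega$ for all $\hat w\in\hat V$. Then $\gamma_s(h):=\sup_{\hat g\in L^2(\Omega;\mathbb C),\ |s|\|\hat g\|_\Omega=1}\min_{\hat v_h\in\hat V_h}\|\nabla(\hat\chi_g-\hat v_h)\|_\Omega$ and $\gamma_{\rho,\omega}(h):=\max\{\gamma_s(h): s=\rho+i\nu,\ \nu\in\mathbb R,\ |\nu|\le\omega\}$. *)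

theory Defs
  imports "HOL-Analysis.Analysis"
begin

section \<open>The Hilbert space of square-integrable functions\<close>

definition sq_integrable :: "('a::euclidean_space \<Rightarrow> 'b::euclidean_space) \<Rightarrow> bool" where
  "sq_integrable f \<longleftrightarrow> f \<in> borel_measurable lborel \<and> integrable lborel (\<lambda>x. (norm (f x))\<^sup>2)"

lemma sq_integrable_measurable: "sq_integrable f \<Longrightarrow> f \<in> borel_measurable lborel"
  by (simp add: sq_integrable_def)

lemma sq_integrable_zero: "sq_integrable (\<lambda>x. 0)"
  by (simp add: sq_integrable_def)

lemma sq_integrable_scaleR:
  assumes "sq_integrable f" shows "sq_integrable (\<lambda>x. c *\<^sub>R f x)"
  using assms by (auto simp: sq_integrable_def power_mult_distrib)

lemma norm_add_sq_le: "(norm (x + y))\<^sup>2 \<le> 2 * (norm x)\<^sup>2 + 2 * (norm (y::'a::real_normed_vector))\<^sup>2"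
proof -
  have "(norm (x + y))\<^sup>2 \<le> (norm x + norm y)\<^sup>2"
    by (rule power_mono[OF norm_triangle_ineq]) simp
  also have "\<dots> \<le> 2 * (norm x)\<^sup>2 + 2 * (norm y)\<^sup>2"
    using sum_squares_bound[of "norm x" "norm y"] by (simp add: power2_sum)
  finally show ?thesis .
qed

lemma sq_integrable_add:
  assumes f: "sq_integrable f" and g: "sq_integrable g"
  shows "sq_integrable (\<lambda>x. f x + g x)"
proof -
  have [measurable]: "f \<in> borel_measurable lborel" "g \<in> borel_measurable lborel"
    using f g by (auto simp: sq_integrable_def)
  have "integrable lborel (\<lambda>x. 2 * (norm (f x))\<^sup>2 + 2 * (norm (g x))\<^sup>2)"
    using f g by (auto simp: sq_integrable_def)
  then have "integrable lborel (\<lambda>x. (norm (f x + g x))\<^sup>2)"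
    by (rule Bochner_Integration.integrable_bound) (auto simp: norm_add_sq_le)
  then show ?thesis by (simp add: sq_integrable_def)
qed

lemma sq_integrable_minus:
  assumes "sq_integrable f" shows "sq_integrable (\<lambda>x. - f x)"
  using sq_integrable_scaleR[OF assms, of "-1"] by simp

lemma sq_integrable_diff:
  assumes "sq_integrable f" "sq_integrable g" shows "sq_integrable (\<lambda>x. f x - g x)"
  using sq_integrable_add[OF assms(1) sq_integrable_minus[OF assms(2)]] by simp

lemma sq_integrable_inner:
  assumes f: "sq_integrable f" and g: "sq_integrable g"
  shows "integrable lborel (\<lambda>x. f x \<bullet> g x)"
proof -
  have [measurable]: "f \<in> borel_measurable lborel" "g \<in> borel_measurable lborel"
    using f g by (auto simp: sq_integrable_def)
  have "integrable lborel (\<lambda>x. (norm (f x))\<^sup>2 + (norm (g x))\<^sup>2)"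
    using f g by (auto simp: sq_integrable_def)
  then show ?thesis
  proof (rule Bochner_Integration.integrable_bound)
    show "AE x in lborel. norm (f x \<bullet> g x) \<le> norm ((norm (f x))\<^sup>2 + (norm (g x))\<^sup>2)"
    proof (intro AE_I2)
      fix x
      have "\<bar>f x \<bullet> g x\<bar> \<le> norm (f x) * norm (g x)" by (rule Cauchy_Schwarz_ineq2)
      also have "\<dots> \<le> (norm (f x))\<^sup>2 + (norm (g x))\<^sup>2"
        using sum_squares_bound[of "norm (f x)" "norm (g x)"]
          mult_nonneg_nonneg[OF norm_ge_zero[of "f x"] norm_ge_zero[of "g x"]] by linarith
      finally show "norm (f x \<bullet> g x) \<le> norm ((norm (f x))\<^sup>2 + (norm (g x))\<^sup>2)" by simp
    qed
  qed measurable
qed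

quotient_type (overloaded) ('a, 'b) L2 = "'a::euclidean_space \<Rightarrow> 'b::euclidean_space" /
  partial: "\<lambda>f g. sq_integrable f \<and> sq_integrable g \<and> (AE x in lborel. f x = g x)"
  morphisms rep_L2 abs_L2
proof (rule part_equivpI)
  show "\<exists>f::'a \<Rightarrow> 'b. sq_integrable f \<and> sq_integrable f \<and> (AE x in lborel. f x = f x)"
    using sq_integrable_zero by blast
  show "symp (\<lambda>f g::'a \<Rightarrow> 'b. sq_integrable f \<and> sq_integrable g \<and> (AE x in lborel. f x = g x))"
    by (rule sympI) (auto elim: eventually_mono)
  show "transp (\<lambda>f g::'a \<Rightarrow> 'b. sq_integrable f \<and> sq_integrable g \<and> (AE x in lborel. f x = g x))"
  proof (rule transpI, intro conjI)
    fix f g h :: "'a \<Rightarrow> 'b"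
    assume 1: "sq_integrable f \<and> sq_integrable g \<and> (AE x in lborel. f x = g x)"
      and 2: "sq_integrable g \<and> sq_integrable h \<and> (AE x in lborel. g x = h x)"
    from 1 2 show "sq_integrable f" "sq_integrable h" by auto
    from 1 have "AE x in lborel. f x = g x" by blast
    moreover from 2 have "AE x in lborel. g x = h x" by blast
    ultimately show "AE x in lborel. f x = h x" by eventually_elim simp
  qed
qed

lemma sq_integrable_rep_L2: "sq_integrable (rep_L2 v)"
  using Quotient3_rep_reflp[OF Quotient3_L2, of v] by blast

lemma abs_rep_L2: "abs_L2 (rep_L2 v) = v"
  by (rule Quotient3_abs_rep[OF Quotient3_L2])

lemma abs_L2_eq_iff:
  assumes "sq_integrable f" "sq_integrable g"
  shows "abs_L2 f = abs_L2 g \<longleftrightarrow> (AE x in lborel. f x = g x)"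
  using Quotient3_rel[OF Quotient3_L2, of f g] assms by auto

lemma rep_abs_L2:
  assumes "sq_integrable f" shows "AE x in lborel. rep_L2 (abs_L2 f) x = f x"
  using abs_L2_eq_iff[OF sq_integrable_rep_L2 assms, of "abs_L2 f"] by (simp add: abs_rep_L2)

instantiation L2 :: (euclidean_space, euclidean_space) real_vector
begin

lift_definition zero_L2 :: "('a, 'b) L2" is "\<lambda>x. 0"
  by (simp add: sq_integrable_zero)

lift_definition plus_L2 :: "('a, 'b) L2 \<Rightarrow> ('a, 'b) L2 \<Rightarrow> ('a, 'b) L2" is "\<lambda>f g x. f x + g x"
proof (intro conjI)
  fix f f' g g' :: "'a \<Rightarrow> 'b"
  assume 1: "sq_integrable f \<and> sq_integrable f' \<and> (AE x in lborel. f x = f' x)"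
    and 2: "sq_integrable g \<and> sq_integrable g' \<and> (AE x in lborel. g x = g' x)"
  from 1 2 show "sq_integrable (\<lambda>x. f x + g x)" "sq_integrable (\<lambda>x. f' x + g' x)"
    by (simp_all add: sq_integrable_add)
  from 1 have "AE x in lborel. f x = f' x" by blast
  moreover from 2 have "AE x in lborel. g x = g' x" by blast
  ultimately show "AE x in lborel. f x + g x = f' x + g' x" by eventually_elim simp
qed

lift_definition uminus_L2 :: "('a, 'b) L2 \<Rightarrow> ('a, 'b) L2" is "\<lambda>f x. - f x"
  by (auto simp: sq_integrable_minus)

lift_definition scaleR_L2 :: "real \<Rightarrow> ('a, 'b) L2 \<Rightarrow> ('a, 'b) L2" is "\<lambda>c f x. c *\<^sub>R f x"
  by (auto simp: sq_integrable_scaleR elim: eventually_mono)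

definition minus_L2 :: "('a, 'b) L2 \<Rightarrow> ('a, 'b) L2 \<Rightarrow> ('a, 'b) L2" where
  "minus_L2 v w = v + (- w)"

instance
proof
  fix a b :: real and u v w :: "('a, 'b) L2"
  show "u + v + w = u + (v + w)"
    by transfer (auto simp: sq_integrable_add add.assoc)
  show "u + v = v + u"
    by transfer (auto simp: sq_integrable_add add.commute)
  show "0 + u = u"
    by transfer auto
  show "- u + u = 0"
    by transfer (auto simp: sq_integrable_zero)
  show "u - v = u + - v" by (rule minus_L2_def)
  show "a *\<^sub>R (u + v) = a *\<^sub>R u + a *\<^sub>R v"
    by transfer (auto simp: sq_integrable_add sq_integrable_scaleR scaleR_right_distrib)
  show "(a + b) *\<^sub>R u = a *\<^sub>R u + b *\<^sub>R u"
    by transfer (auto simp: sq_integrable_add sq_integrable_scaleR scaleR_left_distrib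
        intro!: sq_integrable_add)
  show "a *\<^sub>R b *\<^sub>R u = (a * b) *\<^sub>R u"
    by transfer (auto simp: sq_integrable_scaleR)
  show "1 *\<^sub>R u = u"
    by transfer auto
qed

end

instantiation L2 :: (euclidean_space, euclidean_space) real_inner
begin

lift_definition inner_L2 :: "('a, 'b) L2 \<Rightarrow> ('a, 'b) L2 \<Rightarrow> real"
  is "\<lambda>f g. \<integral>x. f x \<bullet> g x \<partial>lborel"
proof -
  fix f f' g g' :: "'a \<Rightarrow> 'b"
  assume 1: "sq_integrable f \<and> sq_integrable f' \<and> (AE x in lborel. f x = f' x)"
    and 2: "sq_integrable g \<and> sq_integrable g' \<and> (AE x in lborel. g x = g' x)"
  have [measurable]: "f \<in> borel_measurable lborel" "f' \<in> borel_measurable lborel"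
      "g \<in> borel_measurable lborel" "g' \<in> borel_measurable lborel"
    using 1 2 by (auto simp: sq_integrable_def)
  from 1 have "AE x in lborel. f x = f' x" by blast
  moreover from 2 have "AE x in lborel. g x = g' x" by blast
  ultimately have "AE x in lborel. f x \<bullet> g x = f' x \<bullet> g' x" by eventually_elim simp
  then show "(\<integral>x. f x \<bullet> g x \<partial>lborel) = (\<integral>x. f' x \<bullet> g' x \<partial>lborel)"
    by (intro integral_cong_AE) auto
qed

definition norm_L2 :: "('a, 'b) L2 \<Rightarrow> real" where
  "norm_L2 v = sqrt (v \<bullet> v)"

definition sgn_L2 :: "('a, 'b) L2 \<Rightarrow> ('a, 'b) L2" where
  "sgn_L2 v = v /\<^sub>R norm v"

definition dist_L2 :: "('a, 'b) L2 \<Rightarrow> ('a, 'b) L2 \<Rightarrow> real" where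
  "dist_L2 v w = norm (v - w)"

definition uniformity_L2 :: "(('a, 'b) L2 \<times> ('a, 'b) L2) filter" where
  "uniformity_L2 = (INF e\<in>{0<..}. principal {(x, y). dist x y < e})"

definition open_L2 :: "('a, 'b) L2 set \<Rightarrow> bool" where
  "open_L2 U \<longleftrightarrow> (\<forall>x\<in>U. eventually (\<lambda>(x', y). x' = x \<longrightarrow> y \<in> U) uniformity)"

instance
proof
  fix a :: real and u v w :: "('a, 'b) L2"
  show "dist u v = norm (u - v)" by (rule dist_L2_def)
  show "sgn u = u /\<^sub>R norm u" by (rule sgn_L2_def)
  show "(uniformity :: (('a, 'b) L2 \<times> ('a, 'b) L2) filter)
      = (INF e\<in>{0<..}. principal {(x, y). dist x y < e})" by (rule uniformity_L2_def)
  show "open U \<longleftrightarrow> (\<forall>x\<in>U. eventually (\<lambda>(x', y). x' = x \<longrightarrow> y \<in> U) uniformity)"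
    for U :: "('a, 'b) L2 set" by (rule open_L2_def)
  show "u \<bullet> v = v \<bullet> u"
    by transfer (simp add: inner_commute)
  show "(u + v) \<bullet> w = u \<bullet> w + v \<bullet> w"
    by transfer (simp add: inner_add_left sq_integrable_inner)
  show "(a *\<^sub>R u) \<bullet> v = a * (u \<bullet> v)"
    by transfer simp
  show "0 \<le> u \<bullet> u"
    by transfer simp
  show "u \<bullet> u = 0 \<longleftrightarrow> u = 0"
  proof transfer
    fix f :: "'a \<Rightarrow> 'b"
    assume f: "sq_integrable f \<and> sq_integrable f \<and> (AE x in lborel. f x = f x)"
    then have "(\<integral>x. f x \<bullet> f x \<partial>lborel) = 0 \<longleftrightarrow> (AE x in lborel. f x \<bullet> f x = 0)"
      by (intro integral_nonneg_eq_0_iff_AE) (auto simp: sq_integrable_inner)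
    with f show "(\<integral>x. f x \<bullet> f x \<partial>lborel) = 0 \<longleftrightarrow>
        (sq_integrable f \<and> sq_integrable (\<lambda>x. 0 :: 'b) \<and> (AE x in lborel. f x = 0))"
      by (simp add: sq_integrable_zero)
  qed
  show "norm u = sqrt (u \<bullet> u)" by (rule norm_L2_def)
qed

end

lemma abs_L2_zero: "abs_L2 (\<lambda>x. 0) = 0"
  by (simp add: zero_L2_def)

lemma abs_L2_add:
  assumes "sq_integrable f" "sq_integrable g"
  shows "abs_L2 (\<lambda>x. f x + g x) = abs_L2 f + abs_L2 g"
  using assms plus_L2.abs_eq[of f g] by simp

lemma abs_L2_scaleR:
  assumes "sq_integrable f" shows "abs_L2 (\<lambda>x. c *\<^sub>R f x) = c *\<^sub>R abs_L2 f"
  using assms scaleR_L2.abs_eq[of f c] by simp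

lemma abs_L2_diff:
  assumes "sq_integrable f" "sq_integrable g"
  shows "abs_L2 (\<lambda>x. f x - g x) = abs_L2 f - abs_L2 g"
  using abs_L2_add[OF assms(1) sq_integrable_scaleR[OF assms(2), of "-1"]]
    abs_L2_scaleR[OF assms(2), of "-1"] by simp

lemma inner_abs_L2:
  assumes "sq_integrable f" "sq_integrable g"
  shows "abs_L2 f \<bullet> abs_L2 g = (\<integral>x. f x \<bullet> g x \<partial>lborel)"
  using assms inner_L2.abs_eq[of f g] by simp

lemma norm_abs_L2:
  assumes "sq_integrable f"
  shows "(norm (abs_L2 f))\<^sup>2 = (\<integral>x. (norm (f x))\<^sup>2 \<partial>lborel)"
  using assms by (simp add: power2_norm_eq_inner inner_abs_L2)

lemma nn_integral_norm_abs_L2: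
  assumes "sq_integrable f"
  shows "(\<integral>\<^sup>+x. ennreal ((norm (f x))\<^sup>2) \<partial>lborel) = ennreal ((norm (abs_L2 f))\<^sup>2)"
  using assms by (subst norm_abs_L2) (auto simp: sq_integrable_def intro!: nn_integral_eq_integral)

lemma sq_integrableI_nn:
  assumes "f \<in> borel_measurable lborel" "(\<integral>\<^sup>+x. ennreal ((norm (f x))\<^sup>2) \<partial>lborel) < \<infinity>"
  shows "sq_integrable f"
  using assms by (auto simp: sq_integrable_def intro!: integrableI_nonneg)

lemma L2_summable_half:
  fixes a :: "nat \<Rightarrow> real"
  assumes "\<And>k. 0 \<le> a k" "\<And>k. a k \<le> C * (1/2)^k" shows "summable (\<lambda>k. a k)"
proof (rule summable_comparison_test')
  show "summable (\<lambda>k. C * (1/2)^k)" by (intro summable_mult summable_geometric) simp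
  show "norm (a k) \<le> C * (1/2)^k" if "k \<ge> 0" for k using assms[of k] by simp
qed

instance L2 :: (euclidean_space, euclidean_space) complete_space
proof
  fix X :: "nat \<Rightarrow> ('a, 'b) L2" assume X: "Cauchy X"
  have "\<exists>r::nat \<Rightarrow> nat. strict_mono r \<and> (\<forall>k. \<forall>m\<ge>r k. \<forall>n\<ge>r k. dist (X m) (X n) < (1/4)^k)"
  proof -
    have ex: "\<exists>M. \<forall>m\<ge>M. \<forall>n\<ge>M. dist (X m) (X n) < (1/4)^k" for k
      using X by (simp add: Cauchy_def)
    then obtain N where N: "\<And>k. \<forall>m\<ge>N k. \<forall>n\<ge>N k. dist (X m) (X n) < (1/4)^k" by metis
    define r where "r k = (\<Sum>i\<le>k. Suc (N i))" for k
    have "strict_mono r" by (rule strict_monoI_Suc) (simp add: r_def)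
    moreover have "N k \<le> r k" for k
      unfolding r_def by (rule order_trans[OF _ member_le_sum[of k]]) auto
    ultimately show ?thesis using N by (meson order_trans)
  qed
  then obtain r where r: "strict_mono r"
    and rd: "\<And>k m n. m \<ge> r k \<Longrightarrow> n \<ge> r k \<Longrightarrow> dist (X m) (X n) < (1/4)^k" by blast
  define F where "F k = rep_L2 (X (r k))" for k
  have F: "sq_integrable (F k)" for k by (simp add: F_def sq_integrable_rep_L2)
  have XF: "X (r k) = abs_L2 (F k)" for k by (simp add: F_def abs_rep_L2)
  have [measurable]: "F k \<in> borel_measurable lborel" for k
    using F by (rule sq_integrable_measurable)
  have FD: "(\<integral>\<^sup>+x. ennreal ((norm (F j x - F k x))\<^sup>2) \<partial>lborel)
      = ennreal ((dist (X (r j)) (X (r k)))\<^sup>2)" for j k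
    using nn_integral_norm_abs_L2[OF sq_integrable_diff[OF F F], of j k]
    by (simp add: abs_L2_diff[OF F F] XF dist_norm)
  define d where "d k x = (norm (F (Suc k) x - F k x))\<^sup>2" for k x
  have [measurable]: "d k \<in> borel_measurable lborel" for k unfolding d_def by measurable
  have "(\<integral>\<^sup>+x. (\<Sum>k. ennreal (4^k * d k x)) \<partial>lborel) = (\<Sum>k. \<integral>\<^sup>+x. ennreal (4^k * d k x) \<partial>lborel)"
    by (rule nn_integral_suminf) measurable
  also have "\<dots> \<le> (\<Sum>k. ennreal ((1/2)^k))"
  proof (rule suminf_le)
    fix k
    have "(\<integral>\<^sup>+x. ennreal (4^k * d k x) \<partial>lborel) = ennreal (4^k) * (\<integral>\<^sup>+x. ennreal (d k x) \<partial>lborel)"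
      by (subst nn_integral_cmult[symmetric]) (auto simp: ennreal_mult d_def)
    also have "\<dots> = ennreal (4^k * (dist (X (r (Suc k))) (X (r k)))\<^sup>2)"
      unfolding d_def FD by (simp add: ennreal_mult)
    also have "\<dots> \<le> ennreal ((1/2)^k)"
    proof (rule ennreal_leI)
      have "dist (X (r (Suc k))) (X (r k)) \<le> (1/4)^k"
        using rd[of k "r (Suc k)" "r k"] r by (simp add: strict_mono_less_eq less_imp_le)
      then have "(dist (X (r (Suc k))) (X (r k)))\<^sup>2 \<le> ((1/4)^k)\<^sup>2"
        by (rule power_mono) simp
      then have "4^k * (dist (X (r (Suc k))) (X (r k)))\<^sup>2 \<le> 4^k * ((1/4)^k)\<^sup>2"
        by (rule mult_left_mono) simp
      also have "4^k * ((1/4)^k)\<^sup>2 = (1/4::real)^k"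
        by (simp add: power2_eq_square field_simps)
      also have "\<dots> \<le> (1/2)^k" by (rule power_mono) auto
      finally show "4^k * (dist (X (r (Suc k))) (X (r k)))\<^sup>2 \<le> (1/2)^k" .
    qed
    finally show "(\<integral>\<^sup>+x. ennreal (4^k * d k x) \<partial>lborel) \<le> ennreal ((1/2)^k)" .
  qed auto
  also have "\<dots> = ennreal (\<Sum>k. (1/2)^k)"
    by (rule suminf_ennreal2) (auto intro: summable_geometric)
  also have "ennreal (\<Sum>k. (1/2)^k) < \<infinity>" by simp
  finally have fin: "(\<integral>\<^sup>+x. (\<Sum>k. ennreal (4^k * d k x)) \<partial>lborel) < \<infinity>" .
  have "AE x in lborel. (\<Sum>k. ennreal (4^k * d k x)) \<noteq> \<infinity>"
    by (rule nn_integral_noteq_infinite) (use fin in auto)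
  then have conv: "AE x in lborel. convergent (\<lambda>k. F k x)"
  proof eventually_elim
    fix x assume x: "(\<Sum>k. ennreal (4^k * d k x)) \<noteq> \<infinity>"
    define C where "C = enn2real (\<Sum>k. ennreal (4^k * d k x))"
    have C: "4^k * d k x \<le> C" for k
    proof -
      have "ennreal (4^k * d k x) \<le> (\<Sum>k. ennreal (4^k * d k x))"
        using sum_le_suminf[of "\<lambda>k. ennreal (4^k * d k x)" "{k}"] by auto
      also have "\<dots> = ennreal C" using x by (simp add: C_def less_top)
      finally show ?thesis by (simp add: C_def ennreal_le_iff)
    qed
    have C0: "0 \<le> C" by (simp add: C_def)
    have "summable (\<lambda>k. norm (F (Suc k) x - F k x))"
    proof (rule L2_summable_half)
      fix k
      have p4: "(2^k)\<^sup>2 = (4::real)^k"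
        by (simp add: power2_eq_square flip: power_mult_distrib)
      have "(norm (F (Suc k) x - F k x))\<^sup>2 \<le> (sqrt C * (1/2)^k)\<^sup>2"
        using C[of k] C0
        by (simp add: d_def power_mult_distrib power_divide p4 field_simps)
      then show "norm (F (Suc k) x - F k x) \<le> sqrt C * (1/2)^k"
        by (rule power2_le_imp_le) (simp add: C0)
    qed simp
    then have "summable (\<lambda>k. F (Suc k) x - F k x)" by (rule summable_norm_cancel)
    then have "convergent (\<lambda>n. \<Sum>k<n. F (Suc k) x - F k x)"
      by (simp add: summable_iff_convergent)
    then have "convergent (\<lambda>n. F n x - F 0 x)" by (simp only: sum_lessThan_telescope[of "\<lambda>k. F k x"])
    then show "convergent (\<lambda>k. F k x)"
      using convergent_add_const_right_iff[of "\<lambda>k. F k x" "- F 0 x"] by simp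
  qed
  define G where "G x = lim (\<lambda>k. F k x)" for x
  have [measurable]: "G \<in> borel_measurable lborel" unfolding G_def by measurable
  from conv have lim: "AE x in lborel. (\<lambda>k. F k x) \<longlonglongrightarrow> G x"
    by eventually_elim (simp add: G_def convergent_LIMSEQ_iff)
  have bd: "(\<integral>\<^sup>+x. ennreal ((norm (F k x - G x))\<^sup>2) \<partial>lborel) \<le> ennreal (((1/4)^k)\<^sup>2)" for k
  proof -
    have "(\<integral>\<^sup>+x. ennreal ((norm (F k x - G x))\<^sup>2) \<partial>lborel)
        = (\<integral>\<^sup>+x. liminf (\<lambda>j. ennreal ((norm (F k x - F j x))\<^sup>2)) \<partial>lborel)"
    proof (rule nn_integral_cong_AE, use lim in eventually_elim)
      fix x assume "(\<lambda>j. F j x) \<longlonglongrightarrow> G x"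
      then have "(\<lambda>j. ennreal ((norm (F k x - F j x))\<^sup>2)) \<longlonglongrightarrow> ennreal ((norm (F k x - G x))\<^sup>2)"
        by (intro tendsto_ennrealI tendsto_intros)
      then show "ennreal ((norm (F k x - G x))\<^sup>2) = liminf (\<lambda>j. ennreal ((norm (F k x - F j x))\<^sup>2))"
        by (rule lim_imp_Liminf[OF trivial_limit_sequentially, symmetric])
    qed
    also have "\<dots> \<le> liminf (\<lambda>j. \<integral>\<^sup>+x. ennreal ((norm (F k x - F j x))\<^sup>2) \<partial>lborel)"
      by (rule nn_integral_liminf) measurable
    also have "\<dots> \<le> limsup (\<lambda>j. \<integral>\<^sup>+x. ennreal ((norm (F k x - F j x))\<^sup>2) \<partial>lborel)"
      by (rule Liminf_le_Limsup) simp
    also have "\<dots> \<le> ennreal (((1/4)^k)\<^sup>2)"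
    proof (rule Limsup_bounded, use eventually_ge_at_top[of k] in eventually_elim)
      fix j assume "k \<le> j"
      then have "dist (X (r k)) (X (r j)) \<le> (1/4)^k"
        using rd[of k "r k" "r j"] r by (simp add: strict_mono_less_eq less_imp_le)
      then show "(\<integral>\<^sup>+x. ennreal ((norm (F k x - F j x))\<^sup>2) \<partial>lborel) \<le> ennreal (((1/4)^k)\<^sup>2)"
        unfolding FD by (intro ennreal_leI power_mono) auto
    qed
    finally show ?thesis .
  qed
  have FG: "sq_integrable (\<lambda>x. F k x - G x)" for k
    by (rule sq_integrableI_nn) (use bd[of k] in \<open>auto intro: le_less_trans\<close>)
  have G: "sq_integrable G"
    using sq_integrable_diff[OF F FG, of 0 0] by simp
  have dG: "dist (X (r k)) (abs_L2 G) \<le> (1/4)^k" for k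
  proof -
    have "ennreal ((dist (X (r k)) (abs_L2 G))\<^sup>2) \<le> ennreal (((1/4)^k)\<^sup>2)"
      using bd[of k] nn_integral_norm_abs_L2[OF FG, of k]
      by (simp add: abs_L2_diff[OF F G] XF dist_norm)
    then have "(dist (X (r k)) (abs_L2 G))\<^sup>2 \<le> ((1/4)^k)\<^sup>2"
      by (subst (asm) ennreal_le_iff) auto
    then show ?thesis by (rule power2_le_imp_le) simp
  qed
  have "(\<lambda>k. X (r k)) \<longlonglongrightarrow> abs_L2 G"
  proof (rule metric_tendsto_imp_tendsto)
    show "(\<lambda>k. (1/4::real)^k) \<longlonglongrightarrow> 0" by (rule LIMSEQ_power_zero) simp
    show "\<forall>\<^sub>F k in sequentially. dist (X (r k)) (abs_L2 G) \<le> dist ((1/4::real)^k) 0"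
      using dG by (simp add: dist_real_def)
  qed
  then show "convergent X"
    using Cauchy_converges_subseq[OF X r, of "abs_L2 G"] by (auto simp: convergent_def o_def)
qed

instance L2 :: (euclidean_space, euclidean_space) banach ..

lemma subspace_closure_L2:
  fixes S :: "('v::real_normed_vector) set"
  assumes "subspace S" shows "subspace (closure S)"
  unfolding subspace_def
proof (intro conjI ballI allI)
  show "0 \<in> closure S" using assms closure_subset subspace_0 by blast
next
  fix x y assume "x \<in> closure S" "y \<in> closure S"
  then obtain a b where "\<And>n. a n \<in> S" "a \<longlonglongrightarrow> x" "\<And>n. b n \<in> S" "b \<longlonglongrightarrow> y"
    by (auto simp: closure_sequential)
  then show "x + y \<in> closure S" using assms
    by (auto simp: closure_sequential subspace_def intro!: exI[of _ "\<lambda>n. a n + b n"] tendsto_add)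
next
  fix c x assume "x \<in> closure S"
  then obtain a where "\<And>n. a n \<in> S" "a \<longlonglongrightarrow> x"
    by (auto simp: closure_sequential)
  then show "c *\<^sub>R x \<in> closure S" using assms
    by (auto simp: closure_sequential subspace_def intro!: exI[of _ "\<lambda>n. c *\<^sub>R a n"] tendsto_scaleR)
qed

lemma countable_dense_span:
  fixes S :: "('v::real_normed_vector) set"
  assumes "countable S"
  obtains D where "countable D" "closure (span S) \<subseteq> closure D"
proof
  define D where "D = (\<lambda>l. \<Sum>(q, s)\<leftarrow>l. real_of_rat q *\<^sub>R s) ` lists (UNIV \<times> S)"
  show "countable D" unfolding D_def
    by (intro countable_image countable_lists countable_SIGMA assms) auto
  have D0: "0 \<in> D" unfolding D_def by (rule image_eqI[of _ _ "[]"]) auto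
  have DS: "real_of_rat q *\<^sub>R s + y \<in> D" if "s \<in> S" "y \<in> D" for q s y
  proof -
    from that obtain l where "l \<in> lists (UNIV \<times> S)" "y = (\<Sum>(q, s)\<leftarrow>l. real_of_rat q *\<^sub>R s)"
      by (auto simp: D_def)
    with that show ?thesis unfolding D_def by (intro image_eqI[of _ _ "(q, s) # l"]) auto
  qed
  have "span S \<subseteq> closure D"
  proof
    fix x assume "x \<in> span S"
    then show "x \<in> closure D"
    proof (induction rule: span_induct_alt)
      case base
      show ?case using D0 closure_subset by blast
    next
      case (step c s y)
      show ?case unfolding closure_approachable
      proof (intro allI impI)
        fix e :: real assume e: "0 < e"
        obtain y' where y': "y' \<in> D" "dist y' y < e / 2"
          using step e by (auto simp: closure_approachable dest!: spec[of _ "e/2"])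
        have "c < c + e / (2 * (norm s + 1))"
          using e by (simp add: add_nonneg_pos)
        then obtain q where q: "c < real_of_rat q" "real_of_rat q < c + e / (2 * (norm s + 1))"
          using of_rat_dense by blast
        have "norm ((real_of_rat q - c) *\<^sub>R s) \<le> e / (2 * (norm s + 1)) * norm s"
        proof -
          have "norm ((real_of_rat q - c) *\<^sub>R s) = (real_of_rat q - c) * norm s" using q by simp
          moreover have "real_of_rat q - c \<le> e / (2 * (norm s + 1))" using q by linarith
          ultimately show ?thesis by (metis mult_right_mono norm_ge_zero)
        qed
        also have "\<dots> = e / 2 * (norm s / (norm s + 1))" by simp
        also have "\<dots> \<le> e / 2 * 1"
        proof (rule mult_left_mono)
          have "0 < norm s + 1" using norm_ge_zero[of s] by linarith
          then show "norm s / (norm s + 1) \<le> 1" by (simp add: divide_le_eq_1_pos)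
        qed (use e in simp)
        finally have "norm ((real_of_rat q - c) *\<^sub>R s) \<le> e / 2" by simp
        then have "norm ((real_of_rat q - c) *\<^sub>R s + (y' - y)) < e"
          using y'(2) norm_triangle_ineq[of "(real_of_rat q - c) *\<^sub>R s" "y' - y"]
          by (simp add: dist_norm)
        then have "dist (real_of_rat q *\<^sub>R s + y') (c *\<^sub>R s + y) < e"
          by (simp add: dist_norm algebra_simps)
        with DS[OF step(1) y'(1)] show "\<exists>z\<in>D. dist z (c *\<^sub>R s + y) < e" by blast
      qed
    qed
  qed
  then show "closure (span S) \<subseteq> closure D"
    by (rule closure_minimal) simp
qed

lemma abs_L2_sum:
  assumes "finite I" "\<And>i. i \<in> I \<Longrightarrow> sq_integrable (f i)"
  shows "sq_integrable (\<lambda>x. \<Sum>i\<in>I. f i x)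
    \<and> abs_L2 (\<lambda>x. \<Sum>i\<in>I. f i x) = (\<Sum>i\<in>I. abs_L2 (f i))"
  using assms
  by (induction I rule: finite_induct) (auto simp: sq_integrable_zero abs_L2_zero sq_integrable_add abs_L2_add)

lemma abs_L2_tendsto:
  fixes f :: "'a::euclidean_space \<Rightarrow> 'b::euclidean_space"
  assumes f: "sq_integrable f" and h: "sq_integrable (h :: 'a \<Rightarrow> real)"
    and F: "\<And>i::nat. F i \<in> borel_measurable lborel"
    and bd: "\<And>i x. norm (F i x) \<le> h x" and lim: "\<And>x. (\<lambda>i. F i x) \<longlonglongrightarrow> f x"
  shows "(\<lambda>i. abs_L2 (F i)) \<longlonglongrightarrow> abs_L2 f" "\<And>i. sq_integrable (F i)"
proof -
  have [measurable]: "\<And>i. F i \<in> borel_measurable lborel" "f \<in> borel_measurable lborel"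
    using F f by (auto simp: sq_integrable_def)
  have h2: "integrable lborel (\<lambda>x. (h x)\<^sup>2)" using h by (simp add: sq_integrable_def)
  have h0: "0 \<le> h x" for x using bd[of 0 x] norm_ge_zero order_trans by blast
  show Fi: "\<And>i. sq_integrable (F i)"
    unfolding sq_integrable_def
    using Bochner_Integration.integrable_bound[OF h2, of "\<lambda>x. (norm (F _ x))\<^sup>2"] bd h0
    by (auto intro!: power_mono)
  have fh: "norm (f x) \<le> h x" for x
    using bd by (intro LIMSEQ_le_const2[OF tendsto_norm[OF lim]]) auto
  have "(\<lambda>i. \<integral>x. (norm (F i x - f x))\<^sup>2 \<partial>lborel) \<longlonglongrightarrow> integral\<^sup>L lborel (\<lambda>x::'a. 0)"
  proof (rule integral_dominated_convergence[where w="\<lambda>x. 4 * (h x)\<^sup>2"])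
    show "integrable lborel (\<lambda>x. 4 * (h x)\<^sup>2)" using h2 by simp
    show "AE x in lborel. (\<lambda>i. (norm (F i x - f x))\<^sup>2) \<longlonglongrightarrow> 0"
    proof (rule AE_I2)
      fix x
      have "(\<lambda>i. (norm (F i x - f x))\<^sup>2) \<longlonglongrightarrow> (norm (f x - f x))\<^sup>2"
        by (intro tendsto_intros lim)
      then show "(\<lambda>i. (norm (F i x - f x))\<^sup>2) \<longlonglongrightarrow> 0" by simp
    qed
    show "AE x in lborel. norm ((norm (F i x - f x))\<^sup>2) \<le> 4 * (h x)\<^sup>2" for i
    proof (rule AE_I2)
      fix x
      have "norm (F i x - f x) \<le> 2 * h x"
        using norm_triangle_ineq4[of "F i x" "f x"] bd[of i x] fh[of x] by linarith
      then have "(norm (F i x - f x))\<^sup>2 \<le> (2 * h x)\<^sup>2" by (rule power_mono) simp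
      then show "norm ((norm (F i x - f x))\<^sup>2) \<le> 4 * (h x)\<^sup>2" by (simp add: power_mult_distrib)
    qed
  qed auto
  moreover have "(\<integral>x. (norm (F i x - f x))\<^sup>2 \<partial>lborel) = (dist (abs_L2 (F i)) (abs_L2 f))\<^sup>2" for i
    using norm_abs_L2[OF sq_integrable_diff[OF Fi f], of i] by (simp add: abs_L2_diff[OF Fi f] dist_norm)
  ultimately have "(\<lambda>i. (dist (abs_L2 (F i)) (abs_L2 f))\<^sup>2) \<longlonglongrightarrow> 0" by simp
  then have "(\<lambda>i. sqrt ((dist (abs_L2 (F i)) (abs_L2 f))\<^sup>2)) \<longlonglongrightarrow> sqrt 0"
    by (rule tendsto_real_sqrt)
  then show "(\<lambda>i. abs_L2 (F i)) \<longlonglongrightarrow> abs_L2 f"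
    by (subst tendsto_dist_iff) simp
qed

lemma sq_integrable_indicator:
  assumes "A \<in> sets borel"
  shows "sq_integrable (\<lambda>x::'a::euclidean_space. indicat_real (A \<inter> ball 0 n) x *\<^sub>R (e::'b::euclidean_space))"
proof -
  have [measurable]: "A \<in> sets borel" by fact
  have "integrable lborel (\<lambda>x::'a. indicat_real (A \<inter> ball 0 n) x * (norm e)\<^sup>2)"
  proof (intro integrable_mult_left integrable_real_indicator)
    have "emeasure lborel (A \<inter> ball 0 n) \<le> emeasure lborel (ball (0::'a) n)"
      by (rule emeasure_mono) auto
    also have "\<dots> < \<infinity>" by (rule emeasure_lborel_ball_finite)
    finally show "emeasure lborel (A \<inter> ball 0 n) < \<infinity>" .
  qed simp
  moreover have "(\<lambda>x::'a. (norm (indicat_real (A \<inter> ball 0 n) x *\<^sub>R e))\<^sup>2)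
      = (\<lambda>x. indicat_real (A \<inter> ball 0 n) x * (norm e)\<^sup>2)"
    by (auto simp: indicator_def)
  ultimately show ?thesis by (auto simp: sq_integrable_def)
qed

lemma L2_separable: "\<exists>D :: ('a::euclidean_space, 'b::euclidean_space) L2 set. countable D \<and> closure D = UNIV"
proof -
  obtain B :: "'a set set" where B: "countable B" "topological_basis B"
    using ex_countable_basis by blast
  define B' where "B' = Inter ` {F. finite F \<and> F \<subseteq> B}"
  have B': "countable B'" unfolding B'_def
    by (intro countable_image countable_Collect_finite_subset B)
  have Bopen: "open A" if "A \<in> B'" for A
    using that B(2) by (auto simp: B'_def dest: topological_basis_open subsetD)
  have "B \<subseteq> B'" unfolding B'_def by (auto intro!: image_eqI[of _ _ "{_}"])
  have Binter: "Int_stable B'"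
  proof (rule Int_stableI)
    fix a b assume "a \<in> B'" "b \<in> B'"
    then obtain F G where "finite F" "F \<subseteq> B" "a = \<Inter>F" "finite G" "G \<subseteq> B" "b = \<Inter>G"
      by (auto simp: B'_def)
    then show "a \<inter> b \<in> B'" unfolding B'_def by (intro image_eqI[of _ _ "F \<union> G"]) auto
  qed
  have Bsig: "sets borel = sigma_sets UNIV B'"
  proof
    have "sets borel = sigma_sets UNIV B"
      using arg_cong[OF borel_eq_countable_basis[OF B], of sets] by (simp add: sets_measure_of)
    also have "\<dots> \<subseteq> sigma_sets UNIV B'" by (rule sigma_sets_mono') fact
    finally show "sets borel \<subseteq> sigma_sets UNIV B'" .
    have "B' \<subseteq> sets borel" using Bopen by auto
    then show "sigma_sets UNIV B' \<subseteq> sets borel"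
      using sets.sigma_sets_subset[of B' borel] by simp
  qed
  define I :: "'a set \<Rightarrow> nat \<Rightarrow> 'b \<Rightarrow> ('a, 'b) L2"
    where "I A n e = abs_L2 (\<lambda>x. indicat_real (A \<inter> ball 0 (real n)) x *\<^sub>R e)" for A n e
  define S where "S = (\<lambda>(A, n, e). I A n e) ` (B' \<times> (UNIV::nat set) \<times> (Basis::'b set))"
  define M where "M = closure (span S)"
  have "countable S" unfolding S_def
    by (intro countable_image countable_SIGMA B') (auto intro: countable_finite)
  then obtain D where D: "countable D" "closure (span S) \<subseteq> closure D"
    by (rule countable_dense_span)
  have M: "subspace M" unfolding M_def by (rule subspace_closure_L2) simp
  have Mlim: "l \<in> M" if "\<And>n. a n \<in> M" "a \<longlonglongrightarrow> l" for a :: "nat \<Rightarrow> _" and l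
    unfolding M_def
    by (rule closed_sequentially[of _ a]) (use that in \<open>auto simp: M_def\<close>)
  note sqi = sq_integrable_indicator[where 'a='a and 'b='b]
  have ind: "I A n e \<in> M" if A: "A \<in> sets borel" and e: "e \<in> Basis" for A n e
  proof -
    have base: "I A n e \<in> M" if "A \<in> B'" for A
      unfolding M_def using that e
      by (intro subsetD[OF closure_subset] span_base) (auto simp: S_def intro!: image_eqI[of _ _ "(A, n, e)"])
    have UN: "UNIV \<in> B'" unfolding B'_def by (rule image_eqI[of _ _ "{}"]) auto
    have diff: "I (UNIV - A) n e = I UNIV n e - I A n e" if "A \<in> sets borel" for A
    proof -
      have "(\<lambda>x::'a. indicat_real ((UNIV - A) \<inter> ball 0 (real n)) x *\<^sub>R e)
        = (\<lambda>x. indicat_real (UNIV \<inter> ball 0 (real n)) x *\<^sub>R e - indicat_real (A \<inter> ball 0 (real n)) x *\<^sub>R e)"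
        by (auto simp: indicator_def)
      then show ?thesis unfolding I_def using that using abs_L2_diff[OF sqi[of UNIV] sqi[OF that], of "real n" e "real n" e] by simp
    qed
    have BP: "B' \<subseteq> Pow UNIV" by simp
    from A have As: "A \<in> sigma_sets UNIV B'" by (simp add: Bsig)
    from Binter BP As have "A \<in> sets borel \<and> I A n e \<in> M"
    proof (induction rule: sigma_sets_induct_disjoint)
      case (basic A)
      then show ?case using base Bopen by auto
    next
      case empty
      show ?case using subspace_0[OF M] by (simp add: I_def abs_L2_zero)
    next
      case (compl A)
      then have "I UNIV n e - I A n e \<in> M" using base[OF UN] by (intro subspace_diff[OF M]) auto
      with compl show ?case by (auto simp: diff)
    next
      case (union A)
      then have Ab: "\<And>i. A i \<in> sets borel" by auto
      define C where "C k = (\<Union>i<k. A i)" for k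
      have Cb: "C k \<in> sets borel" for k unfolding C_def using Ab by auto
      have CM: "I (C k) n e \<in> M" for k
      proof (induction k)
        case 0
        show ?case using subspace_0[OF M] by (simp add: C_def I_def abs_L2_zero)
      next
        case (Suc k)
        have "C k \<inter> A k = {}"
        proof -
          have "A i \<inter> A k = {}" if "i < k" for i
            using union(1) that unfolding disjoint_family_on_def by (metis UNIV_I nat_neq_iff)
          then show ?thesis unfolding C_def by blast
        qed
        then have "(\<lambda>x::'a. indicat_real (C (Suc k) \<inter> ball 0 (real n)) x *\<^sub>R e)
          = (\<lambda>x. indicat_real (C k \<inter> ball 0 (real n)) x *\<^sub>R e + indicat_real (A k \<inter> ball 0 (real n)) x *\<^sub>R e)"
        proof -
          have "C (Suc k) = C k \<union> A k" by (auto simp: C_def lessThan_Suc)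
          with \<open>C k \<inter> A k = {}\<close> show ?thesis by (auto simp: indicator_def fun_eq_iff)
        qed
        then have "I (C (Suc k)) n e = I (C k) n e + I (A k) n e"
          unfolding I_def by (simp only: abs_L2_add[OF sqi[OF Cb] sqi[OF Ab]])
        with Suc union show ?case by (auto intro!: subspace_add[OF M])
      qed
      have "(\<lambda>k. I (C k) n e) \<longlonglongrightarrow> I (\<Union>i. A i) n e"
        unfolding I_def
      proof (rule abs_L2_tendsto(1)[where h="\<lambda>x. indicat_real (UNIV \<inter> ball 0 (real n)) x *\<^sub>R norm e"])
        show "sq_integrable (\<lambda>x::'a. indicat_real (\<Union> (range A) \<inter> ball 0 (real n)) x *\<^sub>R e)"
          using Ab by (intro sqi) auto
        show "sq_integrable (\<lambda>x::'a. indicat_real (UNIV \<inter> ball 0 (real n)) x *\<^sub>R norm e)"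
          by (rule sq_integrable_indicator) simp
        show "(\<lambda>x::'a. indicat_real (C i \<inter> ball 0 (real n)) x *\<^sub>R e) \<in> borel_measurable lborel" for i
          using sqi[OF Cb] by (rule sq_integrable_measurable)
        show "norm (indicat_real (C i \<inter> ball 0 (real n)) x *\<^sub>R e)
          \<le> indicat_real (UNIV \<inter> ball 0 (real n)) x *\<^sub>R norm e" for i and x :: 'a
          by (auto simp: indicator_def)
        show "(\<lambda>i. indicat_real (C i \<inter> ball 0 (real n)) x *\<^sub>R e)
          \<longlonglongrightarrow> indicat_real (\<Union> (range A) \<inter> ball 0 (real n)) x *\<^sub>R e" for x :: 'a
        proof (rule tendsto_eventually)
          show "\<forall>\<^sub>F i in sequentially. indicat_real (C i \<inter> ball 0 (real n)) x *\<^sub>R e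
              = indicat_real (\<Union> (range A) \<inter> ball 0 (real n)) x *\<^sub>R e"
          proof (cases "x \<in> \<Union> (range A)")
            case True
            then obtain j where "x \<in> A j" by auto
            then have "x \<in> C i" if "j < i" for i using that by (auto simp: C_def)
            with True show ?thesis
              using eventually_gt_at_top[of j]
              by (elim eventually_mono) (auto simp: indicator_def)
          next
            case False
            then show ?thesis by (auto simp: C_def indicator_def)
          qed
        qed
      qed
      then have "I (\<Union>i. A i) n e \<in> M" using CM by (rule Mlim[rotated])
      then show ?case using Ab by auto
    qed
    then show ?thesis by simp
  qed
  have indy: "I A n y \<in> M" if A: "A \<in> sets borel" for A n y
  proof -
    have "(\<lambda>x::'a. indicat_real (A \<inter> ball 0 (real n)) x *\<^sub>R y)
      = (\<lambda>x. \<Sum>e\<in>Basis. (y \<bullet> e) *\<^sub>R (indicat_real (A \<inter> ball 0 (real n)) x *\<^sub>R e))"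
      by (auto simp: indicator_def euclidean_representation fun_eq_iff)
    then have "I A n y = (\<Sum>e\<in>Basis. (y \<bullet> e) *\<^sub>R I A n e)"
      unfolding I_def
      using abs_L2_sum[of "Basis::'b set" "\<lambda>e x::'a. (y \<bullet> e) *\<^sub>R (indicat_real (A \<inter> ball 0 (real n)) x *\<^sub>R e)"]
      by (simp only: sq_integrable_scaleR[OF sqi[OF A]] finite_Basis abs_L2_scaleR[OF sqi[OF A]])
    also have "\<dots> \<in> M" using ind[OF A] by (auto intro!: subspace_sum[OF M] subspace_scale[OF M])
    finally show ?thesis .
  qed
  have "v \<in> M" for v
  proof -
    define f where "f = rep_L2 v"
    have f: "sq_integrable f" and vf: "v = abs_L2 f" by (simp_all add: f_def sq_integrable_rep_L2 abs_rep_L2)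
    obtain F where F: "\<And>i. simple_function lborel (F i)" "\<And>x. (\<lambda>i. F i x) \<longlonglongrightarrow> f x"
      "\<And>i x. dist (F i x) 0 \<le> 2 * dist (f x) 0"
      using borel_measurable_implies_sequence_metric[OF sq_integrable_measurable[OF f], of 0] by auto
    define G where "G i x = indicat_real (ball 0 (real i)) x *\<^sub>R F i x" for i and x :: 'a
    have "(\<lambda>i. abs_L2 (G i)) \<longlonglongrightarrow> abs_L2 f"
    proof (rule abs_L2_tendsto(1)[OF f, where h="\<lambda>x. 2 * norm (f x)"])
      have "sq_integrable (\<lambda>x. norm (f x))" using f by (auto simp: sq_integrable_def)
      from sq_integrable_scaleR[OF this, of 2]
      show "sq_integrable (\<lambda>x. 2 * norm (f x))" by simp
      have "F i \<in> borel_measurable lborel" for i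
        using F(1) by (rule borel_measurable_simple_function)
      then show "G i \<in> borel_measurable lborel" for i
        unfolding G_def by (intro borel_measurable_scaleR borel_measurable_indicator) auto
      show "norm (G i x) \<le> 2 * norm (f x)" for i x
        using F(3)[of i x] by (auto simp: G_def indicator_def dist_norm)
      show "(\<lambda>i. G i x) \<longlonglongrightarrow> f x" for x
      proof (rule Lim_transform_eventually[OF F(2)])
        obtain N where "norm x < real N" using reals_Archimedean2 by blast
        then show "\<forall>\<^sub>F i in sequentially. F i x = G i x"
          using eventually_ge_at_top[of N] by (elim eventually_mono) (auto simp: G_def indicator_def)
      qed
    qed
    moreover have "abs_L2 (G i) \<in> M" for i
    proof -
      have fin: "finite (range (F i))" using F(1)[of i] by (simp add: simple_function_def)
      have Fm: "F i -` {y} \<in> sets borel" for y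
        using simple_functionD(2)[OF F(1)[of i], of "{y}"] by simp
      have "G i = (\<lambda>x. \<Sum>y\<in>range (F i). indicat_real (F i -` {y} \<inter> ball 0 (real i)) x *\<^sub>R y)"
      proof
        fix x
        have "(\<Sum>y\<in>range (F i). indicat_real (F i -` {y} \<inter> ball 0 (real i)) x *\<^sub>R y)
          = (\<Sum>y\<in>range (F i). if F i x = y then indicat_real (ball 0 (real i)) x *\<^sub>R y else 0)"
          by (rule sum.cong) (auto simp: indicator_def)
        also have "\<dots> = G i x" using fin by (simp add: G_def)
        finally show "G i x = (\<Sum>y\<in>range (F i). indicat_real (F i -` {y} \<inter> ball 0 (real i)) x *\<^sub>R y)" ..
      qed
      then have "abs_L2 (G i) = (\<Sum>y\<in>range (F i). I (F i -` {y}) i y)"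
        unfolding I_def
        using abs_L2_sum[OF fin, of "\<lambda>y x. indicat_real (F i -` {y} \<inter> ball 0 (real i)) x *\<^sub>R y"]
        by (simp only: sqi[OF Fm])
      also have "\<dots> \<in> M" by (intro subspace_sum[OF M] indy Fm)
      finally show ?thesis .
    qed
    ultimately show "v \<in> M" unfolding vf by (rule Mlim[rotated])
  qed
  with D show ?thesis unfolding M_def by blast
qed

instance L2 :: (euclidean_space, euclidean_space) second_countable_topology
proof
  obtain D :: "('a, 'b) L2 set" where D: "countable D" "closure D = UNIV"
    using L2_separable by blast
  define B where "B = (\<lambda>(c, n). ball c (1 / real (Suc n))) ` (D \<times> UNIV)"
  have "topological_basis B"
  proof (rule topological_basisI)
    show "open U" if "U \<in> B" for U using that by (auto simp: B_def)
  next
    fix U and x :: "('a, 'b) L2" assume "open U" "x \<in> U"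
    then obtain e where e: "0 < e" "ball x e \<subseteq> U" by (auto simp: open_contains_ball)
    obtain n where n: "1 / real (Suc n) < e / 2"
      using nat_approx_posE[of "e/2"] e by auto
    have "x \<in> closure D" using D by simp
    then obtain c where c: "c \<in> D" "dist c x < 1 / real (Suc n)"
      by (auto simp: closure_approachable simp del: of_nat_Suc dest!: spec[of _ "1 / real (Suc n)"])
    have "ball c (1 / real (Suc n)) \<subseteq> ball x e"
    proof
      fix z assume "z \<in> ball c (1 / real (Suc n))"
      then have "dist c z < e / 2" using n by simp
      moreover have "dist x c < e / 2" using c n by (simp add: dist_commute)
      ultimately show "z \<in> ball x e"
        using dist_triangle[of x z c] by simp
    qed
    with e c show "\<exists>V\<in>B. x \<in> V \<and> V \<subseteq> U"
      by (intro bexI[of _ "ball c (1 / real (Suc n))"]) (auto simp: B_def)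
  qed
  moreover have "countable B" unfolding B_def using D by auto
  ultimately show "\<exists>B::('a, 'b) L2 set set. countable B \<and> open = generate_topology B"
    using topological_basis_imp_subbasis by blast
qed

section \<open>Sobolev spaces\<close>

text \<open>Elements of \<open>L\<^sup>2(\<Omega>)\<close> are represented by their extension by zero to the whole space.\<close>

definition L2_on :: "'a::euclidean_space set \<Rightarrow> ('a, 'b::euclidean_space) L2 set" where
  "L2_on \<Omega> = {v. AE x in lborel. x \<notin> \<Omega> \<longrightarrow> rep_L2 v x = 0}"

definition dir_deriv :: "'a::real_normed_vector \<Rightarrow> ('a \<Rightarrow> 'b::real_normed_vector) \<Rightarrow> 'a \<Rightarrow> 'b" where
  "dir_deriv b f x = vector_derivative (\<lambda>s. f (x + s *\<^sub>R b)) (at 0)"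

primrec iter_dir_deriv :: "'a::real_normed_vector list \<Rightarrow> ('a \<Rightarrow> 'b::real_normed_vector) \<Rightarrow> 'a \<Rightarrow> 'b" where
  "iter_dir_deriv [] f = f"
| "iter_dir_deriv (b # bs) f = dir_deriv b (iter_dir_deriv bs f)"

definition smooth :: "('a::euclidean_space \<Rightarrow> 'b::real_normed_vector) \<Rightarrow> bool" where
  "smooth f \<longleftrightarrow> (\<forall>bs. set bs \<subseteq> Basis \<longrightarrow> (\<forall>x. iter_dir_deriv bs f differentiable (at x)))"

definition test_function :: "'a::euclidean_space set \<Rightarrow> ('a \<Rightarrow> 'b::real_normed_vector) \<Rightarrow> bool" where
  "test_function S \<phi> \<longleftrightarrow>
     smooth \<phi> \<and> compact (closure {x. \<phi> x \<noteq> 0}) \<and> closure {x. \<phi> x \<noteq> 0} \<subseteq> S"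

definition classical_grad :: "(real^'n \<Rightarrow> 'b::real_normed_vector) \<Rightarrow> real^'n \<Rightarrow> 'b^'n" where
  "classical_grad \<phi> x = (\<chi> i. dir_deriv (axis i 1) \<phi> x)"

definition weak_gradient ::
  "(real^'n) set \<Rightarrow> (real^'n, 'b::euclidean_space) L2 \<Rightarrow> (real^'n, 'b^'n) L2 \<Rightarrow> bool" where
  "weak_gradient \<Omega> v G \<longleftrightarrow> v \<in> L2_on \<Omega> \<and> G \<in> L2_on \<Omega> \<and>
     (\<forall>\<phi> :: real^'n \<Rightarrow> real. test_function \<Omega> \<phi> \<longrightarrow>
       (\<forall>i. (\<integral>x. dir_deriv (axis i 1) \<phi> x *\<^sub>R rep_L2 v x \<partial>lborel)
          = - (\<integral>x. \<phi> x *\<^sub>R (rep_L2 G x $ i) \<partial>lborel)))"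

definition grad :: "(real^'n) set \<Rightarrow> (real^'n, 'b::euclidean_space) L2 \<Rightarrow> (real^'n, 'b^'n) L2" where
  "grad \<Omega> v = (THE G. weak_gradient \<Omega> v G)"

definition H1 :: "(real^'n) set \<Rightarrow> (real^'n, 'b::euclidean_space) L2 set" where
  "H1 \<Omega> = {v. \<exists>G. weak_gradient \<Omega> v G}"

text \<open>\<open>H\<^sup>1\<^sub>0(\<Omega>)\<close> is the closure of the test functions in the \<open>H\<^sup>1\<close>-norm; the case
  \<open>'b = complex\<close> gives \<open>H\<^sup>1\<^sub>0(\<Omega>; \<complex>)\<close>.\<close>

definition H10 :: "(real^'n) set \<Rightarrow> (real^'n, 'b::euclidean_space) L2 set" where
  "H10 \<Omega> = {v \<in> H1 \<Omega>. \<forall>\<epsilon>>0. \<exists>\<phi>. test_function \<Omega> \<phi> \<and>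
     norm (v - abs_L2 \<phi>) < \<epsilon> \<and> norm (grad \<Omega> v - abs_L2 (classical_grad \<phi>)) < \<epsilon>}"

section \<open>Domain, mesh and finite elements\<close>

text \<open>Near every boundary point, \<open>\<Omega>\<close> is the strict epigraph, in a direction \<open>\<nu>\<close>, of a Lipschitz
  function of the coordinates orthogonal to \<open>\<nu>\<close>.\<close>

definition lipschitz_boundary :: "'a::euclidean_space set \<Rightarrow> bool" where
  "lipschitz_boundary \<Omega> \<longleftrightarrow> (\<forall>x\<in>frontier \<Omega>. \<exists>\<nu> \<psi> C \<epsilon>. norm \<nu> = 1 \<and>
     C-lipschitz_on {y. y \<bullet> \<nu> = 0} \<psi> \<and> 0 < \<epsilon> \<and>
     (\<forall>y\<in>ball x \<epsilon>. y \<in> \<Omega> \<longleftrightarrow> \<psi> (y - (y \<bullet> \<nu>) *\<^sub>R \<nu>) < y \<bullet> \<nu>))"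

definition lipschitz_polyhedron :: "'a::euclidean_space set \<Rightarrow> bool" where
  "lipschitz_polyhedron \<Omega> \<longleftrightarrow> open \<Omega> \<and> bounded \<Omega> \<and> lipschitz_boundary \<Omega> \<and>
     (\<exists>P. finite P \<and> (\<forall>p\<in>P. polytope p) \<and> closure \<Omega> = \<Union>P)"

definition simplicial_mesh :: "(real^'n) set \<Rightarrow> (real^'n) set set \<Rightarrow> bool" where
  "simplicial_mesh \<Omega> \<T> \<longleftrightarrow> triangulation \<T> \<and> (\<forall>T\<in>\<T>. int CARD('n) simplex T) \<and>
     \<Union>\<T> = closure \<Omega>"

definition poly_degree_le :: "nat \<Rightarrow> (real^'n \<Rightarrow> 'b::real_vector) \<Rightarrow> bool" where
  "poly_degree_le k p \<longleftrightarrow> (\<exists>c :: ('n \<Rightarrow> nat) \<Rightarrow> 'b.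
     p = (\<lambda>x. \<Sum>a | sum a UNIV \<le> k. (\<Prod>i\<in>UNIV. (x $ i) ^ a i) *\<^sub>R c a))"

text \<open>A function that is continuous on the closure of \<open>\<Omega>\<close> and vanishes on its boundary is the same
  as a continuous function on the whole space that vanishes outside \<open>\<Omega>\<close>.\<close>

definition FE_space :: "(real^'n) set \<Rightarrow> (real^'n) set set \<Rightarrow> nat \<Rightarrow> (real^'n, 'b::euclidean_space) L2 set"
  where
  "FE_space \<Omega> \<T> k = {v \<in> H10 \<Omega>. \<exists>g. continuous_on UNIV g \<and> (\<forall>x. x \<notin> \<Omega> \<longrightarrow> g x = 0) \<and>
     (\<forall>T\<in>\<T>. \<exists>p. poly_degree_le k p \<and> (\<forall>x\<in>T. g x = p x)) \<and> v = abs_L2 g}"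

section \<open>Functions of time\<close>

text \<open>Here \<open>J = {0..}\<close>, and a function \<open>J \<rightarrow> Y\<close>, where \<open>Y\<close> is a closed subspace of the Banach space
  \<open>'v\<close>, is a function on all reals whose values at negative times are never used.\<close>

primrec time_deriv :: "nat \<Rightarrow> (real \<Rightarrow> 'v::real_normed_vector) \<Rightarrow> real \<Rightarrow> 'v" where
  "time_deriv 0 v = v"
| "time_deriv (Suc r) v = (\<lambda>t. vector_derivative (time_deriv r v) (at t within {0..}))"

definition Cr :: "nat \<Rightarrow> 'v::real_normed_vector set \<Rightarrow> (real \<Rightarrow> 'v) \<Rightarrow> bool" where
  "Cr r Y v \<longleftrightarrow> (\<forall>t\<ge>0. v t \<in> Y) \<and>
     (\<forall>j<r. \<forall>t\<ge>0. time_deriv j v differentiable (at t within {0..})) \<and>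
     continuous_on {0..} (time_deriv r v)"

definition Linfty :: "(real \<Rightarrow> 'v::{banach, second_countable_topology}) \<Rightarrow> bool" where
  "Linfty v \<longleftrightarrow> set_borel_measurable lborel {0..} v \<and>
     (\<exists>C. AE t in lborel. 0 \<le> t \<longrightarrow> norm (v t) \<le> C)"

definition Cr_b :: "nat \<Rightarrow> 'v::{banach, second_countable_topology} set \<Rightarrow> (real \<Rightarrow> 'v) \<Rightarrow> bool" where
  "Cr_b r Y v \<longleftrightarrow> Cr r Y v \<and> Linfty (time_deriv r v)"

definition L2_time :: "'v::{banach, second_countable_topology} set \<Rightarrow> (real \<Rightarrow> 'v) \<Rightarrow> bool" where
  "L2_time Y v \<longleftrightarrow> (\<forall>t\<ge>0. v t \<in> Y) \<and> set_borel_measurable lborel {0..} v \<and>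
     set_integrable lborel {0..} (\<lambda>t. (norm (v t))\<^sup>2)"

definition H1_time :: "'v::{banach, second_countable_topology} set \<Rightarrow> (real \<Rightarrow> 'v) \<Rightarrow> bool" where
  "H1_time Y v \<longleftrightarrow> L2_time Y v \<and> (\<exists>g. L2_time Y g \<and>
     (\<forall>\<phi> :: real \<Rightarrow> real. test_function {0<..} \<phi> \<longrightarrow>
       (LINT t:{0..}|lborel. deriv \<phi> t *\<^sub>R v t) = - (LINT t:{0..}|lborel. \<phi> t *\<^sub>R g t)))"

section \<open>The wave equation and the leapfrog scheme\<close>

definition wave_solution ::
  "(real^'n) set \<Rightarrow> (real \<Rightarrow> (real^'n, real) L2) \<Rightarrow> (real \<Rightarrow> (real^'n, real) L2) \<Rightarrow> bool" where
  "wave_solution \<Omega> f u \<longleftrightarrow>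
     Cr 2 (L2_on \<Omega>) u \<and> u 0 = 0 \<and> time_deriv 1 u 0 = 0 \<and>
     (\<forall>t\<ge>0. u t \<in> H10 \<Omega>) \<and> continuous_on {0..} (\<lambda>t. grad \<Omega> (u t)) \<and>
     (\<forall>t\<ge>0. \<forall>v\<in>H10 \<Omega>. time_deriv 2 u t \<bullet> v + grad \<Omega> (u t) \<bullet> grad \<Omega> v = f t \<bullet> v)"

definition leapfrog_solution ::
  "(real^'n) set \<Rightarrow> (real^'n, real) L2 set \<Rightarrow> real \<Rightarrow> (real \<Rightarrow> (real^'n, real) L2)
    \<Rightarrow> (nat \<Rightarrow> (real^'n, real) L2) \<Rightarrow> bool" where
  "leapfrog_solution \<Omega> Vh \<tau> f U \<longleftrightarrow> (\<forall>n. U n \<in> Vh) \<and> U 0 = 0 \<and> U 1 = 0 \<and>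
     (\<forall>n\<ge>1. \<forall>v\<in>Vh. (1 / \<tau>\<^sup>2) * ((U (n + 1) - 2 *\<^sub>R U n + U (n - 1)) \<bullet> v)
        + grad \<Omega> (U n) \<bullet> grad \<Omega> v = f (real n * \<tau>) \<bullet> v)"

section \<open>Time reconstructions\<close>

definition zero_ext :: "(nat \<Rightarrow> 'v::real_vector) \<Rightarrow> int \<Rightarrow> 'v" where
  "zero_ext W m = (if m < 0 then 0 else W (nat m))"

definition quad_reconstruction :: "real \<Rightarrow> (nat \<Rightarrow> 'v::real_vector) \<Rightarrow> real \<Rightarrow> 'v" where
  "quad_reconstruction \<tau> W t =
    (let n = \<lfloor>t / \<tau>\<rfloor>; \<xi> = t - real_of_int n * \<tau>; W = zero_ext W in
       W n
       + \<xi> *\<^sub>R ((1 / (2 * \<tau>)) *\<^sub>R (W (n + 1) - W (n - 1)))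
       + (\<xi>^2 / 2) *\<^sub>R ((1 / \<tau>^2) *\<^sub>R (W (n + 1) - 2 *\<^sub>R W n + W (n - 1))))"

definition quartic_reconstruction :: "real \<Rightarrow> (nat \<Rightarrow> 'v::real_vector) \<Rightarrow> real \<Rightarrow> 'v" where
  "quartic_reconstruction \<tau> W t =
    (let n = \<lfloor>t / \<tau>\<rfloor>; \<xi> = t - real_of_int n * \<tau>; W = zero_ext W;
         \<alpha> = (1 / 24) *\<^sub>R (3 *\<^sub>R W (n + 1) + 17 *\<^sub>R W n + 5 *\<^sub>R W (n - 1) - W (n - 2));
         \<beta> = (1 / (12 * \<tau>)) *\<^sub>R (5 *\<^sub>R W (n + 1) + 3 *\<^sub>R W n - 9 *\<^sub>R W (n - 1) + W (n - 2));
         \<gamma> = (1 / \<tau>^2) *\<^sub>R (W (n + 1) - 2 *\<^sub>R W n + W (n - 1));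
         \<theta> = (1 / (2 * \<tau>^3)) *\<^sub>R (W (n + 2) - 2 *\<^sub>R W (n + 1) + 2 *\<^sub>R W (n - 1) - W (n - 2));
         \<epsilon> = (1 / \<tau>^4) *\<^sub>R (W (n + 2) - 4 *\<^sub>R W (n + 1) + 6 *\<^sub>R W n - 4 *\<^sub>R W (n - 1) + W (n - 2))
     in \<alpha> + \<xi> *\<^sub>R \<beta> + (\<xi>^2 / 2) *\<^sub>R \<gamma> + (\<xi>^3 / 6) *\<^sub>R \<theta> + (\<xi>^4 / 24) *\<^sub>R \<epsilon>)"

text \<open>The time derivative computed separately on each \<open>J\<^sub>n = [n \<tau>, (n + 1) \<tau>)\<close>; it is one-sided
  at \<open>n \<tau>\<close>.\<close>

definition broken_deriv :: "real \<Rightarrow> (real \<Rightarrow> 'v::real_normed_vector) \<Rightarrow> real \<Rightarrow> 'v" where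
  "broken_deriv \<tau> v t = (let n = real_of_int \<lfloor>t / \<tau>\<rfloor> in
     vector_derivative v (at t within {n * \<tau>..<(n + 1) * \<tau>}))"

section \<open>Residual norm and approximation factor\<close>

text \<open>Norms defined by suprema are valued in the extended nonnegative reals, so that no supremum
  of a possibly unbounded (or empty) set of reals is ever taken.\<close>

definition residual ::
  "(real^'n) set \<Rightarrow> (real \<Rightarrow> (real^'n, real) L2) \<Rightarrow> (real \<Rightarrow> (real^'n, real) L2) \<Rightarrow> real
    \<Rightarrow> (real^'n, real) L2 \<Rightarrow> real" where
  "residual \<Omega> f\<tau> w t v = f\<tau> t \<bullet> v - time_deriv 2 w t \<bullet> v - grad \<Omega> (w t) \<bullet> grad \<Omega> v"

definition dual_norm :: "(real^'n) set \<Rightarrow> ((real^'n, real) L2 \<Rightarrow> real) \<Rightarrow> ennreal" where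
  "dual_norm \<Omega> l = (SUP v\<in>{v \<in> H10 \<Omega>. norm (grad \<Omega> v) = 1}. ennreal \<bar>l v\<bar>)"

definition cinner_L2 :: "('a::euclidean_space, complex) L2 \<Rightarrow> ('a, complex) L2 \<Rightarrow> complex" where
  "cinner_L2 v w = (\<integral>x. rep_L2 v x * cnj (rep_L2 w x) \<partial>lborel)"

definition cinner_L2_vec ::
  "('a::euclidean_space, complex^'n) L2 \<Rightarrow> ('a, complex^'n) L2 \<Rightarrow> complex" where
  "cinner_L2_vec V W = (\<integral>x. (\<Sum>i\<in>UNIV. rep_L2 V x $ i * cnj (rep_L2 W x $ i)) \<partial>lborel)"

definition helmholtz_form ::
  "(real^'n) set \<Rightarrow> complex \<Rightarrow> (real^'n, complex) L2 \<Rightarrow> (real^'n, complex) L2 \<Rightarrow> complex" where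
  "helmholtz_form \<Omega> s v w = s\<^sup>2 * cinner_L2 v w + cinner_L2_vec (grad \<Omega> v) (grad \<Omega> w)"

definition adjoint_solution ::
  "(real^'n) set \<Rightarrow> complex \<Rightarrow> (real^'n, complex) L2 \<Rightarrow> (real^'n, complex) L2" where
  "adjoint_solution \<Omega> s g = (THE \<phi>. \<phi> \<in> H10 \<Omega> \<and>
     (\<forall>w\<in>H10 \<Omega>. helmholtz_form \<Omega> s w \<phi> = of_real ((cmod s)\<^sup>2) * cinner_L2 w g))"

definition approx_factor :: "(real^'n) set \<Rightarrow> (real^'n) set set \<Rightarrow> nat \<Rightarrow> complex \<Rightarrow> ennreal" where
  "approx_factor \<Omega> \<T> k s = (SUP g\<in>{g \<in> L2_on \<Omega>. cmod s * norm g = 1}.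
     INF v\<in>FE_space \<Omega> \<T> k. ennreal (norm (grad \<Omega> (adjoint_solution \<Omega> s g - v))))"

definition approx_factor_cutoff ::
  "(real^'n) set \<Rightarrow> (real^'n) set set \<Rightarrow> nat \<Rightarrow> real \<Rightarrow> real \<Rightarrow> ennreal" where
  "approx_factor_cutoff \<Omega> \<T> k \<rho> \<omega> = (SUP \<nu>\<in>{-\<omega>..\<omega>}. approx_factor \<Omega> \<T> k (Complex \<rho> \<nu>))"

end

theory Submission
  imports Defs "HOL-Probability.Characteristic_Functions" "HOL-Probability.Sinc_Integral"
begin

text \<open>The Laplace transform in time on the line \<open>Re s = \<rho>\<close> turns the wave equation into a family of
  Helmholtz problems, one for each frequency \<open>\<nu> = Im s\<close>. By Plancherel's theorem (\<open>plancherel_le\<close> and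
  \<open>plancherel_ge\<close>) the integrals weighted by \<open>exp (- 2 \<rho> t)\<close> are integrals over \<open>\<nu>\<close> of squared norms
  of transforms, up to the common factor \<open>2 \<pi>\<close>. It is therefore enough to bound
  \<open>|s|\<^sup>2 |E|\<^sup>2 + |D E|\<^sup>2\<close> for each single \<open>s\<close>, where \<open>E\<close> is the transform of the error and \<open>D\<close> the
  gradient. The error solves a Helmholtz problem whose load consists of the residual and of \<open>\<eta>\<close>.

  The two reconstructions fit together because the second derivative of the quartic reconstruction of
  a sequence is the quadratic reconstruction of its second differences
  (\<open>shift_shift_quartic_coeff\<close>). Applied to the leapfrog scheme this says that, for a finite element
  function \<open>v\<close>, the residual at \<open>v\<close> equals \<open>(\<nabla>\<delta>, \<nabla>v)\<close>: Galerkin orthogonality holds up to the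
  difference of the two reconstructions.

  Below the cutoff (\<open>low_frequency_estimate\<close>) the problem is tested with \<open>E\<close>. The only obstruction is
  the indefinite term, which is at most \<open>|s|\<^sup>2 |E|\<^sup>2\<close>. It is estimated by duality
  (\<open>duality_estimate\<close>): \<open>E\<close> is paired with the solution of the adjoint problem, the residual sees only
  the part of that solution not captured by the finite elements, which the approximation factor
  measures, and what remains is controlled by \<open>\<delta>\<close>. Young's inequality produces the constants 40, 20
  and 11.

  Above the cutoff (\<open>high_frequency_estimate\<close>) the exact and the discrete solution are bounded
  separately by their data, using that the Helmholtz form becomes coercive when its second argument is
  multiplied by \<open>s\<close> (\<open>b_form_cscale_self\<close>). Since \<open>f\<close> vanishes near 0, the transform of its \<open>r\<close>-th
  derivative is \<open>s\<^sup>r\<close> times that of \<open>f\<close>, and \<open>|s| \<ge> \<omega>\<close> yields the factor \<open>1 / \<omega>\<^sup>2\<^sup>r\<close>.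

  This argument uses only a subspace \<open>V\<close> of a Hilbert space and a linear map \<open>D\<close> on it with closed graph
  and a Poincare inequality; it is carried out in the locale \<open>wave_space\<close> and ends with
  \<open>abstract_error_estimate\<close>. Complex vectors are pairs of real ones throughout. The residual is
  represented by an element of the range of \<open>D\<close> (\<open>dual_representation\<close>), whose norm is at most the
  dual norm of the residual (\<open>norm_le_dual_norm\<close>). The locale is instantiated by \<open>H\<^sup>1\<^sub>0(\<Omega>)\<close> and the
  weak gradient, with \<open>H10_closed_graph\<close> and \<open>H10_poincare\<close>, and \<open>approximable_FE_space\<close> translates the
  approximation factor of the complex adjoint problem into the language of pairs.\<close>

section \<open>Orthogonal projection and the theorems of Riesz and Lax--Milgram\<close>

text \<open>A minimizing sequence for the distance is Cauchy by the parallelogram law, since midpoints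
  stay in the subspace; its limit is the foot of the perpendicular.\<close>

lemma orthogonal_projection_exists:
  fixes M :: "'a::{real_inner, complete_space} set"
  assumes M: "subspace M" "closed M"
  shows "\<exists>p\<in>M. \<forall>y\<in>M. (x - p) \<bullet> y = 0"
proof -
  define d where "d = infdist x M"
  have ne: "M \<noteq> {}" using subspace_0[OF M(1)] by blast
  have d0: "0 \<le> d" by (simp add: d_def infdist_nonneg)
  have dle: "d \<le> norm (x - y)" if "y \<in> M" for y
    using infdist_le[OF that, of x] by (simp add: d_def dist_norm)
  have "\<exists>y\<in>M. norm (x - y) < d + 1 / real (Suc n)" for n
  proof (rule ccontr)
    assume "\<not> ?thesis"
    then have "d + 1 / real (Suc n) \<le> infdist x M"
      using ne by (auto simp: infdist_def dist_norm not_less intro!: cINF_greatest)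
    then show False by (simp add: d_def)
  qed
  then obtain y where yM: "\<And>n. y n \<in> M" and yd: "\<And>n. norm (x - y n) < d + 1 / real (Suc n)" by metis
  have par: "(norm (a - b))\<^sup>2 \<le> 2 * (norm (x - a))\<^sup>2 + 2 * (norm (x - b))\<^sup>2 - 4 * d\<^sup>2"
    if "a \<in> M" "b \<in> M" for a b
  proof -
    have "(1/2) *\<^sub>R (a + b) \<in> M" using that M(1) by (simp add: subspace_add subspace_scale)
    then have "d \<le> norm (x - (1/2) *\<^sub>R (a + b))" by (rule dle)
    then have "d\<^sup>2 \<le> (norm (x - (1/2) *\<^sub>R (a + b)))\<^sup>2" using d0 by (rule power_mono)
    moreover have "(norm (a - b))\<^sup>2 + 4 * (norm (x - (1/2) *\<^sub>R (a + b)))\<^sup>2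
        = 2 * (norm (x - a))\<^sup>2 + 2 * (norm (x - b))\<^sup>2"
      unfolding power2_norm_eq_inner
      by (simp add: inner_diff_left inner_diff_right inner_add_left inner_add_right inner_commute algebra_simps)
    ultimately show ?thesis by linarith
  qed
  have "Cauchy y"
  proof (rule metric_CauchyI)
    fix e :: real assume e: "0 < e"
    have "(\<lambda>n. 4 * ((d + 1 / real (Suc n))\<^sup>2 - d\<^sup>2)) \<longlonglongrightarrow> 4 * ((d + 0)\<^sup>2 - d\<^sup>2)"
      by (intro tendsto_intros LIMSEQ_Suc[OF lim_1_over_n])
    then have "\<forall>\<^sub>F n in sequentially. 4 * ((d + 1 / real (Suc n))\<^sup>2 - d\<^sup>2) < e\<^sup>2"
      using e by (intro order_tendstoD(2)) auto
    then obtain N where N: "4 * ((d + 1 / real (Suc N))\<^sup>2 - d\<^sup>2) < e\<^sup>2"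
      by (auto simp: eventually_sequentially)
    have bd: "(norm (x - y n))\<^sup>2 \<le> (d + 1 / real (Suc N))\<^sup>2" if "n \<ge> N" for n
    proof (rule power_mono)
      have "1 / real (Suc n) \<le> 1 / real (Suc N)" using that by (simp add: frac_le)
      then show "norm (x - y n) \<le> d + 1 / real (Suc N)" using yd[of n] by linarith
    qed simp
    show "\<exists>N. \<forall>m\<ge>N. \<forall>n\<ge>N. dist (y m) (y n) < e"
    proof (intro exI[of _ N] allI impI)
      fix m n assume "m \<ge> N" "n \<ge> N"
      then have "(norm (y m - y n))\<^sup>2 < e\<^sup>2" using par[OF yM yM, of m n] bd[of m] bd[of n] N by argo
      then show "dist (y m) (y n) < e" using e by (simp add: dist_norm power_less_imp_less_base)
    qed
  qed
  then obtain p where p: "y \<longlonglongrightarrow> p" using Cauchy_convergent_iff convergent_def by blast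
  have pM: "p \<in> M" using closed_sequentially[OF M(2) yM p] .
  have "(\<lambda>n. norm (x - y n)) \<longlonglongrightarrow> norm (x - p)" by (intro tendsto_intros p)
  moreover have "(\<lambda>n. d + 1 / real (Suc n)) \<longlonglongrightarrow> d + 0"
    by (intro tendsto_intros LIMSEQ_Suc[OF lim_1_over_n])
  ultimately have pd: "norm (x - p) \<le> d"
    using yd by (intro LIMSEQ_le[of "\<lambda>n. norm (x - y n)" _ "\<lambda>n. d + 1 / real (Suc n)"]) (auto intro: less_imp_le)
  show ?thesis
  proof (intro bexI[OF _ pM] ballI)
    fix z assume z: "z \<in> M"
    show "(x - p) \<bullet> z = 0"
    proof (cases "z = 0")
      case False
      define t where "t = ((x - p) \<bullet> z) / (norm z)\<^sup>2"
      have "p + t *\<^sub>R z \<in> M" using pM z M(1) by (simp add: subspace_add subspace_scale)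
      then have "norm (x - p) \<le> norm (x - (p + t *\<^sub>R z))" using dle pd by force
      then have "(norm (x - p))\<^sup>2 \<le> (norm (x - (p + t *\<^sub>R z)))\<^sup>2" by (simp add: power_mono)
      also have "\<dots> = (norm (x - p))\<^sup>2 - 2 * t * ((x - p) \<bullet> z) + t\<^sup>2 * (norm z)\<^sup>2"
        unfolding power2_norm_eq_inner
        by (simp add: inner_diff_left inner_diff_right inner_add_left inner_add_right inner_commute power2_eq_square algebra_simps)
      also have "\<dots> = (norm (x - p))\<^sup>2 - ((x - p) \<bullet> z)\<^sup>2 / (norm z)\<^sup>2"
        using False by (simp add: t_def power2_eq_square field_simps)
      finally have "((x - p) \<bullet> z)\<^sup>2 / (norm z)\<^sup>2 \<le> 0" by simp
      then show ?thesis using False by (simp add: divide_le_0_iff)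
    qed simp
  qed
qed

text \<open>Linearity and boundedness are asked for on the subspace only, because \<open>dual_representation\<close>
  composes with an inverse of \<open>D\<close> that is meaningful only on the range of \<open>D\<close>. The representer is a multiple of the
  component of some vector orthogonal to the kernel.\<close>

lemma riesz_representation_on:
  fixes M :: "'a::{real_inner, complete_space} set" and l :: "'a \<Rightarrow> real"
  assumes M: "subspace M" "closed M"
    and add: "\<And>x y. x \<in> M \<Longrightarrow> y \<in> M \<Longrightarrow> l (x + y) = l x + l y"
    and scale: "\<And>c x. x \<in> M \<Longrightarrow> l (c *\<^sub>R x) = c * l x"
    and bound: "\<And>x. x \<in> M \<Longrightarrow> \<bar>l x\<bar> \<le> C * norm x"
  shows "\<exists>p\<in>M. \<forall>x\<in>M. l x = p \<bullet> x"
proof (cases "\<forall>x\<in>M. l x = 0")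
  case True
  then show ?thesis using subspace_0[OF M(1)] by (intro bexI[of _ 0]) auto
next
  case False
  then obtain x0 where x0: "x0 \<in> M" "l x0 \<noteq> 0" by blast
  have l0: "l 0 = 0" using scale[OF subspace_0[OF M(1)], of 0] by simp
  have diff: "l (x - y) = l x - l y" if "x \<in> M" "y \<in> M" for x y
    using add[OF that(1), of "(-1) *\<^sub>R y"] scale[OF that(2), of "-1"] that M(1)
    by (simp add: subspace_neg)
  define N where "N = {x\<in>M. l x = 0}"
  have N: "subspace N" unfolding N_def subspace_def using M(1) add scale l0
    by (auto simp: subspace_0 subspace_add subspace_scale)
  have "closed N"
  proof (subst closed_sequential_limits, intro allI impI, elim conjE)
    fix y p assume y: "\<forall>n. y n \<in> N" "y \<longlonglongrightarrow> p"
    have p: "p \<in> M" using closed_sequentially[OF M(2), of y p] y by (auto simp: N_def)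
    have "(\<lambda>n. C * norm (p - y n)) \<longlonglongrightarrow> C * norm (p - p)" by (intro tendsto_intros y)
    moreover have "\<bar>l p\<bar> \<le> C * norm (p - y n)" for n
      using bound[of "p - y n"] diff[OF p, of "y n"] y(1) p M(1) by (auto simp: N_def subspace_diff)
    ultimately have "\<bar>l p\<bar> \<le> C * norm (p - p)" by (intro LIMSEQ_le_const) auto
    then show "p \<in> N" using p by (simp add: N_def)
  qed
  then obtain n0 where n0: "n0 \<in> N" "\<And>y. y \<in> N \<Longrightarrow> (x0 - n0) \<bullet> y = 0"
    using orthogonal_projection_exists[OF N, of x0] by blast
  define z where "z = x0 - n0"
  have z: "z \<in> M" "l z = l x0" using x0 n0 M(1) diff[of x0 n0] by (auto simp: z_def N_def subspace_diff)
  have z0: "z \<noteq> 0" using z(2) x0 l0 by auto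
  show ?thesis
  proof (intro bexI[of _ "(l z / (norm z)\<^sup>2) *\<^sub>R z"] ballI)
    show "(l z / (norm z)\<^sup>2) *\<^sub>R z \<in> M" using z M(1) by (simp add: subspace_scale)
    fix x assume x: "x \<in> M"
    have xs: "(l x / l z) *\<^sub>R z \<in> M" using z(1) M(1) by (simp add: subspace_scale)
    have "x - (l x / l z) *\<^sub>R z \<in> N"
      using x xs x0 z M(1) diff[OF x xs] scale[OF z(1)] by (simp add: N_def subspace_diff)
    then have "z \<bullet> (x - (l x / l z) *\<^sub>R z) = 0" using n0(2) by (simp add: z_def)
    then have "z \<bullet> x = (l x / l z) * (norm z)\<^sup>2"
      by (simp add: inner_diff_right power2_norm_eq_inner)
    then show "l x = ((l z / (norm z)\<^sup>2) *\<^sub>R z) \<bullet> x" using z0 z x0 by simp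
  qed
qed

text \<open>With \<open>A x\<close> and \<open>p\<close> the Riesz representers of \<open>\<lambda>y. a y x\<close> and of \<open>l\<close>, the relaxation
  \<open>x \<mapsto> x - lam (A x - p)\<close> is a contraction for small \<open>lam\<close>, and its fixed point solves the problem.\<close>

lemma lax_milgram_on:
  fixes M :: "'a::{real_inner, complete_space} set"
  assumes M: "subspace M" "closed M" and a: "bounded_bilinear (a :: 'a \<Rightarrow> 'a \<Rightarrow> real)"
    and coercive: "\<And>x. x \<in> M \<Longrightarrow> c * (norm x)\<^sup>2 \<le> a x x" and c: "0 < c"
    and l: "bounded_linear l"
  shows "\<exists>x\<in>M. \<forall>y\<in>M. a y x = l y"
proof -
  interpret a: bounded_bilinear a by fact
  interpret l: bounded_linear l by fact
  obtain K where K: "0 < K" "\<And>x y. norm (a x y) \<le> norm x * norm y * K" using a.pos_bounded by blast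
  obtain L where L: "\<And>x. norm (l x) \<le> norm x * L" using l.bounded by blast
  have "\<exists>p\<in>M. \<forall>y\<in>M. a y x = p \<bullet> y" for x
    by (rule riesz_representation_on[OF M, where C = "K * norm x"])
      (use K(2)[of _ x] in \<open>auto simp: a.add_left a.scaleR_left mult.commute mult.left_commute\<close>)
  then obtain A where AM: "\<And>x. A x \<in> M" and A: "\<And>x y. y \<in> M \<Longrightarrow> a y x = A x \<bullet> y" by metis
  have "\<exists>p\<in>M. \<forall>y\<in>M. l y = p \<bullet> y"
    by (rule riesz_representation_on[OF M, where C = L]) (use L in \<open>auto simp: l.add l.scaleR mult.commute\<close>)
  then obtain p where pM: "p \<in> M" and p: "\<And>y. y \<in> M \<Longrightarrow> l y = p \<bullet> y" by blast
  (* a bound of the form that exceeds c strictly: the contraction factor below then lies in [0, 1) *)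
  define K' where "K' = K + c"
  have K': "0 < K'" "c < K'" using K c by (auto simp: K'_def)
  define lam where "lam = c / K'\<^sup>2"
  define T where "T x = x - lam *\<^sub>R (A x - p)" for x
  define \<theta> where "\<theta> = sqrt (1 - c\<^sup>2 / K'\<^sup>2)"
  have q: "0 < c\<^sup>2 / K'\<^sup>2" "c\<^sup>2 / K'\<^sup>2 \<le> 1" using K' c by (auto simp: power_mono)
  have "\<exists>!x\<in>M. T x = x"
  proof (rule Banach_fix)
    show "complete M" using M(2) by (simp add: complete_eq_closed)
    show "M \<noteq> {}" using pM by blast
    show "0 \<le> \<theta>" "\<theta> < 1" using q by (auto simp: \<theta>_def)
    show "T ` M \<subseteq> M" using M(1) AM pM by (auto simp: T_def subspace_diff subspace_scale)
    show "dist (T x) (T y) \<le> \<theta> * dist x y" if x: "x \<in> M" and y: "y \<in> M" for x y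
    proof -
      define h where "h = x - y"
      define k where "k = A x - A y"
      have hM: "h \<in> M" and kM: "k \<in> M" using x y AM M(1) by (auto simp: h_def k_def subspace_diff)
      have ah: "a z h = k \<bullet> z" if "z \<in> M" for z
        using A[OF that] by (simp add: h_def k_def a.diff_right inner_diff_left)
      have "(norm k)\<^sup>2 = a k h" using ah[OF kM] by (simp add: power2_norm_eq_inner)
      also have "\<dots> \<le> norm k * norm h * K" using K(2)[of k h] by simp
      finally have "norm k \<le> K * norm h"
        by (cases "norm k = 0") (use K(1) in \<open>auto simp: power2_eq_square mult.commute mult.left_commute\<close>)
      also have "\<dots> \<le> K' * norm h" using c by (simp add: K'_def mult_right_mono)
      finally have k2: "(norm k)\<^sup>2 \<le> K'\<^sup>2 * (norm h)\<^sup>2"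
        using power_mono[of "norm k" "K' * norm h" 2] by (simp add: power_mult_distrib)
      have h2: "c * (norm h)\<^sup>2 \<le> k \<bullet> h" using coercive[OF hM] ah[OF hM] by simp
      have "(dist (T x) (T y))\<^sup>2 = (norm (h - lam *\<^sub>R k))\<^sup>2"
        by (simp add: T_def h_def k_def dist_norm algebra_simps)
      also have "\<dots> = (norm h)\<^sup>2 - 2 * lam * (k \<bullet> h) + lam\<^sup>2 * (norm k)\<^sup>2"
        unfolding power2_norm_eq_inner
        by (simp add: inner_diff_left inner_diff_right inner_commute power2_eq_square algebra_simps)
      also have "\<dots> \<le> (norm h)\<^sup>2 - 2 * lam * (c * (norm h)\<^sup>2) + lam\<^sup>2 * (K'\<^sup>2 * (norm h)\<^sup>2)"
      proof (intro add_mono diff_mono mult_left_mono h2 k2)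
        show "0 \<le> 2 * lam" using c by (simp add: lam_def)
      qed auto
      also have "\<dots> = (1 - c\<^sup>2 / K'\<^sup>2) * (norm h)\<^sup>2"
        using K' by (simp add: lam_def power2_eq_square field_simps)
      also have "\<dots> = (\<theta> * dist x y)\<^sup>2"
        using q by (simp add: \<theta>_def power_mult_distrib h_def dist_norm)
      finally show ?thesis using q by (intro power2_le_imp_le[of "dist (T x) (T y)"]) (auto simp: \<theta>_def)
    qed
  qed
  then obtain x where x: "x \<in> M" "T x = x" by blast
  then have "A x = p" using c K' by (simp add: T_def lam_def)
  then show ?thesis using x(1) A p by (intro bexI[of _ x]) auto
qed

text \<open>The component of the integral orthogonal to \<open>M\<close> is orthogonal to every value of \<open>g\<close>, hence to
  the integral and to itself.\<close>

lemma integral_in_closed_subspace: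
  fixes g :: "'b \<Rightarrow> 'a::{real_inner, banach, second_countable_topology}"
  assumes M: "subspace M" "closed M" and int: "integrable \<mu> g" and g: "\<And>x. g x \<in> M"
  shows "integral\<^sup>L \<mu> g \<in> M"
proof -
  obtain p where p: "p \<in> M" "\<And>y. y \<in> M \<Longrightarrow> (integral\<^sup>L \<mu> g - p) \<bullet> y = 0"
    using orthogonal_projection_exists[OF M] by blast
  define z where "z = integral\<^sup>L \<mu> g - p"
  obtain p' where p': "p' \<in> M" "\<And>y. y \<in> M \<Longrightarrow> (z - p') \<bullet> y = 0"
    using orthogonal_projection_exists[OF M] by blast
  have "z \<bullet> integral\<^sup>L \<mu> g = (\<integral>x. z \<bullet> g x \<partial>\<mu>)" using int by simp
  also have "\<dots> = 0" using p(2) g by (simp add: z_def)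
  finally have "z \<bullet> z = 0" using p(2)[OF p(1)] by (simp add: z_def inner_diff_right)
  then show ?thesis using p(1) by (simp add: z_def)
qed

section \<open>Complexification of a real Hilbert space\<close>

text \<open>A pair \<open>(x, y)\<close> stands for \<open>x + \<i> y\<close>, and \<open>cscale z\<close> is multiplication by the complex number \<open>z\<close>.
  The inner product of pairs is the real part of the complex one, so the imaginary part of a
  sesquilinear identity is recovered by testing with \<open>cscale \<i> v\<close>.\<close>

definition cscale :: "complex \<Rightarrow> 'a::real_vector \<times> 'a \<Rightarrow> 'a \<times> 'a" where
  "cscale z x = (Re z *\<^sub>R fst x - Im z *\<^sub>R snd x, Im z *\<^sub>R fst x + Re z *\<^sub>R snd x)"

lemma cscale_add: "cscale z (x + y) = cscale z x + cscale z y"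
  and cscale_diff: "cscale z (x - y) = cscale z x - cscale z y"
  and cscale_scaleR: "cscale z (c *\<^sub>R x) = c *\<^sub>R cscale z x"
  by (auto simp: cscale_def algebra_simps prod_eq_iff)

lemma cscale_cscale: "cscale z (cscale w x) = cscale (z * w) x"
  and cscale_one: "cscale 1 x = x"
  by (auto simp: cscale_def algebra_simps prod_eq_iff)

lemma inner_cscale_left: "cscale z x \<bullet> y = x \<bullet> cscale (cnj z) (y :: 'a::real_inner \<times> 'a)"
  by (simp add: cscale_def inner_prod_def inner_diff_left inner_diff_right inner_add_left inner_add_right algebra_simps)

lemma inner_cscale_self: "cscale z x \<bullet> x = Re z * (norm (x :: 'a::real_inner \<times> 'a))\<^sup>2"
  by (simp add: cscale_def inner_prod_def power2_norm_eq_inner inner_diff_left inner_add_left inner_commute algebra_simps)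

lemma norm_cscale: "norm (cscale z x) = cmod z * norm (x :: 'a::real_inner \<times> 'a)"
proof -
  have "(norm (cscale z x))\<^sup>2 = (cmod z * norm x)\<^sup>2"
    unfolding power_mult_distrib cmod_power2 power2_norm_eq_inner inner_prod_def cscale_def
    by (simp add: inner_diff_left inner_diff_right inner_add_left inner_add_right inner_commute power2_eq_square algebra_simps)
  then show ?thesis by (simp add: power2_eq_iff_nonneg)
qed

lemma bounded_linear_cscale: "bounded_linear (cscale z :: 'a::real_inner \<times> 'a \<Rightarrow> _)"
  by (rule bounded_linear_intro[where K = "cmod z"]) (simp_all add: cscale_add cscale_scaleR norm_cscale mult.commute)

lemma cscale_in_Times: "subspace V \<Longrightarrow> x \<in> V \<times> V \<Longrightarrow> cscale z x \<in> V \<times> V"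
  by (cases x) (simp add: cscale_def subspace_add subspace_diff subspace_scale)

section \<open>Plancherel's theorem for Hilbert-space-valued functions\<close>

text \<open>The two components are the real and the imaginary part of the integral of
  \<open>exp (- \<i> \<nu> t) g(t)\<close>.\<close>

definition fourier :: "(real \<Rightarrow> 'a::{real_inner, banach, second_countable_topology}) \<Rightarrow> real \<Rightarrow> 'a \<times> 'a" where
  "fourier g \<nu> = ((\<integral>t. cos (\<nu> * t) *\<^sub>R g t \<partial>lborel), - (\<integral>t. sin (\<nu> * t) *\<^sub>R g t \<partial>lborel))"

lemma integrable_cos_scaleR:
  fixes g :: "real \<Rightarrow> 'a::{banach, second_countable_topology}"
  assumes "integrable lborel g" shows "integrable lborel (\<lambda>t. cos (\<nu> * t) *\<^sub>R g t)"
  by (rule Bochner_Integration.integrable_bound[OF integrable_norm[OF assms]])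
    (use assms in \<open>auto intro!: AE_I2 mult_left_le_one_le\<close>)

lemma integrable_sin_scaleR:
  fixes g :: "real \<Rightarrow> 'a::{banach, second_countable_topology}"
  assumes "integrable lborel g" shows "integrable lborel (\<lambda>t. sin (\<nu> * t) *\<^sub>R g t)"
  by (rule Bochner_Integration.integrable_bound[OF integrable_norm[OF assms]])
    (use assms in \<open>auto intro!: AE_I2 mult_left_le_one_le\<close>)

lemma borel_measurable_fourier [measurable]:
  assumes [measurable]: "g \<in> borel_measurable borel"
  shows "fourier g \<in> borel_measurable borel"
  unfolding fourier_def by measurable

lemma integrable_inner_prod:
  fixes g :: "'b::euclidean_space \<Rightarrow> 'a::{real_inner, banach, second_countable_topology}"
    and h :: "'c::euclidean_space \<Rightarrow> 'a"
  assumes g: "integrable lborel g" and h: "integrable lborel h"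
  shows "integrable (lborel \<Otimes>\<^sub>M lborel) (\<lambda>(t, t'). g t \<bullet> h t')"
proof (rule lborel_pair.Fubini_integrable)
  have [measurable]: "g \<in> borel_measurable borel" "h \<in> borel_measurable borel"
    using borel_measurable_integrable[OF g] borel_measurable_integrable[OF h] by simp_all
  show "(\<lambda>(t, t'). g t \<bullet> h t') \<in> borel_measurable (lborel \<Otimes>\<^sub>M lborel)" by measurable
  show "integrable lborel (\<lambda>t. \<integral>t'. norm (case (t, t') of (t, t') \<Rightarrow> g t \<bullet> h t') \<partial>lborel)"
  proof (rule Bochner_Integration.integrable_bound)
    show "integrable lborel (\<lambda>t. norm (g t) * (\<integral>t'. norm (h t') \<partial>lborel))" using g by simp
    show "(\<lambda>t. \<integral>t'. norm (case (t, t') of (t, t') \<Rightarrow> g t \<bullet> h t') \<partial>lborel) \<in> borel_measurable lborel"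
      by measurable
    show "AE t in lborel. norm (\<integral>t'. norm (case (t, t') of (t, t') \<Rightarrow> g t \<bullet> h t') \<partial>lborel)
        \<le> norm (norm (g t) * (\<integral>t'. norm (h t') \<partial>lborel))"
    proof (rule AE_I2)
      fix t
      have "(\<integral>t'. \<bar>g t \<bullet> h t'\<bar> \<partial>lborel) \<le> (\<integral>t'. norm (g t) * norm (h t') \<partial>lborel)"
        using h by (intro integral_mono) (auto simp: Cauchy_Schwarz_ineq2)
      also have "\<dots> = norm (g t) * (\<integral>t'. norm (h t') \<partial>lborel)" by simp
      finally show "norm (\<integral>t'. norm (case (t, t') of (t, t') \<Rightarrow> g t \<bullet> h t') \<partial>lborel)
        \<le> norm (norm (g t) * (\<integral>t'. norm (h t') \<partial>lborel))" by simp
    qed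
  qed
  show "AE t in lborel. integrable lborel (\<lambda>t'. case (t, t') of (t, t') \<Rightarrow> g t \<bullet> h t')"
    using h by simp
qed

lemma inner_integrals:
  fixes g :: "'b::euclidean_space \<Rightarrow> 'a::{real_inner, banach, second_countable_topology}"
    and h :: "'c::euclidean_space \<Rightarrow> 'a"
  assumes g: "integrable lborel g" and h: "integrable lborel h"
  shows "integral\<^sup>L lborel g \<bullet> integral\<^sup>L lborel h
    = integral\<^sup>L (lborel \<Otimes>\<^sub>M lborel) (\<lambda>(t, t'). g t \<bullet> h t')"
proof -
  have "integral\<^sup>L lborel g \<bullet> integral\<^sup>L lborel h = (\<integral>t. g t \<bullet> integral\<^sup>L lborel h \<partial>lborel)"
    using g by simp
  also have "\<dots> = (\<integral>t. (\<integral>t'. g t \<bullet> h t' \<partial>lborel) \<partial>lborel)"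
    using h by simp
  also have "\<dots> = integral\<^sup>L (lborel \<Otimes>\<^sub>M lborel) (\<lambda>(t, t'). g t \<bullet> h t')"
    by (rule lborel_pair.integral_fst[OF integrable_inner_prod[OF g h]])
  finally show ?thesis .
qed

text \<open>The addition theorem merges the cosine and the sine part into a kernel depending only on
  \<open>t - t'\<close>; this is what lets the Gaussian regularization turn the square into a correlation.\<close>

lemma norm_fourier_squared:
  fixes g :: "real \<Rightarrow> 'a::{real_inner, banach, second_countable_topology}"
  assumes g: "integrable lborel g"
  shows "(norm (fourier g \<nu>))\<^sup>2
    = integral\<^sup>L (lborel \<Otimes>\<^sub>M lborel) (\<lambda>(t, t'). cos (\<nu> * (t - t')) * (g t \<bullet> g t'))"
proof -
  note c = integrable_cos_scaleR[OF g, of \<nu>] and s = integrable_sin_scaleR[OF g, of \<nu>]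
  have "(norm (fourier g \<nu>))\<^sup>2
      = integral\<^sup>L (lborel \<Otimes>\<^sub>M lborel) (\<lambda>(t, t'). (cos (\<nu> * t) *\<^sub>R g t) \<bullet> (cos (\<nu> * t') *\<^sub>R g t'))
      + integral\<^sup>L (lborel \<Otimes>\<^sub>M lborel) (\<lambda>(t, t'). (sin (\<nu> * t) *\<^sub>R g t) \<bullet> (sin (\<nu> * t') *\<^sub>R g t'))"
    by (simp only: power2_norm_eq_inner fourier_def inner_prod_def fst_conv snd_conv inner_minus_left
        inner_minus_right minus_minus inner_integrals[OF c c] inner_integrals[OF s s])
  also have "\<dots> = integral\<^sup>L (lborel \<Otimes>\<^sub>M lborel)
      (\<lambda>x. (case x of (t, t') \<Rightarrow> (cos (\<nu> * t) *\<^sub>R g t) \<bullet> (cos (\<nu> * t') *\<^sub>R g t'))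
        + (case x of (t, t') \<Rightarrow> (sin (\<nu> * t) *\<^sub>R g t) \<bullet> (sin (\<nu> * t') *\<^sub>R g t')))"
    by (rule Bochner_Integration.integral_add[symmetric]) (rule integrable_inner_prod[OF c c] integrable_inner_prod[OF s s])+
  also have "\<dots> = integral\<^sup>L (lborel \<Otimes>\<^sub>M lborel) (\<lambda>(t, t'). cos (\<nu> * (t - t')) * (g t \<bullet> g t'))"
    by (rule Bochner_Integration.integral_cong)
      (auto simp: right_diff_distrib cos_diff algebra_simps)
  finally show ?thesis .
qed

text \<open>A rescaling of the characteristic function of the standard normal distribution.\<close>

lemma gaussian_fourier:
  assumes \<sigma>: "0 < \<sigma>"
  shows "integrable lborel (\<lambda>\<nu>::real. exp (- (\<sigma> * \<nu>)\<^sup>2 / 2))"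
    and "(\<integral>\<nu>. exp (- (\<sigma> * \<nu>)\<^sup>2 / 2) * cos (\<nu> * x) \<partial>lborel) = 2 * pi * normal_density 0 \<sigma> x"
proof -
  have e: "exp (- y\<^sup>2 / 2) = sqrt (2 * pi) * std_normal_density y" for y
    by (simp add: std_normal_density_def)
  have "integrable lborel (\<lambda>y. sqrt (2 * pi) * std_normal_density y)" by simp
  from lborel_integrable_real_affine[OF this, of \<sigma> 0]
  show "integrable lborel (\<lambda>\<nu>::real. exp (- (\<sigma> * \<nu>)\<^sup>2 / 2))"
    unfolding e using \<sigma> by simp
  have std: "(\<integral>y. std_normal_density y * cos (t * y) \<partial>lborel) = exp (- t\<^sup>2 / 2)" for t
  proof -
    have "complex_of_real (exp (- t\<^sup>2 / 2)) = (\<integral>y. iexp (t * y) \<partial>std_normal_distribution)"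
      using fun_cong[OF char_std_normal_distribution, of t] by (simp add: char_def)
    also have "\<dots> = (\<integral>y. std_normal_density y *\<^sub>R iexp (t * y) \<partial>lborel)"
      by (rule integral_density) auto
    finally have eq: "complex_of_real (exp (- t\<^sup>2 / 2)) = (\<integral>y. std_normal_density y *\<^sub>R iexp (t * y) \<partial>lborel)" .
    have "integrable lborel (\<lambda>y. std_normal_density y *\<^sub>R iexp (t * y))"
      by (rule Bochner_Integration.integrable_bound[OF integrable_normal_density[OF zero_less_one, of 0]]) auto
    then have "Re (\<integral>y. std_normal_density y *\<^sub>R iexp (t * y) \<partial>lborel)
        = (\<integral>y. Re (std_normal_density y *\<^sub>R iexp (t * y)) \<partial>lborel)"
      by (rule integral_bounded_linear[OF bounded_linear_Re, symmetric])
    then show ?thesis using arg_cong[OF eq, of Re] by (simp add: Re_exp)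
  qed
  have "(\<integral>y. exp (- y\<^sup>2 / 2) * cos (y * (x / \<sigma>)) \<partial>lborel)
      = \<bar>\<sigma>\<bar> *\<^sub>R (\<integral>\<nu>. exp (- (0 + \<sigma> * \<nu>)\<^sup>2 / 2) * cos ((0 + \<sigma> * \<nu>) * (x / \<sigma>)) \<partial>lborel)"
    using \<sigma> by (intro lborel_integral_real_affine) simp
  moreover have "(\<integral>y. exp (- y\<^sup>2 / 2) * cos (y * (x / \<sigma>)) \<partial>lborel)
      = sqrt (2 * pi) * exp (- (x / \<sigma>)\<^sup>2 / 2)"
  proof -
    have "(\<integral>y. exp (- y\<^sup>2 / 2) * cos (y * (x / \<sigma>)) \<partial>lborel)
        = (\<integral>y. sqrt (2 * pi) * (std_normal_density y * cos ((x / \<sigma>) * y)) \<partial>lborel)"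
      by (simp only: e mult.assoc mult.commute[of "x / \<sigma>"])
    then show ?thesis by (simp only: integral_mult_right_zero std)
  qed
  ultimately have *: "\<sigma> * (\<integral>\<nu>. exp (- (\<sigma> * \<nu>)\<^sup>2 / 2) * cos (\<nu> * x) \<partial>lborel)
      = sqrt (2 * pi) * exp (- (x / \<sigma>)\<^sup>2 / 2)" using \<sigma> by (simp add: mult.commute)
  have "sqrt (2 * pi) * sqrt (2 * pi) = 2 * pi" by simp
  then have "2 * pi = sqrt (2 * pi) * sqrt (2 * pi)" ..
  then have "\<sigma> * (2 * pi * normal_density 0 \<sigma> x) = sqrt (2 * pi) * exp (- (x / \<sigma>)\<^sup>2 / 2)"
    using \<sigma> by (simp add: normal_density_def power_divide real_sqrt_mult)
  with * have "\<sigma> * (\<integral>\<nu>. exp (- (\<sigma> * \<nu>)\<^sup>2 / 2) * cos (\<nu> * x) \<partial>lborel)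
      = \<sigma> * (2 * pi * normal_density 0 \<sigma> x)" by (rule trans[OF _ sym])
  then show "(\<integral>\<nu>. exp (- (\<sigma> * \<nu>)\<^sup>2 / 2) * cos (\<nu> * x) \<partial>lborel) = 2 * pi * normal_density 0 \<sigma> x"
    by (rule mult_left_cancel[THEN iffD1, rotated]) (use \<sigma> in simp)
qed

text \<open>The Gaussian factor makes the triple integral over \<open>\<nu>\<close>, \<open>t\<close> and \<open>t'\<close> absolutely convergent.
  Integrating over \<open>\<nu>\<close> first leaves a normal density of width \<open>\<sigma>\<close> in \<open>t - t'\<close>, and the substitution
  \<open>t' = t - \<sigma> y\<close> gives an average of shifted correlations of \<open>g\<close>. Both halves of Plancherel's theorem
  follow by letting \<open>\<sigma>\<close> tend to 0.\<close>

lemma gaussian_regularized_fourier: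
  fixes g :: "real \<Rightarrow> 'a::{real_inner, banach, second_countable_topology}"
  assumes g: "integrable lborel g" and B: "\<And>t. norm (g t) \<le> B" and \<sigma>: "0 < \<sigma>"
  shows "integrable lborel (\<lambda>\<nu>. exp (- (\<sigma> * \<nu>)\<^sup>2 / 2) * (norm (fourier g \<nu>))\<^sup>2)"
    and "integrable (lborel \<Otimes>\<^sub>M lborel) (\<lambda>(t, y). std_normal_density y * (g t \<bullet> g (t - \<sigma> * y)))"
    and "(\<integral>\<nu>. exp (- (\<sigma> * \<nu>)\<^sup>2 / 2) * (norm (fourier g \<nu>))\<^sup>2 \<partial>lborel)
      = 2 * pi * integral\<^sup>L (lborel \<Otimes>\<^sub>M lborel) (\<lambda>(t, y). std_normal_density y * (g t \<bullet> g (t - \<sigma> * y)))"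
proof -
  have [measurable]: "g \<in> borel_measurable borel" using borel_measurable_integrable[OF g] by simp
  define N where "N = normal_density 0 \<sigma>"
  have [measurable]: "N \<in> borel_measurable borel" by (simp add: N_def)
  define \<phi> where "\<phi> \<nu> = exp (- (\<sigma> * \<nu>)\<^sup>2 / 2)" for \<nu>
  have \<phi>: "integrable lborel \<phi>" unfolding \<phi>_def by (rule gaussian_fourier(1)[OF \<sigma>])
  have [measurable]: "\<phi> \<in> borel_measurable borel" using borel_measurable_integrable[OF \<phi>] by simp
  define G where "G p = (case p of (t, t') \<Rightarrow> g t \<bullet> g t')" for p
  have G: "integrable lborel G"
    using integrable_inner_prod[OF g g] by (simp add: G_def[abs_def] lborel_prod)
  have [measurable]: "G \<in> borel_measurable borel" using borel_measurable_integrable[OF G] by simp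
  define F where "F \<nu> p = \<phi> \<nu> * (cos (\<nu> * (fst p - snd p)) * G p)" for \<nu> and p :: "real \<times> real"
  have F: "integrable (lborel \<Otimes>\<^sub>M lborel) (\<lambda>(\<nu>, p). F \<nu> p)"
  proof (rule Bochner_Integration.integrable_bound[OF integrable_inner_prod[OF \<phi> G]])
    show "(\<lambda>(\<nu>, p). F \<nu> p) \<in> borel_measurable (lborel \<Otimes>\<^sub>M lborel)"
    proof -
      have [measurable]: "(\<lambda>x::real \<times> real \<times> real. G (snd x)) \<in> borel_measurable (lborel \<Otimes>\<^sub>M lborel)"
        "(\<lambda>x::real \<times> real \<times> real. fst (snd x)) \<in> borel_measurable (lborel \<Otimes>\<^sub>M lborel)"
        "(\<lambda>x::real \<times> real \<times> real. snd (snd x)) \<in> borel_measurable (lborel \<Otimes>\<^sub>M lborel)"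
        by (rule measurable_compose[OF measurable_snd],
            auto intro!: borel_measurable_continuous_onI continuous_intros)+
      show ?thesis unfolding F_def case_prod_beta by measurable
    qed
    show "AE x in lborel \<Otimes>\<^sub>M lborel. norm (case x of (\<nu>, p) \<Rightarrow> F \<nu> p) \<le> norm (case x of (\<nu>, p) \<Rightarrow> \<phi> \<nu> \<bullet> G p)"
      by (rule AE_I2) (auto simp: F_def abs_mult intro!: mult_left_mono mult_left_le_one_le)
  qed
  have nf: "\<phi> \<nu> * (norm (fourier g \<nu>))\<^sup>2 = (\<integral>p. F \<nu> p \<partial>lborel)" for \<nu>
    unfolding norm_fourier_squared[OF g] F_def by (simp add: G_def lborel_prod case_prod_unfold)
  show 1: "integrable lborel (\<lambda>\<nu>. exp (- (\<sigma> * \<nu>)\<^sup>2 / 2) * (norm (fourier g \<nu>))\<^sup>2)"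
    using lborel_pair.integrable_fst[OF F] by (simp only: nf[symmetric] \<phi>_def)
  have "(\<integral>\<nu>. \<phi> \<nu> * (norm (fourier g \<nu>))\<^sup>2 \<partial>lborel) = (\<integral>p. (\<integral>\<nu>. F \<nu> p \<partial>lborel) \<partial>lborel)"
    unfolding nf by (rule lborel_pair.Fubini_integral[OF F, symmetric])
  also have "(\<lambda>p. \<integral>\<nu>. F \<nu> p \<partial>lborel) = (\<lambda>p. 2 * pi * (N (fst p - snd p) * G p))"
  proof
    fix p
    have "(\<integral>\<nu>. F \<nu> p \<partial>lborel) = (\<integral>\<nu>. G p * (\<phi> \<nu> * cos (\<nu> * (fst p - snd p))) \<partial>lborel)"
      by (simp add: F_def mult_ac)
    also have "\<dots> = G p * (2 * pi * N (fst p - snd p))"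
      unfolding integral_mult_right_zero \<phi>_def gaussian_fourier(2)[OF \<sigma>] N_def ..
    finally show "(\<integral>\<nu>. F \<nu> p \<partial>lborel) = 2 * pi * (N (fst p - snd p) * G p)" by simp
  qed
  finally have 2: "(\<integral>\<nu>. \<phi> \<nu> * (norm (fourier g \<nu>))\<^sup>2 \<partial>lborel)
      = 2 * pi * (\<integral>p. N (fst p - snd p) * G p \<partial>lborel)" by simp
  have Nb: "N x \<le> 1 / sqrt (2 * pi * \<sigma>\<^sup>2)" for x
    using \<sigma> by (simp add: N_def normal_density_def divide_right_mono)
  have NG: "integrable (lborel \<Otimes>\<^sub>M lborel) (\<lambda>(t, t'). N (t - t') * (g t \<bullet> g t'))"
  proof (rule Bochner_Integration.integrable_bound[where f = "\<lambda>(t, t'). (1 / sqrt (2 * pi * \<sigma>\<^sup>2)) * (g t \<bullet> g t')"])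
    show "integrable (lborel \<Otimes>\<^sub>M lborel) (\<lambda>(t, t'). (1 / sqrt (2 * pi * \<sigma>\<^sup>2)) * (g t \<bullet> g t'))"
      using integrable_mult_right[OF integrable_inner_prod[OF g g], of "1 / sqrt (2 * pi * \<sigma>\<^sup>2)"]
      by (simp only: case_prod_unfold)
    show "AE x in lborel \<Otimes>\<^sub>M lborel. norm (case x of (t, t') \<Rightarrow> N (t - t') * (g t \<bullet> g t'))
      \<le> norm (case x of (t, t') \<Rightarrow> (1 / sqrt (2 * pi * \<sigma>\<^sup>2)) * (g t \<bullet> g t'))"
    proof (rule AE_I2, clarify)
      fix t t'
      have "\<bar>N (t - t')\<bar> \<le> \<bar>1 / sqrt (2 * pi * \<sigma>\<^sup>2)\<bar>" using Nb[of "t - t'"] by (simp add: N_def)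
      then show "norm (N (t - t') * (g t \<bullet> g t')) \<le> norm ((1 / sqrt (2 * pi * \<sigma>\<^sup>2)) * (g t \<bullet> g t'))"
        unfolding real_norm_def abs_mult by (rule mult_right_mono) simp
    qed
  qed measurable
  have 3: "(\<integral>p. N (fst p - snd p) * G p \<partial>lborel) = (\<integral>t. (\<integral>t'. N (t - t') * (g t \<bullet> g t') \<partial>lborel) \<partial>lborel)"
    using lborel_pair.integral_fst[OF NG] by (simp add: lborel_prod G_def case_prod_unfold)
  have 4: "(\<integral>t'. N (t - t') * (g t \<bullet> g t') \<partial>lborel)
      = (\<integral>y. std_normal_density y * (g t \<bullet> g (t - \<sigma> * y)) \<partial>lborel)" for t
  proof -
    have N\<sigma>: "\<sigma> * N (\<sigma> * y) = std_normal_density y" for y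
      using \<sigma> by (simp add: N_def normal_density_def power_mult_distrib real_sqrt_mult)
    have "(\<integral>t'. N (t - t') * (g t \<bullet> g t') \<partial>lborel)
        = \<bar>- \<sigma>\<bar> *\<^sub>R (\<integral>y. N (t - (t + (- \<sigma>) * y)) * (g t \<bullet> g (t + (- \<sigma>) * y)) \<partial>lborel)"
      using \<sigma> by (intro lborel_integral_real_affine) simp
    also have "\<dots> = \<sigma> * (\<integral>y. N (\<sigma> * y) * (g t \<bullet> g (t - \<sigma> * y)) \<partial>lborel)"
    proof -
      have "(\<lambda>y. N (t - (t + (- \<sigma>) * y)) * (g t \<bullet> g (t + (- \<sigma>) * y)))
          = (\<lambda>y. N (\<sigma> * y) * (g t \<bullet> g (t - \<sigma> * y)))"
        by (rule ext) (simp only: mult_minus_left add_uminus_conv_diff diff_diff_eq2 add_diff_cancel_left' minus_diff_eq)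
      moreover have "\<bar>- \<sigma>\<bar> = \<sigma>" using \<sigma> by simp
      ultimately show ?thesis by (simp only: real_scaleR_def)
    qed
    also have "\<dots> = (\<integral>y. \<sigma> * (N (\<sigma> * y) * (g t \<bullet> g (t - \<sigma> * y))) \<partial>lborel)"
      by (simp only: integral_mult_right_zero)
    finally show ?thesis by (simp only: mult.assoc[symmetric] N\<sigma>)
  qed
  have g': "integrable lborel (\<lambda>t. B * norm (g t))" using g by simp
  show 5: "integrable (lborel \<Otimes>\<^sub>M lborel) (\<lambda>(t, y). std_normal_density y * (g t \<bullet> g (t - \<sigma> * y)))"
  proof (rule Bochner_Integration.integrable_bound[OF integrable_inner_prod[OF g' integrable_normal_density[OF zero_less_one, of 0]]])
    show "AE x in lborel \<Otimes>\<^sub>M lborel. norm (case x of (t, y) \<Rightarrow> std_normal_density y * (g t \<bullet> g (t - \<sigma> * y)))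
        \<le> norm (case x of (t, t') \<Rightarrow> (B * norm (g t)) \<bullet> std_normal_density t')"
    proof (rule AE_I2, clarify)
      fix t y
      have "\<bar>g t \<bullet> g (t - \<sigma> * y)\<bar> \<le> norm (g t) * B"
        by (rule order_trans[OF Cauchy_Schwarz_ineq2]) (intro mult_left_mono B norm_ge_zero)
      then have "\<bar>g t \<bullet> g (t - \<sigma> * y)\<bar> \<le> \<bar>B * norm (g t)\<bar>" by (simp add: mult.commute)
      then have "std_normal_density y * \<bar>g t \<bullet> g (t - \<sigma> * y)\<bar> \<le> std_normal_density y * \<bar>B * norm (g t)\<bar>"
        by (intro mult_left_mono) simp_all
      then show "norm (std_normal_density y * (g t \<bullet> g (t - \<sigma> * y))) \<le> norm ((B * norm (g t)) \<bullet> std_normal_density y)"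
        by (simp add: abs_mult mult.commute)
    qed
  qed measurable
  have 6: "(\<integral>t. (\<integral>y. std_normal_density y * (g t \<bullet> g (t - \<sigma> * y)) \<partial>lborel) \<partial>lborel)
      = integral\<^sup>L (lborel \<Otimes>\<^sub>M lborel) (\<lambda>(t, y). std_normal_density y * (g t \<bullet> g (t - \<sigma> * y)))"
    by (rule lborel_pair.integral_fst[OF 5])
  show "(\<integral>\<nu>. exp (- (\<sigma> * \<nu>)\<^sup>2 / 2) * (norm (fourier g \<nu>))\<^sup>2 \<partial>lborel)
      = 2 * pi * integral\<^sup>L (lborel \<Otimes>\<^sub>M lborel) (\<lambda>(t, y). std_normal_density y * (g t \<bullet> g (t - \<sigma> * y)))"
    using 2 unfolding 3 4 6 by (simp only: \<phi>_def)
qed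

lemma integrable_norm_squared:
  fixes g :: "real \<Rightarrow> 'a::{real_inner, banach, second_countable_topology}"
  assumes g: "integrable lborel g" and B: "\<And>t. norm (g t) \<le> B"
  shows "integrable lborel (\<lambda>t. (norm (g t))\<^sup>2)"
proof (rule Bochner_Integration.integrable_bound[of lborel "\<lambda>t. B * norm (g t)"])
  show "integrable lborel (\<lambda>t. B * norm (g t))" using g by simp
  show "(\<lambda>t. (norm (g t))\<^sup>2) \<in> borel_measurable lborel" using g by auto
  show "AE t in lborel. norm ((norm (g t))\<^sup>2) \<le> norm (B * norm (g t))"
  proof (rule AE_I2)
    fix t
    have "(norm (g t))\<^sup>2 \<le> B * norm (g t)"
      unfolding power2_eq_square by (intro mult_right_mono B norm_ge_zero)
    then show "norm ((norm (g t))\<^sup>2) \<le> norm (B * norm (g t))" by simp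
  qed
qed

text \<open>Translations preserve the squared norm, so every shifted correlation is at most the squared norm
  of \<open>g\<close>, uniformly in \<open>\<sigma>\<close>; Fatou's lemma removes the regularization.\<close>

theorem plancherel_le:
  fixes g :: "real \<Rightarrow> 'a::{real_inner, banach, second_countable_topology}"
  assumes g: "integrable lborel g" and B: "\<And>t. norm (g t) \<le> B"
  shows "(\<integral>\<^sup>+\<nu>. ennreal ((norm (fourier g \<nu>))\<^sup>2) \<partial>lborel) \<le> ennreal (2 * pi * (\<integral>t. (norm (g t))\<^sup>2 \<partial>lborel))"
proof -
  have [measurable]: "g \<in> borel_measurable borel" using borel_measurable_integrable[OF g] by simp
  note g2 = integrable_norm_squared[OF g B]
  define P where "P = (\<integral>t. (norm (g t))\<^sup>2 \<partial>lborel)"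
  have bd: "(\<integral>\<nu>. exp (- (\<sigma> * \<nu>)\<^sup>2 / 2) * (norm (fourier g \<nu>))\<^sup>2 \<partial>lborel) \<le> 2 * pi * P" if \<sigma>: "0 < \<sigma>" for \<sigma>
  proof -
    note I = gaussian_regularized_fourier[OF g B \<sigma>]
    have t: "(\<integral>t. std_normal_density y * (g t \<bullet> g (t - \<sigma> * y)) \<partial>lborel) \<le> std_normal_density y * P" for y
    proof -
      have gs: "integrable lborel (\<lambda>t. (norm (g (- \<sigma> * y + 1 * t)))\<^sup>2)"
        by (rule lborel_integrable_real_affine[OF g2]) simp
      have Ps: "(\<integral>t. (norm (g (t - \<sigma> * y)))\<^sup>2 \<partial>lborel) = P"
        using lborel_integral_real_affine[of 1 "\<lambda>t. (norm (g t))\<^sup>2" "- \<sigma> * y"] by (simp add: P_def)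
      have "(\<integral>t. g t \<bullet> g (t - \<sigma> * y) \<partial>lborel) \<le> (\<integral>t. ((norm (g t))\<^sup>2 + (norm (g (t - \<sigma> * y)))\<^sup>2) / 2 \<partial>lborel)"
      proof (rule integral_mono')
        show "integrable lborel (\<lambda>t. ((norm (g t))\<^sup>2 + (norm (g (t - \<sigma> * y)))\<^sup>2) / 2)"
          using g2 gs by simp
        show "g t \<bullet> g (t - \<sigma> * y) \<le> ((norm (g t))\<^sup>2 + (norm (g (t - \<sigma> * y)))\<^sup>2) / 2" for t
          using norm_cauchy_schwarz[of "g t" "g (t - \<sigma> * y)"] sum_squares_bound[of "norm (g t)" "norm (g (t - \<sigma> * y))"]
          by (simp add: field_simps)
      qed simp
      also have "\<dots> = P" using g2 gs Ps by (simp add: P_def)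
      finally show ?thesis by (simp add: mult_left_mono)
    qed
    have "integral\<^sup>L (lborel \<Otimes>\<^sub>M lborel) (\<lambda>(t, y). std_normal_density y * (g t \<bullet> g (t - \<sigma> * y)))
        = (\<integral>y. (\<integral>t. std_normal_density y * (g t \<bullet> g (t - \<sigma> * y)) \<partial>lborel) \<partial>lborel)"
      by (rule lborel_pair.integral_snd[OF I(2), symmetric])
    also have "\<dots> \<le> (\<integral>y. std_normal_density y * P \<partial>lborel)"
      by (rule integral_mono[OF lborel_pair.integrable_snd[OF I(2)] _ t]) simp
    also have "\<dots> = P" by simp
    finally show ?thesis using I(3) by simp
  qed
  have "(\<integral>\<^sup>+\<nu>. ennreal ((norm (fourier g \<nu>))\<^sup>2) \<partial>lborel)
      = (\<integral>\<^sup>+\<nu>. liminf (\<lambda>n. ennreal (exp (- (inverse (real (Suc n)) * \<nu>)\<^sup>2 / 2) * (norm (fourier g \<nu>))\<^sup>2)) \<partial>lborel)"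
  proof (rule nn_integral_cong)
    fix \<nu> :: real
    have "(\<lambda>n. exp (- (inverse (real (Suc n)) * \<nu>)\<^sup>2 / 2) * (norm (fourier g \<nu>))\<^sup>2)
        \<longlonglongrightarrow> exp (- (0 * \<nu>)\<^sup>2 / 2) * (norm (fourier g \<nu>))\<^sup>2"
      by (intro tendsto_intros LIMSEQ_inverse_real_of_nat) simp
    then have "(\<lambda>n. ennreal (exp (- (inverse (real (Suc n)) * \<nu>)\<^sup>2 / 2) * (norm (fourier g \<nu>))\<^sup>2))
        \<longlonglongrightarrow> ennreal ((norm (fourier g \<nu>))\<^sup>2)" by (intro tendsto_ennrealI) simp
    then show "ennreal ((norm (fourier g \<nu>))\<^sup>2)
        = liminf (\<lambda>n. ennreal (exp (- (inverse (real (Suc n)) * \<nu>)\<^sup>2 / 2) * (norm (fourier g \<nu>))\<^sup>2))"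
      by (rule lim_imp_Liminf[OF trivial_limit_sequentially, symmetric])
  qed
  also have "\<dots> \<le> liminf (\<lambda>n. \<integral>\<^sup>+\<nu>. ennreal (exp (- (inverse (real (Suc n)) * \<nu>)\<^sup>2 / 2) * (norm (fourier g \<nu>))\<^sup>2) \<partial>lborel)"
    by (rule nn_integral_liminf) measurable
  also have "\<dots> \<le> ennreal (2 * pi * P)"
  proof (rule order_trans[OF Liminf_le_Limsup Limsup_bounded])
    show "\<forall>\<^sub>F n in sequentially. (\<integral>\<^sup>+\<nu>. ennreal (exp (- (inverse (real (Suc n)) * \<nu>)\<^sup>2 / 2) * (norm (fourier g \<nu>))\<^sup>2) \<partial>lborel)
        \<le> ennreal (2 * pi * P)"
    proof (intro always_eventually allI)
      fix n
      have s: "0 < inverse (real (Suc n))" by simp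
      have "(\<integral>\<^sup>+\<nu>. ennreal (exp (- (inverse (real (Suc n)) * \<nu>)\<^sup>2 / 2) * (norm (fourier g \<nu>))\<^sup>2) \<partial>lborel)
          = ennreal (\<integral>\<nu>. exp (- (inverse (real (Suc n)) * \<nu>)\<^sup>2 / 2) * (norm (fourier g \<nu>))\<^sup>2 \<partial>lborel)"
        by (rule nn_integral_eq_integral[OF gaussian_regularized_fourier(1)[OF g B s]]) simp
      also have "\<dots> \<le> ennreal (2 * pi * P)" by (rule ennreal_leI[OF bd[OF s]])
      finally show "(\<integral>\<^sup>+\<nu>. ennreal (exp (- (inverse (real (Suc n)) * \<nu>)\<^sup>2 / 2) * (norm (fourier g \<nu>))\<^sup>2) \<partial>lborel)
        \<le> ennreal (2 * pi * P)" .
    qed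
  qed simp
  finally show ?thesis by (simp add: P_def)
qed

text \<open>The regularized integrals stay below the full one and converge to the squared norm by dominated
  convergence. Continuity almost everywhere gives the pointwise limit of the shifted correlations.\<close>

theorem plancherel_ge:
  fixes g :: "real \<Rightarrow> 'a::{real_inner, banach, second_countable_topology}"
  assumes g: "integrable lborel g" and B: "\<And>t. norm (g t) \<le> B"
    and cont: "AE t in lborel. isCont g t"
  shows "ennreal (2 * pi * (\<integral>t. (norm (g t))\<^sup>2 \<partial>lborel)) \<le> (\<integral>\<^sup>+\<nu>. ennreal ((norm (fourier g \<nu>))\<^sup>2) \<partial>lborel)"
proof -
  have [measurable]: "g \<in> borel_measurable borel" using borel_measurable_integrable[OF g] by simp
  note g2 = integrable_norm_squared[OF g B]
  define s where "s n = inverse (real (Suc n))" for n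
  have s: "0 < s n" "s \<longlonglongrightarrow> 0" for n
    using LIMSEQ_inverse_real_of_nat by (simp_all add: s_def[abs_def])
  define H where "H n = (\<lambda>(t, y). std_normal_density y * (g t \<bullet> g (t - s n * y)))" for n
  define H0 where "H0 = (\<lambda>(t, y). std_normal_density y * (g t \<bullet> g t))"
  have [measurable]: "H n \<in> borel_measurable (lborel \<Otimes>\<^sub>M lborel)" for n unfolding H_def by measurable
  have [measurable]: "H0 \<in> borel_measurable (lborel \<Otimes>\<^sub>M lborel)" unfolding H0_def by measurable
  have g': "integrable lborel (\<lambda>t. B * norm (g t))" using g by simp
  have "(\<lambda>n. integral\<^sup>L (lborel \<Otimes>\<^sub>M lborel) (H n)) \<longlonglongrightarrow> integral\<^sup>L (lborel \<Otimes>\<^sub>M lborel) H0"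
  proof (rule integral_dominated_convergence[where w="\<lambda>(t, y). (B * norm (g t)) \<bullet> std_normal_density y"])
    show "integrable (lborel \<Otimes>\<^sub>M lborel) (\<lambda>(t, y). (B * norm (g t)) \<bullet> std_normal_density y)"
      by (rule integrable_inner_prod[OF g' integrable_normal_density[OF zero_less_one]])
    have "AE p in lborel \<Otimes>\<^sub>M (lborel :: real measure). isCont g (fst p)"
    proof -
      obtain N where N: "\<And>t. t \<in> space lborel - N \<Longrightarrow> isCont g t" "N \<in> null_sets lborel"
        using AE_E3[OF cont] by blast
      have [measurable]: "N \<in> sets borel" using N(2) by auto
      have "AE p in lborel \<Otimes>\<^sub>M (lborel :: real measure). fst p \<notin> N"
      proof (rule lborel_pair.AE_pair_measure[where P = "\<lambda>p. fst p \<notin> N"])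
        have "{p \<in> space (lborel \<Otimes>\<^sub>M (lborel :: real measure)). fst p \<notin> N}
            = fst -` (- N) \<inter> space (lborel \<Otimes>\<^sub>M lborel)" by auto
        also have "\<dots> \<in> sets (lborel \<Otimes>\<^sub>M lborel)"
          by (rule measurable_sets[OF measurable_fst]) (simp add: borel_comp)
        finally show "{p \<in> space (lborel \<Otimes>\<^sub>M (lborel :: real measure)). fst p \<notin> N} \<in> sets (lborel \<Otimes>\<^sub>M lborel)" .
        show "AE t in lborel. AE y in lborel. fst (t, y :: real) \<notin> N"
          using AE_not_in[OF N(2)] by eventually_elim simp
      qed
      then show ?thesis by eventually_elim (use N(1) in auto)
    qed
    then show "AE p in lborel \<Otimes>\<^sub>M (lborel :: real measure). (\<lambda>n. H n p) \<longlonglongrightarrow> H0 p"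
    proof eventually_elim
      fix p :: "real \<times> real" assume p: "isCont g (fst p)"
      obtain t y where ty: "p = (t, y)" by (cases p)
      have "(\<lambda>n. t - s n * y) \<longlonglongrightarrow> t - 0 * y" by (intro tendsto_intros s)
      then have "(\<lambda>n. g (t - s n * y)) \<longlonglongrightarrow> g t"
        using p ty by (intro isCont_tendsto_compose[where g=g]) auto
      then show "(\<lambda>n. H n p) \<longlonglongrightarrow> H0 p" unfolding ty H_def H0_def prod.case by (intro tendsto_intros)
    qed
    show "AE p in lborel \<Otimes>\<^sub>M lborel. norm (H n p) \<le> (case p of (t, y) \<Rightarrow> (B * norm (g t)) \<bullet> std_normal_density y)" for n
    proof (rule AE_I2, clarify)
      fix t y
      have "\<bar>g t \<bullet> g (t - s n * y)\<bar> \<le> norm (g t) * B"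
        by (rule order_trans[OF Cauchy_Schwarz_ineq2]) (intro mult_left_mono B norm_ge_zero)
      then have "std_normal_density y * \<bar>g t \<bullet> g (t - s n * y)\<bar> \<le> std_normal_density y * (norm (g t) * B)"
        by (intro mult_left_mono) simp_all
      then show "norm (H n (t, y)) \<le> (B * norm (g t)) \<bullet> std_normal_density y"
        by (simp add: H_def abs_mult mult_ac)
    qed
  qed measurable
  moreover have "integral\<^sup>L (lborel \<Otimes>\<^sub>M lborel) H0 = (\<integral>t. (norm (g t))\<^sup>2 \<partial>lborel)"
  proof -
    have i: "integrable (lborel \<Otimes>\<^sub>M lborel) (\<lambda>(t, y). (norm (g t))\<^sup>2 \<bullet> std_normal_density y)"
      by (rule integrable_inner_prod[OF g2 integrable_normal_density[OF zero_less_one]])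
    have "integral\<^sup>L (lborel \<Otimes>\<^sub>M lborel) H0 = (\<integral>t. (\<integral>y. (norm (g t))\<^sup>2 \<bullet> std_normal_density y \<partial>lborel) \<partial>lborel)"
      using lborel_pair.integral_fst[OF i] by (simp add: H0_def power2_norm_eq_inner mult.commute)
    then show ?thesis by simp
  qed
  ultimately have lim: "(\<lambda>n. 2 * pi * integral\<^sup>L (lborel \<Otimes>\<^sub>M lborel) (H n)) \<longlonglongrightarrow> 2 * pi * (\<integral>t. (norm (g t))\<^sup>2 \<partial>lborel)"
    by (intro tendsto_intros) simp
  show ?thesis
  proof (rule LIMSEQ_le_const2[OF tendsto_ennrealI[OF lim]], intro exI[of _ 0] allI impI)
    fix n
    note I = gaussian_regularized_fourier[OF g B s(1)[of n]]
    have "ennreal (2 * pi * integral\<^sup>L (lborel \<Otimes>\<^sub>M lborel) (H n))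
        = (\<integral>\<^sup>+\<nu>. ennreal (exp (- (s n * \<nu>)\<^sup>2 / 2) * (norm (fourier g \<nu>))\<^sup>2) \<partial>lborel)"
      unfolding H_def I(3)[symmetric] by (rule nn_integral_eq_integral[OF I(1), symmetric]) simp
    also have "\<dots> \<le> (\<integral>\<^sup>+\<nu>. ennreal ((norm (fourier g \<nu>))\<^sup>2) \<partial>lborel)"
      by (intro nn_integral_mono ennreal_leI mult_left_le_one_le) auto
    finally show "ennreal (2 * pi * integral\<^sup>L (lborel \<Otimes>\<^sub>M lborel) (H n))
        \<le> (\<integral>\<^sup>+\<nu>. ennreal ((norm (fourier g \<nu>))\<^sup>2) \<partial>lborel)" .
  qed
qed

section \<open>The Laplace transform on a vertical line\<close>

definition damped :: "real \<Rightarrow> (real \<Rightarrow> 'a::real_vector) \<Rightarrow> real \<Rightarrow> 'a" where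
  "damped \<rho> g t = indicator {0..} t *\<^sub>R (exp (- \<rho> * t) *\<^sub>R g t)"

text \<open>The Laplace transform at \<open>s = \<rho> + \<i> \<nu>\<close>.\<close>

definition laplace ::
  "real \<Rightarrow> (real \<Rightarrow> 'a::{real_inner, banach, second_countable_topology}) \<Rightarrow> real \<Rightarrow> 'a \<times> 'a" where
  "laplace \<rho> g = fourier (damped \<rho> g)"

text \<open>Growth is allowed at half of the damping rate. Damped functions are then bounded and integrable.
  Solutions of the wave equation with bounded source are transformable for every positive \<open>\<rho>\<close>
  (\<open>solution_growth\<close>).\<close>

definition transformable :: "real \<Rightarrow> (real \<Rightarrow> 'a::real_normed_vector) \<Rightarrow> bool" where
  "transformable \<rho> g \<longleftrightarrow> (\<lambda>t. indicator {0..} t *\<^sub>R g t) \<in> borel_measurable borel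
     \<and> (\<exists>C. \<forall>t\<ge>0. norm (g t) \<le> C * exp (\<rho> / 2 * t))"

definition energy :: "real \<Rightarrow> (real \<Rightarrow> 'b::real_normed_vector) \<Rightarrow> real" where
  "energy \<rho> g = (\<integral>t. indicator {0..} t * ((norm (g t))\<^sup>2 * exp (- 2 * \<rho> * t)) \<partial>lborel)"

lemma transformableI_continuous:
  assumes "continuous_on {0..} g" "\<And>t. 0 \<le> t \<Longrightarrow> norm (g t) \<le> C * exp (\<rho> / 2 * t)"
  shows "transformable \<rho> g"
  unfolding transformable_def
  using borel_measurable_continuous_on_indicator[OF _ assms(1)] assms(2) by auto

lemma transformable_bounded_linear:
  assumes T: "bounded_linear T" and g: "transformable \<rho> g"
  shows "transformable \<rho> (\<lambda>t. T (g t))"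
proof -
  interpret T: bounded_linear T by fact
  obtain C where C: "\<And>t. 0 \<le> t \<Longrightarrow> norm (g t) \<le> C * exp (\<rho> / 2 * t)"
    and m: "(\<lambda>t. indicator {0..} t *\<^sub>R g t) \<in> borel_measurable borel"
    using g by (auto simp: transformable_def)
  obtain K where K: "0 < K" "\<And>x. norm (T x) \<le> norm x * K" using T.pos_bounded by blast
  have "(\<lambda>t. T (indicator {0..} t *\<^sub>R g t)) \<in> borel_measurable borel"
    by (rule measurable_compose[OF m borel_measurable_continuous_onI]) (simp add: T.continuous_on)
  then have "(\<lambda>t. indicator {0..} t *\<^sub>R T (g t)) \<in> borel_measurable borel" by (simp add: T.scaleR)
  moreover have "norm (T (g t)) \<le> (C * K) * exp (\<rho> / 2 * t)" if "0 \<le> t" for t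
  proof -
    have "norm (T (g t)) \<le> norm (g t) * K" by (rule K(2))
    also have "\<dots> \<le> (C * exp (\<rho> / 2 * t)) * K" using C[OF that] K(1) by (intro mult_right_mono) auto
    finally show ?thesis by (simp only: mult_ac)
  qed
  ultimately show ?thesis unfolding transformable_def by blast
qed

lemma transformable_add:
  fixes g h :: "real \<Rightarrow> 'a::{real_normed_vector, second_countable_topology}"
  assumes "transformable \<rho> g" "transformable \<rho> h" shows "transformable \<rho> (\<lambda>t. g t + h t)"
proof -
  from assms obtain C D where C: "\<And>t. 0 \<le> t \<Longrightarrow> norm (g t) \<le> C * exp (\<rho> / 2 * t)"
    and D: "\<And>t. 0 \<le> t \<Longrightarrow> norm (h t) \<le> D * exp (\<rho> / 2 * t)" by (auto simp: transformable_def)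
  have "norm (g t + h t) \<le> (C + D) * exp (\<rho> / 2 * t)" if "0 \<le> t" for t
    using norm_triangle_ineq[of "g t" "h t"] C[OF that] D[OF that] by (simp add: distrib_right)
  moreover have "(\<lambda>t. indicator {0..} t *\<^sub>R (g t + h t)) \<in> borel_measurable borel"
    unfolding scaleR_add_right using assms by (intro borel_measurable_add) (simp_all add: transformable_def)
  ultimately show ?thesis unfolding transformable_def by blast
qed

lemma transformable_scaleR:
  assumes "transformable \<rho> g" shows "transformable \<rho> (\<lambda>t. c *\<^sub>R g t)"
  using transformable_bounded_linear[OF bounded_linear_scaleR_right assms] .

lemma transformable_minus:
  assumes "transformable \<rho> g" shows "transformable \<rho> (\<lambda>t. - g t)"
  using transformable_scaleR[OF assms, of "-1"] by simp

lemma transformable_diff: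
  fixes g h :: "real \<Rightarrow> 'a::{real_normed_vector, second_countable_topology}"
  assumes "transformable \<rho> g" "transformable \<rho> h" shows "transformable \<rho> (\<lambda>t. g t - h t)"
  using transformable_add[OF assms(1) transformable_minus[OF assms(2)]] by simp

lemma damped_bound:
  assumes "transformable \<rho> g"
  obtains C where "0 \<le> C" "\<And>t. norm (damped \<rho> g t) \<le> C * (indicator {0..} t * exp (- (t * (\<rho> / 2))))"
proof -
  obtain C where C: "\<And>t. 0 \<le> t \<Longrightarrow> norm (g t) \<le> C * exp (\<rho> / 2 * t)"
    using assms by (auto simp: transformable_def)
  show thesis
  proof
    show "0 \<le> C" using order_trans[OF norm_ge_zero C[of 0]] by simp
    show "norm (damped \<rho> g t) \<le> C * (indicator {0..} t * exp (- (t * (\<rho> / 2))))" for t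
    proof (cases "0 \<le> t")
      case True
      have "exp (- \<rho> * t) * norm (g t) \<le> exp (- \<rho> * t) * (C * exp (\<rho> / 2 * t))"
        using C[OF True] by (intro mult_left_mono) auto
      also have "\<dots> = C * exp (- (t * (\<rho> / 2)))"
        by (simp add: mult_exp_exp mult.left_commute[of _ C] field_simps)
      finally show ?thesis using True by (simp add: damped_def)
    qed (simp add: damped_def)
  qed
qed

lemma damped_measurable:
  fixes g :: "real \<Rightarrow> 'a::{banach, second_countable_topology}"
  assumes "transformable \<rho> g" shows "damped \<rho> g \<in> borel_measurable borel"
proof -
  have "(\<lambda>t. exp (- \<rho> * t) *\<^sub>R (indicator {0..} t *\<^sub>R g t)) \<in> borel_measurable borel"
  proof (rule borel_measurable_scaleR)
    show "(\<lambda>t. indicator {0..} t *\<^sub>R g t) \<in> borel_measurable borel"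
      using assms unfolding transformable_def by blast
  qed measurable
  moreover have "damped \<rho> g = (\<lambda>t. exp (- \<rho> * t) *\<^sub>R (indicator {0..} t *\<^sub>R g t))"
    by (rule ext) (simp only: damped_def scaleR_left_commute)
  ultimately show ?thesis by (simp only:)
qed

lemma damped_add: "damped \<rho> (\<lambda>t. g t + h t) = (\<lambda>t. damped \<rho> g t + damped \<rho> h t)"
  by (auto simp: damped_def fun_eq_iff scaleR_add_right scaleR_diff_right)

lemma integrable_fourier_integrands:
  fixes g :: "real \<Rightarrow> 'a::{real_inner, banach, second_countable_topology}"
  assumes "integrable lborel g"
  shows "fst (fourier g \<nu>) = (\<integral>t. cos (\<nu> * t) *\<^sub>R g t \<partial>lborel)"
    "snd (fourier g \<nu>) = (\<integral>t. - (sin (\<nu> * t) *\<^sub>R g t) \<partial>lborel)"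
    "integrable lborel (\<lambda>t. cos (\<nu> * t) *\<^sub>R g t)"
    "integrable lborel (\<lambda>t. - (sin (\<nu> * t) *\<^sub>R g t))"
  using integrable_cos_scaleR[OF assms] integrable_sin_scaleR[OF assms] by (simp_all add: fourier_def)

context
  fixes \<rho> :: real
  assumes rho: "0 < \<rho>"
begin

lemma integrable_exp_halfline: "integrable lborel (\<lambda>t. indicator {0..} t * exp (- (t * (\<rho> / 2))))"
proof (rule Bochner_Integration.integrable_bound)
  have "0 < \<rho> / 2" using rho by simp
  from integrable_I0i_exp_mscale[OF this]
  show "integrable lborel (\<lambda>t. indicator {0<..} t * exp (- (t * (\<rho> / 2))))"
    by (simp add: set_integrable_def)
  show "AE t in lborel. norm (indicator {0..} t * exp (- (t * (\<rho> / 2))))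
      \<le> norm (indicator {0<..} t * exp (- (t * (\<rho> / 2))))"
    using AE_lborel_singleton[of "0::real"] by eventually_elim (auto simp: indicator_def)
qed simp

lemma damped_integrable:
  fixes g :: "real \<Rightarrow> 'a::{banach, second_countable_topology}"
  assumes "transformable \<rho> g" shows "integrable lborel (damped \<rho> g)"
proof -
  obtain C where C: "\<And>t. norm (damped \<rho> g t) \<le> C * (indicator {0..} t * exp (- (t * (\<rho> / 2))))"
    using damped_bound[OF assms] by metis
  show ?thesis
  proof (rule Bochner_Integration.integrable_bound[OF integrable_mult_right[OF integrable_exp_halfline]])
    show "AE t in lborel. norm (damped \<rho> g t) \<le> norm (C * (indicator {0..} t * exp (- (t * (\<rho> / 2)))))"
      unfolding real_norm_def by (rule AE_I2) (rule order_trans[OF C abs_ge_self])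
  qed (use damped_measurable[OF assms] in simp)
qed

lemma damped_bounded:
  fixes g :: "real \<Rightarrow> 'a::{banach, second_countable_topology}"
  assumes "transformable \<rho> g" shows "\<exists>B. \<forall>t. norm (damped \<rho> g t) \<le> B"
proof -
  obtain C where C: "0 \<le> C" "\<And>t. norm (damped \<rho> g t) \<le> C * (indicator {0..} t * exp (- (t * (\<rho> / 2))))"
    using damped_bound[OF assms] by metis
  have "indicator {0..} t * exp (- (t * (\<rho> / 2))) \<le> 1" for t
    using rho by (auto simp: indicator_def)
  then have "norm (damped \<rho> g t) \<le> C * 1" for t using C order_trans mult_left_mono by metis
  then show ?thesis by blast
qed

lemma laplace_bounded_linear:
  assumes T: "bounded_linear T" and g: "transformable \<rho> g"
  shows "laplace \<rho> (\<lambda>t. T (g t)) \<nu> = (T (fst (laplace \<rho> g \<nu>)), T (snd (laplace \<rho> g \<nu>)))"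
proof -
  interpret T: bounded_linear T by fact
  note i = integrable_fourier_integrands[OF damped_integrable[OF g], of \<nu>]
  have d: "damped \<rho> (\<lambda>t. T (g t)) = (\<lambda>t. T (damped \<rho> g t))"
    by (simp add: damped_def fun_eq_iff T.scaleR)
  have "T (fst (laplace \<rho> g \<nu>)) = (\<integral>t. cos (\<nu> * t) *\<^sub>R T (damped \<rho> g t) \<partial>lborel)"
    unfolding laplace_def i(1) integral_bounded_linear[OF T i(3), symmetric] by (simp add: T.scaleR)
  moreover have "T (snd (laplace \<rho> g \<nu>)) = (\<integral>t. - (sin (\<nu> * t) *\<^sub>R T (damped \<rho> g t)) \<partial>lborel)"
    unfolding laplace_def i(2) integral_bounded_linear[OF T i(4), symmetric] by (simp add: T.scaleR T.neg)
  ultimately show ?thesis by (simp add: laplace_def d fourier_def)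
qed

lemma laplace_add:
  assumes "transformable \<rho> g" "transformable \<rho> h"
  shows "laplace \<rho> (\<lambda>t. g t + h t) \<nu> = laplace \<rho> g \<nu> + laplace \<rho> h \<nu>"
  unfolding laplace_def fourier_def damped_add scaleR_add_right add_Pair
    Bochner_Integration.integral_add[OF integrable_cos_scaleR[OF damped_integrable[OF assms(1)]]
      integrable_cos_scaleR[OF damped_integrable[OF assms(2)]]]
    Bochner_Integration.integral_add[OF integrable_sin_scaleR[OF damped_integrable[OF assms(1)]]
      integrable_sin_scaleR[OF damped_integrable[OF assms(2)]]] minus_add_distrib ..

lemma laplace_scaleR:
  assumes "transformable \<rho> g"
  shows "laplace \<rho> (\<lambda>t. c *\<^sub>R g t) \<nu> = c *\<^sub>R laplace \<rho> g \<nu>"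
  using laplace_bounded_linear[OF bounded_linear_scaleR_right assms, of c \<nu>] by (simp add: prod_eq_iff)

lemma laplace_diff:
  assumes "transformable \<rho> g" "transformable \<rho> h"
  shows "laplace \<rho> (\<lambda>t. g t - h t) \<nu> = laplace \<rho> g \<nu> - laplace \<rho> h \<nu>"
proof -
  have "laplace \<rho> (\<lambda>t. g t - h t) \<nu> = laplace \<rho> g \<nu> + laplace \<rho> (\<lambda>t. (-1) *\<^sub>R h t) \<nu>"
    using laplace_add[OF assms(1) transformable_scaleR[OF assms(2), of "-1"], of \<nu>]
    by (simp only: scaleR_minus1_left add_uminus_conv_diff)
  then show ?thesis
    using laplace_scaleR[OF assms(2), of "-1" \<nu>] by (simp only: scaleR_minus1_left add_uminus_conv_diff)
qed

lemma laplace_cong: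
  assumes "\<And>t. 0 \<le> t \<Longrightarrow> g t = h t" shows "laplace \<rho> g = laplace \<rho> h"
proof -
  have "damped \<rho> g = damped \<rho> h" using assms by (auto simp: damped_def fun_eq_iff indicator_def)
  then show ?thesis by (simp add: laplace_def)
qed

lemma laplace_in_subspace:
  assumes M: "subspace M" "closed M" and g: "transformable \<rho> g" and gM: "\<And>t. 0 \<le> t \<Longrightarrow> g t \<in> M"
  shows "fst (laplace \<rho> g \<nu>) \<in> M" "snd (laplace \<rho> g \<nu>) \<in> M"
proof -
  note i = integrable_fourier_integrands[OF damped_integrable[OF g], of \<nu>]
  have d: "damped \<rho> g t \<in> M" for t
    using gM[of t] M(1) by (auto simp: damped_def indicator_def subspace_scale subspace_0)
  show "fst (laplace \<rho> g \<nu>) \<in> M" unfolding laplace_def i(1)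
    by (rule integral_in_closed_subspace[OF M i(3)]) (intro subspace_scale[OF M(1)] d)
  show "snd (laplace \<rho> g \<nu>) \<in> M" unfolding laplace_def i(2)
    by (rule integral_in_closed_subspace[OF M i(4)]) (intro subspace_neg[OF M(1)] subspace_scale[OF M(1)] d)
qed

lemma laplace_inner:
  assumes "transformable \<rho> g"
  shows "laplace \<rho> (\<lambda>t. g t \<bullet> v) \<nu> = (fst (laplace \<rho> g \<nu>) \<bullet> v, snd (laplace \<rho> g \<nu>) \<bullet> v)"
  using laplace_bounded_linear[OF bounded_linear_inner_left assms, of v \<nu>] by simp

text \<open>The exceptional set \<open>S\<close> accommodates the time nodes, where the reconstructions have kinks.\<close>

lemma integral_derivative_zero:
  fixes h h' :: "real \<Rightarrow> real"
  assumes cont: "continuous_on {0..} h" and h0: "h 0 = 0" and lim: "(h \<longlongrightarrow> 0) at_top"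
    and S: "\<And>T. finite (S \<inter> {0..T})"
    and deriv: "\<And>t. 0 < t \<Longrightarrow> t \<notin> S \<Longrightarrow> (h has_vector_derivative h' t) (at t)"
    and int: "integrable lborel (\<lambda>t. indicator {0..} t *\<^sub>R h' t)"
  shows "(\<integral>t. indicator {0..} t *\<^sub>R h' t \<partial>lborel) = 0"
proof -
  have "(\<integral>t. indicator {..T} t *\<^sub>R (indicator {0..} t *\<^sub>R h' t) \<partial>lborel) = h T" if T: "0 \<le> T" for T
  proof -
    have ind: "indicator {..T} t *\<^sub>R (indicator {0..} t *\<^sub>R h' t) = indicator {0..T} t *\<^sub>R h' t" for t
      by (auto simp: indicator_def)
    have "integrable lborel (\<lambda>t. indicator {..T} t *\<^sub>R (indicator {0..} t *\<^sub>R h' t))"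
      using int by (rule integrable_mult_indicator[rotated]) simp
    then have si: "set_integrable lborel {0..T} h'" by (simp only: ind set_integrable_def)
    have "(h' has_integral (h T - h 0)) {0..T}"
    proof (rule fundamental_theorem_of_calculus_strong[of "insert 0 (S \<inter> {0..T})"])
      show "continuous_on {0..T} h" by (rule continuous_on_subset[OF cont]) auto
      show "(h has_vector_derivative h' t) (at t)" if "t \<in> {0..T} - insert 0 (S \<inter> {0..T})" for t
        using that by (intro deriv) auto
    qed (use S T in auto)
    then have "integral {0..T} h' = h T" using h0 by (simp add: integral_unique)
    then show ?thesis using set_borel_integral_eq_integral(2)[OF si]
      by (simp only: ind set_lebesgue_integral_def)
  qed
  then have "\<forall>\<^sub>F T in at_top. (\<integral>t. indicator {..T} t *\<^sub>R (indicator {0..} t *\<^sub>R h' t) \<partial>lborel) = h T"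
    by (intro eventually_mono[OF eventually_ge_at_top[of 0]])
  then have "(h \<longlongrightarrow> (\<integral>t. indicator {0..} t *\<^sub>R h' t \<partial>lborel)) at_top"
    using tendsto_integral_at_top[OF _ int] by (simp add: tendsto_cong)
  then show ?thesis using lim by (rule tendsto_unique[rotated]) simp
qed

text \<open>Integration by parts: the function \<open>exp (- \<rho> t) k(t) g(t)\<close>, with \<open>k\<close> the cosine or the sine,
  vanishes at both ends of the half-line, so the integral of its derivative is zero.\<close>

lemma laplace_derivative_real:
  fixes g g' :: "real \<Rightarrow> real"
  assumes cont: "continuous_on {0..} g" and g0: "g 0 = 0"
    and S: "\<And>T. finite (S \<inter> {0..T})"
    and deriv: "\<And>t. 0 < t \<Longrightarrow> t \<notin> S \<Longrightarrow> (g has_vector_derivative g' t) (at t)"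
    and tg: "transformable \<rho> g" and tg': "transformable \<rho> g'"
  shows "laplace \<rho> g' \<nu> = cscale (Complex \<rho> \<nu>) (laplace \<rho> g \<nu>)"
proof -
  note i = damped_integrable[OF tg] and i' = damped_integrable[OF tg']
  have zero: "(\<integral>t. k t * damped \<rho> g' t + (k' t - \<rho> * k t) * damped \<rho> g t \<partial>lborel) = 0"
    if k: "\<And>t. (k has_real_derivative k' t) (at t)" and k1: "\<And>t. \<bar>k t\<bar> \<le> 1"
      and ik: "integrable lborel (\<lambda>t. k t * damped \<rho> g' t + (k' t - \<rho> * k t) * damped \<rho> g t)" for k k'
  proof -
    define h where "h t = exp (- \<rho> * t) * k t * g t" for t
    define h' where "h' t = exp (- \<rho> * t) * (k t * g' t + (k' t - \<rho> * k t) * g t)" for t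
    have eq: "k t * damped \<rho> g' t + (k' t - \<rho> * k t) * damped \<rho> g t = indicator {0..} t *\<^sub>R h' t" for t
      by (simp add: damped_def h'_def algebra_simps)
    have kc: "continuous_on A k" for A
      using k by (meson DERIV_isCont continuous_at_imp_continuous_on)
    obtain C where C: "0 \<le> C" "\<And>t. norm (damped \<rho> g t) \<le> C * (indicator {0..} t * exp (- (t * (\<rho> / 2))))"
      using damped_bound[OF tg] by metis
    have "(\<integral>t. indicator {0..} t *\<^sub>R h' t \<partial>lborel) = 0"
    proof (rule integral_derivative_zero[where h = h and S = S])
      show "continuous_on {0..} h" unfolding h_def by (intro continuous_intros kc cont)
      show "h 0 = 0" by (simp add: h_def g0)
      show "(h has_vector_derivative h' t) (at t)" if "0 < t" "t \<notin> S" for t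
      proof -
        have "(g has_real_derivative g' t) (at t)"
          using deriv[OF that] by (simp add: has_real_derivative_iff_has_vector_derivative)
        then have "(h has_real_derivative h' t) (at t)" unfolding h_def h'_def
          by (auto intro!: derivative_eq_intros k simp: algebra_simps)
        then show ?thesis by (simp add: has_real_derivative_iff_has_vector_derivative)
      qed
      show "(h \<longlongrightarrow> 0) at_top"
      proof (rule Lim_null_comparison)
        show "\<forall>\<^sub>F t in at_top. norm (h t) \<le> C * exp (- (t * (\<rho> / 2)))"
          using eventually_ge_at_top[of 0]
        proof eventually_elim
          fix t :: real assume t: "0 \<le> t"
          have "norm (h t) = \<bar>k t\<bar> * norm (damped \<rho> g t)" using t by (simp add: h_def damped_def abs_mult)
          also have "\<dots> \<le> norm (damped \<rho> g t)" using k1 by (intro mult_left_le_one_le) auto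
          also have "\<dots> \<le> C * exp (- (t * (\<rho> / 2)))" using C(2)[of t] t by simp
          finally show "norm (h t) \<le> C * exp (- (t * (\<rho> / 2)))" .
        qed
        have "filterlim (\<lambda>t. t * (\<rho> / 2)) at_top at_top"
          using rho by (intro filterlim_at_top_mult_tendsto_pos[OF tendsto_const _ filterlim_ident]) simp
        then have "((\<lambda>t. exp (- (t * (\<rho> / 2)))) \<longlongrightarrow> 0) at_top"
          by (intro filterlim_compose[OF exp_at_bot] filterlim_compose[OF filterlim_uminus_at_bot_at_top])
        then show "((\<lambda>t. C * exp (- (t * (\<rho> / 2)))) \<longlongrightarrow> 0) at_top" by (rule tendsto_mult_right_zero)
      qed
    qed (use S ik in \<open>auto simp: eq\<close>)
    then show ?thesis by (simp add: eq)
  qed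
  have c': "integrable lborel (\<lambda>t. cos (\<nu> * t) * damped \<rho> g' t)" and c: "integrable lborel (\<lambda>t. cos (\<nu> * t) * damped \<rho> g t)"
    and s': "integrable lborel (\<lambda>t. sin (\<nu> * t) * damped \<rho> g' t)" and s: "integrable lborel (\<lambda>t. sin (\<nu> * t) * damped \<rho> g t)"
    using integrable_cos_scaleR[OF i] integrable_cos_scaleR[OF i'] integrable_sin_scaleR[OF i] integrable_sin_scaleR[OF i']
    by simp_all
  define ca sa ca' sa' where "ca = (\<integral>t. cos (\<nu> * t) * damped \<rho> g t \<partial>lborel)"
    and "sa = (\<integral>t. sin (\<nu> * t) * damped \<rho> g t \<partial>lborel)"
    and "ca' = (\<integral>t. cos (\<nu> * t) * damped \<rho> g' t \<partial>lborel)"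
    and "sa' = (\<integral>t. sin (\<nu> * t) * damped \<rho> g' t \<partial>lborel)"
  have hc: "has_bochner_integral lborel (\<lambda>t. cos (\<nu> * t) * damped \<rho> g' t + (- \<nu> * sin (\<nu> * t) - \<rho> * cos (\<nu> * t)) * damped \<rho> g t)
      (ca' + (- \<nu> * sa - \<rho> * ca))"
  proof -
    have "has_bochner_integral lborel (\<lambda>t. cos (\<nu> * t) * damped \<rho> g' t
          + (- \<nu> * (sin (\<nu> * t) * damped \<rho> g t) - \<rho> * (cos (\<nu> * t) * damped \<rho> g t))) (ca' + (- \<nu> * sa - \<rho> * ca))"
      unfolding ca_def sa_def ca'_def
      by (intro has_bochner_integral_add has_bochner_integral_diff has_bochner_integral_mult_right
          has_bochner_integral_integrable c' c s)
    then show ?thesis by (simp add: algebra_simps)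
  qed
  have hs: "has_bochner_integral lborel (\<lambda>t. sin (\<nu> * t) * damped \<rho> g' t + (\<nu> * cos (\<nu> * t) - \<rho> * sin (\<nu> * t)) * damped \<rho> g t)
      (sa' + (\<nu> * ca - \<rho> * sa))"
  proof -
    have "has_bochner_integral lborel (\<lambda>t. sin (\<nu> * t) * damped \<rho> g' t
          + (\<nu> * (cos (\<nu> * t) * damped \<rho> g t) - \<rho> * (sin (\<nu> * t) * damped \<rho> g t))) (sa' + (\<nu> * ca - \<rho> * sa))"
      unfolding ca_def sa_def sa'_def
      by (intro has_bochner_integral_add has_bochner_integral_diff has_bochner_integral_mult_right
          has_bochner_integral_integrable c s' s)
    then show ?thesis by (simp add: algebra_simps)
  qed
  have dc: "((\<lambda>t. cos (\<nu> * t)) has_real_derivative - \<nu> * sin (\<nu> * t)) (at t)"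
    and ds: "((\<lambda>t. sin (\<nu> * t)) has_real_derivative \<nu> * cos (\<nu> * t)) (at t)" for t
    by (auto intro!: derivative_eq_intros)
  have "ca' + (- \<nu> * sa - \<rho> * ca) = 0"
    using zero[OF dc _ integrable.intros[OF hc]] has_bochner_integral_integral_eq[OF hc] by simp
  moreover have "sa' + (\<nu> * ca - \<rho> * sa) = 0"
    using zero[OF ds _ integrable.intros[OF hs]] has_bochner_integral_integral_eq[OF hs] by simp
  moreover have "laplace \<rho> g \<nu> = (ca, - sa)" "laplace \<rho> g' \<nu> = (ca', - sa')"
    by (simp_all only: laplace_def fourier_def real_scaleR_def ca_def sa_def ca'_def sa'_def)
  ultimately show ?thesis by (simp add: cscale_def)
qed

lemma laplace_derivative:
  fixes g g' :: "real \<Rightarrow> 'a::{real_inner, banach, second_countable_topology}"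
  assumes cont: "continuous_on {0..} g" and g0: "g 0 = 0"
    and S: "\<And>T. finite (S \<inter> {0..T})"
    and deriv: "\<And>t. 0 < t \<Longrightarrow> t \<notin> S \<Longrightarrow> (g has_vector_derivative g' t) (at t)"
    and tg: "transformable \<rho> g" and tg': "transformable \<rho> g'"
  shows "laplace \<rho> g' \<nu> = cscale (Complex \<rho> \<nu>) (laplace \<rho> g \<nu>)"
proof -
  have "laplace \<rho> (\<lambda>t. g' t \<bullet> v) \<nu> = cscale (Complex \<rho> \<nu>) (laplace \<rho> (\<lambda>t. g t \<bullet> v) \<nu>)" for v
  proof (rule laplace_derivative_real[OF _ _ S])
    show "continuous_on {0..} (\<lambda>t. g t \<bullet> v)" by (intro continuous_intros cont)
    show "((\<lambda>t. g t \<bullet> v) has_vector_derivative g' t \<bullet> v) (at t)" if "0 < t" "t \<notin> S" for t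
      by (rule bounded_linear.has_vector_derivative[OF bounded_linear_inner_left deriv[OF that]])
  qed (auto simp: g0 intro!: transformable_bounded_linear[OF bounded_linear_inner_left] tg tg')
  then have "fst (laplace \<rho> g' \<nu>) \<bullet> v = fst (cscale (Complex \<rho> \<nu>) (laplace \<rho> g \<nu>)) \<bullet> v"
    "snd (laplace \<rho> g' \<nu>) \<bullet> v = snd (cscale (Complex \<rho> \<nu>) (laplace \<rho> g \<nu>)) \<bullet> v" for v
    by (auto simp: laplace_inner tg tg' cscale_def inner_diff_left inner_add_left)
  then have "fst (laplace \<rho> g' \<nu>) = fst (cscale (Complex \<rho> \<nu>) (laplace \<rho> g \<nu>))"
    "snd (laplace \<rho> g' \<nu>) = snd (cscale (Complex \<rho> \<nu>) (laplace \<rho> g \<nu>))"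
    by (blast intro: vector_eq_rdot[THEN iffD1])+
  then show ?thesis by (rule prod_eqI)
qed

lemma norm_damped_squared:
  "(norm (damped \<rho> g t))\<^sup>2 = indicator {0..} t * ((norm (g t))\<^sup>2 * exp (- 2 * \<rho> * t))"
  by (simp add: damped_def power_mult_distrib indicator_def flip: exp_double)

lemma damped_square_integrable:
  fixes g :: "real \<Rightarrow> 'a::{real_inner, banach, second_countable_topology}"
  assumes "transformable \<rho> g"
  shows "integrable lborel (\<lambda>t. indicator {0..} t * ((norm (g t))\<^sup>2 * exp (- 2 * \<rho> * t)))"
proof -
  obtain B where "\<And>t. norm (damped \<rho> g t) \<le> B" using damped_bounded[OF assms] by blast
  from integrable_norm_squared[OF damped_integrable[OF assms] this] show ?thesis
    by (simp add: norm_damped_squared)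
qed

lemma energy_nonneg: "0 \<le> energy \<rho> g"
  unfolding energy_def by (rule Bochner_Integration.integral_nonneg) simp

lemma laplace_measurable:
  assumes "transformable \<rho> g" shows "laplace \<rho> g \<in> borel_measurable borel"
  unfolding laplace_def by (rule borel_measurable_fourier[OF damped_measurable[OF assms]])

lemma laplace_plancherel_le:
  assumes "transformable \<rho> g"
  shows "(\<integral>\<^sup>+\<nu>. ennreal ((norm (laplace \<rho> g \<nu>))\<^sup>2) \<partial>lborel) \<le> ennreal (2 * pi * energy \<rho> g)"
proof -
  obtain B where "\<And>t. norm (damped \<rho> g t) \<le> B" using damped_bounded[OF assms] by blast
  from plancherel_le[OF damped_integrable[OF assms] this] show ?thesis
    by (simp add: norm_damped_squared laplace_def energy_def)
qed

text \<open>Cutting off negative times creates at most one discontinuity, at 0.\<close>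

lemma laplace_plancherel_ge:
  assumes g: "transformable \<rho> g" and cont: "continuous_on {0..} g"
  shows "ennreal (2 * pi * energy \<rho> g) \<le> (\<integral>\<^sup>+\<nu>. ennreal ((norm (laplace \<rho> g \<nu>))\<^sup>2) \<partial>lborel)"
proof -
  obtain B where B: "\<And>t. norm (damped \<rho> g t) \<le> B" using damped_bounded[OF g] by blast
  have "AE t in lborel. isCont (damped \<rho> g) t"
    using AE_lborel_singleton[of "0::real"]
  proof eventually_elim
    fix t :: real assume "t \<noteq> 0"
    then consider "t < 0" | "0 < t" by linarith
    then show "isCont (damped \<rho> g) t"
    proof cases
      case 1
      have "isCont (\<lambda>t. 0 :: 'a) t" by simp
      moreover have "\<forall>\<^sub>F x in nhds t. damped \<rho> g x = 0"
        using eventually_nhds_in_open[of "{..<0}" t] 1 by (auto elim!: eventually_mono simp: damped_def)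
      ultimately show ?thesis by (simp add: isCont_cong)
    next
      case 2
      have "continuous_on {0<..} (\<lambda>t. exp (- \<rho> * t) *\<^sub>R g t)"
        by (intro continuous_intros continuous_on_subset[OF cont]) auto
      then have "isCont (\<lambda>t. exp (- \<rho> * t) *\<^sub>R g t) t" using 2 by (simp add: continuous_on_eq_continuous_at)
      moreover have "\<forall>\<^sub>F x in nhds t. damped \<rho> g x = exp (- \<rho> * x) *\<^sub>R g x"
        using eventually_nhds_in_open[of "{0<..}" t] 2 by (auto elim!: eventually_mono simp: damped_def)
      ultimately show ?thesis by (simp add: isCont_cong)
    qed
  qed
  from plancherel_ge[OF damped_integrable[OF g] B this] show ?thesis
    by (simp add: norm_damped_squared laplace_def energy_def)
qed

end

section \<open>Abstract wave equations: estimates in the frequency domain\<close>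

text \<open>An abstraction of \<open>H\<^sup>1\<^sub>0(\<Omega>)\<close> with its gradient. The closed graph makes \<open>V\<close> complete in the graph
  norm and lets \<open>D\<close> commute with transforms; the Poincare inequality makes the range of \<open>D\<close> closed.\<close>

locale wave_space =
  fixes V :: "'h::{real_inner, banach, second_countable_topology} set"
    and D :: "'h \<Rightarrow> 'g::{real_inner, banach, second_countable_topology}"
  assumes V: "subspace V"
    and D_add: "\<And>x y. x \<in> V \<Longrightarrow> y \<in> V \<Longrightarrow> D (x + y) = D x + D y"
    and D_scale: "\<And>c x. x \<in> V \<Longrightarrow> D (c *\<^sub>R x) = c *\<^sub>R D x"
    and closed_graph: "closed ((\<lambda>v. (v, D v)) ` V)"
    and poincare: "\<exists>C. \<forall>v\<in>V. norm v \<le> C * norm (D v)"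
begin

lemma D_zero: "D 0 = 0"
  using D_scale[OF subspace_0[OF V], of 0] by simp

lemma D_diff: "x \<in> V \<Longrightarrow> y \<in> V \<Longrightarrow> D (x - y) = D x - D y"
  using D_add[of x "(-1) *\<^sub>R y"] D_scale[of y "-1"] by (simp add: subspace_neg[OF V])

lemma subspace_graph: "subspace U \<Longrightarrow> U \<subseteq> V \<Longrightarrow> subspace ((\<lambda>v. (v, D v)) ` U)"
  unfolding subspace_def
  by (auto simp: image_iff D_zero zero_prod_def D_add[OF subsetD subsetD] D_scale[OF subsetD])

definition D2 :: "'h \<times> 'h \<Rightarrow> 'g \<times> 'g" where "D2 x = (D (fst x), D (snd x))"

text \<open>The real part of the Helmholtz form \<open>s\<^sup>2 (x, y) + (D x, D y)\<close> on the complexification.\<close>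

definition b_form :: "complex \<Rightarrow> 'h \<times> 'h \<Rightarrow> 'h \<times> 'h \<Rightarrow> real" where
  "b_form s x y = cscale (s\<^sup>2) x \<bullet> y + D2 x \<bullet> D2 y"

lemma V2: "subspace (V \<times> V)"
  using V by (rule subspace_Times[OF V])

lemma D2_diff: "x \<in> V \<times> V \<Longrightarrow> y \<in> V \<times> V \<Longrightarrow> D2 (x - y) = D2 x - D2 y"
  and D2_scaleR: "x \<in> V \<times> V \<Longrightarrow> D2 (c *\<^sub>R x) = c *\<^sub>R D2 x"
  and D2_cscale: "x \<in> V \<times> V \<Longrightarrow> D2 (cscale z x) = cscale z (D2 x)"
  by (auto simp: D2_def cscale_def D_add D_diff D_scale subspace_scale[OF V])

text \<open>Moving \<open>s\<close> onto the second argument multiplies both terms by \<open>cnj s\<close>, and \<open>s\<^sup>2 cnj s = |s|\<^sup>2 s\<close> has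
  the same positive real part as \<open>|s|\<^sup>2 cnj s\<close>. The form, indefinite on the diagonal, thus becomes
  coercive.\<close>

lemma b_form_cscale_self:
  assumes "x \<in> V \<times> V"
  shows "b_form s x (cscale s x) = Re s * ((cmod s)\<^sup>2 * (norm x)\<^sup>2 + (norm (D2 x))\<^sup>2)"
    and "b_form s (cscale (cnj s) x) x = Re s * ((cmod s)\<^sup>2 * (norm x)\<^sup>2 + (norm (D2 x))\<^sup>2)"
proof -
  have e: "cnj s * s\<^sup>2 = of_real ((cmod s)\<^sup>2) * s" "s\<^sup>2 * cnj s = of_real ((cmod s)\<^sup>2) * s"
    unfolding complex_norm_square by (simp_all only: power2_eq_square mult_ac)
  have "cscale (s\<^sup>2) x \<bullet> cscale s x = cscale (cnj s * s\<^sup>2) x \<bullet> x"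
    by (simp add: inner_cscale_left[of "cnj s * s\<^sup>2"] inner_cscale_left[of "s\<^sup>2"] cscale_cscale mult.commute)
  then show "b_form s x (cscale s x) = Re s * ((cmod s)\<^sup>2 * (norm x)\<^sup>2 + (norm (D2 x))\<^sup>2)"
    unfolding b_form_def D2_cscale[OF assms] e(1) inner_cscale_self
    by (simp add: inner_cscale_self inner_commute[of "D2 x"] algebra_simps)
  show "b_form s (cscale (cnj s) x) x = Re s * ((cmod s)\<^sup>2 * (norm x)\<^sup>2 + (norm (D2 x))\<^sup>2)"
    unfolding b_form_def D2_cscale[OF assms] cscale_cscale e(2) inner_cscale_self
    by (simp add: algebra_simps)
qed

text \<open>Lax--Milgram for the form with first argument multiplied by \<open>cnj s\<close>, which is coercive by the
  preceding identity; the factor is undone by substituting test functions.\<close>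

lemma adjoint_exists:
  assumes s: "0 < Re s"
  shows "\<exists>\<phi>\<in>V \<times> V. \<forall>w\<in>V \<times> V. b_form s w \<phi> = (cmod s)\<^sup>2 * (w \<bullet> g)"
proof -
  have s0: "s \<noteq> 0" using s by auto
  (* the graph of D2, a closed subspace of a Hilbert space, replaces V with its graph norm *)
  define M where "M = {p. (fst (fst p), fst (snd p)) \<in> (\<lambda>v. (v, D v)) ` V \<and> (snd (fst p), snd (snd p)) \<in> (\<lambda>v. (v, D v)) ` V}"
  note G = subspace_graph[OF V subset_refl]
  have M: "subspace M" unfolding M_def subspace_def
    using subspace_0[OF G] subspace_add[OF G] subspace_scale[OF G]
    by (simp add: zero_prod_def del: image_iff) (metis (no_types, lifting) add_Pair scaleR_Pair)
  have "closed M"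
  proof -
    have "M = (\<lambda>p. (fst (fst p), fst (snd p))) -` ((\<lambda>v. (v, D v)) ` V) \<inter> (\<lambda>p. (snd (fst p), snd (snd p))) -` ((\<lambda>v. (v, D v)) ` V)"
      by (auto simp: M_def)
    then show ?thesis
      by (simp only:) (intro closed_Int continuous_closed_vimage closed_graph continuous_intros)
  qed
  have MV: "p \<in> M \<longleftrightarrow> fst p \<in> V \<times> V \<and> snd p = D2 (fst p)" for p
    by (cases p) (auto simp: M_def D2_def image_iff mem_Times_iff prod_eq_iff)
  define a where "a p q = cscale (s\<^sup>2 * cnj s) (fst p) \<bullet> fst q + cscale (cnj s) (snd p) \<bullet> snd q"
    for p q :: "('h \<times> 'h) \<times> ('g \<times> 'g)"
  have a: "bounded_bilinear a"
  proof
    fix p p' q q' :: "('h \<times> 'h) \<times> ('g \<times> 'g)" and k :: real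
    show "a (p + p') q = a p q + a p' q" "a p (q + q') = a p q + a p q'"
      by (simp_all add: a_def cscale_add inner_add_left inner_add_right)
    show "a (k *\<^sub>R p) q = k *\<^sub>R a p q" "a p (k *\<^sub>R q) = k *\<^sub>R a p q"
      by (simp_all add: a_def cscale_scaleR distrib_left)
  next
    have "norm (a p q) \<le> norm p * norm q * (cmod (s\<^sup>2 * cnj s) + cmod (cnj s))" for p q
    proof -
      have cs: "\<bar>cscale z x \<bullet> y\<bar> \<le> cmod z * (norm p * norm q)" if "norm x \<le> norm p" "norm y \<le> norm q"
        for z and x y :: "'b::real_inner \<times> 'b"
      proof -
        have "\<bar>cscale z x \<bullet> y\<bar> \<le> cmod z * norm x * norm y"
          using Cauchy_Schwarz_ineq2[of "cscale z x" y] by (simp add: norm_cscale)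
        also have "\<dots> \<le> cmod z * (norm p * norm q)"
          unfolding mult.assoc using that by (intro mult_left_mono mult_mono) auto
        finally show ?thesis .
      qed
      have "norm (fst p) \<le> norm p" "norm (fst q) \<le> norm q" "norm (snd p) \<le> norm p" "norm (snd q) \<le> norm q"
        by (metis prod.collapse norm_fst_le norm_snd_le)+
      then have "\<bar>cscale (s\<^sup>2 * cnj s) (fst p) \<bullet> fst q\<bar> + \<bar>cscale (cnj s) (snd p) \<bullet> snd q\<bar>
          \<le> cmod (s\<^sup>2 * cnj s) * (norm p * norm q) + cmod (cnj s) * (norm p * norm q)"
        by (intro add_mono cs)
      also have "\<dots> = norm p * norm q * (cmod (s\<^sup>2 * cnj s) + cmod (cnj s))"
        by (simp only: distrib_left mult.commute)
      finally show ?thesis unfolding a_def real_norm_def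
        by (rule order_trans[OF abs_triangle_ineq])
    qed
    then show "\<exists>K. \<forall>p q. norm (a p q) \<le> norm p * norm q * K" by blast
  qed
  define c where "c = min (Re s * (cmod s)\<^sup>2) (Re s)"
  have c: "0 < c" using s s0 by (simp add: c_def)
  have "\<exists>x\<in>M. \<forall>y\<in>M. a y x = (cmod s)\<^sup>2 * (cscale (cnj s) (fst y) \<bullet> g)"
  proof (rule lax_milgram_on[OF M \<open>closed M\<close> a _ c])
    show "c * (norm p)\<^sup>2 \<le> a p p" if "p \<in> M" for p
    proof -
      have "a p p = b_form s (cscale (cnj s) (fst p)) (fst p)"
        using that by (simp add: MV a_def b_form_def cscale_cscale D2_cscale)
      also have "\<dots> = Re s * (cmod s)\<^sup>2 * (norm (fst p))\<^sup>2 + Re s * (norm (snd p))\<^sup>2"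
        using that MV b_form_cscale_self(2)[of "fst p" s] by (simp add: algebra_simps)
      also have "\<dots> \<ge> c * (norm (fst p))\<^sup>2 + c * (norm (snd p))\<^sup>2"
        by (intro add_mono mult_right_mono) (auto simp: c_def)
      also have "c * (norm (fst p))\<^sup>2 + c * (norm (snd p))\<^sup>2 = c * (norm p)\<^sup>2"
        by (simp add: norm_prod_def distrib_left)
      finally show ?thesis .
    qed
    show "bounded_linear (\<lambda>y. (cmod s)\<^sup>2 * (cscale (cnj s) (fst y) \<bullet> g))"
      by (intro bounded_linear_mult_right[THEN bounded_linear_compose] bounded_linear_inner_left[THEN bounded_linear_compose]
          bounded_linear_cscale[THEN bounded_linear_compose] bounded_linear_fst)
  qed
  then obtain p where p: "p \<in> M" "\<And>y. y \<in> M \<Longrightarrow> a y p = (cmod s)\<^sup>2 * (cscale (cnj s) (fst y) \<bullet> g)" by blast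
  show ?thesis
  proof (intro bexI[of _ "fst p"] ballI)
    show "fst p \<in> V \<times> V" using p(1) MV by blast
    fix w assume w: "w \<in> V \<times> V"
    define w' where "w' = cscale (inverse (cnj s)) w"
    have w': "w' \<in> V \<times> V" unfolding w'_def by (rule cscale_in_Times[OF V w])
    have ww: "w = cscale (cnj s) w'" using s0 by (simp add: w'_def cscale_cscale cscale_one)
    have "b_form s w (fst p) = a (w', D2 w') p"
      using p(1) w' by (simp add: ww MV a_def b_form_def cscale_cscale D2_cscale)
    also have "\<dots> = (cmod s)\<^sup>2 * (w \<bullet> g)"
      using p(2)[of "(w', D2 w')"] w' by (simp add: MV ww)
    finally show "b_form s w (fst p) = (cmod s)\<^sup>2 * (w \<bullet> g)" .
  qed
qed

lemma b_form_diff_right: "x \<in> V \<times> V \<Longrightarrow> y \<in> V \<times> V \<Longrightarrow> b_form s w (x - y) = b_form s w x - b_form s w y"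
  by (simp add: b_form_def D2_diff inner_diff_right)

lemma adjoint_unique:
  assumes s: "0 < Re s" and x: "x \<in> V \<times> V" and y: "y \<in> V \<times> V"
    and eq: "\<And>w. w \<in> V \<times> V \<Longrightarrow> b_form s w x = b_form s w y"
  shows "x = y"
proof -
  have d: "x - y \<in> V \<times> V" using subspace_diff[OF V2 x y] .
  have "b_form s (cscale (cnj s) (x - y)) (x - y) = 0"
    using eq[OF cscale_in_Times[OF V d]] x y by (simp add: b_form_diff_right)
  then have "(cmod s)\<^sup>2 * (norm (x - y))\<^sup>2 + (norm (D2 (x - y)))\<^sup>2 = 0"
    using b_form_cscale_self(2)[OF d, of s] s by simp
  then have "(cmod s)\<^sup>2 * (norm (x - y))\<^sup>2 = 0" by (simp add: add_nonneg_eq_0_iff)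
  then show ?thesis using s by auto
qed

text \<open>Projecting \<open>a\<close> onto the line through \<open>c\<close> neither worsens the approximation nor exceeds \<open>a\<close> in norm.
  It allows discrete approximations whose gradients obey the stability bound of the adjoint solution.\<close>

lemma scaled_approximation:
  fixes a c :: "'a::real_inner"
  obtains t where "norm (a - t *\<^sub>R c) \<le> norm (a - c)" "norm (t *\<^sub>R c) \<le> norm a"
proof (cases "c = 0")
  case False
  define t where "t = (a \<bullet> c) / (norm c)\<^sup>2"
  have tc: "t * (norm c)\<^sup>2 = a \<bullet> c" using False by (simp add: t_def)
  have e: "(norm (a - k *\<^sub>R c))\<^sup>2 = (norm a)\<^sup>2 - t\<^sup>2 * (norm c)\<^sup>2 + (t - k)\<^sup>2 * (norm c)\<^sup>2" for k
  proof -
    have "(norm (a - k *\<^sub>R c))\<^sup>2 = (norm a)\<^sup>2 - 2 * k * (a \<bullet> c) + k\<^sup>2 * (norm c)\<^sup>2"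
      unfolding power2_norm_eq_inner
      by (simp add: inner_diff_left inner_diff_right inner_commute power2_eq_square algebra_simps)
    then show ?thesis unfolding tc[symmetric] by (simp add: power2_eq_square algebra_simps)
  qed
  show thesis
  proof (rule that[of t])
    have "(norm (a - t *\<^sub>R c))\<^sup>2 \<le> (norm (a - 1 *\<^sub>R c))\<^sup>2" unfolding e by simp
    then show "norm (a - t *\<^sub>R c) \<le> norm (a - c)" by (simp only: scaleR_one power2_le_imp_le norm_ge_zero)
    have "0 \<le> (norm (a - t *\<^sub>R c))\<^sup>2" by simp
    then have "(norm (t *\<^sub>R c))\<^sup>2 \<le> (norm a)\<^sup>2" unfolding e by (simp add: power_mult_distrib)
    then show "norm (t *\<^sub>R c) \<le> norm a" by (rule power2_le_imp_le) simp
  qed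
qed (use that[of 1] in simp)

text \<open>The coercivity identity with test function \<open>cnj s \<phi>\<close> gives \<open>\<rho> (p\<^sup>2 + d\<^sup>2) \<le> |s| p\<close> for \<open>p = |s| |\<phi>|\<close> and
  \<open>d = |D \<phi>|\<close>. The bound on \<open>p\<close> is immediate, and completing the square in \<open>p\<close> gains the factor 2 in
  the bound on \<open>d\<close>.\<close>

lemma adjoint_stability:
  assumes s: "0 < Re s" and \<phi>: "\<phi> \<in> V \<times> V" "\<And>w. w \<in> V \<times> V \<Longrightarrow> b_form s w \<phi> = (cmod s)\<^sup>2 * (w \<bullet> g)"
    and g: "cmod s * norm g = 1"
  shows "norm \<phi> \<le> 1 / Re s" "norm (D2 \<phi>) \<le> cmod s / (2 * Re s)"
proof -
  define \<rho> m p d where "\<rho> = Re s" and "m = cmod s" and "p = cmod s * norm \<phi>" and "d = norm (D2 \<phi>)"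
  have m: "0 < m" "0 < \<rho>" using s by (auto simp: m_def \<rho>_def)
  have p0: "0 \<le> p" by (simp add: p_def)
  have "\<rho> * (p\<^sup>2 + d\<^sup>2) = m\<^sup>2 * (cscale (cnj s) \<phi> \<bullet> g)"
    using b_form_cscale_self(2)[OF \<phi>(1), of s] \<phi>(2)[OF cscale_in_Times[OF V \<phi>(1)], of "cnj s"]
    by (simp add: \<rho>_def m_def p_def d_def power_mult_distrib)
  also have "\<dots> \<le> m\<^sup>2 * (norm (cscale (cnj s) \<phi>) * norm g)"
    by (intro mult_left_mono norm_cauchy_schwarz) simp
  also have "\<dots> = m * p * (m * norm g)" by (simp add: norm_cscale m_def p_def power2_eq_square)
  also have "\<dots> = m * p" using g by (simp add: m_def)
  finally have *: "\<rho> * (p\<^sup>2 + d\<^sup>2) \<le> m * p" .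
  have **: "p\<^sup>2 + d\<^sup>2 \<le> (m / \<rho>) * p" using * m by (simp add: field_simps)
  have "p\<^sup>2 \<le> (m / \<rho>) * p" using ** zero_le_power2[of d] by linarith
  then have pp: "p * p \<le> (m / \<rho>) * p" by (simp only: power2_eq_square)
  have "p \<le> m / \<rho>"
  proof (cases "p = 0")
    case False
    then have "0 < p" using p0 by simp
    then show ?thesis using pp by (simp only: mult_le_cancel_right_pos)
  qed (use m in simp)
  then show "norm \<phi> \<le> 1 / Re s" using m by (simp add: p_def flip: m_def \<rho>_def) (simp add: field_simps)
  have "d\<^sup>2 \<le> (m / \<rho>) * p - p\<^sup>2" using ** by simp
  also have "\<dots> = (m / (2 * \<rho>))\<^sup>2 - (p - m / (2 * \<rho>))\<^sup>2" using m by (simp add: power2_eq_square field_simps)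
  also have "\<dots> \<le> (m / (2 * \<rho>))\<^sup>2" by simp
  finally have "d\<^sup>2 \<le> (m / (2 * \<rho>))\<^sup>2" .
  moreover have "0 \<le> m / (2 * \<rho>)" using m by simp
  ultimately have "d \<le> m / (2 * \<rho>)" by (rule power2_le_imp_le)
  then show "norm (D2 \<phi>) \<le> cmod s / (2 * Re s)" by (simp only: d_def m_def \<rho>_def)
qed

text \<open>The number \<open>\<gamma>\<close> bounds the approximation factor of \<open>W\<close> at \<open>s\<close>. The slack \<open>\<epsilon>\<close> makes the definition
  follow from a bound on an infimum.\<close>

definition approximable :: "'h set \<Rightarrow> complex \<Rightarrow> real \<Rightarrow> bool" where
  "approximable W s \<gamma> \<longleftrightarrow> (\<forall>g\<in>V \<times> V. \<forall>\<phi>\<in>V \<times> V. cmod s * norm g = 1 \<longrightarrow>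
     (\<forall>w\<in>V \<times> V. b_form s w \<phi> = (cmod s)\<^sup>2 * (w \<bullet> g)) \<longrightarrow>
     (\<forall>\<epsilon>>0. \<exists>v\<in>W \<times> W. norm (D2 (\<phi> - v)) \<le> \<gamma> + \<epsilon>))"

text \<open>The Aubin--Nitsche argument. For the adjoint solution \<open>\<phi>\<close> with datum proportional to \<open>E\<close>, the
  product \<open>|s| |E|\<close> is the load evaluated at \<open>\<phi>\<close>. The load \<open>Q\<close> is split along a multiple of a good
  approximation in \<open>W\<close>; on that multiple \<open>Q\<close> may be replaced by \<open>\<Delta>\<close>.\<close>

lemma duality_estimate:
  assumes s: "0 < Re s" and W: "subspace W" "W \<subseteq> V" and E: "E \<in> V \<times> V"
    and err: "\<And>v. v \<in> V \<times> V \<Longrightarrow> b_form s E v = Q \<bullet> D2 v + H \<bullet> v"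
    and orth: "\<And>v. v \<in> W \<times> W \<Longrightarrow> Q \<bullet> D2 v = \<Delta> \<bullet> D2 v"
    and approx: "approximable W s \<gamma>" and gamma: "0 \<le> \<gamma>"
  shows "cmod s * norm E \<le> \<gamma> * norm Q + cmod s * norm \<Delta> / (2 * Re s) + norm H / Re s" (is "?x \<le> ?R")
proof (cases "E = 0")
  case True
  then show ?thesis using s gamma by simp
next
  case False
  then have x: "0 < ?x" using s by (intro mult_pos_pos) auto
  define g where "g = (1 / ?x) *\<^sub>R E"
  have g: "g \<in> V \<times> V" unfolding g_def by (rule subspace_scale[OF V2 E])
  have g1: "cmod s * norm g = 1" using s False by (auto simp: g_def)
  obtain \<phi> where \<phi>: "\<phi> \<in> V \<times> V" "\<And>w. w \<in> V \<times> V \<Longrightarrow> b_form s w \<phi> = (cmod s)\<^sup>2 * (w \<bullet> g)"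
    using adjoint_exists[OF s, of g] by blast
  note st = adjoint_stability[OF s \<phi> g1]
  have bE: "?x = b_form s E \<phi>"
  proof -
    have "b_form s E \<phi> = (cmod s)\<^sup>2 * (1 / ?x * (norm E)\<^sup>2)"
      using \<phi>(2)[OF E] by (simp add: g_def power2_norm_eq_inner)
    also have "\<dots> = ?x" using x by (simp add: power2_eq_square)
    finally show ?thesis ..
  qed
  have "?x \<le> ?R + \<epsilon> * norm Q" if \<epsilon>: "0 < \<epsilon>" for \<epsilon>
  proof -
    obtain v where v: "v \<in> W \<times> W" "norm (D2 (\<phi> - v)) \<le> \<gamma> + \<epsilon>"
      using approx g \<phi> g1 \<epsilon> unfolding approximable_def by blast
    have vV: "v \<in> V \<times> V" using v W by auto
    obtain t where t: "norm (D2 \<phi> - t *\<^sub>R D2 v) \<le> norm (D2 \<phi> - D2 v)" "norm (t *\<^sub>R D2 v) \<le> norm (D2 \<phi>)"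
      by (rule scaled_approximation)
    have tv: "t *\<^sub>R v \<in> W \<times> W" using subspace_scale[OF subspace_Times[OF W(1) W(1)] v(1)] .
    have "?x = Q \<bullet> D2 \<phi> + H \<bullet> \<phi>" using bE err[OF \<phi>(1)] by simp
    also have "\<dots> = Q \<bullet> (D2 \<phi> - t *\<^sub>R D2 v) + \<Delta> \<bullet> (t *\<^sub>R D2 v) + H \<bullet> \<phi>"
      using orth[OF tv] vV by (auto simp: D2_scaleR inner_diff_right)
    also have "\<dots> \<le> norm Q * (\<gamma> + \<epsilon>) + norm \<Delta> * (cmod s / (2 * Re s)) + norm H * (1 / Re s)"
    proof (intro add_mono order_trans[OF norm_cauchy_schwarz] mult_left_mono norm_ge_zero)
      show "norm (D2 \<phi> - t *\<^sub>R D2 v) \<le> \<gamma> + \<epsilon>" using t v(2) vV \<phi>(1) by (simp add: D2_diff)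
    qed (use t st in auto)
    finally show ?thesis by (simp add: algebra_simps)
  qed
  then have ev: "\<forall>\<^sub>F \<epsilon> in at_right 0. ?x \<le> ?R + \<epsilon> * norm Q"
    by (rule eventually_mono[OF eventually_at_right_less])
  have "((\<lambda>\<epsilon>. ?R + \<epsilon> * norm Q) \<longlongrightarrow> ?R + 0 * norm Q) (at_right 0)" by (intro tendsto_intros)
  from tendsto_lowerbound[OF this ev trivial_limit_at_right_real] show ?thesis
    unfolding mult_zero_left add_0_right .
qed

text \<open>Testing with \<open>E\<close> itself bounds \<open>|D E|\<close> except for the term \<open>- Re (s\<^sup>2) |E|\<^sup>2 \<le> |s|\<^sup>2 |E|\<^sup>2\<close>, which the
  duality estimate controls. The constants come from Young's inequality.\<close>

lemma low_frequency_estimate: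
  assumes s: "0 < Re s" and W: "subspace W" "W \<subseteq> V" and E: "E \<in> V \<times> V"
    and err: "\<And>v. v \<in> V \<times> V \<Longrightarrow> b_form s E v = Q \<bullet> D2 v + H \<bullet> v"
    and orth: "\<And>v. v \<in> W \<times> W \<Longrightarrow> Q \<bullet> D2 v = \<Delta> \<bullet> D2 v"
    and approx: "approximable W s \<gamma>" and gamma: "0 \<le> \<gamma>"
  shows "(cmod s)\<^sup>2 * (norm E)\<^sup>2 + (norm (D2 E))\<^sup>2
    \<le> (1 + 40 * \<gamma>\<^sup>2) * (norm Q)\<^sup>2 + 20 / (Re s)\<^sup>2 * (norm (cscale s \<Delta>))\<^sup>2 + 11 / (Re s)\<^sup>2 * (norm H)\<^sup>2"
proof -
  define x y q A B C where "x = cmod s * norm E" and "y = norm (D2 E)" and "q = norm Q"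
    and "A = \<gamma> * norm Q" and "B = norm (cscale s \<Delta>) / (2 * Re s)" and "C = norm H / Re s"
  have nn: "0 \<le> x" "0 \<le> y" "0 \<le> q" "0 \<le> A" "0 \<le> B" "0 \<le> C"
    using s gamma by (auto simp: x_def y_def q_def A_def B_def C_def)
  have xle: "x \<le> A + B + C"
    using duality_estimate[OF s W E err orth approx gamma] by (simp add: x_def A_def B_def C_def norm_cscale)
  have "Re (s\<^sup>2) = (Re s)\<^sup>2 - (Im s)\<^sup>2" by (simp add: power2_eq_square)
  also have "\<dots> \<ge> - (cmod s)\<^sup>2" by (simp add: cmod_power2)
  finally have re: "- (cmod s)\<^sup>2 \<le> Re (s\<^sup>2)" .
  have "b_form s E E = Re (s\<^sup>2) * (norm E)\<^sup>2 + y\<^sup>2"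
    by (simp add: b_form_def inner_cscale_self y_def power2_norm_eq_inner)
  then have "y\<^sup>2 = Q \<bullet> D2 E + H \<bullet> E - Re (s\<^sup>2) * (norm E)\<^sup>2" using err[OF E] by simp
  moreover have "- Re (s\<^sup>2) * (norm E)\<^sup>2 \<le> (cmod s)\<^sup>2 * (norm E)\<^sup>2"
    using re by (intro mult_right_mono) auto
  moreover have "(cmod s)\<^sup>2 * (norm E)\<^sup>2 = x\<^sup>2" by (simp add: x_def power_mult_distrib)
  moreover have "Q \<bullet> D2 E \<le> q * y" unfolding q_def y_def by (rule norm_cauchy_schwarz)
  moreover have "H \<bullet> E \<le> C * x"
  proof -
    have "H \<bullet> E \<le> norm H * norm E" by (rule norm_cauchy_schwarz)
    also have "norm E \<le> x / Re s"
      using s complex_Re_le_cmod[of s] by (simp add: x_def field_simps mult_right_mono)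
    then have "norm H * norm E \<le> norm H * (x / Re s)" by (rule mult_left_mono) simp
    finally show ?thesis by (simp add: C_def)
  qed
  ultimately have "y\<^sup>2 \<le> q * y + C * x + x\<^sup>2" by simp
  moreover have "2 * (q * y) \<le> q\<^sup>2 + y\<^sup>2" using sum_squares_bound[of q y] by simp
  ultimately have "x\<^sup>2 + y\<^sup>2 \<le> q\<^sup>2 + 2 * (C * x) + 3 * x\<^sup>2" by linarith
  also have "\<dots> \<le> q\<^sup>2 + (C\<^sup>2 + 4 * x\<^sup>2)" using sum_squares_bound[of C x] by simp
  also have "x\<^sup>2 \<le> (A + B + C)\<^sup>2" using xle nn by (intro power_mono)
  then have "q\<^sup>2 + (C\<^sup>2 + 4 * x\<^sup>2) \<le> q\<^sup>2 + (C\<^sup>2 + 4 * (A + B + C)\<^sup>2)" by simp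
  (* weights chosen so that A, with the approximation factor, gets 40, and B, which carries a factor 1/2, gets 80 = 4 * 20 *)
  also have "\<dots> \<le> q\<^sup>2 + (40 * A\<^sup>2 + 80 * B\<^sup>2 + 11 * C\<^sup>2)"
  proof -
    have e: "(A + B + C)\<^sup>2 = A\<^sup>2 + B\<^sup>2 + C\<^sup>2 + 2 * A * B + 2 * A * C + 2 * B * C"
      by (simp add: power2_eq_square algebra_simps)
    have "2 * A * (2 * C) \<le> A\<^sup>2 * 4 + C\<^sup>2" using sum_squares_bound[of "2 * A" C] by (simp add: power_mult_distrib)
    moreover have "2 * B * (2 * C) \<le> B\<^sup>2 * 4 + C\<^sup>2" using sum_squares_bound[of "2 * B" C] by (simp add: power_mult_distrib)
    moreover have "2 * A * B \<le> A\<^sup>2 + B\<^sup>2" by (rule sum_squares_bound)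
    ultimately show ?thesis unfolding e
      using zero_le_power2[of A] zero_le_power2[of B] zero_le_power2[of C] by argo
  qed
  finally have "x\<^sup>2 + y\<^sup>2 \<le> q\<^sup>2 + (40 * A\<^sup>2 + 80 * B\<^sup>2 + 11 * C\<^sup>2)" .
  moreover have "80 * B\<^sup>2 = 20 / (Re s)\<^sup>2 * (norm (cscale s \<Delta>))\<^sup>2"
    by (simp add: B_def power_divide power_mult_distrib)
  moreover have "11 * C\<^sup>2 = 11 / (Re s)\<^sup>2 * (norm H)\<^sup>2" by (simp add: C_def power_divide)
  ultimately show ?thesis
    by (simp add: x_def y_def q_def A_def power_mult_distrib distrib_right)
qed

text \<open>Coercivity and Young's inequality. A load \<open>G\<close> acting through \<open>D x\<close> costs one factor \<open>s\<close>, that is,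
  one time derivative of \<open>G\<close>.\<close>

lemma energy_norm_le:
  assumes s: "0 < Re s" and x: "x \<in> V \<times> V"
    and bx: "b_form s x (cscale s x) = F \<bullet> cscale s x + G \<bullet> cscale s (D2 x)"
  shows "(cmod s)\<^sup>2 * (norm x)\<^sup>2 + (norm (D2 x))\<^sup>2 \<le> ((norm F)\<^sup>2 + (norm (cscale s G))\<^sup>2) / (Re s)\<^sup>2"
proof -
  define \<rho> a d f g where "\<rho> = Re s" and "a = cmod s * norm x" and "d = norm (D2 x)" and "f = norm F"
    and "g = norm (cscale s G)"
  have "\<rho> * (a\<^sup>2 + d\<^sup>2) = F \<bullet> cscale s x + G \<bullet> cscale s (D2 x)"
    using bx b_form_cscale_self(1)[OF x, of s] by (simp add: \<rho>_def a_def d_def power_mult_distrib)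
  also have "\<dots> \<le> f * a + g * d"
    using norm_cauchy_schwarz[of F "cscale s x"] norm_cauchy_schwarz[of G "cscale s (D2 x)"]
    by (simp add: f_def g_def a_def d_def norm_cscale mult_ac)
  finally have 1: "\<rho> * (a\<^sup>2 + d\<^sup>2) \<le> f * a + g * d" .
  have r: "0 < \<rho>" using s by (simp add: \<rho>_def)
  have "2 * ((\<rho> * a) * f) \<le> (\<rho> * a)\<^sup>2 + f\<^sup>2" "2 * ((\<rho> * d) * g) \<le> (\<rho> * d)\<^sup>2 + g\<^sup>2"
    using sum_squares_bound[of "\<rho> * a" f] sum_squares_bound[of "\<rho> * d" g] by simp_all
  moreover have "2 * (\<rho> * (\<rho> * (a\<^sup>2 + d\<^sup>2))) \<le> 2 * (\<rho> * (f * a + g * d))" using 1 r by simp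
  ultimately have "\<rho>\<^sup>2 * (a\<^sup>2 + d\<^sup>2) \<le> f\<^sup>2 + g\<^sup>2"
    by (simp add: power2_eq_square algebra_simps)
  then show ?thesis using r
    by (simp add: pos_le_divide_eq mult.commute \<rho>_def a_def d_def f_def g_def power_mult_distrib)
qed

text \<open>Above the cutoff there is nothing to gain from comparing \<open>Y\<close> and \<open>Z\<close>: each is bounded by its data,
  and \<open>F'\<close> is split into \<open>F\<close> and \<open>F' - F\<close>.\<close>

lemma high_frequency_estimate:
  assumes s: "0 < Re s" and Y: "Y \<in> V \<times> V" and Z: "Z \<in> V \<times> V"
    and bY: "\<And>v. v \<in> V \<times> V \<Longrightarrow> b_form s Y v = F \<bullet> v"
    and bZ: "b_form s Z (cscale s Z) = F' \<bullet> cscale s Z - \<Delta> \<bullet> cscale s (D2 Z)"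
  shows "(cmod s)\<^sup>2 * (norm (Y - Z))\<^sup>2 + (norm (D2 (Y - Z)))\<^sup>2
    \<le> (20 * (norm (cscale s \<Delta>))\<^sup>2 + 11 * (norm (F - F'))\<^sup>2 + 8 * (norm F)\<^sup>2) / (Re s)\<^sup>2"
proof -
  have sq: "(norm (a - b))\<^sup>2 \<le> 2 * (norm a)\<^sup>2 + 2 * (norm b)\<^sup>2" for a b :: "'c::real_inner"
  proof -
    have "(norm (a - b))\<^sup>2 + (norm (a + b))\<^sup>2 = 2 * (norm a)\<^sup>2 + 2 * (norm b)\<^sup>2"
      unfolding power2_norm_eq_inner by (simp add: inner_diff_left inner_diff_right inner_add_left inner_add_right)
    then show ?thesis using zero_le_power2[of "norm (a + b)"] by linarith
  qed
  have 1: "(cmod s)\<^sup>2 * (norm Y)\<^sup>2 + (norm (D2 Y))\<^sup>2 \<le> (norm F)\<^sup>2 / (Re s)\<^sup>2"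
    using energy_norm_le[OF s Y, of F 0] bY[OF cscale_in_Times[OF V Y], of s] by (simp add: norm_cscale)
  have 2: "(cmod s)\<^sup>2 * (norm Z)\<^sup>2 + (norm (D2 Z))\<^sup>2 \<le> ((norm F')\<^sup>2 + (norm (cscale s \<Delta>))\<^sup>2) / (Re s)\<^sup>2"
    using energy_norm_le[OF s Z, of F' "- \<Delta>"] bZ by (simp add: norm_cscale)
  have 3: "(norm F')\<^sup>2 \<le> 2 * (norm F)\<^sup>2 + 2 * (norm (F - F'))\<^sup>2" using sq[of F "F - F'"] by simp
  have "(cmod s)\<^sup>2 * (norm (Y - Z))\<^sup>2 + (norm (D2 (Y - Z)))\<^sup>2
      \<le> (cmod s)\<^sup>2 * (2 * (norm Y)\<^sup>2 + 2 * (norm Z)\<^sup>2) + (2 * (norm (D2 Y))\<^sup>2 + 2 * (norm (D2 Z))\<^sup>2)"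
    unfolding D2_diff[OF Y Z] by (intro add_mono mult_left_mono sq) simp
  also have "\<dots> = 2 * ((cmod s)\<^sup>2 * (norm Y)\<^sup>2 + (norm (D2 Y))\<^sup>2) + 2 * ((cmod s)\<^sup>2 * (norm Z)\<^sup>2 + (norm (D2 Z))\<^sup>2)"
    by (simp add: algebra_simps)
  also have "\<dots> \<le> 2 * ((norm F)\<^sup>2 / (Re s)\<^sup>2) + 2 * (((norm F')\<^sup>2 + (norm (cscale s \<Delta>))\<^sup>2) / (Re s)\<^sup>2)"
    by (intro add_mono mult_left_mono 1 2) simp_all
  also have "\<dots> = (2 * (norm F)\<^sup>2 + 2 * (norm F')\<^sup>2 + 2 * (norm (cscale s \<Delta>))\<^sup>2) / (Re s)\<^sup>2"
    by (simp add: add_divide_distrib)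
  also have "\<dots> \<le> (20 * (norm (cscale s \<Delta>))\<^sup>2 + 11 * (norm (F - F'))\<^sup>2 + 8 * (norm F)\<^sup>2) / (Re s)\<^sup>2"
    using 3 zero_le_power2[of "norm (cscale s \<Delta>)"] zero_le_power2[of "norm (F - F')"] zero_le_power2[of "norm F"]
    by (intro divide_right_mono) (linarith, simp)
  finally show ?thesis .
qed

end

section \<open>Abstract wave equations: the estimate in the time domain\<close>

lemma has_vector_derivative_at_positive:
  assumes "(g has_vector_derivative g') (at t within {0..})" "0 < (t::real)"
  shows "(g has_vector_derivative g') (at t)"
proof -
  have "(g has_vector_derivative g') (at t within {0<..})"
    by (rule has_vector_derivative_within_subset[OF assms(1)]) auto
  moreover have "at t within {0<..} = at t" by (rule at_within_open) (use assms(2) in auto)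
  ultimately show ?thesis by simp
qed

text \<open>Transfers the growth bound of a derivative to the function, so that all lower derivatives of the
  source are transformable as soon as the highest one is bounded.\<close>

lemma exponential_growth:
  fixes g g' :: "real \<Rightarrow> 'a::real_normed_vector"
  assumes k: "0 < k" and C: "0 \<le> C" and g0: "g 0 = 0"
    and deriv: "\<And>t. 0 \<le> t \<Longrightarrow> (g has_vector_derivative g' t) (at t within {0..})"
    and bound: "\<And>t. 0 \<le> t \<Longrightarrow> norm (g' t) \<le> C * exp (k * t)" and t: "0 \<le> t"
  shows "norm (g t) \<le> C / k * exp (k * t)"
proof (cases "t = 0")
  case False
  then have t0: "0 < t" using t by simp
  have cont: "continuous_on {0..t} g"
    by (rule continuous_on_subset[of "{0..}"]) (use deriv in \<open>auto intro!: continuous_on_vector_derivative\<close>)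
  have "norm (g t - g 0) \<le> C / k * exp (k * t) - C / k * exp (k * 0)"
  proof (rule differentiable_bound_general[OF t0 cont])
    show "continuous_on {0..t} (\<lambda>t. C / k * exp (k * t))" by (intro continuous_intros)
    fix x assume x: "0 < x" "x < t"
    show "(g has_vector_derivative g' x) (at x)" using has_vector_derivative_at_positive[OF deriv] x by simp
    have "((\<lambda>t. C / k * exp (k * t)) has_real_derivative C * exp (k * x)) (at x)"
      using k by (auto intro!: derivative_eq_intros)
    then show "((\<lambda>t. C / k * exp (k * t)) has_vector_derivative C * exp (k * x)) (at x)"
      by (simp add: has_real_derivative_iff_has_vector_derivative)
    show "norm (g' x) \<le> C * exp (k * x)" using bound x by simp
  qed
  moreover have "0 \<le> C / k" using C k by simp
  ultimately show ?thesis using g0 by simp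
qed (use g0 C k in simp)

context wave_space begin

text \<open>The transform of \<open>\<lambda>t. (g t, D (g t))\<close> is an integral over a closed subspace and therefore stays in
  it. This identifies the transform of \<open>\<lambda>t. D (g t)\<close>. For a subspace \<open>U\<close> that is not closed the transform
  is only known to lie in the closure of \<open>U\<close> in the graph norm.\<close>

lemma laplace_graph:
  assumes rho: "0 < \<rho>" and U: "subspace U" "U \<subseteq> V" and g: "transformable \<rho> g" "transformable \<rho> (\<lambda>t. D (g t))"
    and gU: "\<And>t. 0 \<le> t \<Longrightarrow> g t \<in> U"
  shows "laplace \<rho> g \<nu> \<in> V \<times> V" "laplace \<rho> (\<lambda>t. D (g t)) \<nu> = D2 (laplace \<rho> g \<nu>)"
    "(fst (laplace \<rho> g \<nu>), D (fst (laplace \<rho> g \<nu>))) \<in> closure ((\<lambda>v. (v, D v)) ` U)"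
    "(snd (laplace \<rho> g \<nu>), D (snd (laplace \<rho> g \<nu>))) \<in> closure ((\<lambda>v. (v, D v)) ` U)"
proof -
  define p where "p t = (g t, D (g t))" for t
  have "bounded_linear (\<lambda>x::'h. (x, 0::'g))" "bounded_linear (\<lambda>x::'g. (0::'h, x))"
    by (auto intro!: bounded_linear_Pair bounded_linear_ident bounded_linear_zero)
  then have p: "transformable \<rho> p"
    using transformable_add[OF transformable_bounded_linear[OF _ g(1), of "\<lambda>x. (x, 0)"]
        transformable_bounded_linear[OF _ g(2), of "\<lambda>x. (0, x)"]]
    by (simp add: p_def[abs_def])
  have cl: "subspace (closure ((\<lambda>v. (v, D v)) ` U))" "closed (closure ((\<lambda>v. (v, D v)) ` U))"
    using subspace_closure_L2[OF subspace_graph[OF U]] by simp_all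
  have pU: "p t \<in> closure ((\<lambda>v. (v, D v)) ` U)" if "0 \<le> t" for t
  proof -
    have "p t \<in> (\<lambda>v. (v, D v)) ` U" unfolding p_def using gU[OF that] by (rule imageI)
    then show ?thesis by (rule subsetD[OF closure_subset])
  qed
  note P = laplace_in_subspace[OF rho cl p pU, of \<nu>]
  have sub: "closure ((\<lambda>v. (v, D v)) ` U) \<subseteq> (\<lambda>v. (v, D v)) ` V"
    by (rule closure_minimal[OF image_mono[OF U(2)] closed_graph])
  have e1: "laplace \<rho> g \<nu> = (fst (fst (laplace \<rho> p \<nu>)), fst (snd (laplace \<rho> p \<nu>)))"
    using laplace_bounded_linear[OF rho bounded_linear_fst p, of \<nu>] by (simp add: p_def)
  have e2: "laplace \<rho> (\<lambda>t. D (g t)) \<nu> = (snd (fst (laplace \<rho> p \<nu>)), snd (snd (laplace \<rho> p \<nu>)))"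
    using laplace_bounded_linear[OF rho bounded_linear_snd p, of \<nu>] by (simp add: p_def)
  from P sub have Q: "fst (laplace \<rho> p \<nu>) \<in> (\<lambda>v. (v, D v)) ` V" "snd (laplace \<rho> p \<nu>) \<in> (\<lambda>v. (v, D v)) ` V"
    by blast+
  then show "laplace \<rho> g \<nu> \<in> V \<times> V" "laplace \<rho> (\<lambda>t. D (g t)) \<nu> = D2 (laplace \<rho> g \<nu>)"
    by (auto simp: e1 e2 D2_def)
  have "fst (laplace \<rho> p \<nu>) = (fst (laplace \<rho> g \<nu>), D (fst (laplace \<rho> g \<nu>)))"
    "snd (laplace \<rho> p \<nu>) = (snd (laplace \<rho> g \<nu>), D (snd (laplace \<rho> g \<nu>)))"
    using Q by (auto simp: e1)
  with P show "(fst (laplace \<rho> g \<nu>), D (fst (laplace \<rho> g \<nu>))) \<in> closure ((\<lambda>v. (v, D v)) ` U)"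
    "(snd (laplace \<rho> g \<nu>), D (snd (laplace \<rho> g \<nu>))) \<in> closure ((\<lambda>v. (v, D v)) ` U)" by simp_all
qed

lemma laplace_weak_equation:
  assumes rho: "0 < \<rho>" and cont: "continuous_on {0..} g" and g0: "g 0 = 0" and S: "\<And>T. finite (S \<inter> {0..T})"
    and deriv: "\<And>t v. 0 < t \<Longrightarrow> t \<notin> S \<Longrightarrow> v \<in> V \<Longrightarrow>
      ((\<lambda>t. g t \<bullet> v) has_vector_derivative (a t \<bullet> v + b t \<bullet> D v)) (at t)"
    and g: "transformable \<rho> g" and a: "transformable \<rho> a" and b: "transformable \<rho> b" and v: "v \<in> V \<times> V"
  shows "cscale (Complex \<rho> \<nu>) (laplace \<rho> g \<nu>) \<bullet> v = laplace \<rho> a \<nu> \<bullet> v + laplace \<rho> b \<nu> \<bullet> D2 v"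
proof -
  note ti = transformable_bounded_linear[OF bounded_linear_inner_left]
  have c: "fst (cscale (Complex \<rho> \<nu>) (laplace \<rho> g \<nu>)) \<bullet> w = fst (laplace \<rho> a \<nu>) \<bullet> w + fst (laplace \<rho> b \<nu>) \<bullet> D w
      \<and> snd (cscale (Complex \<rho> \<nu>) (laplace \<rho> g \<nu>)) \<bullet> w = snd (laplace \<rho> a \<nu>) \<bullet> w + snd (laplace \<rho> b \<nu>) \<bullet> D w"
    if w: "w \<in> V" for w
  proof -
    have "laplace \<rho> (\<lambda>t. a t \<bullet> w + b t \<bullet> D w) \<nu> = cscale (Complex \<rho> \<nu>) (laplace \<rho> (\<lambda>t. g t \<bullet> w) \<nu>)"
      by (rule laplace_derivative_real[OF rho _ _ S deriv[OF _ _ w]])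
        (auto simp: g0 intro!: continuous_intros cont ti g a b transformable_add)
    then show ?thesis
      by (simp add: laplace_add[OF rho ti[OF a] ti[OF b]] laplace_inner[OF rho] a b g cscale_def
          inner_diff_left inner_add_left prod_eq_iff)
  qed
  show ?thesis using c[of "fst v"] c[of "snd v"] v
    by (auto simp: inner_prod_def D2_def mem_Times_iff)
qed

text \<open>The energy \<open>E(t) = |u1|\<^sup>2 + |D u|\<^sup>2\<close> has derivative \<open>2 (f, u1)\<close>. As \<open>u1\<close> need not take values in \<open>V\<close>, it
  is not admissible as a test function; the derivative of \<open>|D u|\<^sup>2\<close> is computed from difference
  quotients, for which \<open>u y - u s\<close> is an admissible test function.\<close>

lemma solution_growth:
  assumes rho: "0 < \<rho>"
    and u1: "\<And>t. 0 \<le> t \<Longrightarrow> (u has_vector_derivative u1 t) (at t within {0..})"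
    and u2: "\<And>t. 0 \<le> t \<Longrightarrow> (u1 has_vector_derivative u2 t) (at t within {0..})"
    and init: "u 0 = 0" "u1 0 = 0" and uV: "\<And>t. 0 \<le> t \<Longrightarrow> u t \<in> V"
    and cDu: "continuous_on {0..} (\<lambda>t. D (u t))" and cu2: "continuous_on {0..} u2" and cf: "continuous_on {0..} f"
    and eq: "\<And>t v. 0 \<le> t \<Longrightarrow> v \<in> V \<Longrightarrow> u2 t \<bullet> v + D (u t) \<bullet> D v = f t \<bullet> v"
    and F: "\<And>t. 0 \<le> t \<Longrightarrow> norm (f t) \<le> F" and t: "0 \<le> t"
  shows "(norm (u1 t))\<^sup>2 + (norm (D (u t)))\<^sup>2 \<le> (F / \<rho>)\<^sup>2 * exp (\<rho> * t)"
proof -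
  have cu1: "continuous_on {0..} u1" and cu: "continuous_on {0..} u"
    using u1 u2 by (auto intro!: continuous_on_vector_derivative)
  have isC: "isCont g s" if "continuous_on {0..} g" "0 < s" for g :: "real \<Rightarrow> 'c::topological_space" and s
  proof -
    have "continuous_on {0<..} g" by (rule continuous_on_subset[OF that(1)]) auto
    then show ?thesis using that(2) by (simp add: continuous_on_eq_continuous_at)
  qed
  have dD: "((\<lambda>t. (norm (D (u t)))\<^sup>2) has_real_derivative 2 * ((f s - u2 s) \<bullet> u1 s)) (at s)" if s: "0 < s" for s
  proof -
    have q: "((\<lambda>y. (1 / (y - s)) *\<^sub>R (u y - u s)) \<longlongrightarrow> u1 s) (at s)"
    proof (rule LIM_zero_cancel, rule tendsto_norm_zero_cancel)
      have "((\<lambda>y. norm ((u y - u s) - (y - s) *\<^sub>R u1 s) / norm (y - s)) \<longlongrightarrow> 0) (at s)"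
        using has_vector_derivative_at_positive[OF u1 s] s by (simp add: has_vector_derivative_def has_derivative_iff_norm)
      then show "((\<lambda>y. norm ((1 / (y - s)) *\<^sub>R (u y - u s) - u1 s)) \<longlongrightarrow> 0) (at s)"
      proof (rule Lim_transform_eventually)
        show "\<forall>\<^sub>F y in at s. norm ((u y - u s) - (y - s) *\<^sub>R u1 s) / norm (y - s)
            = norm ((1 / (y - s)) *\<^sub>R (u y - u s) - u1 s)"
          unfolding eventually_at_filter
        proof (intro always_eventually allI impI)
          fix y assume "y \<noteq> s"
          then have "(1 / (y - s)) *\<^sub>R (u y - u s) - u1 s = (1 / (y - s)) *\<^sub>R ((u y - u s) - (y - s) *\<^sub>R u1 s)"
            by (simp add: scaleR_diff_right)
          then show "norm ((u y - u s) - (y - s) *\<^sub>R u1 s) / norm (y - s) = norm ((1 / (y - s)) *\<^sub>R (u y - u s) - u1 s)"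
            by (simp only: norm_scaleR) simp
        qed
      qed
    qed
    have c: "((\<lambda>y. (f y - u2 y) + (f s - u2 s)) \<longlongrightarrow> (f s - u2 s) + (f s - u2 s)) (at s)"
      using isC[OF cf s] isC[OF cu2 s] by (intro tendsto_intros) (auto simp: isCont_def)
    have "((\<lambda>y. ((norm (D (u y)))\<^sup>2 - (norm (D (u s)))\<^sup>2) / (y - s)) \<longlongrightarrow> ((f s - u2 s) + (f s - u2 s)) \<bullet> u1 s) (at s)"
    proof (rule Lim_transform_eventually[OF tendsto_inner[OF c q]])
      have "\<forall>\<^sub>F y in at s. 0 < y" using s by (intro order_tendstoD(1)[OF tendsto_ident_at])
      then show "\<forall>\<^sub>F y in at s. ((f y - u2 y) + (f s - u2 s)) \<bullet> ((1 / (y - s)) *\<^sub>R (u y - u s))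
          = ((norm (D (u y)))\<^sup>2 - (norm (D (u s)))\<^sup>2) / (y - s)"
      proof eventually_elim
        case (elim y)
        have yV: "u y \<in> V" "u s \<in> V" "u y - u s \<in> V" using uV elim s subspace_diff[OF V] by auto
        have "(norm (D (u y)))\<^sup>2 - (norm (D (u s)))\<^sup>2 = D (u y) \<bullet> D (u y - u s) + D (u s) \<bullet> D (u y - u s)"
          unfolding D_diff[OF yV(1,2)] power2_norm_eq_inner by (simp add: inner_diff_right inner_commute)
        also have "\<dots> = ((f y - u2 y) + (f s - u2 s)) \<bullet> (u y - u s)"
          using eq[OF less_imp_le[OF elim] yV(3)] eq[OF less_imp_le[OF s] yV(3)]
          by (simp add: inner_add_left inner_diff_left[of "f y"] inner_diff_left[of "f s"])
        finally show ?case by simp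
      qed
    qed
    then show ?thesis by (simp add: has_field_derivative_iff inner_add_left)
  qed
  define E where "E t = (norm (u1 t))\<^sup>2 + (norm (D (u t)))\<^sup>2" for t
  (* the second summand absorbs the source after Young's inequality, so that the sum is nonincreasing *)
  define \<psi> where "\<psi> t = E t * exp (- \<rho> * t) + (F / \<rho>)\<^sup>2 * exp (- \<rho> * t)" for t
  have dE: "(E has_real_derivative 2 * (f s \<bullet> u1 s)) (at s)" if s: "0 < s" for s
  proof -
    have "((\<lambda>t. u1 t \<bullet> u1 t) has_vector_derivative (u1 s \<bullet> u2 s + u2 s \<bullet> u1 s)) (at s)"
      by (rule bounded_bilinear.has_vector_derivative[OF bounded_bilinear_inner]) (use has_vector_derivative_at_positive[OF u2 s] s in auto)
    then have "((\<lambda>t. (norm (u1 t))\<^sup>2) has_real_derivative 2 * (u2 s \<bullet> u1 s)) (at s)"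
      by (simp add: has_real_derivative_iff_has_vector_derivative power2_norm_eq_inner inner_commute)
    from DERIV_add[OF this dD[OF s]] show ?thesis
      by (simp add: E_def[abs_def] inner_diff_left)
  qed
  have "\<psi> t \<le> \<psi> 0"
  proof (rule DERIV_nonpos_imp_decreasing_open[OF t])
    show "continuous_on {0..t} \<psi>"
      unfolding \<psi>_def E_def
      by (intro continuous_intros continuous_on_subset[OF cu1] continuous_on_subset[OF cDu]) auto
    fix s assume s: "0 < s" "s < t"
    have "(\<psi> has_real_derivative ((2 * (f s \<bullet> u1 s) - \<rho> * E s - F\<^sup>2 / \<rho>) * exp (- \<rho> * s))) (at s)"
      unfolding \<psi>_def using rho
      by (auto intro!: derivative_eq_intros dE s simp: field_simps power2_eq_square)
    moreover have "2 * (f s \<bullet> u1 s) \<le> \<rho> * E s + F\<^sup>2 / \<rho>"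
    proof -
      have "f s \<bullet> u1 s \<le> norm (f s) * norm (u1 s)" by (rule norm_cauchy_schwarz)
      also have "\<dots> \<le> F * norm (u1 s)" using F[of s] s by (intro mult_right_mono) auto
      finally have "\<rho> * (2 * (f s \<bullet> u1 s)) \<le> 2 * F * (\<rho> * norm (u1 s))" using rho by simp
      also have "\<dots> \<le> F\<^sup>2 + (\<rho> * norm (u1 s))\<^sup>2" by (rule sum_squares_bound)
      also have "\<dots> \<le> \<rho> * (\<rho> * E s + F\<^sup>2 / \<rho>)"
        using rho by (simp add: E_def power_mult_distrib distrib_left) (simp add: power2_eq_square)
      finally show ?thesis using rho by simp
    qed
    ultimately show "\<exists>y. (\<psi> has_real_derivative y) (at s) \<and> y \<le> 0"
      by (intro exI conjI) (assumption, simp add: mult_nonpos_nonneg)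
  qed
  then have "E t * exp (- \<rho> * t) + (F / \<rho>)\<^sup>2 * exp (- \<rho> * t) \<le> (F / \<rho>)\<^sup>2"
    by (simp add: \<psi>_def E_def init D_zero)
  then have "E t * exp (- \<rho> * t) \<le> (F / \<rho>)\<^sup>2"
    by (smt (verit) exp_gt_zero mult_nonneg_nonneg zero_le_power2)
  then have "E t * exp (- \<rho> * t) * exp (\<rho> * t) \<le> (F / \<rho>)\<^sup>2 * exp (\<rho> * t)" by (rule mult_right_mono) simp
  then show ?thesis by (simp add: E_def mult.assoc flip: exp_add)
qed

end

section \<open>Representation of the residual and the abstract error estimate\<close>

context wave_space begin

text \<open>By the Poincare inequality a Cauchy sequence of images has a Cauchy sequence of preimages.\<close>

lemma closed_range: "closed (D ` V)"
proof -
  obtain C where C: "\<And>v. v \<in> V \<Longrightarrow> norm v \<le> C * norm (D v)" using poincare by blast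
  have "complete (D ` V)"
  proof (rule completeI)
    fix y assume y: "\<forall>n. y n \<in> D ` V" "Cauchy y"
    then obtain v where v: "\<And>n. v n \<in> V" "\<And>n. y n = D (v n)" by (auto simp: image_iff) metis
    have "Cauchy v"
    proof (rule metric_CauchyI)
      fix e :: real assume e: "0 < e"
      define C' where "C' = max C 1"
      have C': "0 < C'" "C \<le> C'" by (auto simp: C'_def)
      obtain N where N: "\<And>m n. m \<ge> N \<Longrightarrow> n \<ge> N \<Longrightarrow> dist (y m) (y n) < e / C'"
        using metric_CauchyD[OF y(2), of "e / C'"] e C' by auto
      have "dist (v m) (v n) < e" if "m \<ge> N" "n \<ge> N" for m n
      proof -
        have "dist (v m) (v n) \<le> C * dist (y m) (y n)"
          using C[OF subspace_diff[OF V v(1) v(1)], of m n] by (simp add: dist_norm v(2) D_diff v(1))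
        also have "\<dots> \<le> C' * dist (y m) (y n)" using C'(2) by (rule mult_right_mono) simp
        also have "\<dots> < C' * (e / C')" using N[OF that] C' by (intro mult_strict_left_mono) auto
        finally show ?thesis using C' by simp
      qed
      then show "\<exists>N. \<forall>m\<ge>N. \<forall>n\<ge>N. dist (v m) (v n) < e" by blast
    qed
    then obtain v0 where v0: "v \<longlonglongrightarrow> v0" using Cauchy_convergent_iff convergent_def by blast
    obtain y0 where y0: "y \<longlonglongrightarrow> y0" using y(2) Cauchy_convergent_iff convergent_def by blast
    have "(\<lambda>n. (v n, y n)) \<longlonglongrightarrow> (v0, y0)" by (intro tendsto_Pair v0 y0)
    then have "(v0, y0) \<in> (\<lambda>v. (v, D v)) ` V"
      by (rule closed_sequentially[OF closed_graph, rotated]) (use v in auto)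
    then have "y0 \<in> D ` V" by auto
    then show "\<exists>l\<in>D ` V. y \<longlonglongrightarrow> l" using y0 by blast
  qed
  then show ?thesis by (rule complete_imp_closed)
qed

lemma subspace_range: "subspace (D ` V)"
  unfolding subspace_def
proof (intro conjI ballI allI)
  show "0 \<in> D ` V" using D_zero subspace_0[OF V] by (metis image_eqI)
  show "x + y \<in> D ` V" if "x \<in> D ` V" "y \<in> D ` V" for x y
    using that D_add subspace_add[OF V] by (metis (no_types, lifting) imageE image_eqI)
  show "c *\<^sub>R x \<in> D ` V" if "x \<in> D ` V" for c x
    using that D_scale subspace_scale[OF V] by (metis (no_types, lifting) imageE image_eqI)
qed

text \<open>Riesz representation of \<open>D v \<mapsto> (h, v)\<close> on the closed range of \<open>D\<close>. The representer depends linearly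
  and continuously on \<open>h\<close>, which makes the representer of the residual a measurable function of time.\<close>

lemma dual_representation:
  "\<exists>T. bounded_linear T \<and> (\<forall>h. T h \<in> D ` V) \<and> (\<forall>h. \<forall>v\<in>V. T h \<bullet> D v = h \<bullet> v)"
proof -
  obtain C0 where C0: "\<And>v. v \<in> V \<Longrightarrow> norm v \<le> C0 * norm (D v)" using poincare by blast
  define C where "C = \<bar>C0\<bar>"
  have C: "norm v \<le> C * norm (D v)" if "v \<in> V" for v
    by (rule order_trans[OF C0[OF that]]) (simp add: C_def mult_right_mono)
  have inj: "inj_on D V"
  proof (rule inj_onI)
    fix x y assume "x \<in> V" "y \<in> V" "D x = D y"
    then show "x = y" using C[OF subspace_diff[OF V, of x y]] by (simp add: D_diff)
  qed
  define G where "G = the_inv_into V D"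
  have G: "G y \<in> V" "D (G y) = y" if "y \<in> D ` V" for y
    using that inj by (auto simp: G_def the_inv_into_into f_the_inv_into_f)
  have GD: "G (D v) = v" if "v \<in> V" for v using inj that by (simp add: G_def the_inv_into_f_f)
  have "\<exists>p\<in>D ` V. \<forall>y\<in>D ` V. h \<bullet> G y = p \<bullet> y" for h
  proof (rule riesz_representation_on[OF subspace_range closed_range])
    fix x y assume x: "x \<in> D ` V" and y: "y \<in> D ` V"
    have "G (x + y) = G x + G y" using GD[of "G x + G y"] G[OF x] G[OF y] by (simp add: D_add subspace_add[OF V])
    then show "h \<bullet> G (x + y) = h \<bullet> G x + h \<bullet> G y" by (simp add: inner_add_right)
  next
    fix c x assume x: "x \<in> D ` V"
    have "G (c *\<^sub>R x) = c *\<^sub>R G x" using GD[of "c *\<^sub>R G x"] G[OF x] by (simp add: D_scale subspace_scale[OF V])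
    then show "h \<bullet> G (c *\<^sub>R x) = c * (h \<bullet> G x)" by simp
    have "\<bar>h \<bullet> G x\<bar> \<le> norm h * norm (G x)" by (rule Cauchy_Schwarz_ineq2)
    also have "\<dots> \<le> norm h * (C * norm x)" using C[OF G(1)[OF x]] G(2)[OF x] by (intro mult_left_mono) auto
    finally show "\<bar>h \<bullet> G x\<bar> \<le> (norm h * C) * norm x" by simp
  qed
  then obtain T where T: "\<And>h. T h \<in> D ` V" "\<And>h y. y \<in> D ` V \<Longrightarrow> h \<bullet> G y = T h \<bullet> y" by metis
  have TV: "T h \<bullet> D v = h \<bullet> v" if "v \<in> V" for h v using T(2)[of "D v" h] GD[OF that] that by simp
  have uniq: "a = c" if ac: "a \<in> D ` V" "c \<in> D ` V" "\<And>v. v \<in> V \<Longrightarrow> a \<bullet> D v = c \<bullet> D v" for a c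
  proof -
    obtain v where v: "v \<in> V" "a - c = D v" using subspace_diff[OF subspace_range ac(1,2)] by blast
    have "(a - c) \<bullet> (a - c) = 0" using ac(3)[OF v(1)] unfolding v(2)[symmetric] by (simp add: inner_diff_left)
    then show ?thesis by simp
  qed
  have "bounded_linear T"
  proof (rule bounded_linear_intro[where K = C])
    show "T (x + y) = T x + T y" for x y
      by (rule uniq) (auto simp: TV inner_add_left intro: T subspace_add[OF subspace_range])
    show "T (c *\<^sub>R x) = c *\<^sub>R T x" for c x
      by (rule uniq) (auto simp: TV intro: T subspace_scale[OF subspace_range])
    show "norm (T x) \<le> norm x * C" for x
    proof -
      obtain v where v: "v \<in> V" "T x = D v" using T(1)[of x] by blast
      have "(norm (T x))\<^sup>2 = x \<bullet> v" using TV[OF v(1), of x] v(2) by (simp add: power2_norm_eq_inner)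
      also have "\<dots> \<le> norm x * norm v" by (rule norm_cauchy_schwarz)
      also have "\<dots> \<le> norm x * (C * norm (T x))" using C[OF v(1)] v(2) by (intro mult_left_mono) auto
      finally have le: "norm (T x) * norm (T x) \<le> (norm x * C) * norm (T x)" by (simp only: power2_eq_square mult.assoc)
      show ?thesis
      proof (cases "T x = 0")
        case True
        then show ?thesis by (simp add: C_def)
      qed (use le in \<open>simp add: mult_le_cancel_right_pos\<close>)
    qed
  qed
  then show ?thesis using T(1) TV by blast
qed

lemma ennreal_sum_le:
  assumes "0 \<le> a" "0 \<le> b" "0 \<le> x" "0 \<le> y" "0 \<le> z" "0 \<le> w" and le: "a + b \<le> x + y + z + w"
  shows "ennreal a + ennreal b \<le> (ennreal x + ennreal y) + (ennreal z + ennreal w)"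
proof -
  have "ennreal a + ennreal b = ennreal (a + b)" using assms by simp
  also have "\<dots> \<le> ennreal (x + y + z + w)" by (rule ennreal_leI[OF le])
  also have "\<dots> = (ennreal x + ennreal y) + (ennreal z + ennreal w)" using assms by (simp add: add.assoc)
  finally show ?thesis .
qed

text \<open>The frequency estimates, integrated over all frequencies. The function \<open>q\<close> represents the residual of
  \<open>w\<close>, and \<open>dl\<close> is the gradient of the difference of the two reconstructions. The transformability of
  the functions that are compared makes the energies finite, so that the inequality has content.\<close>

theorem abstract_error_estimate:
  fixes fd :: "nat \<Rightarrow> real \<Rightarrow> 'h"
  assumes rho: "0 < \<rho>" and omega: "0 < \<omega>" and W: "subspace W" "W \<subseteq> V" and gamma: "0 \<le> \<gamma>"
    and approx: "\<And>\<nu>. \<bar>\<nu>\<bar> \<le> \<omega> \<Longrightarrow> approximable W (Complex \<rho> \<nu>) \<gamma>"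
    and u1: "\<And>t. 0 \<le> t \<Longrightarrow> (u has_vector_derivative u1 t) (at t within {0..})"
    and u2: "\<And>t. 0 \<le> t \<Longrightarrow> (u1 has_vector_derivative u2 t) (at t within {0..})"
    and init: "u 0 = 0" "u1 0 = 0" and uV: "\<And>t. 0 \<le> t \<Longrightarrow> u t \<in> V"
    and cDu: "continuous_on {0..} (\<lambda>t. D (u t))" and cu2: "continuous_on {0..} u2" and cf: "continuous_on {0..} f"
    and eq: "\<And>t v. 0 \<le> t \<Longrightarrow> v \<in> V \<Longrightarrow> u2 t \<bullet> v + D (u t) \<bullet> D v = f t \<bullet> v"
    and F: "\<And>t. 0 \<le> t \<Longrightarrow> norm (f t) \<le> F"
    and fd0: "fd 0 = f" and fdi: "\<And>j. j < r \<Longrightarrow> fd j 0 = 0"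
    and fd: "\<And>j t. j < r \<Longrightarrow> 0 \<le> t \<Longrightarrow> (fd j has_vector_derivative fd (Suc j) t) (at t within {0..})"
    and cfd: "continuous_on {0..} (fd r)" and Fr: "\<And>t. 0 \<le> t \<Longrightarrow> norm (fd r t) \<le> Fr"
    and S: "\<And>T. finite (S \<inter> {0..T})"
    and cw: "continuous_on {0..} w" and cw1: "continuous_on {0..} w1" and wi: "w 0 = 0" "w1 0 = 0"
    and dw: "\<And>t. 0 < t \<Longrightarrow> t \<notin> S \<Longrightarrow> (w has_vector_derivative w1 t) (at t)"
    and dw1: "\<And>t. 0 < t \<Longrightarrow> t \<notin> S \<Longrightarrow> (w1 has_vector_derivative w2 t) (at t)"
    and tw: "transformable \<rho> w" "transformable \<rho> w1" "transformable \<rho> w2"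
    and wW: "\<And>t. 0 \<le> t \<Longrightarrow> w t \<in> W"
    and cDw: "continuous_on {0..} (\<lambda>t. D (w t))" and tDw: "transformable \<rho> (\<lambda>t. D (w t))"
    and tf: "transformable \<rho> f\<tau>" and tq: "transformable \<rho> q"
    and res: "\<And>t v. 0 < t \<Longrightarrow> t \<notin> S \<Longrightarrow> v \<in> V \<Longrightarrow> w2 t \<bullet> v = f\<tau> t \<bullet> v - q t \<bullet> D v - D (w t) \<bullet> D v"
    and orth: "\<And>t v. 0 \<le> t \<Longrightarrow> v \<in> W \<Longrightarrow> q t \<bullet> D v = dl t \<bullet> D v"
    and cdl: "continuous_on {0..} dl" and dli: "dl 0 = 0"
    and ddl: "\<And>t. 0 < t \<Longrightarrow> t \<notin> S \<Longrightarrow> (dl has_vector_derivative dl1 t) (at t)"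
    and tdl: "transformable \<rho> dl" "transformable \<rho> dl1"
  shows "transformable \<rho> (\<lambda>t. u1 t - w1 t)" "transformable \<rho> (\<lambda>t. D (u t - w t))"
    "transformable \<rho> (\<lambda>t. f t - f\<tau> t)" "transformable \<rho> (fd r)"
    "energy \<rho> (\<lambda>t. u1 t - w1 t) + energy \<rho> (\<lambda>t. D (u t - w t))
    \<le> (1 + 40 * \<gamma>\<^sup>2) * energy \<rho> q + 20 / \<rho>\<^sup>2 * energy \<rho> dl1
      + 11 / \<rho>\<^sup>2 * energy \<rho> (\<lambda>t. f t - f\<tau> t) + 8 / \<rho>\<^sup>2 * (1 / \<omega> ^ (2 * r)) * energy \<rho> (fd r)"
proof -
  obtain CP where CP: "\<And>v. v \<in> V \<Longrightarrow> norm v \<le> CP * norm (D v)" using poincare by blast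
  have F0: "0 \<le> F" using F[of 0] norm_ge_zero order_trans by blast
  have growth: "(norm (u1 t))\<^sup>2 + (norm (D (u t)))\<^sup>2 \<le> (F / \<rho>)\<^sup>2 * exp (\<rho> * t)" if "0 \<le> t" for t
    by (rule solution_growth[OF rho u1 u2 init uV cDu cu2 cf eq F that])
  have e2: "(F / \<rho>)\<^sup>2 * exp (\<rho> * t) = (F / \<rho> * exp (\<rho> / 2 * t))\<^sup>2" for t
  proof -
    have "(exp (\<rho> / 2 * t))\<^sup>2 = exp (\<rho> * t)" by (simp flip: exp_double)
    then show ?thesis by (simp only: power_mult_distrib)
  qed
  have b1: "norm (u1 t) \<le> F / \<rho> * exp (\<rho> / 2 * t)" and b2: "norm (D (u t)) \<le> F / \<rho> * exp (\<rho> / 2 * t)" if "0 \<le> t" for t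
  proof -
    have nn: "0 \<le> F / \<rho> * exp (\<rho> / 2 * t)" using F0 rho by simp
    have "(norm (u1 t))\<^sup>2 \<le> (F / \<rho> * exp (\<rho> / 2 * t))\<^sup>2" "(norm (D (u t)))\<^sup>2 \<le> (F / \<rho> * exp (\<rho> / 2 * t))\<^sup>2"
      using growth[OF that] zero_le_power2[of "norm (u1 t)"] zero_le_power2[of "norm (D (u t))"]
      unfolding e2 by linarith+
    then show "norm (u1 t) \<le> F / \<rho> * exp (\<rho> / 2 * t)" "norm (D (u t)) \<le> F / \<rho> * exp (\<rho> / 2 * t)"
      using nn power2_le_imp_le by blast+
  qed
  have cu: "continuous_on {0..} u" and cu1: "continuous_on {0..} u1"
    using u1 u2 by (auto intro!: continuous_on_vector_derivative)
  have tu1: "transformable \<rho> u1" by (rule transformableI_continuous[OF cu1 b1])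
  have tDu: "transformable \<rho> (\<lambda>t. D (u t))" by (rule transformableI_continuous[OF cDu b2])
  have tu: "transformable \<rho> u"
  proof (rule transformableI_continuous[OF cu])
    fix t :: real assume t: "0 \<le> t"
    have "norm (u t) \<le> CP * norm (D (u t))" by (rule CP[OF uV[OF t]])
    also have "\<dots> \<le> \<bar>CP\<bar> * norm (D (u t))" by (rule mult_right_mono) auto
    also have "\<dots> \<le> \<bar>CP\<bar> * (F / \<rho> * exp (\<rho> / 2 * t))" by (intro mult_left_mono b2 t) simp
    finally show "norm (u t) \<le> (\<bar>CP\<bar> * (F / \<rho>)) * exp (\<rho> / 2 * t)" by (simp only: mult.assoc)
  qed
  have expge: "1 \<le> exp (\<rho> / 2 * t)" if "0 \<le> t" for t using that rho by simp
  have bdd: "norm x \<le> K * exp (\<rho> / 2 * t)" if "norm x \<le> K" "0 \<le> t" for x :: 'h and K t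
    using that mult_left_mono[OF expge[OF that(2)], of K] norm_ge_zero[of x] by linarith
  have tff: "transformable \<rho> f" by (rule transformableI_continuous[OF cf bdd[OF F]])
  have fdb: "\<exists>K\<ge>0. \<forall>t\<ge>0. norm (fd j t) \<le> K * exp (\<rho> / 2 * t)" if "j \<le> r" for j
    using that
  proof (induction rule: inc_induct)
    case base
    have "0 \<le> Fr" using Fr[of 0] norm_ge_zero order_trans by blast
    then show ?case using bdd Fr by blast
  next
    case (step j)
    then obtain K where K: "0 \<le> K" "\<And>t. 0 \<le> t \<Longrightarrow> norm (fd (Suc j) t) \<le> K * exp (\<rho> / 2 * t)" by blast
    have "norm (fd j t) \<le> K / (\<rho> / 2) * exp (\<rho> / 2 * t)" if "0 \<le> t" for t
      by (rule exponential_growth[OF _ K(1) fdi[OF step(2)] fd[OF step(2)] K(2) that]) (use rho in simp_all)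
    moreover have "0 \<le> K / (\<rho> / 2)" using K(1) rho by simp
    ultimately show ?case by blast
  qed
  have cfdj: "continuous_on {0..} (fd j)" if "j \<le> r" for j
  proof (cases "j = r")
    case False
    then show ?thesis using fd[of j] that by (auto intro!: continuous_on_vector_derivative)
  qed (use cfd in simp)
  have tfd: "transformable \<rho> (fd j)" if jr: "j \<le> r" for j
  proof -
    obtain K where "\<And>t. 0 \<le> t \<Longrightarrow> norm (fd j t) \<le> K * exp (\<rho> / 2 * t)" using fdb[OF jr] by blast
    then show ?thesis by (rule transformableI_continuous[OF cfdj[OF jr]])
  qed
  note pos = has_vector_derivative_at_positive
  have Lfd: "laplace \<rho> (fd j) \<nu> = cscale (Complex \<rho> \<nu> ^ j) (laplace \<rho> f \<nu>)" if "j \<le> r" for j \<nu>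
    using that
  proof (induction j)
    case 0
    show ?case by (simp add: fd0 cscale_one)
  next
    case (Suc j)
    then have j: "j < r" by simp
    have "laplace \<rho> (fd (Suc j)) \<nu> = cscale (Complex \<rho> \<nu>) (laplace \<rho> (fd j) \<nu>)"
      by (rule laplace_derivative[OF rho cfdj fdi[OF j], where S = "{}"])
        (use j in \<open>auto intro!: pos fd tfd\<close>)
    then show ?case using Suc by (simp add: cscale_cscale)
  qed
  (* the transform of w is only known to lie in the closure Wc of W, to which orthogonality extends by continuity *)
  define Wc where "Wc = {v \<in> V. (v, D v) \<in> closure ((\<lambda>v. (v, D v)) ` W)}"
  have clW: "subspace (closure ((\<lambda>v. (v, D v)) ` W))" by (rule subspace_closure_L2[OF subspace_graph[OF W]])
  have Wc: "subspace Wc" unfolding Wc_def subspace_def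
    using subspace_0[OF clW] subspace_add[OF clW] subspace_scale[OF clW]
    by (auto simp: D_zero zero_prod_def subspace_0[OF V] subspace_add[OF V] subspace_scale[OF V] D_add D_scale)
  have pointwise: "(norm (laplace \<rho> (\<lambda>t. u1 t - w1 t) \<nu>))\<^sup>2 + (norm (laplace \<rho> (\<lambda>t. D (u t - w t)) \<nu>))\<^sup>2
      \<le> (1 + 40 * \<gamma>\<^sup>2) * (norm (laplace \<rho> q \<nu>))\<^sup>2 + 20 / \<rho>\<^sup>2 * (norm (laplace \<rho> dl1 \<nu>))\<^sup>2
        + 11 / \<rho>\<^sup>2 * (norm (laplace \<rho> (\<lambda>t. f t - f\<tau> t) \<nu>))\<^sup>2
        + 8 / \<rho>\<^sup>2 * (1 / \<omega> ^ (2 * r)) * (norm (laplace \<rho> (fd r) \<nu>))\<^sup>2" (is "?lhs \<le> ?rhs") for \<nu>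
  proof -
    define s where "s = Complex \<rho> \<nu>"
    have s: "0 < Re s" "Re s = \<rho>" using rho by (simp_all add: s_def)
    define Y Z Q dlt where "Y = laplace \<rho> u \<nu>" and "Z = laplace \<rho> w \<nu>" and "Q = laplace \<rho> q \<nu>"
      and "dlt = laplace \<rho> dl \<nu>"
    have Y1: "laplace \<rho> u1 \<nu> = cscale s Y" unfolding s_def Y_def
      by (rule laplace_derivative[OF rho cu init(1), where S = "{}"]) (auto intro!: pos u1 tu tu1)
    have Z1: "laplace \<rho> w1 \<nu> = cscale s Z" unfolding s_def Z_def
      by (rule laplace_derivative[OF rho cw wi(1) S dw tw(1,2)])
    have dl1: "laplace \<rho> dl1 \<nu> = cscale s dlt" unfolding s_def dlt_def
      by (rule laplace_derivative[OF rho cdl dli S ddl tdl])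
    have YV: "Y \<in> V \<times> V" unfolding Y_def by (rule laplace_graph(1)[OF rho V subset_refl tu tDu uV])
    have DY: "laplace \<rho> (\<lambda>t. D (u t)) \<nu> = D2 Y"
      unfolding Y_def by (rule laplace_graph(2)[OF rho V subset_refl tu tDu uV])
    have wV: "w t \<in> V" if "0 \<le> t" for t using wW[OF that] W(2) by blast
    note lw = laplace_graph[OF rho W tw(1) tDw wW, of \<nu>]
    have ZV: "Z \<in> V \<times> V" and DZ: "laplace \<rho> (\<lambda>t. D (w t)) \<nu> = D2 Z" and ZW: "Z \<in> Wc \<times> Wc"
      using lw unfolding Z_def[symmetric] by (auto simp: Wc_def mem_Times_iff)
    have bY: "b_form s Y v = laplace \<rho> f \<nu> \<bullet> v" if v: "v \<in> V \<times> V" for v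
    proof -
      have "cscale s (laplace \<rho> u1 \<nu>) \<bullet> v = laplace \<rho> f \<nu> \<bullet> v + laplace \<rho> (\<lambda>t. - D (u t)) \<nu> \<bullet> D2 v"
        unfolding s_def
      proof (rule laplace_weak_equation[OF rho cu1 init(2), where S = "{}"])
        fix t :: real and v assume t: "0 < t" and v: "v \<in> V"
        have "((\<lambda>t. u1 t \<bullet> v) has_vector_derivative u2 t \<bullet> v) (at t)"
          by (rule bounded_linear.has_vector_derivative[OF bounded_linear_inner_left pos[OF u2 t]]) (use t in simp)
        moreover have "u2 t \<bullet> v = f t \<bullet> v + (- D (u t)) \<bullet> D v"
          using eq[OF less_imp_le[OF t] v] unfolding inner_minus_left by linarith
        ultimately show "((\<lambda>t. u1 t \<bullet> v) has_vector_derivative (f t \<bullet> v + (- D (u t)) \<bullet> D v)) (at t)"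
          by simp
      qed (auto intro!: tu1 tff transformable_minus tDu v)
      also have "laplace \<rho> (\<lambda>t. - D (u t)) \<nu> = - D2 Y"
        using laplace_scaleR[OF rho tDu, of "-1" \<nu>] by (simp add: DY)
      finally show ?thesis by (simp add: Y1 b_form_def cscale_cscale power2_eq_square)
    qed
    have bZ: "b_form s Z v = laplace \<rho> f\<tau> \<nu> \<bullet> v - Q \<bullet> D2 v" if v: "v \<in> V \<times> V" for v
    proof -
      have "cscale s (laplace \<rho> w1 \<nu>) \<bullet> v = laplace \<rho> f\<tau> \<nu> \<bullet> v + laplace \<rho> (\<lambda>t. - (q t + D (w t))) \<nu> \<bullet> D2 v"
        unfolding s_def
      proof (rule laplace_weak_equation[OF rho cw1 wi(2) S])
        fix t :: real and v assume t: "0 < t" "t \<notin> S" and v: "v \<in> V"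
        have "((\<lambda>t. w1 t \<bullet> v) has_vector_derivative w2 t \<bullet> v) (at t)"
          by (rule bounded_linear.has_vector_derivative[OF bounded_linear_inner_left dw1[OF t]])
        then show "((\<lambda>t. w1 t \<bullet> v) has_vector_derivative (f\<tau> t \<bullet> v + (- (q t + D (w t))) \<bullet> D v)) (at t)"
          using res[OF t v] by (simp add: inner_add_left algebra_simps)
      qed (rule tw tf v transformable_minus[OF transformable_add[OF tq tDw]])+
      also have "laplace \<rho> (\<lambda>t. - (q t + D (w t))) \<nu> = - (Q + D2 Z)"
        using laplace_scaleR[OF rho transformable_add[OF tq tDw], of "-1" \<nu>] laplace_add[OF rho tq tDw, of \<nu>]
        by (simp add: DZ Q_def)
      finally show ?thesis
        by (simp add: Z1 b_form_def cscale_cscale power2_eq_square inner_add_left inner_diff_left)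
    qed
    have orthW: "fst Q \<bullet> D v = fst dlt \<bullet> D v \<and> snd Q \<bullet> D v = snd dlt \<bullet> D v" if v: "v \<in> W" for v
    proof -
      have "laplace \<rho> (\<lambda>t. q t \<bullet> D v) = laplace \<rho> (\<lambda>t. dl t \<bullet> D v)"
        by (rule laplace_cong[OF rho]) (rule orth[OF _ v])
      then have "laplace \<rho> (\<lambda>t. q t \<bullet> D v) \<nu> = laplace \<rho> (\<lambda>t. dl t \<bullet> D v) \<nu>" by (rule fun_cong)
      then show ?thesis by (simp add: laplace_inner[OF rho] tq tdl Q_def dlt_def)
    qed
    have orthWc: "fst Q \<bullet> D v = fst dlt \<bullet> D v \<and> snd Q \<bullet> D v = snd dlt \<bullet> D v" if v: "v \<in> Wc" for v
    proof -
      have "closure ((\<lambda>v. (v, D v)) ` W) \<subseteq> {p. fst Q \<bullet> snd p = fst dlt \<bullet> snd p \<and> snd Q \<bullet> snd p = snd dlt \<bullet> snd p}"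
      proof (rule closure_minimal)
        show "closed {p::'h \<times> 'g. fst Q \<bullet> snd p = fst dlt \<bullet> snd p \<and> snd Q \<bullet> snd p = snd dlt \<bullet> snd p}"
          by (intro closed_Collect_conj closed_Collect_eq continuous_intros)
      qed (use orthW in auto)
      then show ?thesis using v by (auto simp: Wc_def)
    qed
    have orth2: "Q \<bullet> D2 v = dlt \<bullet> D2 v" if "v \<in> Wc \<times> Wc" for v
      using orthWc[of "fst v"] orthWc[of "snd v"] that by (auto simp: inner_prod_def D2_def mem_Times_iff)
    have WWc: "W \<subseteq> Wc" unfolding Wc_def using W(2) closure_subset[of "(\<lambda>v. (v, D v)) ` W"] by blast
    define E where "E = Y - Z"
    have EV: "E \<in> V \<times> V" unfolding E_def by (rule subspace_diff[OF V2 YV ZV])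
    have DE: "D2 E = D2 Y - D2 Z" unfolding E_def by (rule D2_diff[OF YV ZV])
    have l1: "laplace \<rho> (\<lambda>t. u1 t - w1 t) \<nu> = cscale s E"
      by (simp add: laplace_diff[OF rho tu1 tw(2)] Y1 Z1 E_def cscale_diff)
    have l2: "laplace \<rho> (\<lambda>t. D (u t - w t)) \<nu> = D2 E"
    proof -
      have "laplace \<rho> (\<lambda>t. D (u t - w t)) = laplace \<rho> (\<lambda>t. D (u t) - D (w t))"
        by (rule laplace_cong[OF rho]) (simp add: D_diff uV wV)
      then show ?thesis by (simp add: laplace_diff[OF rho tDu tDw] DY DZ DE)
    qed
    have l3: "laplace \<rho> (\<lambda>t. f t - f\<tau> t) \<nu> = laplace \<rho> f \<nu> - laplace \<rho> f\<tau> \<nu>" by (rule laplace_diff[OF rho tff tf])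
    have lhs: "?lhs = (cmod s)\<^sup>2 * (norm E)\<^sup>2 + (norm (D2 E))\<^sup>2"
      by (simp add: l1 l2 norm_cscale power_mult_distrib)
    have nn: "0 \<le> 8 / \<rho>\<^sup>2 * (1 / \<omega> ^ (2 * r)) * (norm (laplace \<rho> (fd r) \<nu>))\<^sup>2" using omega by simp
    have nn': "0 \<le> (1 + 40 * \<gamma>\<^sup>2) * (norm (laplace \<rho> q \<nu>))\<^sup>2" by simp
    (* at low frequencies the bound involves the residual q, at high frequencies the derivative fd r *)
    show "?lhs \<le> ?rhs"
    proof (cases "\<bar>\<nu>\<bar> \<le> \<omega>")
      case True
      have "(cmod s)\<^sup>2 * (norm E)\<^sup>2 + (norm (D2 E))\<^sup>2
          \<le> (1 + 40 * \<gamma>\<^sup>2) * (norm Q)\<^sup>2 + 20 / (Re s)\<^sup>2 * (norm (cscale s dlt))\<^sup>2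
            + 11 / (Re s)\<^sup>2 * (norm (laplace \<rho> f \<nu> - laplace \<rho> f\<tau> \<nu>))\<^sup>2"
      proof (rule low_frequency_estimate[OF s(1) W EV])
        show "b_form s E v = Q \<bullet> D2 v + (laplace \<rho> f \<nu> - laplace \<rho> f\<tau> \<nu>) \<bullet> v" if "v \<in> V \<times> V" for v
        proof -
          have "b_form s E v = b_form s Y v - b_form s Z v"
            by (simp add: b_form_def DE inner_diff_left) (simp add: E_def cscale_diff inner_diff_left)
          then show ?thesis using bY[OF that] bZ[OF that] by (simp add: inner_diff_left)
        qed
        show "Q \<bullet> D2 v = dlt \<bullet> D2 v" if "v \<in> W \<times> W" for v using orth2 WWc that by blast
        show "approximable W s \<gamma>" using approx[OF True] by (simp add: s_def)
      qed (rule gamma)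
      then show ?thesis unfolding lhs l3 dl1 Q_def[symmetric] s(2) using nn by linarith
    next
      case False
      have "(cmod s)\<^sup>2 * (norm (Y - Z))\<^sup>2 + (norm (D2 (Y - Z)))\<^sup>2
          \<le> (20 * (norm (cscale s dlt))\<^sup>2 + 11 * (norm (laplace \<rho> f \<nu> - laplace \<rho> f\<tau> \<nu>))\<^sup>2 + 8 * (norm (laplace \<rho> f \<nu>))\<^sup>2) / (Re s)\<^sup>2"
      proof (rule high_frequency_estimate[OF s(1) YV ZV bY])
        have sZ: "cscale s Z \<in> Wc \<times> Wc" "cscale s Z \<in> V \<times> V"
          using cscale_in_Times[OF Wc ZW] cscale_in_Times[OF V ZV] by auto
        show "b_form s Z (cscale s Z) = laplace \<rho> f\<tau> \<nu> \<bullet> cscale s Z - dlt \<bullet> cscale s (D2 Z)"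
          using bZ[OF sZ(2)] orth2[OF sZ(1)] by (simp add: D2_cscale[OF ZV])
      qed
      also have "\<dots> = 20 / \<rho>\<^sup>2 * (norm (laplace \<rho> dl1 \<nu>))\<^sup>2 + 11 / \<rho>\<^sup>2 * (norm (laplace \<rho> (\<lambda>t. f t - f\<tau> t) \<nu>))\<^sup>2
          + 8 / \<rho>\<^sup>2 * (norm (laplace \<rho> f \<nu>))\<^sup>2"
        by (simp add: dl1 l3 s(2) add_divide_distrib)
      also have "8 / \<rho>\<^sup>2 * (norm (laplace \<rho> f \<nu>))\<^sup>2 \<le> 8 / \<rho>\<^sup>2 * (1 / \<omega> ^ (2 * r)) * (norm (laplace \<rho> (fd r) \<nu>))\<^sup>2"
      proof -
        have "\<omega> \<le> cmod s" using False abs_Im_le_cmod[of s] by (simp add: s_def)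
        then have "\<omega> ^ (2 * r) \<le> cmod s ^ (2 * r)" using omega by (intro power_mono) auto
        moreover have "(norm (laplace \<rho> (fd r) \<nu>))\<^sup>2 = cmod s ^ (2 * r) * (norm (laplace \<rho> f \<nu>))\<^sup>2"
          by (simp add: Lfd norm_cscale norm_power power_mult_distrib power_mult[symmetric] mult.commute[of r] flip: s_def)
        ultimately have "\<omega> ^ (2 * r) * (norm (laplace \<rho> f \<nu>))\<^sup>2 \<le> (norm (laplace \<rho> (fd r) \<nu>))\<^sup>2"
          by (simp add: mult_right_mono)
        then have "(norm (laplace \<rho> f \<nu>))\<^sup>2 \<le> (1 / \<omega> ^ (2 * r)) * (norm (laplace \<rho> (fd r) \<nu>))\<^sup>2"
          using omega by (simp add: field_simps)
        then show ?thesis unfolding mult.assoc by (rule mult_left_mono) simp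
      qed
      finally show ?thesis unfolding lhs E_def using nn' by linarith
    qed
  qed
  have teta: "transformable \<rho> (\<lambda>t. f t - f\<tau> t)" by (rule transformable_diff[OF tff tf])
  have te1: "transformable \<rho> (\<lambda>t. u1 t - w1 t)" by (rule transformable_diff[OF tu1 tw(2)])
  have wV: "w t \<in> V" if "0 \<le> t" for t using wW[OF that] W(2) by blast
  define De where "De t = D (u t) - D (w t)" for t
  have De: "D (u t - w t) = De t" if "0 \<le> t" for t using that by (simp add: De_def D_diff uV wV)
  have tDe: "transformable \<rho> De" unfolding De_def by (rule transformable_diff[OF tDu tDw])
  have cDe: "continuous_on {0..} De" unfolding De_def by (intro continuous_intros cDu cDw)
  have "(\<lambda>t. indicator {0..} t *\<^sub>R D (u t - w t)) = (\<lambda>t. indicator {0..} t *\<^sub>R De t)"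
    using De by (auto simp: fun_eq_iff indicator_def)
  with tDe show "transformable \<rho> (\<lambda>t. D (u t - w t))" by (auto simp: transformable_def De)
  show "transformable \<rho> (\<lambda>t. u1 t - w1 t)" "transformable \<rho> (\<lambda>t. f t - f\<tau> t)" "transformable \<rho> (fd r)"
    by (rule te1) (rule teta, rule tfd, rule order_refl)
  have lDe: "laplace \<rho> (\<lambda>t. D (u t - w t)) = laplace \<rho> De" by (rule laplace_cong[OF rho De])
  have enDe: "energy \<rho> (\<lambda>t. D (u t - w t)) = energy \<rho> De"
    unfolding energy_def by (rule Bochner_Integration.integral_cong) (auto simp: indicator_def De)
  have [measurable]: "laplace \<rho> q \<in> borel_measurable borel" "laplace \<rho> dl1 \<in> borel_measurable borel"
    "laplace \<rho> (\<lambda>t. f t - f\<tau> t) \<in> borel_measurable borel" "laplace \<rho> (fd r) \<in> borel_measurable borel"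
    "laplace \<rho> (\<lambda>t. u1 t - w1 t) \<in> borel_measurable borel" "laplace \<rho> De \<in> borel_measurable borel"
    using tq tdl(2) teta tfd te1 tDe by (auto intro: laplace_measurable[OF rho])
  define c1 c2 c3 c4 where "c1 = 1 + 40 * \<gamma>\<^sup>2" and "c2 = 20 / \<rho>\<^sup>2" and "c3 = 11 / \<rho>\<^sup>2"
    and "c4 = 8 / \<rho>\<^sup>2 * (1 / \<omega> ^ (2 * r))"
  have c: "0 \<le> c1" "0 \<le> c2" "0 \<le> c3" "0 \<le> c4" using omega by (auto simp: c1_def c2_def c3_def c4_def)
  note en = energy_nonneg[OF rho]
  have up: "(\<integral>\<^sup>+\<nu>. ennreal (k * (norm (laplace \<rho> g \<nu>))\<^sup>2) \<partial>lborel) \<le> ennreal (2 * pi * (k * energy \<rho> g))"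
    if k: "0 \<le> k" and g: "transformable \<rho> g" for k and g :: "real \<Rightarrow> 'c::{real_inner, banach, second_countable_topology}"
  proof -
    have [measurable]: "laplace \<rho> g \<in> borel_measurable borel" by (rule laplace_measurable[OF rho g])
    have "(\<integral>\<^sup>+\<nu>. ennreal (k * (norm (laplace \<rho> g \<nu>))\<^sup>2) \<partial>lborel) = ennreal k * (\<integral>\<^sup>+\<nu>. ennreal ((norm (laplace \<rho> g \<nu>))\<^sup>2) \<partial>lborel)"
      by (subst nn_integral_cmult[symmetric]) (auto simp: ennreal_mult k)
    also have "\<dots> \<le> ennreal k * ennreal (2 * pi * energy \<rho> g)"
      by (intro mult_left_mono laplace_plancherel_le[OF rho g]) simp
    also have "\<dots> = ennreal (2 * pi * (k * energy \<rho> g))"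
      using k en[of g] by (subst ennreal_mult[symmetric]) (auto simp: mult_ac)
    finally show ?thesis .
  qed
  have "ennreal (2 * pi * (energy \<rho> (\<lambda>t. u1 t - w1 t) + energy \<rho> De))
      = ennreal (2 * pi * energy \<rho> (\<lambda>t. u1 t - w1 t)) + ennreal (2 * pi * energy \<rho> De)"
    using en[of "\<lambda>t. u1 t - w1 t"] en[of De] by (simp add: distrib_left)
  also have "\<dots> \<le> (\<integral>\<^sup>+\<nu>. ennreal ((norm (laplace \<rho> (\<lambda>t. u1 t - w1 t) \<nu>))\<^sup>2) \<partial>lborel)
      + (\<integral>\<^sup>+\<nu>. ennreal ((norm (laplace \<rho> De \<nu>))\<^sup>2) \<partial>lborel)"
    by (intro add_mono laplace_plancherel_ge[OF rho te1] laplace_plancherel_ge[OF rho tDe] cDe continuous_intros cu1 cw1)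
  also have "\<dots> = (\<integral>\<^sup>+\<nu>. ennreal ((norm (laplace \<rho> (\<lambda>t. u1 t - w1 t) \<nu>))\<^sup>2) + ennreal ((norm (laplace \<rho> De \<nu>))\<^sup>2) \<partial>lborel)"
    by (rule nn_integral_add[symmetric]) measurable
  also have "\<dots> \<le> (\<integral>\<^sup>+\<nu>. (ennreal (c1 * (norm (laplace \<rho> q \<nu>))\<^sup>2) + ennreal (c2 * (norm (laplace \<rho> dl1 \<nu>))\<^sup>2))
      + (ennreal (c3 * (norm (laplace \<rho> (\<lambda>t. f t - f\<tau> t) \<nu>))\<^sup>2) + ennreal (c4 * (norm (laplace \<rho> (fd r) \<nu>))\<^sup>2)) \<partial>lborel)"
  proof (rule nn_integral_mono)
    fix \<nu>
    show "ennreal ((norm (laplace \<rho> (\<lambda>t. u1 t - w1 t) \<nu>))\<^sup>2) + ennreal ((norm (laplace \<rho> De \<nu>))\<^sup>2)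
      \<le> (ennreal (c1 * (norm (laplace \<rho> q \<nu>))\<^sup>2) + ennreal (c2 * (norm (laplace \<rho> dl1 \<nu>))\<^sup>2))
      + (ennreal (c3 * (norm (laplace \<rho> (\<lambda>t. f t - f\<tau> t) \<nu>))\<^sup>2) + ennreal (c4 * (norm (laplace \<rho> (fd r) \<nu>))\<^sup>2))"
      using pointwise[of \<nu>, unfolded lDe, folded c1_def c2_def c3_def c4_def]
      by (intro ennreal_sum_le mult_nonneg_nonneg c zero_le_power2)
  qed
  also have "\<dots> = ((\<integral>\<^sup>+\<nu>. ennreal (c1 * (norm (laplace \<rho> q \<nu>))\<^sup>2) \<partial>lborel) + (\<integral>\<^sup>+\<nu>. ennreal (c2 * (norm (laplace \<rho> dl1 \<nu>))\<^sup>2) \<partial>lborel))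
      + ((\<integral>\<^sup>+\<nu>. ennreal (c3 * (norm (laplace \<rho> (\<lambda>t. f t - f\<tau> t) \<nu>))\<^sup>2) \<partial>lborel) + (\<integral>\<^sup>+\<nu>. ennreal (c4 * (norm (laplace \<rho> (fd r) \<nu>))\<^sup>2) \<partial>lborel))"
    by (subst nn_integral_add, measurable)+
  also have "\<dots> \<le> (ennreal (2 * pi * (c1 * energy \<rho> q)) + ennreal (2 * pi * (c2 * energy \<rho> dl1)))
      + (ennreal (2 * pi * (c3 * energy \<rho> (\<lambda>t. f t - f\<tau> t))) + ennreal (2 * pi * (c4 * energy \<rho> (fd r))))"
    by (intro add_mono up c tq tdl teta tfd order_refl)
  also have "\<dots> = ennreal (2 * pi * (c1 * energy \<rho> q + c2 * energy \<rho> dl1 + c3 * energy \<rho> (\<lambda>t. f t - f\<tau> t) + c4 * energy \<rho> (fd r)))"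
    using c en[of q] en[of dl1] en[of "\<lambda>t. f t - f\<tau> t"] en[of "fd r"]
    by (simp add: distrib_left add.assoc)
  finally have "2 * pi * (energy \<rho> (\<lambda>t. u1 t - w1 t) + energy \<rho> De)
      \<le> 2 * pi * (c1 * energy \<rho> q + c2 * energy \<rho> dl1 + c3 * energy \<rho> (\<lambda>t. f t - f\<tau> t) + c4 * energy \<rho> (fd r))"
    by (subst (asm) ennreal_le_iff) (use c en[of q] en[of dl1] en[of "\<lambda>t. f t - f\<tau> t"] en[of "fd r"] in \<open>auto intro!: mult_nonneg_nonneg add_nonneg_nonneg\<close>)
  then show "energy \<rho> (\<lambda>t. u1 t - w1 t) + energy \<rho> (\<lambda>t. D (u t - w t))
    \<le> (1 + 40 * \<gamma>\<^sup>2) * energy \<rho> q + 20 / \<rho>\<^sup>2 * energy \<rho> dl1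
      + 11 / \<rho>\<^sup>2 * energy \<rho> (\<lambda>t. f t - f\<tau> t) + 8 / \<rho>\<^sup>2 * (1 / \<omega> ^ (2 * r)) * energy \<rho> (fd r)"
    unfolding enDe c1_def c2_def c3_def c4_def by (rule mult_left_le_imp_le) simp
qed

end

section \<open>Smooth functions and test functions\<close>

lemma dir_deriv_has_derivative:
  assumes "(f has_derivative F) (at x)" shows "dir_deriv b f x = F b"
proof -
  interpret F: bounded_linear F using assms by (rule has_derivative_bounded_linear)
  have "((\<lambda>s. x + s *\<^sub>R b) has_derivative (\<lambda>s. s *\<^sub>R b)) (at 0)"
    by (auto intro!: derivative_eq_intros)
  from has_derivative_compose[OF this, of f F] assms
  have "((\<lambda>s. f (x + s *\<^sub>R b)) has_vector_derivative F b) (at 0)"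
    by (simp add: has_vector_derivative_def F.scaleR)
  then show ?thesis unfolding dir_deriv_def by (rule vector_derivative_at)
qed

lemma dir_deriv_differentiable:
  assumes "f differentiable (at x)" shows "dir_deriv b f x = frechet_derivative f (at x) b"
  using assms by (intro dir_deriv_has_derivative) (simp add: frechet_derivative_works)

lemma iter_dir_deriv_snoc: "iter_dir_deriv (bs @ [b]) f = iter_dir_deriv bs (dir_deriv b f)"
  by (induction bs) auto

lemma smooth_differentiable: "smooth f \<Longrightarrow> f differentiable (at x)"
  unfolding smooth_def by (drule spec[of _ "[]"]) simp

lemma smooth_continuous: "smooth f \<Longrightarrow> continuous_on A f"
  by (meson continuous_at_imp_continuous_on differentiable_imp_continuous_within smooth_differentiable)

lemma smooth_iter: "smooth f \<Longrightarrow> set bs \<subseteq> Basis \<Longrightarrow> iter_dir_deriv bs f differentiable (at x)"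
  unfolding smooth_def by blast

lemma smooth_dir_deriv: "smooth f \<Longrightarrow> b \<in> Basis \<Longrightarrow> smooth (dir_deriv b f)"
  unfolding smooth_def by (metis iter_dir_deriv_snoc set_append list.set(1,2) Un_subset_iff insert_subset empty_subsetI)

lemma dir_deriv_bounded_linear:
  assumes L: "bounded_linear L" and f: "f differentiable (at x)"
  shows "dir_deriv b (\<lambda>x. L (f x)) x = L (dir_deriv b f x)"
proof -
  obtain F where F: "(f has_derivative F) (at x)" using f by (auto simp: differentiable_def)
  show ?thesis
    using dir_deriv_has_derivative[OF bounded_linear.has_derivative[OF L F]] dir_deriv_has_derivative[OF F] by simp
qed

lemma dir_deriv_add:
  assumes "f differentiable (at x)" "g differentiable (at x)"
  shows "dir_deriv b (\<lambda>x. f x + g x) x = dir_deriv b f x + dir_deriv b g x"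
proof -
  obtain F G where F: "(f has_derivative F) (at x)" and G: "(g has_derivative G) (at x)"
    using assms by (auto simp: differentiable_def)
  show ?thesis
    using dir_deriv_has_derivative[OF has_derivative_add[OF F G]] dir_deriv_has_derivative[OF F] dir_deriv_has_derivative[OF G]
    by simp
qed

lemma smooth_bounded_linear:
  assumes L: "bounded_linear L" and f: "smooth f"
  shows "smooth (\<lambda>x. L (f x))"
proof -
  have iter: "iter_dir_deriv bs (\<lambda>x. L (f x)) = (\<lambda>x. L (iter_dir_deriv bs f x))" if "set bs \<subseteq> Basis" for bs
    using that
  proof (induction bs)
    case (Cons b bs)
    then have d: "iter_dir_deriv bs f differentiable (at x)" for x using smooth_iter[OF f] by simp
    have IH: "iter_dir_deriv bs (\<lambda>x. L (f x)) = (\<lambda>x. L (iter_dir_deriv bs f x))" using Cons by simp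
    show ?case unfolding iter_dir_deriv.simps IH by (rule ext) (rule dir_deriv_bounded_linear[OF L d])
  qed simp
  have "(\<lambda>x. L (iter_dir_deriv bs f x)) differentiable (at x)" if "set bs \<subseteq> Basis" for bs x
    using smooth_iter[OF f that, of x] bounded_linear.has_derivative[OF L] unfolding differentiable_def by blast
  then show ?thesis unfolding smooth_def using iter by simp
qed

lemma smooth_add:
  assumes f: "smooth f" and g: "smooth g" shows "smooth (\<lambda>x. f x + g x)"
proof -
  have iter: "iter_dir_deriv bs (\<lambda>x. f x + g x) = (\<lambda>x. iter_dir_deriv bs f x + iter_dir_deriv bs g x)"
    if "set bs \<subseteq> Basis" for bs
    using that
  proof (induction bs)
    case (Cons b bs)
    then have d: "iter_dir_deriv bs f differentiable (at x)" "iter_dir_deriv bs g differentiable (at x)" for x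
      using smooth_iter[OF f] smooth_iter[OF g] by simp_all
    have IH: "iter_dir_deriv bs (\<lambda>x. f x + g x) = (\<lambda>x. iter_dir_deriv bs f x + iter_dir_deriv bs g x)" using Cons by simp
    show ?case unfolding iter_dir_deriv.simps IH by (rule ext) (rule dir_deriv_add[OF d])
  qed simp
  show ?thesis unfolding smooth_def
    using iter smooth_iter[OF f] smooth_iter[OF g] by (simp add: differentiable_add)
qed

text \<open>A class of functions that is closed under differentiation, also at 0, where the exponential beats
  every polynomial in \<open>1 / y\<close>.\<close>

definition flat_function :: "(real \<Rightarrow> real) \<Rightarrow> bool" where
  "flat_function f \<longleftrightarrow> (\<exists>c>0. \<exists>p. f = (\<lambda>y. if 0 < y then poly p (1 / y) * exp (- c / y) else 0))"

lemma poly_exp_tendsto_zero: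
  assumes c: "0 < (c::real)"
  shows "((\<lambda>y. poly p y * exp (- c * y)) \<longlongrightarrow> 0) at_top"
proof -
  have mono: "((\<lambda>y. y ^ n * exp (- c * y)) \<longlongrightarrow> 0) at_top" for n
  proof -
    have "((\<lambda>y. inverse c ^ n * ((c * y) ^ n / exp (c * y))) \<longlongrightarrow> inverse c ^ n * 0) at_top"
      using c by (intro tendsto_intros filterlim_compose[OF tendsto_power_div_exp_0]
          filterlim_tendsto_pos_mult_at_top[OF tendsto_const _ filterlim_ident])
    then show ?thesis using c by (simp add: exp_minus field_simps power_mult_distrib)
  qed
  show ?thesis
  proof (induction p)
    case (pCons a p)
    have "((\<lambda>y. a * (y ^ 0 * exp (- c * y))) \<longlongrightarrow> a * 0) at_top" by (intro tendsto_intros mono)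
    moreover have "((\<lambda>y. y * (poly p y * exp (- c * y))) \<longlongrightarrow> 0) at_top"
    proof -
      have "((\<lambda>y. \<Sum>i\<le>degree p. coeff p i * (y ^ Suc i * exp (- c * y))) \<longlongrightarrow> (\<Sum>i\<le>degree p. coeff p i * 0)) at_top"
        by (intro tendsto_intros mono)
      then show ?thesis by (simp add: poly_altdef sum_distrib_left sum_distrib_right mult_ac)
    qed
    ultimately show ?case using tendsto_add by (fastforce simp: algebra_simps)
  qed simp
qed

lemma flat_function_derivative:
  assumes "flat_function f"
  obtains g where "flat_function g" "\<And>y. (f has_real_derivative g y) (at y)"
proof -
  obtain c p where c: "0 < c" and f: "f = (\<lambda>y. if 0 < y then poly p (1 / y) * exp (- c / y) else 0)"
    using assms by (auto simp: flat_function_def)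
  define q where "q = monom 1 2 * (smult c p - pderiv p)"
  define g where "g = (\<lambda>y. if 0 < y then poly q (1 / y) * exp (- c / y) else 0)"
  show thesis
  proof
    show "flat_function g" unfolding flat_function_def g_def using c by blast
    show "(f has_real_derivative g y) (at y)" for y
    proof -
      consider "y < 0" | "y = 0" | "0 < y" by linarith
      then show ?thesis
      proof cases
        case 1
        have "\<forall>\<^sub>F x in nhds y. f x = 0"
          using eventually_nhds_in_open[of "{..<0}" y] 1 by (auto elim!: eventually_mono simp: f)
        then have "(f has_real_derivative 0) (at y)"
          using DERIV_cong_ev[OF refl _ refl, THEN iffD2, of f "\<lambda>x. 0" y 0] by simp
        then show ?thesis using 1 by (simp add: g_def)
      next
        case 3
        have "((\<lambda>y. poly p (1 / y) * exp (- c / y)) has_real_derivative poly q (1 / y) * exp (- c / y)) (at y)"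
          using 3 unfolding q_def
          by (auto intro!: derivative_eq_intros DERIV_chain2[OF poly_DERIV] simp: poly_monom field_simps power2_eq_square)
        moreover have "\<forall>\<^sub>F x in nhds y. f x = poly p (1 / x) * exp (- c / x)"
          using eventually_nhds_in_open[of "{0<..}" y] 3 by (auto elim!: eventually_mono simp: f)
        ultimately have "(f has_real_derivative poly q (1 / y) * exp (- c / y)) (at y)"
          by (rule DERIV_cong_ev[OF refl _ refl, THEN iffD2, rotated])
        then show ?thesis using 3 by (simp add: g_def)
      next
        case 2
        have "((\<lambda>x. (f x - f 0) / (x - 0)) \<longlongrightarrow> 0) (at 0)"
        proof (rule filterlim_split_at)
          have "\<forall>\<^sub>F x in at_left 0. (f x - f 0) / (x - 0) = 0"
            by (auto simp: f eventually_at_filter)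
          then show "((\<lambda>x. (f x - f 0) / (x - 0)) \<longlongrightarrow> 0) (at_left 0)" by (rule tendsto_eventually)
          have "((\<lambda>y. poly (pCons 0 p) y * exp (- c * y)) \<longlongrightarrow> 0) at_top" by (rule poly_exp_tendsto_zero[OF c])
          then have "((\<lambda>x. poly (pCons 0 p) (inverse x) * exp (- c * inverse x)) \<longlongrightarrow> 0) (at_right 0)"
            by (rule filterlim_compose[OF _ filterlim_inverse_at_top_right])
          moreover have "\<forall>\<^sub>F x in at_right 0. poly (pCons 0 p) (inverse x) * exp (- c * inverse x) = (f x - f 0) / (x - 0)"
            by (auto simp: f eventually_at_filter divide_inverse mult_ac)
          ultimately show "((\<lambda>x. (f x - f 0) / (x - 0)) \<longlongrightarrow> 0) (at_right 0)" by (rule Lim_transform_eventually)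
        qed
        then show ?thesis using 2 by (simp add: has_field_derivative_iff g_def)
      qed
    qed
  qed
qed

text \<open>The algebra generated by flat functions of one coordinate is closed under directional derivatives.
  Its members are therefore smooth, without any formula for higher derivatives.\<close>

inductive flat_generated :: "('a::euclidean_space \<Rightarrow> real) \<Rightarrow> bool" where
  const: "flat_generated (\<lambda>x. c)"
| flat: "flat_function f \<Longrightarrow> flat_generated (\<lambda>x. f (s * (x \<bullet> b) + a))"
| add: "flat_generated f \<Longrightarrow> flat_generated g \<Longrightarrow> flat_generated (\<lambda>x. f x + g x)"
| mult: "flat_generated f \<Longrightarrow> flat_generated g \<Longrightarrow> flat_generated (\<lambda>x. f x * g x)"

lemma flat_generated_derivative:
  assumes "flat_generated f"
  shows "(\<forall>x. f differentiable (at x)) \<and> (\<forall>v. flat_generated (dir_deriv v f))"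
  using assms
proof (induction rule: flat_generated.induct)
  case (const c)
  have "dir_deriv v (\<lambda>x. c) = (\<lambda>x::'a. 0)" for v
    by (rule ext) (rule dir_deriv_has_derivative[OF has_derivative_const])
  then show ?case by (simp add: flat_generated.const)
next
  case (flat f s b a)
  obtain g where g: "flat_function g" "\<And>y. (f has_real_derivative g y) (at y)"
    using flat_function_derivative[OF flat] by blast
  have D: "((\<lambda>x. f (s * (x \<bullet> b) + a)) has_derivative (\<lambda>h. g (s * (x \<bullet> b) + a) * (s * (h \<bullet> b)))) (at x)" for x
  proof -
    have "((\<lambda>x. s * (x \<bullet> b) + a) has_derivative (\<lambda>h. s * (h \<bullet> b))) (at x)"
      by (auto intro!: derivative_eq_intros)
    from has_derivative_compose[OF this, of f] g(2)[of "s * (x \<bullet> b) + a"]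
    show ?thesis by (simp add: has_field_derivative_def)
  qed
  have "dir_deriv v (\<lambda>x. f (s * (x \<bullet> b) + a)) = (\<lambda>x. g (s * (x \<bullet> b) + a) * (s * (v \<bullet> b)))" for v
    using dir_deriv_has_derivative[OF D] by (simp add: fun_eq_iff)
  then have "flat_generated (dir_deriv v (\<lambda>x. f (s * (x \<bullet> b) + a)))" for v
    using flat_generated.mult[OF flat_generated.flat[OF g(1)] flat_generated.const] by simp
  moreover have "(\<lambda>x. f (s * (x \<bullet> b) + a)) differentiable (at x)" for x
    using D unfolding differentiable_def by blast
  ultimately show ?case by blast
next
  case (add f g)
  then have "dir_deriv v (\<lambda>x. f x + g x) = (\<lambda>x. dir_deriv v f x + dir_deriv v g x)" for v
    by (simp add: fun_eq_iff dir_deriv_add)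
  then show ?case using add by (auto intro: flat_generated.add differentiable_add)
next
  case (mult f g)
  have "dir_deriv v (\<lambda>x. f x * g x) x = f x * dir_deriv v g x + dir_deriv v f x * g x" for v x
  proof -
    obtain F G where F: "(f has_derivative F) (at x)" and G: "(g has_derivative G) (at x)"
      using mult by (meson differentiable_def)
    show ?thesis
      using dir_deriv_has_derivative[OF has_derivative_mult[OF F G]] dir_deriv_has_derivative[OF F] dir_deriv_has_derivative[OF G]
      by simp
  qed
  then have "dir_deriv v (\<lambda>x. f x * g x) = (\<lambda>x. f x * dir_deriv v g x + dir_deriv v f x * g x)" for v
    by (simp add: fun_eq_iff)
  moreover have "flat_generated (\<lambda>x. f x * dir_deriv v g x + dir_deriv v f x * g x)" for v
    using mult by (intro flat_generated.add[OF flat_generated.mult flat_generated.mult]) blast+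
  ultimately show ?case using mult by (simp add: differentiable_mult)
qed

lemma flat_generated_smooth:
  assumes "flat_generated f" shows "smooth f"
proof -
  have "flat_generated (iter_dir_deriv bs f)" for bs
    by (induction bs) (auto simp: assms flat_generated_derivative)
  then show ?thesis unfolding smooth_def using flat_generated_derivative by blast
qed

text \<open>Smooth functions that increase to the indicator of the positive half-line.\<close>

definition step_bump :: "nat \<Rightarrow> real \<Rightarrow> real" where
  "step_bump n y = (if 0 < y then exp (- (1 / real (Suc n)) / y) else 0)"

lemma step_bump: "flat_function (step_bump n)" "0 \<le> step_bump n y" "step_bump n y \<le> 1"
  and step_bump_lim: "(\<lambda>n. step_bump n y) \<longlonglongrightarrow> (if 0 < y then 1 else 0)"
proof -
  show "flat_function (step_bump n)" unfolding flat_function_def step_bump_def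
    by (rule exI[of _ "1 / real (Suc n)"], rule conjI, simp, rule exI[of _ 1]) (simp add: fun_eq_iff)
  show "0 \<le> step_bump n y" "step_bump n y \<le> 1" by (auto simp: step_bump_def)
  show "(\<lambda>n. step_bump n y) \<longlonglongrightarrow> (if 0 < y then 1 else 0)"
  proof (cases "0 < y")
    case True
    have "(\<lambda>n. exp (- (1 / real (Suc n)) / y)) \<longlonglongrightarrow> exp (- 0 / y)"
      by (intro tendsto_intros LIMSEQ_Suc[OF lim_1_over_n]) (use True in simp)
    then show ?thesis using True by (simp add: step_bump_def)
  qed (simp add: step_bump_def)
qed

definition box_bump :: "'a::euclidean_space \<Rightarrow> 'a \<Rightarrow> nat \<Rightarrow> 'a \<Rightarrow> real" where
  "box_bump a b n x = (\<Prod>i\<in>Basis. step_bump n (x \<bullet> i - a \<bullet> i) * step_bump n (b \<bullet> i - x \<bullet> i))"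

lemma box_bump_bounds: "0 \<le> box_bump a b n x" "box_bump a b n x \<le> indicator (box a b) x"
proof -
  show "0 \<le> box_bump a b n x" unfolding box_bump_def by (intro prod_nonneg) (simp add: step_bump)
  show "box_bump a b n x \<le> indicator (box a b) x"
  proof (cases "x \<in> box a b")
    case True
    have "box_bump a b n x \<le> 1" unfolding box_bump_def
      by (intro prod_le_1) (simp add: step_bump mult_le_one)
    then show ?thesis using True by simp
  next
    case False
    then obtain i where "i \<in> Basis" "x \<bullet> i \<le> a \<bullet> i \<or> b \<bullet> i \<le> x \<bullet> i" by (auto simp: mem_box not_less)
    then have "box_bump a b n x = 0" unfolding box_bump_def
      by (intro prod_zero) (auto simp: step_bump_def intro!: bexI[of _ i])
    then show ?thesis by simp
  qed
qed

lemma box_bump_lim: "(\<lambda>n. box_bump a b n x) \<longlonglongrightarrow> indicator (box a b) x"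
proof -
  have "(\<lambda>n. box_bump a b n x) \<longlonglongrightarrow> (\<Prod>i\<in>Basis. (if 0 < x \<bullet> i - a \<bullet> i then 1 else 0) * (if 0 < b \<bullet> i - x \<bullet> i then 1 else 0))"
    unfolding box_bump_def by (intro tendsto_prod tendsto_mult step_bump_lim)
  also have "(\<Prod>i\<in>Basis. (if 0 < x \<bullet> i - a \<bullet> i then 1 else 0) * (if 0 < b \<bullet> i - x \<bullet> i then 1 else 0)) = (indicator (box a b) x :: real)"
  proof (cases "x \<in> box a b")
    case False
    then obtain i where "i \<in> Basis" "x \<bullet> i \<le> a \<bullet> i \<or> b \<bullet> i \<le> x \<bullet> i" by (auto simp: mem_box not_less)
    then show ?thesis using False by (subst prod_zero) (auto intro!: bexI[of _ i])
  qed (simp add: mem_box)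
  finally show ?thesis .
qed

lemma test_function_box_bump:
  assumes "cbox a b \<subseteq> \<Omega>" shows "test_function \<Omega> (box_bump a b n)"
proof -
  have factor: "flat_generated (\<lambda>x. step_bump n (x \<bullet> i - a \<bullet> i) * step_bump n (b \<bullet> i - x \<bullet> i))" for i
    using flat_generated.mult[OF flat_generated.flat[OF step_bump(1), of n 1 i "- (a \<bullet> i)"] flat_generated.flat[OF step_bump(1), of n "-1" i "b \<bullet> i"]]
    by simp
  have "flat_generated (\<lambda>x. \<Prod>i\<in>I. step_bump n (x \<bullet> i - a \<bullet> i) * step_bump n (b \<bullet> i - x \<bullet> i))" if "finite I" for I
    using that
  proof (induction I rule: finite_induct)
    case (insert i I)
    show ?case unfolding prod.insert[OF insert.hyps]
      by (rule flat_generated.mult[OF factor insert.IH])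
  qed (simp add: flat_generated.const)
  then have "smooth (box_bump a b n)" unfolding box_bump_def[abs_def] by (intro flat_generated_smooth) simp
  moreover have "{x. box_bump a b n x \<noteq> 0} \<subseteq> box a b"
  proof
    fix x assume "x \<in> {x. box_bump a b n x \<noteq> 0}"
    then show "x \<in> box a b" using box_bump_bounds[of a b n x] by (cases "x \<in> box a b") auto
  qed
  then have "closure {x. box_bump a b n x \<noteq> 0} \<subseteq> cbox a b"
    by (meson box_subset_cbox closed_cbox closure_minimal order_trans)
  moreover from this have "compact (closure {x. box_bump a b n x \<noteq> 0})"
    by (meson bounded_cbox bounded_subset compact_eq_bounded_closed closed_closure)
  ultimately show ?thesis using assms unfolding test_function_def by blast
qed

text \<open>The fundamental lemma of the calculus of variations. Bumps converge to indicators of boxes, so,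
  after restriction of \<open>g\<close> to a small box, the measures with its positive and its negative part as
  densities agree on all boxes. Boxes form a generator stable under intersections, hence the densities agree almost everywhere.\<close>

lemma test_functions_determine:
  fixes g :: "'a::euclidean_space \<Rightarrow> real"
  assumes \<Omega>: "open \<Omega>" and g: "sq_integrable g"
    and zero: "\<And>\<phi>. test_function \<Omega> \<phi> \<Longrightarrow> (\<integral>x. \<phi> x * g x \<partial>lborel) = 0"
  shows "AE x in lborel. x \<in> \<Omega> \<longrightarrow> g x = 0"
proof -
  have [measurable]: "g \<in> borel_measurable borel" using sq_integrable_measurable[OF g] by simp
  have int: "integrable lborel (\<lambda>x. indicator (box a b) x * g x)" for a b
  proof -
    have "integrable lborel (\<lambda>x. (indicator (box a b) x :: real))" 
      by (rule integrable_real_indicator) (use emeasure_bounded_finite[OF bounded_box, of a b] in auto)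
    moreover have "(\<lambda>x. (norm (indicator (box a b) x :: real))\<^sup>2) = indicator (box a b)"
      by (auto simp: indicator_def)
    ultimately have "sq_integrable (\<lambda>x. indicator (box a b) x :: real)"
      by (simp add: sq_integrable_def)
    from sq_integrable_inner[OF this g] show ?thesis by simp
  qed
  have box0: "(\<integral>x. indicator (box a b) x * g x \<partial>lborel) = 0" if ab: "cbox a b \<subseteq> \<Omega>" for a b
  proof -
    have "(\<lambda>n. \<integral>x. box_bump a b n x * g x \<partial>lborel) \<longlonglongrightarrow> (\<integral>x. indicator (box a b) x * g x \<partial>lborel)"
    proof (rule integral_dominated_convergence[where w = "\<lambda>x. norm (indicator (box a b) x * g x)"])
      show "integrable lborel (\<lambda>x. norm (indicator (box a b) x * g x))" using int by (rule integrable_norm)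
      show "AE x in lborel. (\<lambda>n. box_bump a b n x * g x) \<longlonglongrightarrow> indicator (box a b) x * g x"
        by (intro AE_I2 tendsto_intros box_bump_lim)
      show "AE x in lborel. norm (box_bump a b n x * g x) \<le> norm (indicator (box a b) x * g x)" for n
        unfolding norm_mult by (intro AE_I2 mult_right_mono) (use box_bump_bounds[of a b n] in auto)
      show "(\<lambda>x. box_bump a b n x * g x) \<in> borel_measurable lborel" for n
        using test_function_box_bump[OF ab, of n] unfolding test_function_def
        by (intro borel_measurable_times) (auto intro!: borel_measurable_continuous_onI smooth_continuous)
    qed measurable
    then show ?thesis by (simp add: zero[OF test_function_box_bump[OF ab]] LIMSEQ_const_iff)
  qed
  have zero_box: "AE x in lborel. x \<in> box a b \<longrightarrow> g x = 0" if ab: "cbox a b \<subseteq> \<Omega>" for a b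
  proof -
    define P where "P \<sigma> x = ennreal (indicator (box a b) x * max 0 (\<sigma> * g x))" for \<sigma> x
    have [measurable]: "P \<sigma> \<in> borel_measurable lborel" for \<sigma> unfolding P_def by measurable
    have Pint: "integrable lborel (\<lambda>x. indicator (box c d) x * (indicator (box a b) x * max 0 (\<sigma> * g x)))" for \<sigma> c d
    proof (rule Bochner_Integration.integrable_bound[OF integrable_mult_right[OF int[of a b], of \<sigma>]])
      show "AE x in lborel. norm (indicator (box c d) x * (indicator (box a b) x * max 0 (\<sigma> * g x))) \<le> norm (\<sigma> * (indicator (box a b) x * g x))"
        by (intro AE_I2) (auto simp: indicator_def)
    qed measurable
    have em: "emeasure (density lborel (P \<sigma>)) (box c d)
        = ennreal (\<integral>x. indicator (box c d) x * (indicator (box a b) x * max 0 (\<sigma> * g x)) \<partial>lborel)" for \<sigma> c d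
    proof -
      have "emeasure (density lborel (P \<sigma>)) (box c d) = (\<integral>\<^sup>+x. P \<sigma> x * indicator (box c d) x \<partial>lborel)"
        by (rule emeasure_density) auto
      also have "\<dots> = (\<integral>\<^sup>+x. ennreal (indicator (box c d) x * (indicator (box a b) x * max 0 (\<sigma> * g x))) \<partial>lborel)"
        by (intro nn_integral_cong) (auto simp: P_def indicator_def)
      also have "\<dots> = ennreal (\<integral>x. indicator (box c d) x * (indicator (box a b) x * max 0 (\<sigma> * g x)) \<partial>lborel)"
        by (rule nn_integral_eq_integral[OF Pint]) (auto simp: indicator_def)
      finally show ?thesis .
    qed
    have eq: "emeasure (density lborel (P 1)) (box c d) = emeasure (density lborel (P (-1))) (box c d)" for c d
    proof -
      define e f where "e = (\<Sum>i\<in>Basis. max (a \<bullet> i) (c \<bullet> i) *\<^sub>R i)" and "f = (\<Sum>i\<in>Basis. min (b \<bullet> i) (d \<bullet> i) *\<^sub>R i)"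
      have ef: "box c d \<inter> box a b = box e f" "cbox e f \<subseteq> cbox a b"
        by (auto simp: e_def f_def mem_box)
      have "(\<integral>x. indicator (box c d) x * (indicator (box a b) x * max 0 (1 * g x)) \<partial>lborel)
          - (\<integral>x. indicator (box c d) x * (indicator (box a b) x * max 0 (-1 * g x)) \<partial>lborel)
          = (\<integral>x. indicator (box c d) x * (indicator (box a b) x * max 0 (1 * g x))
              - indicator (box c d) x * (indicator (box a b) x * max 0 (-1 * g x)) \<partial>lborel)"
        by (rule Bochner_Integration.integral_diff[OF Pint Pint, symmetric])
      also have "\<dots> = (\<integral>x. indicator (box e f) x * g x \<partial>lborel)"
        unfolding ef(1)[symmetric] by (rule Bochner_Integration.integral_cong) (auto simp: indicator_def)
      also have "\<dots> = 0" using box0[of e f] ef(2) ab by blast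
      finally show ?thesis unfolding em by simp
    qed
    have "density lborel (P 1) = density lborel (P (-1))"
    proof (rule measure_eqI_generator_eq[where E = "range (\<lambda>(a, b). box a b)" and \<Omega> = UNIV
          and A = "\<lambda>n. box (- (real n *\<^sub>R One)) (real n *\<^sub>R One)"])
      show "Int_stable (range (\<lambda>(a, b). box a b :: 'a set))"
      proof (rule Int_stableI, clarify)
        fix c d a b :: 'a
        define e f where "e = (\<Sum>i\<in>Basis. max (a \<bullet> i) (c \<bullet> i) *\<^sub>R i)" and "f = (\<Sum>i\<in>Basis. min (b \<bullet> i) (d \<bullet> i) *\<^sub>R i)"
        have "box c d \<inter> box a b = box e f" by (auto simp: e_def f_def mem_box)
        then show "box c d \<inter> box a b \<in> range (\<lambda>(a, b). box a b)" by auto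
      qed
      show "sets (density lborel (P 1)) = sigma_sets UNIV (range (\<lambda>(a, b). box a b))"
        "sets (density lborel (P (-1))) = sigma_sets UNIV (range (\<lambda>(a, b). box a b))"
        by (simp_all add: borel_eq_box)
      show "(\<Union>n. box (- (real n *\<^sub>R One)) (real n *\<^sub>R One)) = (UNIV :: 'a set)" by (rule UN_box_eq_UNIV)
      show "emeasure (density lborel (P 1)) X = emeasure (density lborel (P (-1))) X" if "X \<in> range (\<lambda>(a, b). box a b)" for X
        using that eq by auto
      show "emeasure (density lborel (P 1)) (box (- (real n *\<^sub>R One)) (real n *\<^sub>R One)) \<noteq> \<infinity>" for n
        by (simp add: em)
    qed auto
    then have "AE x in lborel. P 1 x = P (-1) x"
      using sigma_finite_measure.density_unique_iff[OF sigma_finite_lborel, of "P 1" "P (-1)"] by simp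
    then show ?thesis
      by eventually_elim (auto simp: P_def max_def ennreal_eq_0_iff split: if_splits)
  qed
  define F where "F = {box a b | a b. cbox a b \<subseteq> \<Omega>}"
  obtain F' where F': "F' \<subseteq> F" "countable F'" "\<Union>F' = \<Union>F"
    using Lindelof[of F] by (auto simp: F_def open_box)
  have cover: "\<Omega> \<subseteq> \<Union>F"
  proof
    fix x assume "x \<in> \<Omega>"
    then obtain a b where "x \<in> box a b" "cbox a b \<subseteq> \<Omega>" using open_contains_cbox[of \<Omega> x] \<Omega>
      by (meson \<Omega> open_contains_cbox)
    then show "x \<in> \<Union>F" by (auto simp: F_def)
  qed
  have "AE x in lborel. \<forall>B\<in>F'. x \<in> B \<longrightarrow> g x = 0"
    using F' zero_box by (subst AE_ball_countable) (auto simp: F_def)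
  then show ?thesis by eventually_elim (use cover F' in blast)
qed

section \<open>Sobolev spaces\<close>

lemma compact_image_bounded:
  assumes "compact K" "continuous_on K g" shows "\<exists>B. \<forall>x\<in>K. norm (g x) \<le> B"
  using compact_imp_bounded[OF compact_continuous_image[OF assms(2,1)]] unfolding bounded_iff by blast

lemma sq_integrable_compact_support:
  fixes g :: "'a::euclidean_space \<Rightarrow> 'b::euclidean_space"
  assumes g: "continuous_on UNIV g" and K: "compact K" "{x. g x \<noteq> 0} \<subseteq> K"
  shows "sq_integrable g"
proof -
  obtain B where B: "\<And>x. x \<in> K \<Longrightarrow> norm (g x) \<le> B"
    using compact_image_bounded[OF K(1) continuous_on_subset[OF g subset_UNIV]] by blast
  have "K \<in> sets borel" by (rule borel_compact[OF K(1)])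
  then have iB: "integrable lborel (\<lambda>x. B\<^sup>2 * indicator K x)"
    using emeasure_bounded_finite[OF compact_imp_bounded[OF K(1)]]
    by (intro integrable_mult_right integrable_real_indicator) auto
  have m [measurable]: "g \<in> borel_measurable borel" by (rule borel_measurable_continuous_onI[OF g])
  have le: "norm ((norm (g x))\<^sup>2) \<le> norm (B\<^sup>2 * indicator K x :: real)" for x
  proof (cases "x \<in> K")
    case True
    then show ?thesis using power_mono[OF B[OF True] norm_ge_zero, of 2] by simp
  next
    case False
    then have "g x = 0" using K(2) by blast
    then show ?thesis by simp
  qed
  have "integrable lborel (\<lambda>x. (norm (g x))\<^sup>2)"
    by (rule Bochner_Integration.integrable_bound[OF iB _ AE_I2[OF le]]) measurable
  then show ?thesis by (simp add: sq_integrable_def)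
qed

lemma dir_deriv_outside:
  assumes K: "closed K" "{x. f x \<noteq> 0} \<subseteq> K" and x: "x \<notin> K"
  shows "dir_deriv b f x = 0"
proof -
  have "((\<lambda>x. 0) has_derivative (\<lambda>h. 0)) (at x)" by simp
  moreover have "open (- K)" "x \<in> - K" using K x by auto
  ultimately have "(f has_derivative (\<lambda>h. 0)) (at x)"
    by (rule has_derivative_transform_within_open) (use K in auto)
  then show ?thesis by (rule dir_deriv_has_derivative)
qed

lemma test_function_sq_integrable:
  "test_function \<Omega> \<phi> \<Longrightarrow> sq_integrable (\<phi> :: 'a::euclidean_space \<Rightarrow> 'b::euclidean_space)"
  unfolding test_function_def
  by (rule sq_integrable_compact_support[OF smooth_continuous _ closure_subset]) auto

lemma test_function_dir_deriv:
  assumes \<phi>: "test_function \<Omega> \<phi>" and b: "b \<in> Basis" shows "test_function \<Omega> (dir_deriv b \<phi>)"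
proof -
  have "{x. dir_deriv b \<phi> x \<noteq> 0} \<subseteq> closure {x. \<phi> x \<noteq> 0}"
    using dir_deriv_outside[OF closed_closure closure_subset] by blast
  then have sub: "closure {x. dir_deriv b \<phi> x \<noteq> 0} \<subseteq> closure {x. \<phi> x \<noteq> 0}"
    by (rule closure_minimal) simp
  then have "compact (closure {x. dir_deriv b \<phi> x \<noteq> 0})"
    using \<phi> unfolding test_function_def
    by (meson bounded_subset closed_closure compact_eq_bounded_closed)
  then show ?thesis using \<phi> sub smooth_dir_deriv[OF _ b] unfolding test_function_def by blast
qed

lemma test_function_bounded_linear:
  assumes L: "bounded_linear L" and \<phi>: "test_function \<Omega> \<phi>" shows "test_function \<Omega> (\<lambda>x. L (\<phi> x))"
proof -
  interpret L: bounded_linear L by fact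
  have sub: "closure {x. L (\<phi> x) \<noteq> 0} \<subseteq> closure {x. \<phi> x \<noteq> 0}"
    by (rule closure_mono) (auto simp: L.zero)
  then have "compact (closure {x. L (\<phi> x) \<noteq> 0})"
    using \<phi> unfolding test_function_def
    by (meson bounded_subset closed_closure compact_eq_bounded_closed)
  then show ?thesis using \<phi> sub smooth_bounded_linear[OF L] unfolding test_function_def by blast
qed

lemma test_function_add:
  assumes "test_function \<Omega> \<phi>" "test_function \<Omega> \<psi>" shows "test_function \<Omega> (\<lambda>x. \<phi> x + \<psi> x)"
proof -
  have sub: "closure {x. \<phi> x + \<psi> x \<noteq> 0} \<subseteq> closure {x. \<phi> x \<noteq> 0} \<union> closure {x. \<psi> x \<noteq> 0}"
    unfolding closure_Un[symmetric] by (rule closure_mono) auto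
  moreover have "compact (closure {x. \<phi> x \<noteq> 0} \<union> closure {x. \<psi> x \<noteq> 0})"
    using assms unfolding test_function_def by (intro compact_Un) auto
  ultimately have "compact (closure {x. \<phi> x + \<psi> x \<noteq> 0})"
    by (meson bounded_subset closed_closure compact_eq_bounded_closed)
  then show ?thesis using assms sub smooth_add unfolding test_function_def by blast
qed

lemma test_function_zero: "test_function \<Omega> (\<lambda>x. 0)"
proof -
  have "smooth (\<lambda>x::'a. 0 :: real)" by (rule flat_generated_smooth[OF flat_generated.const])
  from smooth_bounded_linear[OF bounded_linear_zero this] show ?thesis by (simp add: test_function_def)
qed

lemma axis_Basis: "axis i (1::real) \<in> Basis"
  by (simp add: axis_in_Basis_iff)

lemma classical_grad_add:
  fixes \<phi> \<psi> :: "real^'n \<Rightarrow> 'b::euclidean_space"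
  assumes "test_function \<Omega> \<phi>" "test_function \<Omega> \<psi>"
  shows "classical_grad (\<lambda>x. \<phi> x + \<psi> x) = (\<lambda>x. classical_grad \<phi> x + classical_grad \<psi> x)"
proof -
  have "smooth \<phi>" "smooth \<psi>" using assms unfolding test_function_def by blast+
  then show ?thesis
    by (intro ext) (simp add: classical_grad_def vec_eq_iff dir_deriv_add[OF smooth_differentiable smooth_differentiable])
qed

lemma classical_grad_sq_integrable:
  fixes \<phi> :: "real^'n \<Rightarrow> 'b::euclidean_space"
  assumes \<phi>: "test_function \<Omega> \<phi>" shows "sq_integrable (classical_grad \<phi>)"
proof (rule sq_integrable_compact_support)
  have "smooth (dir_deriv (axis i 1) \<phi>)" for i :: 'n
    using \<phi> smooth_dir_deriv[OF _ axis_Basis] unfolding test_function_def by blast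
  then show "continuous_on UNIV (classical_grad \<phi>)"
    unfolding classical_grad_def[abs_def] by (intro continuous_on_vec_lambda smooth_continuous)
  show "compact (closure {x. \<phi> x \<noteq> 0})" using \<phi> unfolding test_function_def by blast
  show "{x. classical_grad \<phi> x \<noteq> 0} \<subseteq> closure {x. \<phi> x \<noteq> 0}"
    using dir_deriv_outside[OF closed_closure closure_subset, of _ \<phi>]
    by (auto simp: classical_grad_def vec_eq_iff)
qed

lemma inner_abs_L2_right:
  assumes "sq_integrable f" shows "v \<bullet> abs_L2 f = (\<integral>x. rep_L2 v x \<bullet> f x \<partial>lborel)"
  using inner_abs_L2[OF sq_integrable_rep_L2 assms, of v] by (simp add: abs_rep_L2)

lemma integrable_scaleR_sq_integrable:
  fixes f :: "'a::euclidean_space \<Rightarrow> 'b::euclidean_space"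
  assumes \<psi>: "sq_integrable (\<psi> :: 'a \<Rightarrow> real)" and f: "sq_integrable f"
  shows "integrable lborel (\<lambda>x. \<psi> x *\<^sub>R f x)"
proof -
  have [measurable]: "\<psi> \<in> borel_measurable lborel" "f \<in> borel_measurable lborel"
    using \<psi> f by (auto simp: sq_integrable_def)
  have "integrable lborel (\<lambda>x. norm (\<psi> x) \<bullet> norm (f x))"
    by (rule sq_integrable_inner) (use \<psi> f in \<open>auto simp: sq_integrable_def\<close>)
  then show ?thesis by (rule Bochner_Integration.integrable_bound) auto
qed

lemma sq_integrable_scaleR_const:
  assumes "sq_integrable (\<psi> :: 'a::euclidean_space \<Rightarrow> real)"
  shows "sq_integrable (\<lambda>x. \<psi> x *\<^sub>R (e :: 'b::euclidean_space))"
  using assms by (auto simp: sq_integrable_def power_mult_distrib)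

text \<open>This and the next two lemmas express the conditions that define weak gradients by inner products
  in \<open>L\<^sup>2\<close>, which depend continuously on the class.\<close>

lemma integral_scaleR_rep_inner:
  fixes v :: "('a::euclidean_space, 'b::euclidean_space) L2"
  assumes \<psi>: "sq_integrable (\<psi> :: 'a \<Rightarrow> real)"
  shows "(\<integral>x. \<psi> x *\<^sub>R rep_L2 v x \<partial>lborel) \<bullet> e = v \<bullet> abs_L2 (\<lambda>x. \<psi> x *\<^sub>R e)"
proof -
  have "(\<integral>x. \<psi> x *\<^sub>R rep_L2 v x \<partial>lborel) \<bullet> e = (\<integral>x. (\<psi> x *\<^sub>R rep_L2 v x) \<bullet> e \<partial>lborel)"
    by (rule integral_inner_left[symmetric]) (rule integrable_scaleR_sq_integrable[OF \<psi> sq_integrable_rep_L2])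
  also have "\<dots> = v \<bullet> abs_L2 (\<lambda>x. \<psi> x *\<^sub>R e)"
    by (simp add: inner_abs_L2_right sq_integrable_scaleR_const[OF \<psi>])
  finally show ?thesis .
qed

lemma weak_gradient_iff:
  fixes v :: "(real^'n, 'b::euclidean_space) L2"
  shows "weak_gradient \<Omega> v G \<longleftrightarrow> v \<in> L2_on \<Omega> \<and> G \<in> L2_on \<Omega> \<and>
    (\<forall>\<phi> :: real^'n \<Rightarrow> real. test_function \<Omega> \<phi> \<longrightarrow> (\<forall>i e.
      v \<bullet> abs_L2 (\<lambda>x. dir_deriv (axis i 1) \<phi> x *\<^sub>R e) = - (G \<bullet> abs_L2 (\<lambda>x. \<phi> x *\<^sub>R axis i e))))"
proof -
  have "((\<integral>x. dir_deriv (axis i 1) \<phi> x *\<^sub>R rep_L2 v x \<partial>lborel) = - (\<integral>x. \<phi> x *\<^sub>R (rep_L2 G x $ i) \<partial>lborel))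
     \<longleftrightarrow> (\<forall>e. v \<bullet> abs_L2 (\<lambda>x. dir_deriv (axis i 1) \<phi> x *\<^sub>R e) = - (G \<bullet> abs_L2 (\<lambda>x. \<phi> x *\<^sub>R axis i e)))"
    if \<phi>: "test_function \<Omega> \<phi>" for \<phi> :: "real^'n \<Rightarrow> real" and i
  proof -
    note sq = test_function_sq_integrable[OF \<phi>] and sq' = test_function_sq_integrable[OF test_function_dir_deriv[OF \<phi> axis_Basis[of i]]]
    have "(\<integral>x. \<phi> x *\<^sub>R (rep_L2 G x $ i) \<partial>lborel) \<bullet> e = G \<bullet> abs_L2 (\<lambda>x. \<phi> x *\<^sub>R axis i e)" for e
    proof -
      have "(\<integral>x. \<phi> x *\<^sub>R (rep_L2 G x $ i) \<partial>lborel) = (\<integral>x. (\<phi> x *\<^sub>R rep_L2 G x) $ i \<partial>lborel)" by simp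
      also have "\<dots> = (\<integral>x. \<phi> x *\<^sub>R rep_L2 G x \<partial>lborel) $ i"
        by (rule integral_bounded_linear[OF bounded_linear_vec_nth])
          (rule integrable_scaleR_sq_integrable[OF sq sq_integrable_rep_L2])
      also have "\<dots> \<bullet> e = (\<integral>x. \<phi> x *\<^sub>R rep_L2 G x \<partial>lborel) \<bullet> axis i e" by (simp add: inner_axis)
      finally show ?thesis by (simp add: integral_scaleR_rep_inner[OF sq])
    qed
    then show ?thesis
      by (simp add: vector_eq_rdot[symmetric, of _ "- (\<integral>x. \<phi> x *\<^sub>R (rep_L2 G x $ i) \<partial>lborel)"] integral_scaleR_rep_inner[OF sq'])
  qed
  then show ?thesis unfolding weak_gradient_def by blast
qed

lemma L2_on_iff:
  fixes v :: "('a::euclidean_space, 'b::euclidean_space) L2"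
  assumes \<Omega>: "open \<Omega>"
  shows "v \<in> L2_on \<Omega> \<longleftrightarrow> (\<forall>w. v \<bullet> abs_L2 (\<lambda>x. indicat_real (- \<Omega>) x *\<^sub>R rep_L2 w x) = 0)"
proof -
  have [measurable]: "- \<Omega> \<in> sets borel" using \<Omega> by (simp add: borel_closed)
  have [measurable]: "rep_L2 w \<in> borel_measurable borel" for w :: "('a, 'b) L2"
    using sq_integrable_measurable[OF sq_integrable_rep_L2, of w] by simp
  have sq: "sq_integrable (\<lambda>x. indicat_real (- \<Omega>) x *\<^sub>R rep_L2 w x)" for w :: "('a, 'b) L2"
  proof -
    have le: "norm ((norm (indicat_real (- \<Omega>) x *\<^sub>R rep_L2 w x))\<^sup>2) \<le> norm ((norm (rep_L2 w x))\<^sup>2)" for x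
      by (simp add: indicator_def)
    have "integrable lborel (\<lambda>x. (norm (rep_L2 w x))\<^sup>2)" using sq_integrable_rep_L2[of w] by (simp add: sq_integrable_def)
    then have "integrable lborel (\<lambda>x. (norm (indicat_real (- \<Omega>) x *\<^sub>R rep_L2 w x))\<^sup>2)"
      by (rule Bochner_Integration.integrable_bound[OF _ _ AE_I2[OF le]]) measurable
    moreover have "(\<lambda>x. indicat_real (- \<Omega>) x *\<^sub>R rep_L2 w x) \<in> borel_measurable lborel" by measurable
    ultimately show ?thesis unfolding sq_integrable_def by (rule conjI[rotated])
  qed
  show ?thesis
  proof
    assume v: "v \<in> L2_on \<Omega>"
    show "\<forall>w. v \<bullet> abs_L2 (\<lambda>x. indicat_real (- \<Omega>) x *\<^sub>R rep_L2 w x) = 0"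
    proof
      fix w :: "('a, 'b) L2"
      have "AE x in lborel. rep_L2 v x \<bullet> (indicat_real (- \<Omega>) x *\<^sub>R rep_L2 w x) = 0"
        using v unfolding L2_on_def mem_Collect_eq by eventually_elim (auto simp: indicator_def)
      then show "v \<bullet> abs_L2 (\<lambda>x. indicat_real (- \<Omega>) x *\<^sub>R rep_L2 w x) = 0"
        unfolding inner_abs_L2_right[OF sq] by (rule integral_eq_zero_AE)
    qed
  next
    assume "\<forall>w. v \<bullet> abs_L2 (\<lambda>x. indicat_real (- \<Omega>) x *\<^sub>R rep_L2 w x) = 0"
    then have "(\<integral>x. rep_L2 v x \<bullet> (indicat_real (- \<Omega>) x *\<^sub>R rep_L2 v x) \<partial>lborel) = 0"
      unfolding inner_abs_L2_right[OF sq] by blast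
    moreover have "integrable lborel (\<lambda>x. rep_L2 v x \<bullet> (indicat_real (- \<Omega>) x *\<^sub>R rep_L2 v x))"
      by (rule sq_integrable_inner[OF sq_integrable_rep_L2 sq])
    ultimately have "AE x in lborel. rep_L2 v x \<bullet> (indicat_real (- \<Omega>) x *\<^sub>R rep_L2 v x) = 0"
      by (subst (asm) integral_nonneg_eq_0_iff_AE) auto
    then show "v \<in> L2_on \<Omega>" unfolding L2_on_def mem_Collect_eq
      by eventually_elim (auto simp: indicator_def)
  qed
qed

definition weak_gradient_graph ::
  "(real^'n) set \<Rightarrow> ((real^'n, 'b::euclidean_space) L2 \<times> (real^'n, 'b^'n) L2) set" where
  "weak_gradient_graph \<Omega> = {p. weak_gradient \<Omega> (fst p) (snd p)}"

definition test_graph ::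
  "(real^'n) set \<Rightarrow> ((real^'n, 'b::euclidean_space) L2 \<times> (real^'n, 'b^'n) L2) set" where
  "test_graph \<Omega> = {(abs_L2 \<phi>, abs_L2 (classical_grad \<phi>)) | \<phi>. test_function \<Omega> \<phi>}"

text \<open>The graph is an intersection of kernels of continuous linear functionals.\<close>

lemma weak_gradient_graph:
  fixes \<Omega> :: "(real^'n) set"
  assumes \<Omega>: "open \<Omega>"
  shows "closed (weak_gradient_graph \<Omega> :: ((real^'n, 'b::euclidean_space) L2 \<times> (real^'n, 'b^'n) L2) set)"
    "subspace (weak_gradient_graph \<Omega> :: ((real^'n, 'b) L2 \<times> (real^'n, 'b^'n) L2) set)"
proof -
  define A where "A w = {p :: (real^'n, 'b) L2 \<times> (real^'n, 'b^'n) L2. fst p \<bullet> abs_L2 (\<lambda>x. indicat_real (- \<Omega>) x *\<^sub>R rep_L2 w x) = 0}" for w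
  define B where "B w = {p :: (real^'n, 'b) L2 \<times> (real^'n, 'b^'n) L2. snd p \<bullet> abs_L2 (\<lambda>x. indicat_real (- \<Omega>) x *\<^sub>R rep_L2 w x) = 0}" for w
  define C where "C \<phi> i e = {p :: (real^'n, 'b) L2 \<times> (real^'n, 'b^'n) L2.
      fst p \<bullet> abs_L2 (\<lambda>x. dir_deriv (axis i 1) \<phi> x *\<^sub>R e) + snd p \<bullet> abs_L2 (\<lambda>x. \<phi> x *\<^sub>R axis i e) = 0}" for \<phi> :: "real^'n \<Rightarrow> real" and i e
  have eq: "weak_gradient_graph \<Omega> = (\<Inter>w. A w) \<inter> ((\<Inter>w. B w) \<inter> (\<Inter>\<phi>\<in>{\<phi>. test_function \<Omega> \<phi>}. \<Inter>i. \<Inter>e. C \<phi> i e))"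
    unfolding weak_gradient_graph_def weak_gradient_iff L2_on_iff[OF \<Omega>] A_def B_def C_def eq_neg_iff_add_eq_0
    by (intro set_eqI) (simp only: mem_Collect_eq Int_iff INT_iff UNIV_I simp_thms Ball_def)
  have "closed (A w)" "closed (B w')" "closed (C \<phi> i e)" for w w' \<phi> i e
    unfolding A_def B_def C_def by (intro closed_Collect_eq continuous_intros)+
  then show "closed (weak_gradient_graph \<Omega> :: ((real^'n, 'b) L2 \<times> (real^'n, 'b^'n) L2) set)"
    unfolding eq by (intro closed_Int closed_INT ballI)
  have "subspace (A w)" "subspace (B w')" "subspace (C \<phi> i e)" for w w' \<phi> i e
    unfolding A_def B_def C_def subspace_def by (auto simp: inner_add_left algebra_simps simp flip: distrib_left)
  then show "subspace (weak_gradient_graph \<Omega> :: ((real^'n, 'b) L2 \<times> (real^'n, 'b^'n) L2) set)"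
    unfolding eq by (intro subspace_inter subspace_Int)
qed

lemma subspace_test_graph:
  fixes \<Omega> :: "(real^'n) set"
  shows "subspace (test_graph \<Omega> :: ((real^'n, 'b::euclidean_space) L2 \<times> (real^'n, 'b^'n) L2) set)"
  unfolding subspace_def
proof (intro conjI ballI allI)
  have "dir_deriv b (\<lambda>x. 0 :: 'b) x = 0" for b x :: "real^'n"
    by (rule dir_deriv_has_derivative[where F = "\<lambda>x. 0"]) simp
  then have "classical_grad (\<lambda>x::real^'n. 0 :: 'b) = (\<lambda>x. 0)"
    by (simp add: classical_grad_def fun_eq_iff vec_eq_iff)
  then show "(0 :: (real^'n, 'b) L2 \<times> (real^'n, 'b^'n) L2) \<in> test_graph \<Omega>" using test_function_zero
    unfolding test_graph_def by (auto simp: zero_prod_def abs_L2_zero intro!: exI[of _ "\<lambda>x. 0"])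
next
  fix p q :: "(real^'n, 'b) L2 \<times> (real^'n, 'b^'n) L2" assume "p \<in> test_graph \<Omega>" "q \<in> test_graph \<Omega>"
  then obtain \<phi> \<psi> where \<phi>: "test_function \<Omega> \<phi>" "p = (abs_L2 \<phi>, abs_L2 (classical_grad \<phi>))"
    and \<psi>: "test_function \<Omega> \<psi>" "q = (abs_L2 \<psi>, abs_L2 (classical_grad \<psi>))" by (auto simp: test_graph_def)
  have "p + q = (abs_L2 (\<lambda>x. \<phi> x + \<psi> x), abs_L2 (classical_grad (\<lambda>x. \<phi> x + \<psi> x)))"
    by (simp add: \<phi> \<psi> classical_grad_add[OF \<phi>(1) \<psi>(1)] abs_L2_add test_function_sq_integrable[OF \<phi>(1)]
        test_function_sq_integrable[OF \<psi>(1)] classical_grad_sq_integrable[OF \<phi>(1)] classical_grad_sq_integrable[OF \<psi>(1)])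
  then show "p + q \<in> test_graph \<Omega>" using test_function_add[OF \<phi>(1) \<psi>(1)] by (auto simp: test_graph_def)
next
  fix c and p :: "(real^'n, 'b) L2 \<times> (real^'n, 'b^'n) L2" assume "p \<in> test_graph \<Omega>"
  then obtain \<phi> where \<phi>: "test_function \<Omega> \<phi>" "p = (abs_L2 \<phi>, abs_L2 (classical_grad \<phi>))"
    by (auto simp: test_graph_def)
  have "classical_grad (\<lambda>x. c *\<^sub>R \<phi> x) = (\<lambda>x. c *\<^sub>R classical_grad \<phi> x)"
  proof -
    have "smooth \<phi>" using \<phi>(1) unfolding test_function_def by blast
    then show ?thesis
      by (intro ext) (simp add: classical_grad_def vec_eq_iff
          dir_deriv_bounded_linear[OF bounded_linear_scaleR_right smooth_differentiable])
  qed
  then have "c *\<^sub>R p = (abs_L2 (\<lambda>x. c *\<^sub>R \<phi> x), abs_L2 (classical_grad (\<lambda>x. c *\<^sub>R \<phi> x)))"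
    by (simp add: \<phi> abs_L2_scaleR test_function_sq_integrable[OF \<phi>(1)] classical_grad_sq_integrable[OF \<phi>(1)])
  then show "c *\<^sub>R p \<in> test_graph \<Omega>"
    using test_function_bounded_linear[OF bounded_linear_scaleR_right \<phi>(1)] by (auto simp: test_graph_def)
qed

text \<open>The difference of two gradients annihilates all test functions on \<open>\<Omega>\<close> and vanishes outside.\<close>

lemma weak_gradient_unique:
  fixes v :: "(real^'n, 'b::euclidean_space) L2"
  assumes \<Omega>: "open \<Omega>" and "weak_gradient \<Omega> v G" "weak_gradient \<Omega> v G'"
  shows "G = G'"
proof -
  define K where "K = G - G'"
  have "(v, G) - (v, G') \<in> weak_gradient_graph \<Omega>"
    by (rule subspace_diff[OF weak_gradient_graph(2)[OF \<Omega>]]) (use assms in \<open>simp_all add: weak_gradient_graph_def\<close>)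
  then have K: "weak_gradient \<Omega> (0 :: (real^'n, 'b) L2) K" by (simp add: weak_gradient_graph_def K_def)
  have "AE x in lborel. x \<in> \<Omega> \<longrightarrow> rep_L2 K x \<bullet> axis i e = 0" for i e
  proof (rule test_functions_determine[OF \<Omega>])
    show "sq_integrable (\<lambda>x. rep_L2 K x \<bullet> axis i e)"
    proof -
      have [measurable]: "rep_L2 K \<in> borel_measurable lborel" by (rule sq_integrable_measurable[OF sq_integrable_rep_L2])
      have "integrable lborel (\<lambda>x. (norm (rep_L2 K x))\<^sup>2 * (norm (axis i e))\<^sup>2)"
        using sq_integrable_rep_L2[of K] by (simp add: sq_integrable_def)
      then have "integrable lborel (\<lambda>x. (norm (rep_L2 K x \<bullet> axis i e))\<^sup>2)"
      proof (rule Bochner_Integration.integrable_bound)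
        show "AE x in lborel. norm ((norm (rep_L2 K x \<bullet> axis i e))\<^sup>2) \<le> norm ((norm (rep_L2 K x))\<^sup>2 * (norm (axis i e))\<^sup>2)"
        proof (rule AE_I2)
          fix x
          show "norm ((norm (rep_L2 K x \<bullet> axis i e))\<^sup>2) \<le> norm ((norm (rep_L2 K x))\<^sup>2 * (norm (axis i e))\<^sup>2)"
            using power_mono[OF Cauchy_Schwarz_ineq2[of "rep_L2 K x" "axis i e"] abs_ge_zero, of 2]
            by (simp add: power_mult_distrib)
        qed
      qed measurable
      then show ?thesis by (simp add: sq_integrable_def)
    qed
    fix \<phi> :: "real^'n \<Rightarrow> real" assume \<phi>: "test_function \<Omega> \<phi>"
    have "K \<bullet> abs_L2 (\<lambda>x. \<phi> x *\<^sub>R axis i e) = 0" using K \<phi> unfolding weak_gradient_iff by auto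
    then show "(\<integral>x. \<phi> x * (rep_L2 K x \<bullet> axis i e) \<partial>lborel) = 0"
      by (simp add: inner_abs_L2_right sq_integrable_scaleR_const[OF test_function_sq_integrable[OF \<phi>]])
  qed
  then have "AE x in lborel. \<forall>b\<in>Basis. x \<in> \<Omega> \<longrightarrow> rep_L2 K x \<bullet> b = 0"
    by (subst AE_ball_countable) (auto simp: countable_finite Basis_vec_def)
  moreover have "AE x in lborel. x \<notin> \<Omega> \<longrightarrow> rep_L2 K x = 0"
    using K unfolding weak_gradient_def L2_on_def by blast
  ultimately have "AE x in lborel. rep_L2 K x = 0"
    by eventually_elim (metis euclidean_all_zero_iff)
  then have "K = 0"
    using abs_L2_eq_iff[OF sq_integrable_rep_L2 sq_integrable_zero, of K] by (simp add: abs_rep_L2 abs_L2_zero)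
  then show ?thesis by (simp add: K_def)
qed

lemma grad_eq: "open \<Omega> \<Longrightarrow> weak_gradient \<Omega> v G \<Longrightarrow> grad \<Omega> v = G"
  unfolding grad_def by (rule the_equality) (auto intro: weak_gradient_unique)

text \<open>The graph of the gradient on \<open>H\<^sup>1\<^sub>0(\<Omega>)\<close> is an intersection of two closed subspaces. Linearity of the
  gradient and closedness of its graph can be read off.\<close>

lemma H10_graph:
  fixes \<Omega> :: "(real^'n) set"
  assumes \<Omega>: "open \<Omega>"
  shows "(\<lambda>v :: (real^'n, 'b::euclidean_space) L2. (v, grad \<Omega> v)) ` H10 \<Omega> = weak_gradient_graph \<Omega> \<inter> closure (test_graph \<Omega>)"
proof -
  have cl: "(v, G) \<in> closure (test_graph \<Omega>) \<longleftrightarrow> (\<forall>\<epsilon>>0. \<exists>\<phi>. test_function \<Omega> \<phi> \<and>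
     norm (v - abs_L2 \<phi>) < \<epsilon> \<and> norm (G - abs_L2 (classical_grad \<phi>)) < \<epsilon>)" for v :: "(real^'n, 'b) L2" and G
  proof
    assume c: "(v, G) \<in> closure (test_graph \<Omega>)"
    show "\<forall>\<epsilon>>0. \<exists>\<phi>. test_function \<Omega> \<phi> \<and> norm (v - abs_L2 \<phi>) < \<epsilon> \<and> norm (G - abs_L2 (classical_grad \<phi>)) < \<epsilon>"
    proof (intro allI impI)
      fix \<epsilon> :: real assume "0 < \<epsilon>"
      then obtain p where p: "p \<in> test_graph \<Omega>" "dist p (v, G) < \<epsilon>" using c unfolding closure_approachable by blast
      then obtain \<phi> where \<phi>: "test_function \<Omega> \<phi>" "p = (abs_L2 \<phi>, abs_L2 (classical_grad \<phi>))" by (auto simp: test_graph_def)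
      have "dist (fst p) v \<le> dist p (v, G)" "dist (snd p) G \<le> dist p (v, G)"
        using dist_fst_le[of p "(v, G)"] dist_snd_le[of p "(v, G)"] by simp_all
      then show "\<exists>\<phi>. test_function \<Omega> \<phi> \<and> norm (v - abs_L2 \<phi>) < \<epsilon> \<and> norm (G - abs_L2 (classical_grad \<phi>)) < \<epsilon>"
        using \<phi> p(2) by (intro exI[of _ \<phi>]) (auto simp: dist_norm norm_minus_commute)
    qed
  next
    assume r: "\<forall>\<epsilon>>0. \<exists>\<phi>. test_function \<Omega> \<phi> \<and> norm (v - abs_L2 \<phi>) < \<epsilon> \<and> norm (G - abs_L2 (classical_grad \<phi>)) < \<epsilon>"
    show "(v, G) \<in> closure (test_graph \<Omega>)" unfolding closure_approachable
    proof (intro allI impI)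
      fix \<epsilon> :: real assume "0 < \<epsilon>"
      then obtain \<phi> where \<phi>: "test_function \<Omega> \<phi>" "norm (v - abs_L2 \<phi>) < \<epsilon> / 2" "norm (G - abs_L2 (classical_grad \<phi>)) < \<epsilon> / 2"
        using r half_gt_zero by blast
      have "dist (abs_L2 \<phi>, abs_L2 (classical_grad \<phi>)) (v, G) \<le> dist (abs_L2 \<phi>) v + dist (abs_L2 (classical_grad \<phi>)) G"
        unfolding dist_Pair_Pair by (rule sqrt_sum_squares_le_sum) auto
      also have "\<dots> < \<epsilon>" using \<phi>(2,3) by (simp add: dist_norm norm_minus_commute)
      finally show "\<exists>y\<in>test_graph \<Omega>. dist y (v, G) < \<epsilon>" using \<phi>(1) by (auto simp: test_graph_def)
    qed
  qed
  have "v \<in> H10 \<Omega> \<and> G = grad \<Omega> v \<longleftrightarrow> weak_gradient \<Omega> v G \<and> (v, G) \<in> closure (test_graph \<Omega>)"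
    for v :: "(real^'n, 'b) L2" and G
    unfolding cl H10_def H1_def mem_Collect_eq using grad_eq[OF \<Omega>] by metis
  then have "p \<in> (\<lambda>v. (v, grad \<Omega> v)) ` H10 \<Omega> \<longleftrightarrow> p \<in> weak_gradient_graph \<Omega> \<inter> closure (test_graph \<Omega>)"
    for p :: "(real^'n, 'b) L2 \<times> (real^'n, 'b^'n) L2"
  proof -
    obtain v G where p: "p = (v, G)" by (cases p)
    have "p \<in> (\<lambda>v. (v, grad \<Omega> v)) ` H10 \<Omega> \<longleftrightarrow> v \<in> H10 \<Omega> \<and> G = grad \<Omega> v" unfolding p by auto
    also have "\<dots> \<longleftrightarrow> weak_gradient \<Omega> v G \<and> (v, G) \<in> closure (test_graph \<Omega>)" by fact
    also have "\<dots> \<longleftrightarrow> p \<in> weak_gradient_graph \<Omega> \<inter> closure (test_graph \<Omega>)"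
      unfolding weak_gradient_graph_def p by simp
    finally show ?thesis .
  qed
  then show ?thesis by blast
qed

lemma H10_weak_gradient: "open \<Omega> \<Longrightarrow> v \<in> H10 \<Omega> \<Longrightarrow> weak_gradient \<Omega> v (grad \<Omega> v)"
  unfolding H10_def H1_def using grad_eq by blast

lemma H10_closed_graph: "open \<Omega> \<Longrightarrow> closed ((\<lambda>v. (v, grad \<Omega> v)) ` H10 \<Omega>)"
  unfolding H10_graph using weak_gradient_graph(1) by blast

lemma subspace_H10_graph: "open \<Omega> \<Longrightarrow> subspace ((\<lambda>v. (v, grad \<Omega> v)) ` H10 \<Omega>)"
  unfolding H10_graph by (intro subspace_inter weak_gradient_graph(2) subspace_closure_L2 subspace_test_graph)

lemma H10_linear:
  fixes \<Omega> :: "(real^'n) set" and x y :: "(real^'n, 'b::euclidean_space) L2"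
  assumes \<Omega>: "open \<Omega>"
  shows "subspace (H10 \<Omega> :: (real^'n, 'b) L2 set)"
    "x \<in> H10 \<Omega> \<Longrightarrow> y \<in> H10 \<Omega> \<Longrightarrow> grad \<Omega> (x + y) = grad \<Omega> x + grad \<Omega> y"
    "x \<in> H10 \<Omega> \<Longrightarrow> grad \<Omega> (c *\<^sub>R x) = c *\<^sub>R grad \<Omega> x"
proof -
  let ?G = "(\<lambda>v :: (real^'n, 'b) L2. (v, grad \<Omega> v)) ` H10 \<Omega>"
  have G: "subspace ?G" by (rule subspace_H10_graph[OF \<Omega>])
  have mem: "(v, g) \<in> ?G \<longleftrightarrow> v \<in> H10 \<Omega> \<and> g = grad \<Omega> v" for v :: "(real^'n, 'b) L2" and g by auto
  have add: "x + y \<in> H10 \<Omega> \<and> grad \<Omega> (x + y) = grad \<Omega> x + grad \<Omega> y" if "x \<in> H10 \<Omega>" "y \<in> H10 \<Omega>" for x y :: "(real^'n, 'b) L2"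
    using subspace_add[OF G, of "(x, grad \<Omega> x)" "(y, grad \<Omega> y)"] that unfolding add_Pair mem by simp
  have scale: "c *\<^sub>R x \<in> H10 \<Omega> \<and> grad \<Omega> (c *\<^sub>R x) = c *\<^sub>R grad \<Omega> x" if "x \<in> H10 \<Omega>" for c and x :: "(real^'n, 'b) L2"
    using subspace_scale[OF G, of "(x, grad \<Omega> x)" c] that unfolding scaleR_Pair mem by simp
  have "(0 :: (real^'n, 'b) L2) \<in> H10 \<Omega>" using subspace_0[OF G] unfolding zero_prod_def mem by (rule conjunct1)
  then show "subspace (H10 \<Omega> :: (real^'n, 'b) L2 set)" unfolding subspace_def using add scale by blast
  show "x \<in> H10 \<Omega> \<Longrightarrow> y \<in> H10 \<Omega> \<Longrightarrow> grad \<Omega> (x + y) = grad \<Omega> x + grad \<Omega> y"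
    "x \<in> H10 \<Omega> \<Longrightarrow> grad \<Omega> (c *\<^sub>R x) = c *\<^sub>R grad \<Omega> x" for x y :: "(real^'n, 'b) L2" and c
    using add scale by blast+
qed

text \<open>Difference quotients have integral zero by translation invariance, and they converge boundedly on a
  compact set.\<close>

lemma integral_dir_deriv_zero:
  fixes \<psi> :: "'a::euclidean_space \<Rightarrow> real"
  assumes d: "\<And>x. \<psi> differentiable (at x)" and c: "continuous_on UNIV (dir_deriv b \<psi>)"
    and K: "compact K" "{x. \<psi> x \<noteq> 0} \<subseteq> K"
  shows "(\<integral>x. dir_deriv b \<psi> x \<partial>lborel) = 0"
proof -
  define h where "h n = inverse (real (Suc n))" for n
  have h: "0 < h n" "h n \<le> 1" "h \<longlonglongrightarrow> 0" for n
    using LIMSEQ_inverse_real_of_nat by (auto simp: h_def[abs_def] inverse_le_1_iff)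
  define F where "F n x = (\<psi> (x + h n *\<^sub>R b) - \<psi> x) / h n" for n x
  have c\<psi>: "continuous_on A \<psi>" for A
    using d by (meson continuous_at_imp_continuous_on differentiable_imp_continuous_within)
  have int: "integrable lborel \<psi>"
  proof -
    obtain B where B: "\<And>x. x \<in> K \<Longrightarrow> norm (\<psi> x) \<le> B" using compact_image_bounded[OF K(1) c\<psi>] by blast
    have "K \<in> sets borel" by (rule borel_compact[OF K(1)])
    then have "integrable lborel (\<lambda>x. B * indicator K x)"
      using emeasure_bounded_finite[OF compact_imp_bounded[OF K(1)]]
      by (intro integrable_mult_right integrable_real_indicator) auto
    then show ?thesis
    proof (rule Bochner_Integration.integrable_bound)
      show "AE x in lborel. norm (\<psi> x) \<le> norm (B * indicator K x)"
      proof (rule AE_I2)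
        fix x show "norm (\<psi> x) \<le> norm (B * indicator K x)"
          using B[of x] K(2) by (cases "x \<in> K") auto
      qed
    qed (simp add: borel_measurable_continuous_onI c\<psi>)
  qed
  have line: "((\<lambda>t. \<psi> (x + t *\<^sub>R b)) has_real_derivative dir_deriv b \<psi> (x + t *\<^sub>R b)) (at t)" for x t
  proof -
    obtain D where D: "(\<psi> has_derivative D) (at (x + t *\<^sub>R b))" using d by (auto simp: differentiable_def)
    have "((\<lambda>t. x + t *\<^sub>R b) has_derivative (\<lambda>s. s *\<^sub>R b)) (at t)" by (auto intro!: derivative_eq_intros)
    from has_derivative_compose[OF this D]
    have "((\<lambda>t. \<psi> (x + t *\<^sub>R b)) has_derivative (\<lambda>s. D (s *\<^sub>R b))) (at t)" .
    moreover have "(\<lambda>s. D (s *\<^sub>R b)) = (*) (dir_deriv b \<psi> (x + t *\<^sub>R b))"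
      using dir_deriv_has_derivative[OF D, of b] linear_cmul[OF has_derivative_linear[OF D]]
      by (intro ext) (simp add: mult.commute)
    ultimately show ?thesis by (simp add: has_field_derivative_def)
  qed
  have trans: "(\<integral>x. \<psi> (x + v) \<partial>lborel) = (\<integral>x. \<psi> x \<partial>lborel)" "integrable lborel (\<lambda>x. \<psi> (x + v))" for v
  proof -
    have m: "\<psi> \<in> borel_measurable borel" by (simp add: borel_measurable_continuous_onI c\<psi>)
    have "(\<integral>x. \<psi> x \<partial>distr lborel borel ((+) v)) = (\<integral>x. \<psi> (v + x) \<partial>lborel)"
      by (rule integral_distr) (use m in simp_all)
    then show "(\<integral>x. \<psi> (x + v) \<partial>lborel) = (\<integral>x. \<psi> x \<partial>lborel)" by (simp add: lborel_distr_plus add.commute)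
    have "integrable (distr lborel borel ((+) v)) \<psi> \<longleftrightarrow> integrable lborel (\<lambda>x. \<psi> (v + x))"
      by (rule integrable_distr_eq) (use m in simp_all)
    then show "integrable lborel (\<lambda>x. \<psi> (x + v))" using int by (simp add: lborel_distr_plus add.commute)
  qed
  define K' where "K' = (\<lambda>(x, s). x - s *\<^sub>R b) ` (K \<times> {0..1::real})"
  have K': "compact K'" unfolding K'_def case_prod_beta
    by (intro compact_continuous_image continuous_intros compact_Times K) simp
  obtain B where B: "\<And>x. x \<in> K \<Longrightarrow> norm (dir_deriv b \<psi> x) \<le> B"
    using compact_image_bounded[OF K(1) continuous_on_subset[OF c subset_UNIV]] by blast
  define B' where "B' = max B 0"
  have B': "\<bar>dir_deriv b \<psi> x\<bar> \<le> B'" for x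
    using B[of x] dir_deriv_outside[OF compact_imp_closed[OF K(1)] K(2), of x b] by (cases "x \<in> K") (auto simp: B'_def)
  have Fb: "\<bar>F n x\<bar> \<le> B' * indicator K' x" for n x
  proof (cases "x \<in> K'")
    case True
    obtain z where "\<psi> (x + h n *\<^sub>R b) - \<psi> (x + 0 *\<^sub>R b) = (h n - 0) * dir_deriv b \<psi> (x + z *\<^sub>R b)"
      using MVT2[OF h(1)[of n], of "\<lambda>t. \<psi> (x + t *\<^sub>R b)" "\<lambda>t. dir_deriv b \<psi> (x + t *\<^sub>R b)"] line by blast
    then have "F n x = dir_deriv b \<psi> (x + z *\<^sub>R b)" using h(1)[of n] by (simp add: F_def)
    then show ?thesis using B' True by simp
  next
    case False
    have out: "x + s *\<^sub>R b \<notin> K" if "0 \<le> s" "s \<le> 1" for s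
    proof
      assume "x + s *\<^sub>R b \<in> K"
      then have "x \<in> K'" unfolding K'_def using that by (intro image_eqI[of _ _ "(x + s *\<^sub>R b, s)"]) auto
      then show False using False by blast
    qed
    have "\<psi> (x + h n *\<^sub>R b) = 0" "\<psi> x = 0" using out[of "h n"] out[of 0] h(1)[of n] h(2)[of n] K(2) by auto
    then show ?thesis using False by (simp add: F_def)
  qed
  have "(\<lambda>n. \<integral>x. F n x \<partial>lborel) \<longlonglongrightarrow> (\<integral>x. dir_deriv b \<psi> x \<partial>lborel)"
  proof (rule integral_dominated_convergence[where w = "\<lambda>x. B' * indicator K' x"])
    have "K' \<in> sets borel" by (rule borel_compact[OF K'])
    then show "integrable lborel (\<lambda>x. B' * indicator K' x)"
      using emeasure_bounded_finite[OF compact_imp_bounded[OF K']]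
      by (intro integrable_mult_right integrable_real_indicator) auto
    show "AE x in lborel. (\<lambda>n. F n x) \<longlonglongrightarrow> dir_deriv b \<psi> x"
    proof (rule AE_I2)
      fix x
      have "((\<lambda>t. (\<psi> (x + t *\<^sub>R b) - \<psi> x) / t) \<longlongrightarrow> dir_deriv b \<psi> x) (at 0)"
        using line[of x 0] by (simp add: has_field_derivative_iff)
      then show "(\<lambda>n. F n x) \<longlonglongrightarrow> dir_deriv b \<psi> x" unfolding F_def
        by (rule filterlim_compose) (use h in \<open>auto simp: filterlim_at intro!: always_eventually\<close>, metis less_irrefl h(1))
    qed
    show "dir_deriv b \<psi> \<in> borel_measurable lborel" using c by (simp add: borel_measurable_continuous_onI)
    have [measurable]: "\<psi> \<in> borel_measurable borel" by (simp add: borel_measurable_continuous_onI c\<psi>)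
    show "F n \<in> borel_measurable lborel" for n unfolding F_def by measurable
    show "AE x in lborel. norm (F n x) \<le> B' * indicator K' x" for n using Fb by simp
  qed
  moreover have "(\<integral>x. F n x \<partial>lborel) = 0" for n
    unfolding F_def using trans int by simp
  ultimately show ?thesis by (simp add: LIMSEQ_const_iff)
qed

text \<open>The integral of the derivative of \<open>x\<^sub>i \<phi>\<^sup>2\<close> in direction \<open>i\<close> vanishes, so the squared norm of \<open>\<phi>\<close> is
  \<open>- 2 (\<phi>, x\<^sub>i \<partial>\<^sub>i\<phi>)\<close>, and \<open>x\<^sub>i\<close> is bounded on the support.\<close>

lemma test_function_poincare:
  fixes \<phi> :: "real^'n \<Rightarrow> real" and i :: 'n
  assumes \<phi>: "test_function \<Omega> \<phi>" and M: "\<And>x. x \<in> \<Omega> \<Longrightarrow> \<bar>x $ i\<bar> \<le> M"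
  shows "norm (abs_L2 \<phi>) \<le> 2 * \<bar>M\<bar> * norm (abs_L2 (classical_grad \<phi>))"
proof -
  define b :: "real^'n" where "b = axis i 1"
  have b: "b \<in> Basis" by (simp add: b_def axis_Basis)
  define d where "d = dir_deriv b \<phi>"
  have td: "test_function \<Omega> d" unfolding d_def by (rule test_function_dir_deriv[OF \<phi> b])
  have sm: "smooth \<phi>" "smooth d" using \<phi> td by (auto simp: test_function_def)
  define \<psi> where "\<psi> x = \<phi> x * \<phi> x * (x $ i)" for x
  have D\<psi>: "(\<psi> has_derivative (\<lambda>h. (\<phi> x * \<phi> x) * (h $ i) + (\<phi> x * frechet_derivative \<phi> (at x) h + frechet_derivative \<phi> (at x) h * \<phi> x) * (x $ i))) (at x)" for x
    unfolding \<psi>_def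
    by (intro has_derivative_mult bounded_linear.has_derivative[OF bounded_linear_vec_nth] has_derivative_ident
        frechet_derivative_works[THEN iffD1] smooth_differentiable sm)
  have d\<psi>: "dir_deriv b \<psi> x = \<phi> x * \<phi> x + 2 * (\<phi> x * (x $ i * d x))" for x
    using dir_deriv_has_derivative[OF D\<psi>, of b x] dir_deriv_differentiable[OF smooth_differentiable[OF sm(1)], of b x]
    by (simp add: b_def d_def algebra_simps)
  define g where "g x = x $ i * d x" for x
  have supp: "closure {x. d x \<noteq> 0} \<subseteq> \<Omega>" "compact (closure {x. d x \<noteq> 0})" using td by (auto simp: test_function_def)
  have cg: "continuous_on UNIV g" unfolding g_def by (intro continuous_intros smooth_continuous sm)
  have g: "sq_integrable g"
    by (rule sq_integrable_compact_support[OF cg supp(2)]) (use closure_subset in \<open>force simp: g_def\<close>)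
  note s\<phi> = test_function_sq_integrable[OF \<phi>] and scg = classical_grad_sq_integrable[OF \<phi>]
  have "(\<integral>x. dir_deriv b \<psi> x \<partial>lborel) = 0"
  proof (rule integral_dir_deriv_zero)
    show "\<psi> differentiable (at x)" for x using D\<psi> unfolding differentiable_def by blast
    show "continuous_on UNIV (dir_deriv b \<psi>)" unfolding d\<psi>[abs_def] by (intro continuous_intros smooth_continuous sm)
    show "compact (closure {x. \<phi> x \<noteq> 0})" using \<phi> by (simp add: test_function_def)
    show "{x. \<psi> x \<noteq> 0} \<subseteq> closure {x. \<phi> x \<noteq> 0}" by (rule order_trans[OF _ closure_subset]) (auto simp: \<psi>_def)
  qed
  moreover have "(\<integral>x. dir_deriv b \<psi> x \<partial>lborel) = (\<integral>x. \<phi> x \<bullet> \<phi> x \<partial>lborel) + 2 * (\<integral>x. \<phi> x \<bullet> g x \<partial>lborel)"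
    using sq_integrable_inner[OF s\<phi> s\<phi>] sq_integrable_inner[OF s\<phi> g] by (simp add: d\<psi> g_def)
  ultimately have "(norm (abs_L2 \<phi>))\<^sup>2 = - (2 * (abs_L2 \<phi> \<bullet> abs_L2 g))"
    by (simp add: power2_norm_eq_inner inner_abs_L2 s\<phi> g)
  also have "\<dots> \<le> 2 * (norm (abs_L2 \<phi>) * norm (abs_L2 g))"
    using Cauchy_Schwarz_ineq2[of "abs_L2 \<phi>" "abs_L2 g"] by linarith
  finally have 1: "norm (abs_L2 \<phi>) * norm (abs_L2 \<phi>) \<le> norm (abs_L2 \<phi>) * (2 * norm (abs_L2 g))"
    by (simp add: power2_eq_square mult_ac)
  have 2: "norm (abs_L2 \<phi>) \<le> 2 * norm (abs_L2 g)"
  proof (cases "norm (abs_L2 \<phi>) = 0")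
    case False
    then have "0 < norm (abs_L2 \<phi>)" by simp
    then show ?thesis using 1 by (simp only: mult_le_cancel_left_pos)
  qed simp
  have "(norm (abs_L2 g))\<^sup>2 \<le> (\<bar>M\<bar> * norm (abs_L2 (classical_grad \<phi>)))\<^sup>2"
  proof -
    have "(norm (abs_L2 g))\<^sup>2 = (\<integral>x. (norm (g x))\<^sup>2 \<partial>lborel)" by (rule norm_abs_L2[OF g])
    also have "\<dots> \<le> (\<integral>x. \<bar>M\<bar>\<^sup>2 * (norm (classical_grad \<phi> x))\<^sup>2 \<partial>lborel)"
    proof (rule integral_mono)
      show "integrable lborel (\<lambda>x. (norm (g x))\<^sup>2)" using g by (simp add: sq_integrable_def)
      show "integrable lborel (\<lambda>x. \<bar>M\<bar>\<^sup>2 * (norm (classical_grad \<phi> x))\<^sup>2)" using scg by (simp add: sq_integrable_def)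
      fix x
      have "norm (g x) \<le> \<bar>M\<bar> * norm (classical_grad \<phi> x)"
      proof (cases "d x = 0")
        case False
        then have "x \<in> closure {x. d x \<noteq> 0}" by (intro subsetD[OF closure_subset]) simp
        then have "x \<in> \<Omega>" using supp(1) by (rule subsetD[rotated])
        then have "\<bar>x $ i\<bar> \<le> \<bar>M\<bar>" by (rule order_trans[OF M abs_ge_self])
        moreover have "\<bar>d x\<bar> \<le> norm (classical_grad \<phi> x)"
          using component_le_norm_cart[of "classical_grad \<phi> x" i] by (simp add: classical_grad_def d_def b_def)
        ultimately show ?thesis by (simp add: g_def abs_mult mult_mono)
      qed (simp add: g_def)
      then show "(norm (g x))\<^sup>2 \<le> \<bar>M\<bar>\<^sup>2 * (norm (classical_grad \<phi> x))\<^sup>2"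
        unfolding power_mult_distrib[symmetric] by (rule power_mono) simp
    qed
    also have "\<dots> = \<bar>M\<bar>\<^sup>2 * (norm (abs_L2 (classical_grad \<phi>)))\<^sup>2" by (simp add: norm_abs_L2[OF scg])
    finally show ?thesis by (simp only: power_mult_distrib)
  qed
  then have "norm (abs_L2 g) \<le> \<bar>M\<bar> * norm (abs_L2 (classical_grad \<phi>))" by (rule power2_le_imp_le) simp
  with 2 show ?thesis by linarith
qed

text \<open>The inequality for test functions is a closed condition on pairs \<open>(v, G)\<close>.\<close>

lemma H10_poincare:
  fixes \<Omega> :: "(real^'n) set"
  assumes \<Omega>: "open \<Omega>" "bounded \<Omega>"
  shows "\<exists>C. \<forall>v\<in>H10 \<Omega>. norm (v :: (real^'n, real) L2) \<le> C * norm (grad \<Omega> v)"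
proof -
  obtain B where B: "\<And>x. x \<in> \<Omega> \<Longrightarrow> norm x \<le> B" using \<Omega>(2) by (auto simp: bounded_iff)
  obtain i :: 'n where True by blast
  have M: "\<bar>x $ i\<bar> \<le> B" if "x \<in> \<Omega>" for x using component_le_norm_cart[of x i] B[OF that] by simp
  have "closure (test_graph \<Omega> :: ((real^'n, real) L2 \<times> (real^'n, real^'n) L2) set) \<subseteq> {p. norm (fst p) \<le> (2 * \<bar>B\<bar>) * norm (snd p)}"
  proof (rule closure_minimal)
    show "(test_graph \<Omega> :: ((real^'n, real) L2 \<times> (real^'n, real^'n) L2) set) \<subseteq> {p. norm (fst p) \<le> (2 * \<bar>B\<bar>) * norm (snd p)}"
      using test_function_poincare[where \<Omega> = \<Omega> and M = B and i = i, OF _ M] by (auto simp: test_graph_def)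
    show "closed {p :: (real^'n, real) L2 \<times> (real^'n, real^'n) L2. norm (fst p) \<le> (2 * \<bar>B\<bar>) * norm (snd p)}"
      by (intro closed_Collect_le continuous_intros)
  qed
  moreover have "(v, grad \<Omega> v) \<in> closure (test_graph \<Omega>)" if v: "v \<in> H10 \<Omega>" for v :: "(real^'n, real) L2"
  proof -
    have "(v, grad \<Omega> v) \<in> (\<lambda>v. (v, grad \<Omega> v)) ` H10 \<Omega>" using v by (rule imageI)
    then show ?thesis unfolding H10_graph[OF \<Omega>(1)] by (rule IntD2)
  qed
  ultimately have "norm v \<le> (2 * \<bar>B\<bar>) * norm (grad \<Omega> v)" if "v \<in> H10 \<Omega>" for v :: "(real^'n, real) L2"
    using subsetD that by fastforce
  then show ?thesis by blast
qed

section \<open>Complex-valued functions as pairs of real-valued functions\<close>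

text \<open>Pointwise application of a linear map. It covers real and imaginary parts, the embedding of real
  functions, and multiplication by a complex number.\<close>

definition L2_map :: "('b::euclidean_space \<Rightarrow> 'c::euclidean_space) \<Rightarrow> ('a::euclidean_space, 'b) L2 \<Rightarrow> ('a, 'c) L2" where
  "L2_map L v = abs_L2 (\<lambda>x. L (rep_L2 v x))"

definition vec_map :: "('b \<Rightarrow> 'c) \<Rightarrow> 'b^'n \<Rightarrow> 'c^'n" where
  "vec_map L y = (\<chi> i. L (y $ i))"

lemma vec_map_nth: "vec_map L y $ i = L (y $ i)"
  by (simp add: vec_map_def)

lemma bounded_linear_vec_map:
  assumes L: "bounded_linear L" shows "bounded_linear (vec_map L :: 'b::real_normed_vector^'n \<Rightarrow> 'c::real_normed_vector^'n)"
proof -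
  interpret L: bounded_linear L by fact
  obtain K where K: "0 < K" "\<And>x. norm (L x) \<le> norm x * K" using L.pos_bounded by blast
  show ?thesis
  proof (rule bounded_linear_intro[where K = "K * real CARD('n)"])
    show "vec_map L (x + y) = vec_map L x + vec_map L y" for x y :: "'b^'n"
      by (simp add: vec_map_def vec_eq_iff L.add)
    show "vec_map L (c *\<^sub>R x) = c *\<^sub>R vec_map L x" for c and x :: "'b^'n"
      by (simp add: vec_map_def vec_eq_iff L.scaleR)
    show "norm (vec_map L x) \<le> norm x * (K * real CARD('n))" for x :: "'b^'n"
    proof -
      have "norm (vec_map L x) \<le> (\<Sum>i\<in>UNIV. norm (L (x $ i)))"
        unfolding norm_vec_def vec_map_nth by (rule L2_set_le_sum) simp
      also have "\<dots> \<le> (\<Sum>i\<in>(UNIV :: 'n set). norm x * K)"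
      proof (rule sum_mono)
        fix i
        have "norm (L (x $ i)) \<le> norm (x $ i) * K" by (rule K(2))
        also have "\<dots> \<le> norm x * K" using K(1) by (intro mult_right_mono Finite_Cartesian_Product.norm_nth_le) simp
        finally show "norm (L (x $ i)) \<le> norm x * K" .
      qed
      finally show ?thesis by (simp add: mult_ac)
    qed
  qed
qed

lemma sq_integrable_linear:
  fixes f :: "'a::euclidean_space \<Rightarrow> 'b::euclidean_space" and L :: "'b \<Rightarrow> 'c::euclidean_space"
  assumes L: "bounded_linear L" and f: "sq_integrable f" shows "sq_integrable (\<lambda>x. L (f x))"
proof -
  interpret L: bounded_linear L by fact
  obtain K where K: "\<And>x. norm (L x) \<le> norm x * K" using L.bounded by blast
  have [measurable]: "f \<in> borel_measurable lborel" using f by (rule sq_integrable_measurable)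
  have [measurable]: "L \<in> borel_measurable borel" by (rule borel_measurable_continuous_onI) (simp add: L.continuous_on)
  have "integrable lborel (\<lambda>x. K\<^sup>2 * (norm (f x))\<^sup>2)" using f by (simp add: sq_integrable_def)
  moreover have le: "norm ((norm (L (f x)))\<^sup>2) \<le> norm (K\<^sup>2 * (norm (f x))\<^sup>2)" for x
    using power_mono[OF K[of "f x"] norm_ge_zero, of 2] by (simp add: power_mult_distrib mult.commute)
  ultimately have "integrable lborel (\<lambda>x. (norm (L (f x)))\<^sup>2)"
    by (intro Bochner_Integration.integrable_bound[OF _ _ AE_I2[OF le]]) simp_all
  then show ?thesis by (simp add: sq_integrable_def)
qed

lemma rep_L2_map:
  assumes L: "bounded_linear L"
  shows "AE x in lborel. rep_L2 (L2_map L v) x = L (rep_L2 v x)"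
  unfolding L2_map_def by (rule rep_abs_L2[OF sq_integrable_linear[OF L sq_integrable_rep_L2]])

lemma L2_map_abs:
  assumes L: "bounded_linear L" and f: "sq_integrable f"
  shows "L2_map L (abs_L2 f) = abs_L2 (\<lambda>x. L (f x))"
  unfolding L2_map_def
  by (subst abs_L2_eq_iff[OF sq_integrable_linear[OF L sq_integrable_rep_L2] sq_integrable_linear[OF L f]])
    (use rep_abs_L2[OF f] in eventually_elim, simp)

lemma L2_map_L2_map:
  assumes L: "bounded_linear L" and K: "bounded_linear K"
  shows "L2_map L (L2_map K v) = L2_map (\<lambda>y. L (K y)) v"
  using L2_map_abs[OF L sq_integrable_linear[OF K sq_integrable_rep_L2], of v] by (simp add: L2_map_def)

lemma L2_map_ident: "L2_map (\<lambda>y. y) v = v"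
  by (simp add: L2_map_def abs_rep_L2)

lemma L2_map_add_fun:
  assumes L: "bounded_linear L" and K: "bounded_linear K"
  shows "L2_map (\<lambda>y. L y + K y) v = L2_map L v + L2_map K v"
  unfolding L2_map_def by (rule abs_L2_add[OF sq_integrable_linear[OF L sq_integrable_rep_L2] sq_integrable_linear[OF K sq_integrable_rep_L2]])

lemma bounded_linear_L2_map:
  assumes L: "bounded_linear L" shows "bounded_linear (L2_map L)"
proof -
  interpret L: bounded_linear L by fact
  obtain K where K: "0 \<le> K" "\<And>x. norm (L x) \<le> norm x * K" using L.nonneg_bounded by blast
  note sq = sq_integrable_linear[OF L sq_integrable_rep_L2]
  show ?thesis
  proof (rule bounded_linear_intro[where K = K])
    show "L2_map L (v + w) = L2_map L v + L2_map L w" for v w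
    proof -
      have "L2_map L (v + w) = L2_map L (abs_L2 (\<lambda>x. rep_L2 v x + rep_L2 w x))"
        by (simp add: abs_L2_add[OF sq_integrable_rep_L2 sq_integrable_rep_L2] abs_rep_L2)
      also have "\<dots> = abs_L2 (\<lambda>x. L (rep_L2 v x) + L (rep_L2 w x))"
        by (simp add: L2_map_abs[OF L sq_integrable_add[OF sq_integrable_rep_L2 sq_integrable_rep_L2]] L.add)
      also have "\<dots> = L2_map L v + L2_map L w" unfolding L2_map_def by (rule abs_L2_add[OF sq sq])
      finally show ?thesis .
    qed
    show "L2_map L (c *\<^sub>R v) = c *\<^sub>R L2_map L v" for c v
    proof -
      have "L2_map L (c *\<^sub>R v) = L2_map L (abs_L2 (\<lambda>x. c *\<^sub>R rep_L2 v x))"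
        by (simp add: abs_L2_scaleR[OF sq_integrable_rep_L2] abs_rep_L2)
      also have "\<dots> = abs_L2 (\<lambda>x. c *\<^sub>R L (rep_L2 v x))"
        by (simp add: L2_map_abs[OF L sq_integrable_scaleR[OF sq_integrable_rep_L2]] L.scaleR)
      also have "\<dots> = c *\<^sub>R L2_map L v" unfolding L2_map_def by (rule abs_L2_scaleR[OF sq])
      finally show ?thesis .
    qed
    show "norm (L2_map L v) \<le> norm v * K" for v
    proof (rule power2_le_imp_le)
      have "(norm (L2_map L v))\<^sup>2 = (\<integral>x. (norm (L (rep_L2 v x)))\<^sup>2 \<partial>lborel)"
        unfolding L2_map_def by (rule norm_abs_L2[OF sq])
      also have "\<dots> \<le> (\<integral>x. K\<^sup>2 * (norm (rep_L2 v x))\<^sup>2 \<partial>lborel)"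
      proof (rule integral_mono)
        show "integrable lborel (\<lambda>x. (norm (L (rep_L2 v x)))\<^sup>2)" using sq[of v] unfolding sq_integrable_def by (rule conjunct2)
        show "integrable lborel (\<lambda>x. K\<^sup>2 * (norm (rep_L2 v x))\<^sup>2)"
          using sq_integrable_rep_L2[of v] by (simp add: sq_integrable_def)
        show "(norm (L (rep_L2 v x)))\<^sup>2 \<le> K\<^sup>2 * (norm (rep_L2 v x))\<^sup>2" for x
          using power_mono[OF K(2)[of "rep_L2 v x"] norm_ge_zero, of 2] by (simp add: power_mult_distrib mult.commute)
      qed
      also have "\<dots> = K\<^sup>2 * (norm v)\<^sup>2"
        using norm_abs_L2[OF sq_integrable_rep_L2, of v] by (simp add: abs_rep_L2)
      finally show "(norm (L2_map L v))\<^sup>2 \<le> (norm v * K)\<^sup>2" by (simp add: power_mult_distrib mult.commute)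
    qed (use K(1) in simp)
  qed
qed

lemma L2_map_L2_on:
  assumes L: "bounded_linear L" and v: "v \<in> L2_on \<Omega>" shows "L2_map L v \<in> L2_on \<Omega>"
proof -
  interpret L: bounded_linear L by fact
  have "AE x in lborel. x \<notin> \<Omega> \<longrightarrow> rep_L2 v x = 0" using v by (simp add: L2_on_def)
  with rep_L2_map[OF L, of v] have "AE x in lborel. x \<notin> \<Omega> \<longrightarrow> rep_L2 (L2_map L v) x = 0"
    by eventually_elim (simp add: L.zero)
  then show ?thesis by (simp add: L2_on_def)
qed

lemma weak_gradient_L2_map:
  fixes v :: "(real^'n, 'b::euclidean_space) L2" and L :: "'b \<Rightarrow> 'c::euclidean_space"
  assumes L: "bounded_linear L" and wg: "weak_gradient \<Omega> v G"
  shows "weak_gradient \<Omega> (L2_map L v) (L2_map (vec_map L) G)"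
proof -
  interpret L: bounded_linear L by fact
  note L' = bounded_linear_vec_map[OF L]
  have mL [measurable]: "L \<in> borel_measurable borel" by (rule borel_measurable_continuous_onI) (simp add: L.continuous_on)
  have mr [measurable]: "rep_L2 w \<in> borel_measurable lborel" for w :: "(real^'n, 'd::euclidean_space) L2"
    by (rule sq_integrable_measurable[OF sq_integrable_rep_L2])
  have int: "(\<integral>x. \<psi> x *\<^sub>R rep_L2 (L2_map L w) x \<partial>lborel) = L (\<integral>x. \<psi> x *\<^sub>R rep_L2 w x \<partial>lborel)"
    if \<psi>: "sq_integrable \<psi>" for \<psi> :: "real^'n \<Rightarrow> real" and w
  proof -
    have [measurable]: "\<psi> \<in> borel_measurable lborel" by (rule sq_integrable_measurable[OF \<psi>])
    have "(\<integral>x. \<psi> x *\<^sub>R rep_L2 (L2_map L w) x \<partial>lborel) = (\<integral>x. L (\<psi> x *\<^sub>R rep_L2 w x) \<partial>lborel)"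
      by (rule integral_cong_AE) (measurable, use rep_L2_map[OF L, of w] in eventually_elim, simp add: L.scaleR)
    also have "\<dots> = L (\<integral>x. \<psi> x *\<^sub>R rep_L2 w x \<partial>lborel)"
      by (rule integral_bounded_linear[OF L integrable_scaleR_sq_integrable[OF \<psi> sq_integrable_rep_L2]])
    finally show ?thesis .
  qed
  have int': "(\<integral>x. \<psi> x *\<^sub>R (rep_L2 (L2_map (vec_map L) G) x $ i) \<partial>lborel) = L (\<integral>x. \<psi> x *\<^sub>R (rep_L2 G x $ i) \<partial>lborel)"
    if \<psi>: "sq_integrable \<psi>" for \<psi> :: "real^'n \<Rightarrow> real" and i
  proof -
    have [measurable]: "\<psi> \<in> borel_measurable lborel" by (rule sq_integrable_measurable[OF \<psi>])
    have nth: "sq_integrable (\<lambda>x. rep_L2 G x $ i)"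
      by (rule sq_integrable_linear[OF bounded_linear_vec_nth sq_integrable_rep_L2])
    have nth': "sq_integrable (\<lambda>x. rep_L2 (L2_map (vec_map L) G) x $ i)"
      by (rule sq_integrable_linear[OF bounded_linear_vec_nth sq_integrable_rep_L2])
    have [measurable]: "(\<lambda>x. rep_L2 G x $ i) \<in> borel_measurable lborel" "(\<lambda>x. rep_L2 (L2_map (vec_map L) G) x $ i) \<in> borel_measurable lborel"
      by (rule sq_integrable_measurable[OF nth]) (rule sq_integrable_measurable[OF nth'])
    have "(\<integral>x. \<psi> x *\<^sub>R (rep_L2 (L2_map (vec_map L) G) x $ i) \<partial>lborel) = (\<integral>x. L (\<psi> x *\<^sub>R (rep_L2 G x $ i)) \<partial>lborel)"
      by (rule integral_cong_AE) (measurable, use rep_L2_map[OF L', of G] in eventually_elim, simp add: L.scaleR vec_map_nth)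
    also have "\<dots> = L (\<integral>x. \<psi> x *\<^sub>R (rep_L2 G x $ i) \<partial>lborel)"
      by (rule integral_bounded_linear[OF L integrable_scaleR_sq_integrable[OF \<psi> nth]])
    finally show ?thesis .
  qed
  show ?thesis unfolding weak_gradient_def
  proof (intro conjI allI impI)
    show "L2_map L v \<in> L2_on \<Omega>" "L2_map (vec_map L) G \<in> L2_on \<Omega>"
      using wg L2_map_L2_on[OF L] L2_map_L2_on[OF L'] unfolding weak_gradient_def by blast+
    fix \<phi> :: "real^'n \<Rightarrow> real" and i assume \<phi>: "test_function \<Omega> \<phi>"
    have "(\<integral>x. dir_deriv (axis i 1) \<phi> x *\<^sub>R rep_L2 v x \<partial>lborel) = - (\<integral>x. \<phi> x *\<^sub>R (rep_L2 G x $ i) \<partial>lborel)"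
      using wg \<phi> unfolding weak_gradient_def by blast
    then show "(\<integral>x. dir_deriv (axis i 1) \<phi> x *\<^sub>R rep_L2 (L2_map L v) x \<partial>lborel)
        = - (\<integral>x. \<phi> x *\<^sub>R (rep_L2 (L2_map (vec_map L) G) x $ i) \<partial>lborel)"
      by (simp add: int[OF test_function_sq_integrable[OF test_function_dir_deriv[OF \<phi> axis_Basis]]]
          int'[OF test_function_sq_integrable[OF \<phi>]] L.neg)
  qed
qed

text \<open>The map \<open>(v, G) \<mapsto> (L v, L G)\<close> preserves both subspaces whose intersection is the graph of the
  gradient.\<close>

lemma H10_L2_map:
  fixes v :: "(real^'n, 'b::euclidean_space) L2" and L :: "'b \<Rightarrow> 'c::euclidean_space"
  assumes \<Omega>: "open \<Omega>" and L: "bounded_linear L" and v: "v \<in> H10 \<Omega>"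
  shows "L2_map L v \<in> H10 \<Omega>" "grad \<Omega> (L2_map L v) = L2_map (vec_map L) (grad \<Omega> v)"
proof -
  note L' = bounded_linear_vec_map[OF L]
  define T where "T p = (L2_map L (fst p), L2_map (vec_map L) (snd p))" for p :: "(real^'n, 'b) L2 \<times> (real^'n, 'b^'n) L2"
  have cont: "continuous_on UNIV T" unfolding T_def
    by (intro continuous_on_Pair bounded_linear.continuous_on[OF bounded_linear_L2_map[OF L]]
        bounded_linear.continuous_on[OF bounded_linear_L2_map[OF L']] continuous_intros)
  have "T ` test_graph \<Omega> \<subseteq> test_graph \<Omega>"
  proof
    fix q assume "q \<in> T ` test_graph \<Omega>"
    then obtain \<phi> where \<phi>: "test_function \<Omega> \<phi>" "q = T (abs_L2 \<phi>, abs_L2 (classical_grad \<phi>))" by (auto simp: test_graph_def)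
    have sm: "smooth \<phi>" using \<phi>(1) unfolding test_function_def by blast
    have "classical_grad (\<lambda>x. L (\<phi> x)) = (\<lambda>x. vec_map L (classical_grad \<phi> x))"
      by (intro ext) (simp add: classical_grad_def vec_map_def dir_deriv_bounded_linear[OF L smooth_differentiable[OF sm]])
    then have "q = (abs_L2 (\<lambda>x. L (\<phi> x)), abs_L2 (classical_grad (\<lambda>x. L (\<phi> x))))"
      by (simp add: \<phi>(2) T_def L2_map_abs[OF L test_function_sq_integrable[OF \<phi>(1)]] L2_map_abs[OF L' classical_grad_sq_integrable[OF \<phi>(1)]])
    then show "q \<in> test_graph \<Omega>" using test_function_bounded_linear[OF L \<phi>(1)] unfolding test_graph_def by blast
  qed
  then have "T ` test_graph \<Omega> \<subseteq> closure (test_graph \<Omega>)" using closure_subset by (rule order_trans)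
  then have cl: "T ` closure (test_graph \<Omega>) \<subseteq> closure (test_graph \<Omega>)"
    by (intro image_closure_subset continuous_on_subset[OF cont]) simp_all
  have "(v, grad \<Omega> v) \<in> (\<lambda>v. (v, grad \<Omega> v)) ` H10 \<Omega>" using v by (rule imageI)
  then have g: "(v, grad \<Omega> v) \<in> weak_gradient_graph \<Omega>" "(v, grad \<Omega> v) \<in> closure (test_graph \<Omega>)"
    unfolding H10_graph[OF \<Omega>] by (rule IntD1, rule IntD2)
  have "T (v, grad \<Omega> v) \<in> weak_gradient_graph \<Omega>"
    using g(1) weak_gradient_L2_map[OF L] by (simp add: weak_gradient_graph_def T_def)
  moreover have "T (v, grad \<Omega> v) \<in> closure (test_graph \<Omega>)" using cl imageI[OF g(2), of T] by (rule subsetD)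
  ultimately have "T (v, grad \<Omega> v) \<in> (\<lambda>v. (v, grad \<Omega> v)) ` H10 \<Omega>" unfolding H10_graph[OF \<Omega>] by (rule IntI)
  then show "L2_map L v \<in> H10 \<Omega>" "grad \<Omega> (L2_map L v) = L2_map (vec_map L) (grad \<Omega> v)"
    by (auto simp: T_def)
qed

definition real_part_pair :: "('a::euclidean_space, complex) L2 \<Rightarrow> ('a, real) L2 \<times> ('a, real) L2" where
  "real_part_pair v = (L2_map Re v, L2_map Im v)"

definition complex_of_pair :: "('a::euclidean_space, real) L2 \<times> ('a, real) L2 \<Rightarrow> ('a, complex) L2" where
  "complex_of_pair p = L2_map complex_of_real (fst p) + L2_map (\<lambda>r. \<i> * complex_of_real r) (snd p)"

definition vec_pair :: "('a::euclidean_space, complex^'n) L2 \<Rightarrow> ('a, real^'n) L2 \<times> ('a, real^'n) L2" where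
  "vec_pair v = (L2_map (vec_map Re) v, L2_map (vec_map Im) v)"

lemma bounded_linear_i_of_real: "bounded_linear (\<lambda>r. \<i> * complex_of_real r)"
  by (rule bounded_linear_compose[OF bounded_linear_mult_right bounded_linear_of_real])

lemmas cplx_linear = bounded_linear_Re bounded_linear_Im bounded_linear_of_real bounded_linear_i_of_real

lemma complex_of_real_part_pair: "complex_of_pair (real_part_pair v) = v"
proof -
  have "complex_of_pair (real_part_pair v) = L2_map (\<lambda>z. complex_of_real (Re z)) v + L2_map (\<lambda>z. \<i> * complex_of_real (Im z)) v"
    by (simp add: complex_of_pair_def real_part_pair_def L2_map_L2_map cplx_linear)
  also have "\<dots> = L2_map (\<lambda>z. complex_of_real (Re z) + \<i> * complex_of_real (Im z)) v"
    by (rule L2_map_add_fun[symmetric])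
      (rule bounded_linear_compose[OF bounded_linear_of_real bounded_linear_Re] bounded_linear_compose[OF bounded_linear_i_of_real bounded_linear_Im])+
  also have "\<dots> = v" by (simp add: complex_eq[symmetric] L2_map_ident)
  finally show ?thesis .
qed

lemma L2_map_zero: "L2_map (\<lambda>y. 0) v = 0"
  by (simp add: L2_map_def abs_L2_zero)

lemma real_part_pair_of_complex: "real_part_pair (complex_of_pair p) = p"
proof -
  note add = linear_add[OF bounded_linear.linear[OF bounded_linear_L2_map]]
  show ?thesis
    by (simp add: complex_of_pair_def real_part_pair_def add cplx_linear L2_map_L2_map L2_map_ident L2_map_zero)
qed

lemma inner_real_part_pair: "real_part_pair v \<bullet> real_part_pair w = v \<bullet> w"
proof -
  note sq = sq_integrable_linear[OF bounded_linear_Re sq_integrable_rep_L2] sq_integrable_linear[OF bounded_linear_Im sq_integrable_rep_L2]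
  have "v \<bullet> w = (\<integral>x. Re (rep_L2 v x) \<bullet> Re (rep_L2 w x) + Im (rep_L2 v x) \<bullet> Im (rep_L2 w x) \<partial>lborel)"
    using inner_abs_L2[OF sq_integrable_rep_L2 sq_integrable_rep_L2, of v w] by (simp add: abs_rep_L2 inner_complex_def)
  also have "\<dots> = real_part_pair v \<bullet> real_part_pair w"
    by (simp only: real_part_pair_def inner_prod_def fst_conv snd_conv L2_map_def inner_abs_L2[OF sq(1) sq(1)] inner_abs_L2[OF sq(2) sq(2)]
        Bochner_Integration.integral_add[OF sq_integrable_inner[OF sq(1) sq(1)] sq_integrable_inner[OF sq(2) sq(2)]])
  finally show ?thesis ..
qed

lemma inner_vec_pair: "vec_pair v \<bullet> vec_pair w = v \<bullet> w"
proof -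
  note sq = sq_integrable_linear[OF bounded_linear_vec_map[OF bounded_linear_Re] sq_integrable_rep_L2]
    sq_integrable_linear[OF bounded_linear_vec_map[OF bounded_linear_Im] sq_integrable_rep_L2]
  have "a \<bullet> b = vec_map Re a \<bullet> vec_map Re b + vec_map Im a \<bullet> vec_map Im b" for a b :: "complex^'b"
    by (simp add: inner_vec_def vec_map_nth inner_complex_def sum.distrib)
  then have "v \<bullet> w = (\<integral>x. vec_map Re (rep_L2 v x) \<bullet> vec_map Re (rep_L2 w x) + vec_map Im (rep_L2 v x) \<bullet> vec_map Im (rep_L2 w x) \<partial>lborel)"
    using inner_abs_L2[OF sq_integrable_rep_L2 sq_integrable_rep_L2, of v w] by (simp add: abs_rep_L2)
  also have "\<dots> = vec_pair v \<bullet> vec_pair w"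
    by (simp only: vec_pair_def inner_prod_def fst_conv snd_conv L2_map_def inner_abs_L2[OF sq(1) sq(1)] inner_abs_L2[OF sq(2) sq(2)]
        Bochner_Integration.integral_add[OF sq_integrable_inner[OF sq(1) sq(1)] sq_integrable_inner[OF sq(2) sq(2)]])
  finally show ?thesis ..
qed

lemma norm_real_part_pair: "norm (real_part_pair v) = norm v" and norm_vec_pair: "norm (vec_pair w) = norm w"
  by (simp_all only: norm_eq_sqrt_inner inner_real_part_pair inner_vec_pair)

lemma bounded_linear_cmult: "bounded_linear (\<lambda>z::complex. c * z)"
  by (rule bounded_linear_mult_right)

text \<open>The correspondence between complex-valued functions and pairs respects multiplication by complex
  numbers; by \<open>inner_real_part_pair\<close> it is also isometric.\<close>

lemma real_part_pair_cmult: "real_part_pair (L2_map (\<lambda>z. c * z) v) = cscale c (real_part_pair v)"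
proof -
  have lin: "bounded_linear (\<lambda>z. Re c *\<^sub>R Re z)" "bounded_linear (\<lambda>z. - Im c *\<^sub>R Im z)" "bounded_linear (\<lambda>z. Im c *\<^sub>R Re z)" "bounded_linear (\<lambda>z. Re c *\<^sub>R Im z)"
    by (rule bounded_linear_compose[OF bounded_linear_scaleR_right bounded_linear_Re]
        bounded_linear_compose[OF bounded_linear_scaleR_right bounded_linear_Im])+
  have sc: "L2_map (\<lambda>z. k *\<^sub>R T z) v = k *\<^sub>R L2_map T v" if T: "bounded_linear T" for k and T :: "complex \<Rightarrow> real"
    unfolding L2_map_def by (rule abs_L2_scaleR[OF sq_integrable_linear[OF T sq_integrable_rep_L2]])
  have min: "L2_map (\<lambda>z. Re c *\<^sub>R Re z - Im c *\<^sub>R Im z) v = Re c *\<^sub>R L2_map Re v - Im c *\<^sub>R L2_map Im v"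
    using L2_map_add_fun[OF lin(1,2), of v] sc[OF bounded_linear_Re, of "Re c"] sc[OF bounded_linear_Im, of "- Im c"] by simp
  have pls: "L2_map (\<lambda>z. Im c *\<^sub>R Re z + Re c *\<^sub>R Im z) v = Im c *\<^sub>R L2_map Re v + Re c *\<^sub>R L2_map Im v"
    using L2_map_add_fun[OF lin(3,4), of v] sc[OF bounded_linear_Re, of "Im c"] sc[OF bounded_linear_Im, of "Re c"] by simp
  have "(\<lambda>z. Re (c * z)) = (\<lambda>z. Re c *\<^sub>R Re z - Im c *\<^sub>R Im z)" "(\<lambda>z. Im (c * z)) = (\<lambda>z. Im c *\<^sub>R Re z + Re c *\<^sub>R Im z)"
    by (simp_all add: fun_eq_iff)
  then show ?thesis
    unfolding real_part_pair_def cscale_def L2_map_L2_map[OF bounded_linear_Re bounded_linear_cmult]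
      L2_map_L2_map[OF bounded_linear_Im bounded_linear_cmult] by (simp only: fst_conv snd_conv min pls)
qed

lemma Re_cinner_L2: "Re (cinner_L2 v w) = v \<bullet> w"
  and cinner_L2_cmult: "cinner_L2 (L2_map (\<lambda>z. c * z) v) w = c * cinner_L2 v w"
proof -
  have m [measurable]: "rep_L2 u \<in> borel_measurable lborel" for u :: "('a, complex) L2"
    by (rule sq_integrable_measurable[OF sq_integrable_rep_L2])
  have [measurable]: "cnj \<in> borel_measurable borel" by (intro borel_measurable_continuous_onI continuous_intros)
  have "integrable lborel (\<lambda>x. norm (rep_L2 v x) \<bullet> norm (rep_L2 w x))"
    by (rule sq_integrable_inner) (use sq_integrable_rep_L2[of v] sq_integrable_rep_L2[of w] in \<open>simp_all add: sq_integrable_def\<close>)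
  then have i: "integrable lborel (\<lambda>x. rep_L2 v x * cnj (rep_L2 w x))"
    by (rule Bochner_Integration.integrable_bound) (measurable, simp add: norm_mult)
  have "Re (cinner_L2 v w) = (\<integral>x. Re (rep_L2 v x * cnj (rep_L2 w x)) \<partial>lborel)"
    unfolding cinner_L2_def by (rule integral_bounded_linear[OF bounded_linear_Re i, symmetric])
  also have "\<dots> = v \<bullet> w"
    using inner_abs_L2[OF sq_integrable_rep_L2 sq_integrable_rep_L2, of v w] by (simp add: abs_rep_L2 inner_complex_def)
  finally show "Re (cinner_L2 v w) = v \<bullet> w" .
  have "cinner_L2 (L2_map (\<lambda>z. c * z) v) w = (\<integral>x. c * (rep_L2 v x * cnj (rep_L2 w x)) \<partial>lborel)"
    unfolding cinner_L2_def
    by (rule integral_cong_AE) (measurable, use rep_L2_map[OF bounded_linear_cmult, of c v] in eventually_elim, simp)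
  then show "cinner_L2 (L2_map (\<lambda>z. c * z) v) w = c * cinner_L2 v w" by (simp add: cinner_L2_def)
qed

lemma Re_cinner_L2_vec: "Re (cinner_L2_vec V W) = V \<bullet> W"
  and cinner_L2_vec_cmult: "cinner_L2_vec (L2_map (vec_map (\<lambda>z. c * z)) V) W = c * cinner_L2_vec V W"
proof -
  have nth: "sq_integrable (\<lambda>x. rep_L2 U x $ i)" for U :: "('a, complex^'b) L2" and i
    by (rule sq_integrable_linear[OF bounded_linear_vec_nth sq_integrable_rep_L2])
  have m [measurable]: "(\<lambda>x. rep_L2 u x $ i) \<in> borel_measurable lborel" for u :: "('a, complex^'b) L2" and i
    by (rule sq_integrable_measurable[OF nth])
  have [measurable]: "cnj \<in> borel_measurable borel" by (intro borel_measurable_continuous_onI continuous_intros)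
  have "integrable lborel (\<lambda>x. rep_L2 V x $ i * cnj (rep_L2 W x $ i))" for i
  proof -
    have "integrable lborel (\<lambda>x. norm (rep_L2 V x $ i) \<bullet> norm (rep_L2 W x $ i))"
      by (rule sq_integrable_inner) (use nth[of V i] nth[of W i] in \<open>simp_all add: sq_integrable_def\<close>)
    then show ?thesis by (rule Bochner_Integration.integrable_bound) (measurable, simp add: norm_mult)
  qed
  then have i: "integrable lborel (\<lambda>x. \<Sum>i\<in>UNIV. rep_L2 V x $ i * cnj (rep_L2 W x $ i))" by (rule Bochner_Integration.integrable_sum)
  have "Re (cinner_L2_vec V W) = (\<integral>x. Re (\<Sum>i\<in>UNIV. rep_L2 V x $ i * cnj (rep_L2 W x $ i)) \<partial>lborel)"
    unfolding cinner_L2_vec_def by (rule integral_bounded_linear[OF bounded_linear_Re i, symmetric])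
  also have "\<dots> = V \<bullet> W"
    using inner_abs_L2[OF sq_integrable_rep_L2 sq_integrable_rep_L2, of V W]
    by (simp add: abs_rep_L2 inner_complex_def inner_vec_def)
  finally show "Re (cinner_L2_vec V W) = V \<bullet> W" .
  have "cinner_L2_vec (L2_map (vec_map (\<lambda>z. c * z)) V) W = (\<integral>x. c * (\<Sum>i\<in>UNIV. rep_L2 V x $ i * cnj (rep_L2 W x $ i)) \<partial>lborel)"
    unfolding cinner_L2_vec_def
    by (rule integral_cong_AE)
      (measurable, use rep_L2_map[OF bounded_linear_vec_map[OF bounded_linear_cmult], of c V] in eventually_elim,
        simp add: vec_map_nth sum_distrib_left mult.assoc)
  then show "cinner_L2_vec (L2_map (vec_map (\<lambda>z. c * z)) V) W = c * cinner_L2_vec V W" by (simp add: cinner_L2_vec_def)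
qed

section \<open>Polyhedral domains and the adjoint problem\<close>

locale polyhedral_domain =
  fixes \<Omega> :: "(real^'n) set"
  assumes polyhedron: "lipschitz_polyhedron \<Omega>"
begin

lemma open_domain: "open \<Omega>" and bounded_domain: "bounded \<Omega>"
  using polyhedron by (simp_all add: lipschitz_polyhedron_def)

end

sublocale polyhedral_domain \<subseteq> wave_space "H10 \<Omega> :: (real^'n, real) L2 set" "grad \<Omega>"
  by unfold_locales (rule H10_linear[OF open_domain] H10_closed_graph[OF open_domain] H10_poincare[OF open_domain bounded_domain] | assumption)+

context polyhedral_domain
begin

lemma real_part_pair_H10:
  assumes "v \<in> H10 \<Omega>"
  shows "real_part_pair v \<in> H10 \<Omega> \<times> H10 \<Omega>" "D2 (real_part_pair v) = vec_pair (grad \<Omega> v)"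
  using H10_L2_map[OF open_domain bounded_linear_Re assms] H10_L2_map[OF open_domain bounded_linear_Im assms]
  by (simp_all add: real_part_pair_def vec_pair_def D2_def)

lemma complex_of_pair_H10:
  assumes "p \<in> H10 \<Omega> \<times> H10 \<Omega>" shows "complex_of_pair p \<in> H10 \<Omega>"
proof -
  have "fst p \<in> H10 \<Omega>" "snd p \<in> H10 \<Omega>" using assms by auto
  then show ?thesis unfolding complex_of_pair_def
    by (intro subspace_add[OF H10_linear(1)[OF open_domain]] H10_L2_map(1)[OF open_domain] cplx_linear)
qed

text \<open>Only real parts correspond; imaginary parts are recovered by \<open>helmholtz_form_cmult\<close>.\<close>

lemma Re_helmholtz_form:
  assumes "w \<in> H10 \<Omega>" "\<phi> \<in> H10 \<Omega>"
  shows "Re (helmholtz_form \<Omega> s w \<phi>) = b_form s (real_part_pair w) (real_part_pair \<phi>)"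
proof -
  have "Re (s\<^sup>2 * cinner_L2 w \<phi>) = cscale (s\<^sup>2) (real_part_pair w) \<bullet> real_part_pair \<phi>"
    by (simp only: cinner_L2_cmult[symmetric] Re_cinner_L2 inner_real_part_pair[symmetric] real_part_pair_cmult)
  moreover have "Re (cinner_L2_vec (grad \<Omega> w) (grad \<Omega> \<phi>)) = D2 (real_part_pair w) \<bullet> D2 (real_part_pair \<phi>)"
    by (simp only: Re_cinner_L2_vec real_part_pair_H10(2)[OF assms(1)] real_part_pair_H10(2)[OF assms(2)] inner_vec_pair)
  ultimately show ?thesis by (simp only: helmholtz_form_def b_form_def plus_complex.sel)
qed

lemma helmholtz_form_cmult:
  assumes "w \<in> H10 \<Omega>"
  shows "L2_map (\<lambda>z. c * z) w \<in> H10 \<Omega>" "helmholtz_form \<Omega> s (L2_map (\<lambda>z. c * z) w) \<phi> = c * helmholtz_form \<Omega> s w \<phi>"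
  using H10_L2_map[OF open_domain bounded_linear_cmult assms]
  by (simp_all add: helmholtz_form_def cinner_L2_cmult cinner_L2_vec_cmult distrib_left mult.left_commute)

lemma complex_eqI_Re: "(\<And>c. Re (c * x) = Re (c * y)) \<Longrightarrow> x = (y :: complex)"
proof (rule complex_eqI)
  assume "\<And>c. Re (c * x) = Re (c * y)"
  from this[of 1] this[of "- \<i>"] show "Re x = Re y" "Im x = Im y" by simp_all
qed

text \<open>A complex number is determined by the real parts of its complex multiples, and the space of test
  functions is closed under complex multiplication.\<close>

lemma adjoint_equation_iff:
  assumes \<phi>: "\<phi> \<in> H10 \<Omega>"
  shows "(\<forall>w\<in>H10 \<Omega>. helmholtz_form \<Omega> s w \<phi> = of_real ((cmod s)\<^sup>2) * cinner_L2 w g)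
    \<longleftrightarrow> (\<forall>w\<in>H10 \<Omega> \<times> H10 \<Omega>. b_form s w (real_part_pair \<phi>) = (cmod s)\<^sup>2 * (w \<bullet> real_part_pair g))"
    (is "?L \<longleftrightarrow> ?R")
proof
  have Re_rhs: "Re (of_real ((cmod s)\<^sup>2) * cinner_L2 w g) = (cmod s)\<^sup>2 * (real_part_pair w \<bullet> real_part_pair g)" for w
    by (simp add: inner_real_part_pair Re_cinner_L2 flip: of_real_power)
  {
    assume L: ?L
    show ?R
    proof
      fix p :: "(real^'n, real) L2 \<times> (real^'n, real) L2" assume "p \<in> H10 \<Omega> \<times> H10 \<Omega>"
      then have w: "complex_of_pair p \<in> H10 \<Omega>" by (rule complex_of_pair_H10)
      show "b_form s p (real_part_pair \<phi>) = (cmod s)\<^sup>2 * (p \<bullet> real_part_pair g)"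
        using arg_cong[OF bspec[OF L w], of Re] unfolding Re_helmholtz_form[OF w \<phi>] Re_rhs real_part_pair_of_complex .
    qed
  }
  assume R: ?R
  show ?L
  proof
    fix w :: "(real^'n, complex) L2" assume w: "w \<in> H10 \<Omega>"
    have Re: "Re (helmholtz_form \<Omega> s w' \<phi>) = Re (of_real ((cmod s)\<^sup>2) * cinner_L2 w' g)" if w': "w' \<in> H10 \<Omega>" for w'
      unfolding Re_helmholtz_form[OF w' \<phi>] Re_rhs by (rule bspec[OF R real_part_pair_H10(1)[OF w']])
    show "helmholtz_form \<Omega> s w \<phi> = of_real ((cmod s)\<^sup>2) * cinner_L2 w g"
    proof (rule complex_eqI_Re)
      fix c
      show "Re (c * helmholtz_form \<Omega> s w \<phi>) = Re (c * (of_real ((cmod s)\<^sup>2) * cinner_L2 w g))"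
        using Re[OF helmholtz_form_cmult(1)[OF w, of c]]
        unfolding helmholtz_form_cmult(2)[OF w] cinner_L2_cmult by (simp only: mult.left_commute)
    qed
  qed
qed

text \<open>Uniqueness in the real formulation makes the definite description denote the solution.\<close>

lemma adjoint_solution_eq:
  assumes s: "0 < Re s" and p: "p \<in> H10 \<Omega> \<times> H10 \<Omega>"
    and eq: "\<And>w. w \<in> H10 \<Omega> \<times> H10 \<Omega> \<Longrightarrow> b_form s w p = (cmod s)\<^sup>2 * (w \<bullet> real_part_pair g)"
  shows "adjoint_solution \<Omega> s g = complex_of_pair p"
  unfolding adjoint_solution_def
proof (rule the_equality)
  show "complex_of_pair p \<in> H10 \<Omega> \<and>
    (\<forall>w\<in>H10 \<Omega>. helmholtz_form \<Omega> s w (complex_of_pair p) = of_real ((cmod s)\<^sup>2) * cinner_L2 w g)"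
    unfolding adjoint_equation_iff[OF complex_of_pair_H10[OF p]] real_part_pair_of_complex
    using complex_of_pair_H10[OF p] eq by blast
next
  fix \<phi> :: "(real^'n, complex) L2"
  assume *: "\<phi> \<in> H10 \<Omega> \<and> (\<forall>w\<in>H10 \<Omega>. helmholtz_form \<Omega> s w \<phi> = of_real ((cmod s)\<^sup>2) * cinner_L2 w g)"
  then have \<phi>: "\<phi> \<in> H10 \<Omega>" ..
  have eq': "\<forall>w\<in>H10 \<Omega> \<times> H10 \<Omega>. b_form s w (real_part_pair \<phi>) = (cmod s)\<^sup>2 * (w \<bullet> real_part_pair g)"
    using * unfolding adjoint_equation_iff[OF \<phi>, symmetric] ..
  have "real_part_pair \<phi> = p"
    by (rule adjoint_unique[OF s real_part_pair_H10(1)[OF \<phi>] p]) (simp add: eq bspec[OF eq'])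
  then show "\<phi> = complex_of_pair p" by (metis complex_of_real_part_pair)
qed

end

section \<open>The finite element space\<close>

lemma poly_degree_le_add:
  assumes "poly_degree_le k p" "poly_degree_le k q" shows "poly_degree_le k (\<lambda>x. p x + q x)"
proof -
  from assms obtain c d where c: "p = (\<lambda>x. \<Sum>a | sum a UNIV \<le> k. (\<Prod>i\<in>UNIV. (x $ i) ^ a i) *\<^sub>R c a)"
    and d: "q = (\<lambda>x. \<Sum>a | sum a UNIV \<le> k. (\<Prod>i\<in>UNIV. (x $ i) ^ a i) *\<^sub>R d a)" unfolding poly_degree_le_def by blast
  show ?thesis unfolding poly_degree_le_def c d
    by (rule exI[of _ "\<lambda>a. c a + d a"]) (simp add: scaleR_add_right sum.distrib)
qed

lemma poly_degree_le_linear: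
  assumes L: "linear L" and p: "poly_degree_le k p" shows "poly_degree_le k (\<lambda>x. L (p x))"
proof -
  from p obtain c where c: "p = (\<lambda>x. \<Sum>a | sum a UNIV \<le> k. (\<Prod>i\<in>UNIV. (x $ i) ^ a i) *\<^sub>R c a)"
    unfolding poly_degree_le_def by blast
  show ?thesis unfolding poly_degree_le_def c
    by (rule exI[of _ "\<lambda>a. L (c a)"]) (simp add: linear_sum[OF L] linear_scale[OF L])
qed

lemma poly_degree_le_zero: "poly_degree_le k (\<lambda>x. 0)"
  unfolding poly_degree_le_def by (rule exI[of _ "\<lambda>a. 0"]) simp

lemma FE_spaceE:
  assumes "bounded \<Omega>" and v: "v \<in> FE_space \<Omega> \<T> k"
  obtains g where "continuous_on UNIV g" "\<forall>x. x \<notin> \<Omega> \<longrightarrow> g x = 0" "sq_integrable g" "v = abs_L2 g"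
    "\<forall>T\<in>\<T>. \<exists>p. poly_degree_le k p \<and> (\<forall>x\<in>T. g x = p x)"
proof -
  from v obtain g where g: "continuous_on UNIV g" "\<forall>x. x \<notin> \<Omega> \<longrightarrow> g x = 0"
    "\<forall>T\<in>\<T>. \<exists>p. poly_degree_le k p \<and> (\<forall>x\<in>T. g x = p x)" "v = abs_L2 g" unfolding FE_space_def by blast
  have "{x. g x \<noteq> 0} \<subseteq> closure \<Omega>" using g(2) closure_subset by blast
  then have "sq_integrable g" using assms(1) g(1) by (intro sq_integrable_compact_support[where K = "closure \<Omega>"]) auto
  with g show thesis using that[of g] by blast
qed

lemma FE_space_subset: "FE_space \<Omega> \<T> k \<subseteq> H10 \<Omega>"
  by (auto simp: FE_space_def)

text \<open>Gives real and imaginary parts of complex finite element functions, and closure under scaling.\<close>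

lemma FE_space_L2_map:
  fixes L :: "'b::euclidean_space \<Rightarrow> 'c::euclidean_space"
  assumes \<Omega>: "open \<Omega>" "bounded \<Omega>" and L: "bounded_linear L" and v: "v \<in> FE_space \<Omega> \<T> k"
  shows "L2_map L v \<in> FE_space \<Omega> \<T> k"
proof -
  obtain g where g: "continuous_on UNIV g" "\<forall>x. x \<notin> \<Omega> \<longrightarrow> g x = 0" "sq_integrable g" "v = abs_L2 g"
    "\<forall>T\<in>\<T>. \<exists>p. poly_degree_le k p \<and> (\<forall>x\<in>T. g x = p x)" by (rule FE_spaceE[OF \<Omega>(2) v])
  have "L2_map L v \<in> H10 \<Omega>" by (rule H10_L2_map(1)[OF \<Omega>(1) L subsetD[OF FE_space_subset v]])
  moreover have "continuous_on UNIV (\<lambda>x. L (g x))" by (rule bounded_linear.continuous_on[OF L g(1)])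
  moreover have "\<forall>x. x \<notin> \<Omega> \<longrightarrow> L (g x) = 0" using g(2) by (simp add: linear_0[OF bounded_linear.linear[OF L]])
  moreover have "\<exists>p. poly_degree_le k p \<and> (\<forall>x\<in>T. L (g x) = p x)" if T: "T \<in> \<T>" for T
  proof -
    from bspec[OF g(5) T] obtain p where p: "poly_degree_le k p" "\<forall>x\<in>T. g x = p x" by blast
    show ?thesis by (rule exI[of _ "\<lambda>x. L (p x)"]) (simp add: p(2) poly_degree_le_linear[OF bounded_linear.linear[OF L] p(1)])
  qed
  moreover have "L2_map L v = abs_L2 (\<lambda>x. L (g x))" unfolding g(4) by (rule L2_map_abs[OF L g(3)])
  ultimately show ?thesis unfolding FE_space_def by blast
qed

lemma subspace_FE_space:
  fixes \<Omega> :: "(real^'n) set"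
  assumes \<Omega>: "open \<Omega>" "bounded \<Omega>"
  shows "subspace (FE_space \<Omega> \<T> k :: (real^'n, 'b::euclidean_space) L2 set)"
proof (rule subspaceI)
  have "poly_degree_le k (\<lambda>x :: real^'n. 0 :: 'b)" by (rule poly_degree_le_zero)
  then show "(0 :: (real^'n, 'b) L2) \<in> FE_space \<Omega> \<T> k" unfolding FE_space_def
    using subspace_0[OF H10_linear(1)[OF \<Omega>(1)]] by (intro CollectI conjI exI[of _ "\<lambda>x. 0"]) (auto simp: abs_L2_zero)
next
  fix v w :: "(real^'n, 'b) L2" assume v: "v \<in> FE_space \<Omega> \<T> k" and w: "w \<in> FE_space \<Omega> \<T> k"
  obtain g where g: "continuous_on UNIV g" "\<forall>x. x \<notin> \<Omega> \<longrightarrow> g x = 0" "sq_integrable g" "v = abs_L2 g"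
    "\<forall>T\<in>\<T>. \<exists>p. poly_degree_le k p \<and> (\<forall>x\<in>T. g x = p x)" by (rule FE_spaceE[OF \<Omega>(2) v])
  obtain h where h: "continuous_on UNIV h" "\<forall>x. x \<notin> \<Omega> \<longrightarrow> h x = 0" "sq_integrable h" "w = abs_L2 h"
    "\<forall>T\<in>\<T>. \<exists>p. poly_degree_le k p \<and> (\<forall>x\<in>T. h x = p x)" by (rule FE_spaceE[OF \<Omega>(2) w])
  have "v + w \<in> H10 \<Omega>"
    by (rule subspace_add[OF H10_linear(1)[OF \<Omega>(1)] subsetD[OF FE_space_subset v] subsetD[OF FE_space_subset w]])
  moreover have "continuous_on UNIV (\<lambda>x. g x + h x)" using g(1) h(1) by (rule continuous_on_add)
  moreover have "\<forall>x. x \<notin> \<Omega> \<longrightarrow> g x + h x = 0" using g(2) h(2) by simp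
  moreover have "\<exists>p. poly_degree_le k p \<and> (\<forall>x\<in>T. g x + h x = p x)" if T: "T \<in> \<T>" for T
  proof -
    from bspec[OF g(5) T] obtain p where p: "poly_degree_le k p" "\<forall>x\<in>T. g x = p x" by blast
    from bspec[OF h(5) T] obtain q where q: "poly_degree_le k q" "\<forall>x\<in>T. h x = q x" by blast
    show ?thesis by (rule exI[of _ "\<lambda>x. p x + q x"]) (simp add: p(2) q(2) poly_degree_le_add[OF p(1) q(1)])
  qed
  moreover have "v + w = abs_L2 (\<lambda>x. g x + h x)" unfolding g(4) h(4) by (rule abs_L2_add[OF g(3) h(3), symmetric])
  ultimately show "v + w \<in> FE_space \<Omega> \<T> k" unfolding FE_space_def by blast
next
  fix c and v :: "(real^'n, 'b) L2" assume v: "v \<in> FE_space \<Omega> \<T> k"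
  have "L2_map (\<lambda>y. c *\<^sub>R y) v = c *\<^sub>R v"
    by (simp add: L2_map_def abs_L2_scaleR[OF sq_integrable_rep_L2] abs_rep_L2)
  then show "c *\<^sub>R v \<in> FE_space \<Omega> \<T> k" using FE_space_L2_map[OF \<Omega> bounded_linear_scaleR_right v, of c] by simp
qed

section \<open>The approximation factor\<close>

context polyhedral_domain
begin

lemma complex_adjoint:
  assumes s: "0 < Re s"
  obtains p where "p \<in> H10 \<Omega> \<times> H10 \<Omega>" "adjoint_solution \<Omega> s g = complex_of_pair p"
    "\<And>w. w \<in> H10 \<Omega> \<times> H10 \<Omega> \<Longrightarrow> b_form s w p = (cmod s)\<^sup>2 * (w \<bullet> real_part_pair g)"
proof -
  from adjoint_exists[OF s, of "real_part_pair g"] obtain p where p: "p \<in> H10 \<Omega> \<times> H10 \<Omega>"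
    "\<forall>w\<in>H10 \<Omega> \<times> H10 \<Omega>. b_form s w p = (cmod s)\<^sup>2 * (w \<bullet> real_part_pair g)" ..
  show thesis by (rule that[OF p(1) adjoint_solution_eq[OF s p(1)]]) (simp_all add: bspec[OF p(2)])
qed

lemma norm_grad_complex_of_pair_diff:
  assumes p: "p \<in> H10 \<Omega> \<times> H10 \<Omega>" and v: "v \<in> H10 \<Omega>"
  shows "norm (grad \<Omega> (complex_of_pair p - v)) = norm (D2 (p - real_part_pair v))"
proof -
  note cp = complex_of_pair_H10[OF p]
  have d: "complex_of_pair p - v \<in> H10 \<Omega>" by (rule subspace_diff[OF H10_linear(1)[OF open_domain] cp v])
  have "real_part_pair (complex_of_pair p - v) = p - real_part_pair v"
    using linear_diff[OF bounded_linear.linear[OF bounded_linear_L2_map[OF bounded_linear_Re]], of "complex_of_pair p" v]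
      linear_diff[OF bounded_linear.linear[OF bounded_linear_L2_map[OF bounded_linear_Im]], of "complex_of_pair p" v]
      real_part_pair_of_complex[of p]
    by (simp add: real_part_pair_def prod_eq_iff)
  then show ?thesis using real_part_pair_H10(2)[OF d] norm_vec_pair[of "grad \<Omega> (complex_of_pair p - v)"] by simp
qed

text \<open>The approximation by 0 is admissible, and stability bounds the gradient of the adjoint solution.\<close>

lemma approx_factor_le:
  assumes s: "0 < Re s"
  shows "approx_factor \<Omega> \<T> k s \<le> ennreal (cmod s / (2 * Re s))"
  unfolding approx_factor_def
proof (rule SUP_least)
  fix g :: "(real^'n, complex) L2" assume "g \<in> {g \<in> L2_on \<Omega>. cmod s * norm g = 1}"
  then have g: "cmod s * norm (real_part_pair g) = 1" by (simp add: norm_real_part_pair)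
  obtain p where p: "p \<in> H10 \<Omega> \<times> H10 \<Omega>" "adjoint_solution \<Omega> s g = complex_of_pair p"
    "\<And>w. w \<in> H10 \<Omega> \<times> H10 \<Omega> \<Longrightarrow> b_form s w p = (cmod s)\<^sup>2 * (w \<bullet> real_part_pair g)"
    by (rule complex_adjoint[OF s, of g]) (simp only:)
  have 0: "0 \<in> FE_space \<Omega> \<T> k" "0 \<in> H10 \<Omega>"
    by (rule subspace_0[OF subspace_FE_space[OF open_domain bounded_domain]] subspace_0[OF H10_linear(1)[OF open_domain]])+
  have "real_part_pair (0 :: (real^'n, complex) L2) = 0"
    using norm_real_part_pair[of "0 :: (real^'n, complex) L2"] by simp
  then have "norm (grad \<Omega> (complex_of_pair p - 0)) = norm (D2 p)"
    using norm_grad_complex_of_pair_diff[OF p(1) 0(2)] by simp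
  then have "norm (grad \<Omega> (adjoint_solution \<Omega> s g - 0)) \<le> cmod s / (2 * Re s)"
    using adjoint_stability(2)[OF s p(1,3) g] unfolding p(2) by simp
  then show "(INF v\<in>FE_space \<Omega> \<T> k. ennreal (norm (grad \<Omega> (adjoint_solution \<Omega> s g - v)))) \<le> ennreal (cmod s / (2 * Re s))"
    by (intro INF_lower2[OF 0(1)] ennreal_leI)
qed

text \<open>Finiteness allows the extended-real factor to be replaced by a real \<open>\<gamma>\<close>.\<close>

lemma approx_factor_cutoff_finite:
  assumes \<rho>: "0 < \<rho>" shows "approx_factor_cutoff \<Omega> \<T> k \<rho> \<omega> < \<infinity>"
proof -
  have "approx_factor_cutoff \<Omega> \<T> k \<rho> \<omega> \<le> ennreal ((\<rho> + \<bar>\<omega>\<bar>) / (2 * \<rho>))"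
    unfolding approx_factor_cutoff_def
  proof (rule SUP_least)
    fix \<nu> assume "\<nu> \<in> {-\<omega>..\<omega>}"
    then have "cmod (Complex \<rho> \<nu>) \<le> \<rho> + \<bar>\<omega>\<bar>" using cmod_le[of "Complex \<rho> \<nu>"] \<rho> by auto
    then have "cmod (Complex \<rho> \<nu>) / (2 * \<rho>) \<le> (\<rho> + \<bar>\<omega>\<bar>) / (2 * \<rho>)" using \<rho> by (intro divide_right_mono) simp_all
    then show "approx_factor \<Omega> \<T> k (Complex \<rho> \<nu>) \<le> ennreal ((\<rho> + \<bar>\<omega>\<bar>) / (2 * \<rho>))"
      using approx_factor_le[of "Complex \<rho> \<nu>" \<T> k] \<rho> by (simp add: ennreal_leI order_trans)
  qed
  then show ?thesis by (simp add: le_less_trans)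
qed

text \<open>The complexified datum is admissible in the supremum, and a value below the infimum plus \<open>\<epsilon>\<close> is
  attained by a finite element function, whose real and imaginary parts form the required pair.\<close>

lemma approximable_FE_space:
  assumes s: "0 < Re s" and \<gamma>: "0 \<le> \<gamma>" "approx_factor \<Omega> \<T> k s \<le> ennreal \<gamma>"
  shows "approximable (FE_space \<Omega> \<T> k) s \<gamma>"
  unfolding approximable_def
proof (intro ballI impI allI)
  fix g p :: "(real^'n, real) L2 \<times> (real^'n, real) L2" and \<epsilon> :: real
  assume g: "g \<in> H10 \<Omega> \<times> H10 \<Omega>" and p: "p \<in> H10 \<Omega> \<times> H10 \<Omega>" and g1: "cmod s * norm g = 1"
    and eq: "\<forall>w\<in>H10 \<Omega> \<times> H10 \<Omega>. b_form s w p = (cmod s)\<^sup>2 * (w \<bullet> g)" and \<epsilon>: "0 < \<epsilon>"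
  define g' where "g' = complex_of_pair g"
  have rg: "real_part_pair g' = g" unfolding g'_def by (rule real_part_pair_of_complex)
  have "cmod s * norm g' = 1" using g1 unfolding norm_real_part_pair[of g', symmetric] rg .
  moreover have "g' \<in> L2_on \<Omega>"
    using H10_weak_gradient[OF open_domain complex_of_pair_H10[OF g]] unfolding g'_def weak_gradient_def by (rule conjunct1)
  ultimately have g': "g' \<in> {g \<in> L2_on \<Omega>. cmod s * norm g = 1}" by simp
  have adj: "adjoint_solution \<Omega> s g' = complex_of_pair p"
    by (rule adjoint_solution_eq[OF s p]) (simp add: rg bspec[OF eq])
  have "(INF v\<in>FE_space \<Omega> \<T> k. ennreal (norm (grad \<Omega> (adjoint_solution \<Omega> s g' - v)))) \<le> approx_factor \<Omega> \<T> k s"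
    unfolding approx_factor_def by (rule SUP_upper[OF g'])
  also have "\<dots> \<le> ennreal \<gamma>" by (rule \<gamma>(2))
  also have "\<dots> < ennreal (\<gamma> + \<epsilon>)" using \<gamma>(1) \<epsilon> by (simp add: ennreal_less_iff)
  finally obtain v where v: "v \<in> FE_space \<Omega> \<T> k" "ennreal (norm (grad \<Omega> (complex_of_pair p - v))) < ennreal (\<gamma> + \<epsilon>)"
    unfolding INF_less_iff adj by blast
  have "norm (D2 (p - real_part_pair v)) \<le> \<gamma> + \<epsilon>"
    using v(2) unfolding norm_grad_complex_of_pair_diff[OF p subsetD[OF FE_space_subset v(1)]]
    by (simp add: ennreal_less_iff)
  moreover have "real_part_pair v \<in> FE_space \<Omega> \<T> k \<times> FE_space \<Omega> \<T> k"
    using FE_space_L2_map[OF open_domain bounded_domain bounded_linear_Re v(1)]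
      FE_space_L2_map[OF open_domain bounded_domain bounded_linear_Im v(1)] by (simp add: real_part_pair_def)
  ultimately show "\<exists>v\<in>FE_space \<Omega> \<T> k \<times> FE_space \<Omega> \<T> k. norm (D2 (p - v)) \<le> \<gamma> + \<epsilon>" by (rule bexI)
qed

end

section \<open>Piecewise polynomials in time\<close>

text \<open>On the cell \<open>[n \<tau>, (n + 1) \<tau>)\<close> this is the polynomial of degree at most 4 whose \<open>j\<close>-th derivative at
  the left end is \<open>c j n\<close>. Cells at negative times are included, so that the node 0 is like any other.\<close>

definition broken_poly :: "real \<Rightarrow> (nat \<Rightarrow> int \<Rightarrow> 'v::real_vector) \<Rightarrow> real \<Rightarrow> 'v" where
  "broken_poly \<tau> c t = (\<Sum>j\<le>4. ((t - of_int \<lfloor>t / \<tau>\<rfloor> * \<tau>) ^ j / fact j) *\<^sub>R c j \<lfloor>t / \<tau>\<rfloor>)"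

definition shift_coeff :: "(nat \<Rightarrow> int \<Rightarrow> 'v::real_vector) \<Rightarrow> nat \<Rightarrow> int \<Rightarrow> 'v" where
  "shift_coeff c j n = (if j < 4 then c (Suc j) n else 0)"

definition time_nodes :: "real \<Rightarrow> real set" where
  "time_nodes \<tau> = range (\<lambda>n. of_int n * \<tau>)"

lemma taylor_piece_derivative:
  fixes c :: "nat \<Rightarrow> int \<Rightarrow> 'v::real_normed_vector"
  shows "((\<lambda>x. \<Sum>j\<le>4. ((x - a) ^ j / fact j) *\<^sub>R c j n) has_vector_derivative
    (\<Sum>j\<le>4. ((t - a) ^ j / fact j) *\<^sub>R shift_coeff c j n)) (at t within S)"
proof -
  have "((\<lambda>x. ((x - a) ^ Suc j / fact (Suc j)) *\<^sub>R c (Suc j) n) has_vector_derivative ((t - a) ^ j / fact j) *\<^sub>R c (Suc j) n) (at t within S)" for j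
  proof -
    have "((\<lambda>x. x - a) has_real_derivative 1) (at t within S)" by (auto intro!: derivative_eq_intros)
    from DERIV_power_Suc[OF this, of j]
    have "((\<lambda>x. (x - a) ^ Suc j) has_real_derivative real (Suc j) * (t - a) ^ j) (at t within S)" by simp
    from DERIV_cdivide[OF this, of "fact (Suc j)"]
    have "((\<lambda>x. (x - a) ^ Suc j / fact (Suc j)) has_real_derivative (t - a) ^ j / fact j) (at t within S)"
      by (rule back_subst[where P = "\<lambda>d. (_ has_real_derivative d) _"]) (simp add: divide_simps)
    from has_vector_derivative_scaleR[OF this has_vector_derivative_const, of "c (Suc j) n"] show ?thesis by (simp del: fact_Suc power_Suc)
  qed
  then have "((\<lambda>x. \<Sum>j\<le>3. ((x - a) ^ Suc j / fact (Suc j)) *\<^sub>R c (Suc j) n) has_vector_derivative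
      (\<Sum>j\<le>3. ((t - a) ^ j / fact j) *\<^sub>R c (Suc j) n)) (at t within S)"
    by (intro has_vector_derivative_sum)
  then have "((\<lambda>x. c 0 n + (\<Sum>j\<le>3. ((x - a) ^ Suc j / fact (Suc j)) *\<^sub>R c (Suc j) n)) has_vector_derivative
      0 + (\<Sum>j\<le>3. ((t - a) ^ j / fact j) *\<^sub>R c (Suc j) n)) (at t within S)"
    by (intro has_vector_derivative_add has_vector_derivative_const)
  moreover have "(\<Sum>j\<le>4. f j) = f 0 + (\<Sum>j\<le>3. f (Suc j))" for f :: "nat \<Rightarrow> 'v"
    using sum.atMost_Suc_shift[of f 3] by simp
  moreover have "(\<Sum>j\<le>4. ((t - a) ^ j / fact j) *\<^sub>R shift_coeff c j n) = (\<Sum>j\<le>3. ((t - a) ^ j / fact j) *\<^sub>R c (Suc j) n)"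
    using sum.atMost_Suc[of "\<lambda>j. ((t - a) ^ j / fact j) *\<^sub>R shift_coeff c j n" 3] by (simp add: shift_coeff_def)
  ultimately show ?thesis by simp
qed

lemma floor_cell:
  assumes \<tau>: "0 < (\<tau>::real)"
  shows "\<lfloor>t / \<tau>\<rfloor> = n \<longleftrightarrow> of_int n * \<tau> \<le> t \<and> t < (of_int n + 1) * \<tau>"
  using \<tau> by (simp add: floor_eq_iff field_simps)

lemma broken_poly_on_cell:
  assumes "0 < \<tau>" "of_int n * \<tau> \<le> t" "t < (of_int n + 1) * \<tau>"
  shows "broken_poly \<tau> c t = (\<Sum>j\<le>4. ((t - of_int n * \<tau>) ^ j / fact j) *\<^sub>R c j n)"
proof -
  have "\<lfloor>t / \<tau>\<rfloor> = n" using assms by (simp add: floor_cell)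
  then show ?thesis by (simp only: broken_poly_def)
qed

lemma broken_poly_at_node: "0 < \<tau> \<Longrightarrow> broken_poly \<tau> c (of_int n * \<tau>) = c 0 n"
  by (subst broken_poly_on_cell[where n = n]) (simp_all add: power_0_left if_distrib[of "\<lambda>x. x / _"] if_distrib[of "\<lambda>x. x *\<^sub>R _"] cong: if_cong)

lemma broken_poly_derivative_within:
  fixes c :: "nat \<Rightarrow> int \<Rightarrow> 'v::real_normed_vector"
  assumes \<tau>: "0 < \<tau>" and t: "of_int n * \<tau> \<le> t" "t < (of_int n + 1) * \<tau>"
  shows "(broken_poly \<tau> c has_vector_derivative broken_poly \<tau> (shift_coeff c) t) (at t within {of_int n * \<tau>..<(of_int n + 1) * \<tau>})"
  unfolding broken_poly_on_cell[OF \<tau> t, of "shift_coeff c"]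
  by (rule has_vector_derivative_transform[OF _ _ taylor_piece_derivative])
    (use t broken_poly_on_cell[OF \<tau>] in auto)

lemma broken_deriv_broken_poly:
  fixes c :: "nat \<Rightarrow> int \<Rightarrow> 'v::real_normed_vector"
  assumes \<tau>: "0 < \<tau>" shows "broken_deriv \<tau> (broken_poly \<tau> c) t = broken_poly \<tau> (shift_coeff c) t"
proof -
  define n where "n = \<lfloor>t / \<tau>\<rfloor>"
  have t: "of_int n * \<tau> \<le> t" "t < (of_int n + 1) * \<tau>" using floor_cell[OF \<tau>, of t n] by (simp_all add: n_def)
  have "t islimpt {t<..<(of_int n + 1) * \<tau>}" using t(2) by (simp add: islimpt_greaterThanLessThan1)
  then have "t islimpt {of_int n * \<tau>..<(of_int n + 1) * \<tau>}" by (rule islimpt_subset) (use t in auto)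
  then have "at t within {of_int n * \<tau>..<(of_int n + 1) * \<tau>} \<noteq> bot" by (simp add: trivial_limit_within)
  then show ?thesis unfolding broken_deriv_def Let_def n_def[symmetric]
    by (rule vector_derivative_within[OF _ broken_poly_derivative_within[OF \<tau> t]])
qed

lemma broken_poly_derivative:
  fixes c :: "nat \<Rightarrow> int \<Rightarrow> 'v::real_normed_vector"
  assumes \<tau>: "0 < \<tau>" and t: "t \<notin> time_nodes \<tau>"
  shows "(broken_poly \<tau> c has_vector_derivative broken_poly \<tau> (shift_coeff c) t) (at t)"
proof -
  define n where "n = \<lfloor>t / \<tau>\<rfloor>"
  have b: "of_int n * \<tau> \<le> t" "t < (of_int n + 1) * \<tau>" using floor_cell[OF \<tau>, of t n] by (simp_all add: n_def)
  moreover have "of_int n * \<tau> \<noteq> t" using t by (auto simp: time_nodes_def)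
  ultimately have "t \<in> interior {of_int n * \<tau>..<(of_int n + 1) * \<tau>}" by simp
  then show ?thesis using broken_poly_derivative_within[OF \<tau> b, of c] by (simp only: at_within_interior)
qed

lemma finite_time_nodes:
  assumes \<tau>: "0 < \<tau>" shows "finite (time_nodes \<tau> \<inter> {0..T})"
proof (rule finite_subset)
  show "time_nodes \<tau> \<inter> {0..T} \<subseteq> (\<lambda>n. of_int n * \<tau>) ` {0..\<lfloor>T / \<tau>\<rfloor>}"
    using \<tau> by (auto simp: time_nodes_def le_floor_iff field_simps zero_le_mult_iff intro!: imageI)
qed simp

text \<open>The hypothesis says that each piece, evaluated at the right end of its cell, is the initial value of
  the next one.\<close>

lemma broken_poly_continuous:
  fixes c :: "nat \<Rightarrow> int \<Rightarrow> 'v::real_normed_vector"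
  assumes \<tau>: "0 < \<tau>" and match: "\<And>n. c 0 (n + 1) = (\<Sum>j\<le>4. (\<tau> ^ j / fact j) *\<^sub>R c j n)"
  shows "continuous_on S (broken_poly \<tau> c)"
proof -
  have cell: "continuous_on {of_int n * \<tau>..(of_int n + 1) * \<tau>} (broken_poly \<tau> c)" for n
  proof (rule continuous_on_cong[THEN iffD1, OF refl])
    fix t assume t: "t \<in> {of_int n * \<tau>..(of_int n + 1) * \<tau>}"
    show "(\<Sum>j\<le>4. ((t - of_int n * \<tau>) ^ j / fact j) *\<^sub>R c j n) = broken_poly \<tau> c t"
    proof (cases "t = (of_int n + 1) * \<tau>")
      case True
      have "t - of_int n * \<tau> = \<tau>" unfolding True by (simp add: algebra_simps)
      moreover have "broken_poly \<tau> c t = c 0 (n + 1)" using broken_poly_at_node[OF \<tau>, of c "n + 1"] True by simp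
      ultimately show ?thesis by (simp only: match)
    next
      case False
      then show ?thesis using t broken_poly_on_cell[OF \<tau>, of n t c] by auto
    qed
  qed (intro continuous_intros, simp)
  have "isCont (broken_poly \<tau> c) t" for t
  proof -
    define n where "n = \<lfloor>t / \<tau>\<rfloor>"
    have t: "of_int n * \<tau> \<le> t" "t < (of_int n + 1) * \<tau>" using floor_cell[OF \<tau>, of t n] by (simp_all add: n_def)
    have "continuous_on ({of_int (n - 1) * \<tau>..(of_int (n - 1) + 1) * \<tau>} \<union> {of_int n * \<tau>..(of_int n + 1) * \<tau>}) (broken_poly \<tau> c)"
      by (rule continuous_on_closed_Un[OF closed_atLeastAtMost closed_atLeastAtMost cell cell])
    then have "continuous_on {of_int (n - 1) * \<tau><..<(of_int n + 1) * \<tau>} (broken_poly \<tau> c)"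
      by (rule continuous_on_subset) auto
    moreover have "of_int (n - 1) * \<tau> < t" using t(1) \<tau> by (simp add: algebra_simps)
    ultimately show ?thesis using t(2) by (auto simp: continuous_on_eq_continuous_at)
  qed
  then show ?thesis by (simp add: continuous_at_imp_continuous_on)
qed

text \<open>Bounded coefficients give a bounded function.\<close>

lemma broken_poly_transformable:
  fixes c :: "nat \<Rightarrow> int \<Rightarrow> 'v::{banach, second_countable_topology}"
  assumes \<tau>: "0 < \<tau>" and \<rho>: "0 < \<rho>" and bdd: "\<And>j. bounded (range (c j))"
  shows "transformable \<rho> (broken_poly \<tau> c)"
  unfolding transformable_def
proof
  have [measurable]: "(\<lambda>t. \<lfloor>t / \<tau>\<rfloor>) \<in> borel \<rightarrow>\<^sub>M count_space UNIV" by measurable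
  have "(\<lambda>t. c j \<lfloor>t / \<tau>\<rfloor>) \<in> borel_measurable borel" for j
    by (rule measurable_compose[of "\<lambda>t. \<lfloor>t / \<tau>\<rfloor>" borel "count_space UNIV"]) simp_all
  moreover have "(\<lambda>t. real_of_int \<lfloor>t / \<tau>\<rfloor>) \<in> borel_measurable borel" by measurable
  ultimately show "(\<lambda>t. indicator {0..} t *\<^sub>R broken_poly \<tau> c t) \<in> borel_measurable borel"
    unfolding broken_poly_def by measurable
  have "\<exists>B. \<forall>n. norm (c j n) \<le> B" for j using bdd[of j] by (auto simp: bounded_iff)
  then obtain B where B: "\<And>j n. norm (c j n) \<le> B j" by metis
  have b: "norm (broken_poly \<tau> c t) \<le> (\<Sum>j\<le>4. \<tau> ^ j / fact j * B j)" for t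
  proof -
    define n where "n = \<lfloor>t / \<tau>\<rfloor>"
    have t: "of_int n * \<tau> \<le> t" "t < (of_int n + 1) * \<tau>" using floor_cell[OF \<tau>, of t n] by (simp_all add: n_def)
    have \<xi>: "0 \<le> t - of_int n * \<tau>" "t - of_int n * \<tau> \<le> \<tau>" using t by (simp_all add: algebra_simps)
    have "norm (broken_poly \<tau> c t) \<le> (\<Sum>j\<le>4. norm (((t - of_int n * \<tau>) ^ j / fact j) *\<^sub>R c j n))"
      unfolding broken_poly_def n_def by (rule norm_sum)
    also have "\<dots> \<le> (\<Sum>j\<le>4. \<tau> ^ j / fact j * B j)"
    proof (rule sum_mono)
      fix j
      have "norm (((t - of_int n * \<tau>) ^ j / fact j) *\<^sub>R c j n) = (t - of_int n * \<tau>) ^ j / fact j * norm (c j n)"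
        using \<xi>(1) by simp
      also have "\<dots> \<le> \<tau> ^ j / fact j * B j"
        using \<xi> \<tau> by (intro mult_mono divide_right_mono power_mono B) simp_all
      finally show "norm (((t - of_int n * \<tau>) ^ j / fact j) *\<^sub>R c j n) \<le> \<tau> ^ j / fact j * B j" .
    qed
    finally show ?thesis .
  qed
  show "\<exists>C. \<forall>t\<ge>0. norm (broken_poly \<tau> c t) \<le> C * exp (\<rho> / 2 * t)"
  proof (intro exI allI impI)
    fix t :: real assume t: "0 \<le> t"
    have "0 \<le> (\<Sum>j\<le>4. \<tau> ^ j / fact j * B j)" using b[of 0] norm_ge_zero order_trans by blast
    then have "(\<Sum>j\<le>4. \<tau> ^ j / fact j * B j) * 1 \<le> (\<Sum>j\<le>4. \<tau> ^ j / fact j * B j) * exp (\<rho> / 2 * t)"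
      using t \<rho> by (intro mult_left_mono) simp_all
    then show "norm (broken_poly \<tau> c t) \<le> (\<Sum>j\<le>4. \<tau> ^ j / fact j * B j) * exp (\<rho> / 2 * t)" using b[of t] by linarith
  qed
qed

lemma broken_poly_diff: "broken_poly \<tau> c t - broken_poly \<tau> d t = broken_poly \<tau> (\<lambda>j n. c j n - d j n) t"
  by (simp add: broken_poly_def sum_subtractf scaleR_diff_right)

lemma broken_poly_in_subspace: "subspace V \<Longrightarrow> (\<And>j n. c j n \<in> V) \<Longrightarrow> broken_poly \<tau> c t \<in> V"
  unfolding broken_poly_def by (intro subspace_sum subspace_scale)

lemma (in wave_space) D_broken_poly:
  assumes "\<And>j n. c j n \<in> V" shows "D (broken_poly \<tau> c t) = broken_poly \<tau> (\<lambda>j n. D (c j n)) t"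
proof -
  have D_sum: "D (\<Sum>j\<le>k. a j *\<^sub>R x j) = (\<Sum>j\<le>k. a j *\<^sub>R D (x j))" if x: "\<And>j. x j \<in> V" for a x and k :: nat
  proof (induction k)
    case (Suc k)
    have "(\<Sum>j\<le>k. a j *\<^sub>R x j) \<in> V" by (intro subspace_sum[OF V] subspace_scale[OF V] x)
    then show ?case using Suc by (simp add: D_add D_scale x subspace_scale[OF V])
  qed (simp add: D_scale x)
  show ?thesis unfolding broken_poly_def by (intro D_sum assms)
qed

section \<open>The time reconstructions\<close>

definition quad_coeff :: "real \<Rightarrow> (int \<Rightarrow> 'v::real_vector) \<Rightarrow> nat \<Rightarrow> int \<Rightarrow> 'v" where
  "quad_coeff \<tau> W j n =
    (if j = 0 then W n
     else if j = 1 then (1 / (2 * \<tau>)) *\<^sub>R (W (n + 1) - W (n - 1))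
     else if j = 2 then (1 / \<tau>^2) *\<^sub>R (W (n + 1) - 2 *\<^sub>R W n + W (n - 1))
     else 0)"

definition quartic_coeff :: "real \<Rightarrow> (int \<Rightarrow> 'v::real_vector) \<Rightarrow> nat \<Rightarrow> int \<Rightarrow> 'v" where
  "quartic_coeff \<tau> W j n =
    (if j = 0 then (1 / 24) *\<^sub>R (3 *\<^sub>R W (n + 1) + 17 *\<^sub>R W n + 5 *\<^sub>R W (n - 1) - W (n - 2))
     else if j = 1 then (1 / (12 * \<tau>)) *\<^sub>R (5 *\<^sub>R W (n + 1) + 3 *\<^sub>R W n - 9 *\<^sub>R W (n - 1) + W (n - 2))
     else if j = 2 then (1 / \<tau>^2) *\<^sub>R (W (n + 1) - 2 *\<^sub>R W n + W (n - 1))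
     else if j = 3 then (1 / (2 * \<tau>^3)) *\<^sub>R (W (n + 2) - 2 *\<^sub>R W (n + 1) + 2 *\<^sub>R W (n - 1) - W (n - 2))
     else if j = 4 then (1 / \<tau>^4) *\<^sub>R (W (n + 2) - 4 *\<^sub>R W (n + 1) + 6 *\<^sub>R W n - 4 *\<^sub>R W (n - 1) + W (n - 2))
     else 0)"

definition second_difference :: "real \<Rightarrow> (int \<Rightarrow> 'v::real_vector) \<Rightarrow> int \<Rightarrow> 'v" where
  "second_difference \<tau> W n = (1 / \<tau>^2) *\<^sub>R (W (n + 1) - 2 *\<^sub>R W n + W (n - 1))"

lemma sum_atMost_4: "(\<Sum>j\<le>4. f j) = f 0 + f 1 + f 2 + f 3 + f (4::nat)"
  by (simp add: numeral_eq_Suc)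

lemma quad_reconstruction_eq: "quad_reconstruction \<tau> U = broken_poly \<tau> (quad_coeff \<tau> (zero_ext U))"
  unfolding fun_eq_iff quad_reconstruction_def broken_poly_def Let_def sum_atMost_4 quad_coeff_def
  by (simp add: fact_numeral)

lemma quartic_reconstruction_eq: "quartic_reconstruction \<tau> U = broken_poly \<tau> (quartic_coeff \<tau> (zero_ext U))"
  unfolding fun_eq_iff quartic_reconstruction_def broken_poly_def Let_def sum_atMost_4 quartic_coeff_def
  by (simp add: fact_numeral)

lemma vector_eqI: "(\<And>v. x \<bullet> v = y \<bullet> v) \<Longrightarrow> x = (y :: 'v::real_inner)"
  using vector_eq_rdot by blast

lemma quad_coeff_match:
  fixes W :: "int \<Rightarrow> 'v::real_inner"
  assumes "0 < \<tau>"
  shows "quad_coeff \<tau> W 0 (n + 1) = (\<Sum>j\<le>4. (\<tau> ^ j / fact j) *\<^sub>R quad_coeff \<tau> W j n)"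
  unfolding sum_atMost_4 quad_coeff_def
  by (rule vector_eqI) (use assms in \<open>simp add: inner_simps field_simps power2_eq_square\<close>)

text \<open>These conditions make the quartic reconstruction and its derivative continuous. The identities between the
  coefficients are verified on real numbers, after taking inner products.\<close>

lemma quartic_coeff_match:
  fixes W :: "int \<Rightarrow> 'v::real_inner"
  assumes "0 < \<tau>"
  shows "quartic_coeff \<tau> W 0 (n + 1) = (\<Sum>j\<le>4. (\<tau> ^ j / fact j) *\<^sub>R quartic_coeff \<tau> W j n)"
    and "shift_coeff (quartic_coeff \<tau> W) 0 (n + 1) = (\<Sum>j\<le>4. (\<tau> ^ j / fact j) *\<^sub>R shift_coeff (quartic_coeff \<tau> W) j n)"
proof -
  have n: "n + 1 + 1 = n + 2" "n + 1 - 1 = n" "n + 1 - 2 = n - 1" by simp_all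
  show "quartic_coeff \<tau> W 0 (n + 1) = (\<Sum>j\<le>4. (\<tau> ^ j / fact j) *\<^sub>R quartic_coeff \<tau> W j n)"
    unfolding sum_atMost_4 quartic_coeff_def n
    by (rule vector_eqI) (use assms in \<open>simp add: inner_simps fact_numeral field_simps power_numeral_reduce\<close>)
  show "shift_coeff (quartic_coeff \<tau> W) 0 (n + 1) = (\<Sum>j\<le>4. (\<tau> ^ j / fact j) *\<^sub>R shift_coeff (quartic_coeff \<tau> W) j n)"
    unfolding sum_atMost_4 quartic_coeff_def shift_coeff_def n
    by (rule vector_eqI) (use assms in \<open>simp add: inner_simps fact_numeral field_simps power_numeral_reduce\<close>)
qed

text \<open>The reason for the coefficients of the quartic reconstruction: its second derivative is the quadratic
  reconstruction of the second differences, hence compatible with the leapfrog scheme.\<close>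

lemma shift_shift_quartic_coeff:
  fixes W :: "int \<Rightarrow> 'v::real_inner"
  shows "shift_coeff (shift_coeff (quartic_coeff \<tau> W)) = quad_coeff \<tau> (second_difference \<tau> W)"
proof (rule ext, rule ext, rule vector_eqI)
  fix j :: nat and n :: int and v :: 'v
  have n: "n + 1 + 1 = n + 2" "n + 1 - 1 = n" "n - 1 + 1 = n" "n - 1 - 1 = n - 2" by simp_all
  define p q where "p = 1 / \<tau>^2" and "q = 1 / (2 * \<tau>)"
  have pq: "1 / (2 * \<tau>^3) = q * p" "1 / \<tau>^4 = p * p" by (simp_all add: p_def q_def power3_eq_cube power2_eq_square power4_eq_xxxx)
  note unf = shift_coeff_def quartic_coeff_def quad_coeff_def second_difference_def n pq p_def[symmetric] q_def[symmetric]
  show "shift_coeff (shift_coeff (quartic_coeff \<tau> W)) j n \<bullet> v = quad_coeff \<tau> (second_difference \<tau> W) j n \<bullet> v"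
  proof (cases "2 < j")
    case True
    then show ?thesis by (simp add: shift_coeff_def quartic_coeff_def quad_coeff_def)
  next
    case False
    then consider "j = 0" | "j = 1" | "j = 2" by linarith
    then show ?thesis
    proof cases
      case 1
      then show ?thesis unfolding unf by simp
    next
      case 2
      show ?thesis unfolding unf 2 by (simp add: inner_add_left inner_diff_left) algebra
    next
      case 3
      show ?thesis unfolding unf 3 by (simp add: inner_add_left inner_diff_left) algebra
    qed
  qed
qed

lemma bounded_quad_coeff:
  fixes W :: "int \<Rightarrow> 'v::real_normed_vector"
  assumes W: "bounded (range W)" shows "bounded (range (quad_coeff \<tau> W j))"
proof -
  have s: "bounded (range (\<lambda>n. W (n + i)))" "bounded (range (\<lambda>n. W (n - i)))" for i
    by (rule bounded_subset[OF W], blast)+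
  show ?thesis unfolding quad_coeff_def
    by (cases "j = 0"; cases "j = 1"; cases "j = 2")
      (simp_all add: W bounded_plus_comp bounded_minus_comp bounded_scaleR_comp s)
qed

lemma bounded_quartic_coeff:
  fixes W :: "int \<Rightarrow> 'v::real_normed_vector"
  assumes W: "bounded (range W)" shows "bounded (range (quartic_coeff \<tau> W j))"
proof -
  have s: "bounded (range (\<lambda>n. W (n + i)))" "bounded (range (\<lambda>n. W (n - i)))" for i
    by (rule bounded_subset[OF W], blast)+
  consider "j = 0" | "j = 1" | "j = 2" | "j = 3" | "j = 4" | "4 < j" by linarith
  then show ?thesis unfolding quartic_coeff_def
    by cases (simp_all add: W bounded_plus_comp bounded_minus_comp bounded_scaleR_comp s)
qed

lemma bounded_shift_coeff:
  fixes c :: "nat \<Rightarrow> int \<Rightarrow> 'v::real_normed_vector"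
  assumes "\<And>j. bounded (range (c j))" shows "bounded (range (shift_coeff c j))"
  using assms by (cases "j < 4") (simp_all add: shift_coeff_def[abs_def])

lemma coeff_in_subspace:
  assumes V: "subspace V" and W: "\<And>n. W n \<in> V"
  shows "quad_coeff \<tau> W j n \<in> V" "quartic_coeff \<tau> W j n \<in> V"
  unfolding quad_coeff_def quartic_coeff_def
  by (simp_all add: subspace_scale[OF V] subspace_add[OF V] subspace_diff[OF V] subspace_0[OF V] W)

lemma shift_coeff_in_subspace:
  assumes "subspace V" "\<And>j n. c j n \<in> V" shows "shift_coeff c j n \<in> V"
  using assms by (simp add: shift_coeff_def subspace_0)

lemma (in wave_space) D_coeff:
  assumes W: "\<And>n. W n \<in> V"
  shows "D (quad_coeff \<tau> W j n) = quad_coeff \<tau> (\<lambda>n. D (W n)) j n"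
    "D (quartic_coeff \<tau> W j n) = quartic_coeff \<tau> (\<lambda>n. D (W n)) j n"
  unfolding quad_coeff_def quartic_coeff_def
  by (simp_all add: D_add D_diff D_scale D_zero W subspace_scale[OF V] subspace_add[OF V] subspace_diff[OF V])

text \<open>The coefficients of the quadratic reconstruction are linear combinations of values with weights that
  do not depend on the sequence, so identities between sequences persist.\<close>

lemma quad_reconstruction_equation:
  fixes A :: "int \<Rightarrow> 'v::real_inner" and B :: "int \<Rightarrow> 'g::real_inner" and F :: "int \<Rightarrow> 'v"
  assumes eq: "\<And>n. A n \<bullet> v + B n \<bullet> g = F n \<bullet> v"
  shows "broken_poly \<tau> (quad_coeff \<tau> A) t \<bullet> v + broken_poly \<tau> (quad_coeff \<tau> B) t \<bullet> g = broken_poly \<tau> (quad_coeff \<tau> F) t \<bullet> v"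
proof -
  have "quad_coeff \<tau> A j n \<bullet> v + quad_coeff \<tau> B j n \<bullet> g = quad_coeff \<tau> F j n \<bullet> v" for j n
    by (simp add: quad_coeff_def inner_simps eq[symmetric]) (simp add: algebra_simps add_divide_distrib diff_divide_distrib)?
  then show ?thesis
    unfolding broken_poly_def inner_sum_left inner_scaleR_left sum.distrib[symmetric] distrib_left[symmetric] by (simp only:)
qed

text \<open>A violation of the bound at one time would persist on an interval of positive length.\<close>

lemma continuous_AE_bounded:
  fixes g :: "real \<Rightarrow> 'v::real_normed_vector"
  assumes c: "continuous_on {0..} g" and AE: "AE t in lborel. 0 \<le> t \<longrightarrow> norm (g t) \<le> C" and t: "0 \<le> t"
  shows "norm (g t) \<le> C"
proof (rule ccontr)
  assume "\<not> norm (g t) \<le> C"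
  then have e: "0 < norm (g t) - C" by simp
  from c t have "\<exists>d>0. \<forall>s\<in>{0..}. dist s t < d \<longrightarrow> dist (g s) (g t) < norm (g t) - C"
    using e unfolding continuous_on_iff by (metis atLeast_iff)
  then obtain d where d: "0 < d" "\<forall>s\<in>{0..}. dist s t < d \<longrightarrow> dist (g s) (g t) < norm (g t) - C" by blast
  have big: "C < norm (g s)" if "s \<in> {t..<t + d}" for s
  proof -
    have "dist (g s) (g t) < norm (g t) - C" using d(2) that t by (auto simp: dist_real_def)
    moreover have "norm (g t) - norm (g s) \<le> dist (g s) (g t)" unfolding dist_norm by (metis norm_minus_commute norm_triangle_ineq2)
    ultimately show ?thesis by linarith
  qed
  have "AE s in lborel. s \<notin> {t..<t + d}"
    using AE by eventually_elim (use big t in force)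
  then have "emeasure lborel {t..<t + d} = 0"
    by (subst (asm) AE_iff_null_sets[symmetric]) (simp_all add: null_sets_def)
  then show False using d(1) by simp
qed

section \<open>The leapfrog scheme in an abstract wave space\<close>

context wave_space
begin

text \<open>Extension by zero produces no defect at the initial time because the first two iterates and the
  initial source vanish.\<close>

lemma leapfrog_all_times:
  assumes U: "\<And>n. U n \<in> V" and U0: "U 0 = 0" "U (Suc 0) = 0" and f0: "F 0 = 0"
    and leap: "\<And>n. 1 \<le> n \<Longrightarrow> (1 / \<tau>\<^sup>2) * ((U (n + 1) - 2 *\<^sub>R U n + U (n - 1)) \<bullet> v) + D (U n) \<bullet> D v = F n \<bullet> v"
  shows "second_difference \<tau> (zero_ext U) n \<bullet> v + D (zero_ext U n) \<bullet> D v = zero_ext F n \<bullet> v"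
proof -
  consider "n < -1" | "n = -1" | "n = 0" | "1 \<le> n" by linarith
  then show ?thesis
  proof cases
    case 4
    then have "zero_ext U (n + 1) = U (nat n + 1)" "zero_ext U n = U (nat n)" "zero_ext U (n - 1) = U (nat n - 1)" "zero_ext F n = F (nat n)"
      by (simp_all add: zero_ext_def nat_add_distrib nat_diff_distrib)
    then show ?thesis using leap[of "nat n"] 4 by (simp add: second_difference_def)
  qed (simp_all add: second_difference_def zero_ext_def U0 f0 D_zero)
qed

text \<open>The abstract estimate applies because the leapfrog equations make the representer \<open>q\<close> of the
  residual act on \<open>W\<close> like the gradient of the difference of the two reconstructions. The latter vanishes
  at time 0 and is continuous with piecewise derivative \<open>dl1\<close>.\<close>

theorem leapfrog_error_estimate:
  fixes fd :: "nat \<Rightarrow> real \<Rightarrow> 'h"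
  assumes rho: "0 < \<rho>" and omega: "0 < \<omega>" and tau: "0 < \<tau>" and W: "subspace W" "W \<subseteq> V" and gamma: "0 \<le> \<gamma>"
    and approx: "\<And>\<nu>. \<bar>\<nu>\<bar> \<le> \<omega> \<Longrightarrow> approximable W (Complex \<rho> \<nu>) \<gamma>"
    and u1: "\<And>t. 0 \<le> t \<Longrightarrow> (u has_vector_derivative u1 t) (at t within {0..})"
    and u2: "\<And>t. 0 \<le> t \<Longrightarrow> (u1 has_vector_derivative u2 t) (at t within {0..})"
    and init: "u 0 = 0" "u1 0 = 0" and uV: "\<And>t. 0 \<le> t \<Longrightarrow> u t \<in> V"
    and cDu: "continuous_on {0..} (\<lambda>t. D (u t))" and cu2: "continuous_on {0..} u2" and cf: "continuous_on {0..} f"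
    and eq: "\<And>t v. 0 \<le> t \<Longrightarrow> v \<in> V \<Longrightarrow> u2 t \<bullet> v + D (u t) \<bullet> D v = f t \<bullet> v"
    and F: "\<And>t. 0 \<le> t \<Longrightarrow> norm (f t) \<le> F" and f0: "f 0 = 0"
    and fd0: "fd 0 = f" and fdi: "\<And>j. j < r \<Longrightarrow> fd j 0 = 0"
    and fd: "\<And>j t. j < r \<Longrightarrow> 0 \<le> t \<Longrightarrow> (fd j has_vector_derivative fd (Suc j) t) (at t within {0..})"
    and cfd: "continuous_on {0..} (fd r)" and Fr: "\<And>t. 0 \<le> t \<Longrightarrow> norm (fd r t) \<le> Fr"
    and U: "\<And>n. U n \<in> W" "U 0 = 0" "U (Suc 0) = 0" "bounded (range U)" "bounded (range (\<lambda>n. D (U n)))"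
    and leap: "\<And>n v. 1 \<le> n \<Longrightarrow> v \<in> W \<Longrightarrow>
      (1 / \<tau>\<^sup>2) * ((U (n + 1) - 2 *\<^sub>R U n + U (n - 1)) \<bullet> v) + D (U n) \<bullet> D v = f (real n * \<tau>) \<bullet> v"
    and c: "c = quartic_coeff \<tau> (zero_ext U)"
    and f\<tau>: "f\<tau> = quad_reconstruction \<tau> (\<lambda>n. f (real n * \<tau>))"
    and dl1: "dl1 = broken_poly \<tau> (shift_coeff (\<lambda>j n. D (quad_coeff \<tau> (zero_ext U) j n - c j n)))"
  obtains q where "transformable \<rho> q" "transformable \<rho> dl1"
    "\<And>t. q t \<in> D ` V"
    "\<And>t v. v \<in> V \<Longrightarrow> q t \<bullet> D v = f\<tau> t \<bullet> v - broken_poly \<tau> (shift_coeff (shift_coeff c)) t \<bullet> v - D (broken_poly \<tau> c t) \<bullet> D v"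
    "transformable \<rho> (\<lambda>t. u1 t - broken_poly \<tau> (shift_coeff c) t)" "transformable \<rho> (\<lambda>t. D (u t - broken_poly \<tau> c t))"
    "transformable \<rho> (\<lambda>t. f t - f\<tau> t)" "transformable \<rho> (fd r)"
    "energy \<rho> (\<lambda>t. u1 t - broken_poly \<tau> (shift_coeff c) t) + energy \<rho> (\<lambda>t. D (u t - broken_poly \<tau> c t))
    \<le> (1 + 40 * \<gamma>\<^sup>2) * energy \<rho> q + 20 / \<rho>\<^sup>2 * energy \<rho> dl1
      + 11 / \<rho>\<^sup>2 * energy \<rho> (\<lambda>t. f t - f\<tau> t) + 8 / \<rho>\<^sup>2 * (1 / \<omega> ^ (2 * r)) * energy \<rho> (fd r)"
proof -
  define Z where "Z = zero_ext U"
  define DZ where "DZ n = D (Z n)" for n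
  define w w1 w2 where "w = broken_poly \<tau> c" and "w1 = broken_poly \<tau> (shift_coeff c)" and "w2 = broken_poly \<tau> (shift_coeff (shift_coeff c))"
  have c': "c = quartic_coeff \<tau> Z" by (simp only: c Z_def)
  have ZW: "Z n \<in> W" for n unfolding Z_def zero_ext_def using U(1) subspace_0[OF W(1)] by simp
  have ZV: "Z n \<in> V" for n using ZW W(2) by blast
  have cW: "c j n \<in> W" for j n unfolding c' by (rule coeff_in_subspace(2)[OF W(1) ZW])
  have cV: "c j n \<in> V" for j n using cW W(2) by blast
  have ext_bdd: "bounded (range (zero_ext X))" if "bounded (range X)" for X :: "nat \<Rightarrow> 'c::real_normed_vector"
    by (rule bounded_subset[where T = "insert 0 (range X)"]) (use that in \<open>auto simp: zero_ext_def\<close>)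
  have Zb: "bounded (range Z)" unfolding Z_def by (rule ext_bdd[OF U(4)])
  have "DZ = zero_ext (\<lambda>n. D (U n))" by (simp add: fun_eq_iff DZ_def Z_def zero_ext_def D_zero)
  then have DZb: "bounded (range DZ)" using ext_bdd[OF U(5)] by simp
  have cb: "bounded (range (c j))" for j unfolding c' by (rule bounded_quartic_coeff[OF Zb])
  have Dw: "D (broken_poly \<tau> c t) = broken_poly \<tau> (quartic_coeff \<tau> DZ) t" for t
    by (simp add: D_broken_poly cV) (simp add: c' D_coeff(2) ZV DZ_def[abs_def])
  have Du: "D (broken_poly \<tau> (quad_coeff \<tau> Z) t) = broken_poly \<tau> (quad_coeff \<tau> DZ) t" for t
    by (simp add: D_broken_poly coeff_in_subspace(1)[OF V ZV]) (simp add: D_coeff(1) ZV DZ_def[abs_def])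
  define dc where "dc j n = quad_coeff \<tau> DZ j n - quartic_coeff \<tau> DZ j n" for j n
  have dcb: "bounded (range (dc j))" for j
    unfolding dc_def by (intro bounded_minus_comp bounded_quad_coeff[OF DZb] bounded_quartic_coeff[OF DZb])
  have dl1': "dl1 = broken_poly \<tau> (shift_coeff dc)"
    unfolding dl1 by (simp add: dc_def[abs_def] Z_def[symmetric] c' D_diff coeff_in_subspace[OF V ZV] D_coeff ZV DZ_def[abs_def])
  define dl where "dl = broken_poly \<tau> dc"
  have dl: "dl t = D (broken_poly \<tau> (quad_coeff \<tau> Z) t) - D (w t)" for t
    unfolding dl_def w_def Dw Du by (simp add: broken_poly_diff dc_def[abs_def])
  have fsamp: "bounded (range (\<lambda>n. f (real n * \<tau>)))" unfolding bounded_iff using F tau by (intro exI[of _ F]) auto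
  have f\<tau>': "f\<tau> = broken_poly \<tau> (quad_coeff \<tau> (zero_ext (\<lambda>n. f (real n * \<tau>))))"
    unfolding f\<tau> by (rule quad_reconstruction_eq)
  note T = broken_poly_transformable[OF tau rho]
  have tw: "transformable \<rho> w" "transformable \<rho> w1" "transformable \<rho> w2" and tDw: "transformable \<rho> (\<lambda>t. D (w t))"
    and tf: "transformable \<rho> f\<tau>" and tdl: "transformable \<rho> dl" "transformable \<rho> dl1"
    unfolding w_def w1_def w2_def Dw f\<tau>' dl_def dl1'
    by (intro T cb dcb bounded_shift_coeff bounded_quartic_coeff[OF DZb] bounded_quad_coeff ext_bdd[OF fsamp])+
  obtain R where R: "bounded_linear R" "\<forall>h. R h \<in> D ` V" "\<forall>h. \<forall>v\<in>V. R h \<bullet> D v = h \<bullet> v"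
    using dual_representation by blast
  define q where "q t = R (f\<tau> t - w2 t) - D (w t)" for t
  have tq: "transformable \<rho> q" unfolding q_def
    by (intro transformable_diff transformable_bounded_linear[OF R(1)] tf tw tDw)
  have wW: "w t \<in> W" for t unfolding w_def by (rule broken_poly_in_subspace[OF W(1) cW])
  have wV: "w t \<in> V" for t using wW W(2) by blast
  have qD: "q t \<in> D ` V" for t unfolding q_def
    by (rule subspace_diff[OF subspace_range]) (use R(2) wV in auto)
  have qv: "q t \<bullet> D v = f\<tau> t \<bullet> v - w2 t \<bullet> v - D (w t) \<bullet> D v" if v: "v \<in> V" for t v
    using R(3) v by (simp add: q_def inner_diff_left)
  have orth: "q t \<bullet> D v = dl t \<bullet> D v" if v: "v \<in> W" for t v
  proof -
    have "second_difference \<tau> Z n \<bullet> v + DZ n \<bullet> D v = zero_ext (\<lambda>n. f (real n * \<tau>)) n \<bullet> v" for n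
      unfolding DZ_def Z_def
      by (rule leapfrog_all_times) (use U(1-3) W(2) f0 leap v in auto)
    then have "broken_poly \<tau> (quad_coeff \<tau> (second_difference \<tau> Z)) t \<bullet> v + broken_poly \<tau> (quad_coeff \<tau> DZ) t \<bullet> D v
        = broken_poly \<tau> (quad_coeff \<tau> (zero_ext (\<lambda>n. f (real n * \<tau>)))) t \<bullet> v" by (rule quad_reconstruction_equation)
    then have "w2 t \<bullet> v + D (broken_poly \<tau> (quad_coeff \<tau> Z) t) \<bullet> D v = f\<tau> t \<bullet> v"
      unfolding w2_def c' shift_shift_quartic_coeff Du f\<tau>' .
    then show ?thesis using qv[of v t] v W(2) by (auto simp: dl inner_diff_left)
  qed
  note cts = broken_poly_continuous[OF tau]
  have cw: "continuous_on {0..} w" and cw1: "continuous_on {0..} w1" and cDw: "continuous_on {0..} (\<lambda>t. D (w t))"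
    unfolding w_def w1_def Dw unfolding c' by (rule cts, rule quartic_coeff_match[OF tau])+
  have cdl: "continuous_on {0..} dl" unfolding dl_def
  proof (rule cts)
    fix n
    show "dc 0 (n + 1) = (\<Sum>j\<le>4. (\<tau> ^ j / fact j) *\<^sub>R dc j n)"
      unfolding dc_def quad_coeff_match[OF tau] quartic_coeff_match(1)[OF tau] by (simp only: scaleR_diff_right sum_subtractf)
  qed
  have at0: "broken_poly \<tau> k 0 = k 0 0" for k :: "nat \<Rightarrow> int \<Rightarrow> 'c::real_vector"
    using broken_poly_at_node[OF tau, of k 0] by simp
  have Z0: "Z 0 = 0" "Z 1 = 0" "Z (-1) = 0" "Z (-2) = 0" unfolding Z_def zero_ext_def using U(2,3) by simp_all
  have wi: "w 0 = 0" "w1 0 = 0" unfolding w_def w1_def at0 c' by (simp_all add: shift_coeff_def quartic_coeff_def Z0)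
  have dli: "dl 0 = 0" unfolding dl_def at0 dc_def by (simp add: quad_coeff_def quartic_coeff_def Z0 DZ_def D_zero)
  have dw: "(w has_vector_derivative w1 t) (at t)" "(w1 has_vector_derivative w2 t) (at t)" "(dl has_vector_derivative dl1 t) (at t)"
    if "t \<notin> time_nodes \<tau>" for t
    unfolding w_def w1_def w2_def dl_def dl1' by (rule broken_poly_derivative[OF tau that])+
  have res: "w2 t \<bullet> v = f\<tau> t \<bullet> v - q t \<bullet> D v - D (w t) \<bullet> D v" if "v \<in> V" for t v
    using qv[OF that, of t] by simp
  note E = abstract_error_estimate[where S = "time_nodes \<tau>" and r = r and \<rho> = \<rho> and \<omega> = \<omega> and \<gamma> = \<gamma> and F = F and Fr = Fr and W = W and w = w and ?w1.0 = w1 and ?w2.0 = w2 and q = q and dl = dl and ?dl1.0 = dl1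
      and f\<tau> = f\<tau> and fd = fd and f = f and u = u and ?u1.0 = u1 and ?u2.0 = u2,
      OF rho omega W gamma approx u1 u2 init uV cDu cu2 cf eq F fd0 fdi fd cfd Fr
      finite_time_nodes[OF tau] cw cw1 wi dw(1) dw(2) tw wW cDw tDw tf tq res orth cdl dli dw(3) tdl]
  show thesis
  proof (rule that[OF tq tdl(2) qD])
    show "q t \<bullet> D v = f\<tau> t \<bullet> v - broken_poly \<tau> (shift_coeff (shift_coeff c)) t \<bullet> v - D (broken_poly \<tau> c t) \<bullet> D v"
      if "v \<in> V" for t v using qv[OF that] unfolding w_def w2_def .
    show "transformable \<rho> (\<lambda>t. u1 t - broken_poly \<tau> (shift_coeff c) t)" unfolding w1_def[symmetric] by (rule E(1))
    show "transformable \<rho> (\<lambda>t. D (u t - broken_poly \<tau> c t))" unfolding w_def[symmetric] by (rule E(2))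
    show "transformable \<rho> (\<lambda>t. f t - f\<tau> t)" by (rule E(3))
    show "transformable \<rho> (fd r)" by (rule E(4))
    show "energy \<rho> (\<lambda>t. u1 t - broken_poly \<tau> (shift_coeff c) t) + energy \<rho> (\<lambda>t. D (u t - broken_poly \<tau> c t))
      \<le> (1 + 40 * \<gamma>\<^sup>2) * energy \<rho> q + 20 / \<rho>\<^sup>2 * energy \<rho> dl1
        + 11 / \<rho>\<^sup>2 * energy \<rho> (\<lambda>t. f t - f\<tau> t) + 8 / \<rho>\<^sup>2 * (1 / \<omega> ^ (2 * r)) * energy \<rho> (fd r)"
      unfolding w_def[symmetric] w1_def[symmetric] by (rule E(5))
  qed
qed

end

section \<open>Time derivatives\<close>

lemma Cr_has_derivative:
  assumes "Cr r Y v" "j < r" "0 \<le> t"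
  shows "(time_deriv j v has_vector_derivative time_deriv (Suc j) v t) (at t within {0..})"
  using assms unfolding Cr_def by (simp add: vector_derivative_works)

lemma Cr_continuous:
  assumes "Cr r Y v" "j \<le> r" shows "continuous_on {0..} (time_deriv j v)"
proof (cases "j = r")
  case True
  then show ?thesis using assms(1) by (simp add: Cr_def)
next
  case False
  then show ?thesis using Cr_has_derivative[OF assms(1), of j] assms(2) by (intro continuous_on_vector_derivative) auto
qed

lemma time_deriv_eq:
  assumes "0 \<le> t" "(time_deriv j v has_vector_derivative d) (at t within {0..})"
  shows "time_deriv (Suc j) v t = d"
proof -
  have "t islimpt {t<..<t + 1}" by (simp add: islimpt_greaterThanLessThan1)
  then have "t islimpt {0..}" by (rule islimpt_subset) (use assms(1) in auto)
  then have "at t within {0..} \<noteq> bot" by (simp add: trivial_limit_within)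
  then show ?thesis using assms(2) by (simp add: vector_derivative_within)
qed

lemma time_deriv_zero_near_0:
  assumes t0: "0 < t0" and f: "\<And>t. 0 \<le> t \<Longrightarrow> t < t0 \<Longrightarrow> f t = 0" and t: "0 \<le> t" "t < t0"
  shows "time_deriv j f t = 0"
  using t
proof (induction j arbitrary: t)
  case (Suc j)
  have "(time_deriv j f has_vector_derivative 0) (at t within {0..})"
  proof (rule has_vector_derivative_transform_within[of "\<lambda>_. 0" _ _ _ "t0 - t"])
    show "0 = time_deriv j f s" if "s \<in> {0..}" "dist s t < t0 - t" for s
      using that Suc.IH[of s] by (simp add: dist_real_def)
  qed (use Suc.prems in simp_all)
  then show ?case by (rule time_deriv_eq[OF Suc.prems(1)])
qed (simp add: f)

text \<open>The second time derivative needs the first one in a whole neighbourhood, which is why nodes are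
  excluded.\<close>

lemma time_deriv_broken_poly:
  fixes c :: "nat \<Rightarrow> int \<Rightarrow> 'v::real_normed_vector"
  assumes \<tau>: "0 < \<tau>" and t: "0 \<le> t" "t \<notin> time_nodes \<tau>"
  shows "time_deriv 2 (broken_poly \<tau> c) t = broken_poly \<tau> (shift_coeff (shift_coeff c)) t"
proof -
  define n where "n = \<lfloor>t / \<tau>\<rfloor>"
  have b: "of_int n * \<tau> \<le> t" "t < (of_int n + 1) * \<tau>" using floor_cell[OF \<tau>, of t n] by (simp_all add: n_def)
  have n0: "0 \<le> of_int n * \<tau>" using t(1) \<tau> by (simp add: n_def)
  have 1: "time_deriv 1 (broken_poly \<tau> c) s = broken_poly \<tau> (shift_coeff c) s" if s: "s \<in> {of_int n * \<tau><..<(of_int n + 1) * \<tau>}" for s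
  proof -
    have "\<lfloor>s / \<tau>\<rfloor> = n" using s by (simp add: floor_cell[OF \<tau>])
    have "s \<notin> time_nodes \<tau>"
    proof
      assume "s \<in> time_nodes \<tau>"
      then obtain m where "s = of_int m * \<tau>" by (auto simp: time_nodes_def)
      then have "\<lfloor>s / \<tau>\<rfloor> = m" using \<tau> by simp
      then show False using \<open>\<lfloor>s / \<tau>\<rfloor> = n\<close> s \<open>s = of_int m * \<tau>\<close> by simp
    qed
    then have "(time_deriv 0 (broken_poly \<tau> c) has_vector_derivative broken_poly \<tau> (shift_coeff c) s) (at s within {0..})"
      by (simp add: has_vector_derivative_at_within broken_poly_derivative[OF \<tau>])
    from time_deriv_eq[OF _ this] show ?thesis using s n0 by simp
  qed
  have "of_int n * \<tau> \<noteq> t" using t(2) by (auto simp: time_nodes_def)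
  then have "t \<in> {of_int n * \<tau><..<(of_int n + 1) * \<tau>}" using b by simp
  then have "(time_deriv 1 (broken_poly \<tau> c) has_vector_derivative broken_poly \<tau> (shift_coeff (shift_coeff c)) t) (at t)"
    by (intro has_vector_derivative_transform_within_open[OF broken_poly_derivative[OF \<tau> t(2)] open_greaterThanLessThan])
      (assumption, rule 1[symmetric], assumption)
  from time_deriv_eq[OF t(1) has_vector_derivative_at_within[OF this]] show ?thesis by (simp add: numeral_2_eq_2)
qed

lemma AE_not_time_node: "AE t in lborel. t \<notin> time_nodes \<tau>"
  by (rule AE_not_in[OF countable_imp_null_set_lborel]) (simp add: time_nodes_def)

text \<open>The supremum is at least the value at the normalized preimage of \<open>p\<close>.\<close>

lemma (in polyhedral_domain) norm_le_dual_norm: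
  assumes p: "p \<in> grad \<Omega> ` H10 \<Omega>" and l: "\<And>v. v \<in> H10 \<Omega> \<Longrightarrow> l v = p \<bullet> grad \<Omega> v"
  shows "ennreal (norm p) \<le> dual_norm \<Omega> l"
proof (cases "p = 0")
  case False
  from p obtain v where v: "v \<in> H10 \<Omega>" "p = grad \<Omega> v" by blast
  define z where "z = (1 / norm p) *\<^sub>R v"
  have z: "z \<in> H10 \<Omega>" unfolding z_def by (rule subspace_scale[OF V v(1)])
  have g: "grad \<Omega> z = (1 / norm p) *\<^sub>R p" unfolding z_def D_scale[OF v(1)] v(2) ..
  have "l z = norm p" using False by (simp add: l[OF z] g power2_norm_eq_inner[symmetric] power2_eq_square)
  moreover have "z \<in> {v \<in> H10 \<Omega>. norm (grad \<Omega> v) = 1}" using z False by (simp add: g)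
  ultimately show ?thesis unfolding dual_norm_def using SUP_upper[of z _ "\<lambda>v. ennreal \<bar>l v\<bar>"] by simp
qed simp

section \<open>The error estimate for the leapfrog scheme\<close>

lemma Linfty_bounded:
  assumes "Linfty v" "continuous_on {0..} v" obtains C where "\<And>t. 0 \<le> t \<Longrightarrow> norm (v t) \<le> C"
proof -
  from assms(1) obtain C where "AE t in lborel. 0 \<le> t \<longrightarrow> norm (v t) \<le> C" unfolding Linfty_def by blast
  from continuous_AE_bounded[OF assms(2) this] show thesis by (rule that)
qed

definition weighted_square :: "real \<Rightarrow> (real \<Rightarrow> 'b::real_normed_vector) \<Rightarrow> real \<Rightarrow> real" where
  "weighted_square \<rho> g t = indicat_real {0..} t * ((norm (g t))\<^sup>2 * exp (- 2 * \<rho> * t))"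

lemma energy_eq_integral: "energy \<rho> g = (\<integral>t. weighted_square \<rho> g t \<partial>lborel)"
  by (simp add: energy_def weighted_square_def)

lemma weighted_square_nonneg: "0 \<le> weighted_square \<rho> g t"
  by (simp add: weighted_square_def)

lemma weighted_square_integrable:
  fixes g :: "real \<Rightarrow> 'b::{real_inner, banach, second_countable_topology}"
  assumes "0 < \<rho>" "transformable \<rho> g" shows "integrable lborel (weighted_square \<rho> g)"
  using damped_square_integrable[OF assms] by (simp add: weighted_square_def[abs_def])

text \<open>The dual norm is extended-real, its lower bound \<open>n\<close> is real.\<close>

lemma residual_terms_le:
  assumes nn: "0 \<le> n" "0 \<le> \<gamma>" "0 \<le> a" "0 \<le> b" "0 \<le> d" "0 \<le> x" and n: "ennreal n \<le> R"
  shows "ennreal ((n\<^sup>2 + a + 40 * \<gamma>\<^sup>2 * n\<^sup>2 + b + d) * x)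
    \<le> (R\<^sup>2 + ennreal a + 40 * (ennreal \<gamma>)\<^sup>2 * R\<^sup>2 + ennreal b + ennreal d) * ennreal x"
proof -
  have "(ennreal \<gamma>)\<^sup>2 = ennreal (\<gamma>\<^sup>2)" "(ennreal n)\<^sup>2 = ennreal (n\<^sup>2)" using nn by (simp_all add: ennreal_power)
  moreover have "ennreal (40 * \<gamma>\<^sup>2 * n\<^sup>2) = 40 * ennreal (\<gamma>\<^sup>2) * ennreal (n\<^sup>2)" by (simp add: ennreal_mult)
  ultimately have "ennreal ((n\<^sup>2 + a + 40 * \<gamma>\<^sup>2 * n\<^sup>2 + b + d) * x)
    = ((ennreal n)\<^sup>2 + ennreal a + 40 * (ennreal \<gamma>)\<^sup>2 * (ennreal n)\<^sup>2 + ennreal b + ennreal d) * ennreal x"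
    using nn by (simp add: ennreal_mult ennreal_plus)
  also have "\<dots> \<le> (R\<^sup>2 + ennreal a + 40 * (ennreal \<gamma>)\<^sup>2 * R\<^sup>2 + ennreal b + ennreal d) * ennreal x"
    by (intro mult_right_mono mult_left_mono add_mono order_refl power_mono n zero_le)
  finally show ?thesis .
qed

theorem theorem4p3:
  fixes \<Omega> :: "(real^'n) set" and \<T> :: "(real^'n) set set" and k r :: nat
    and \<tau> \<rho> \<omega> :: real
    and f u f\<tau> u\<tau> w \<delta> e \<eta> :: "real \<Rightarrow> (real^'n, real) L2"
    and U :: "nat \<Rightarrow> (real^'n, real) L2"
    and \<R> :: "real \<Rightarrow> ennreal"
  assumes "lipschitz_polyhedron \<Omega>"
    and "simplicial_mesh \<Omega> \<T>" and "k \<ge> 1"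
    and "\<tau> > 0" and "\<omega> > 0" and "\<rho> > 0" and "\<rho> * \<tau> \<le> 1"
    and "H1_time (L2_on \<Omega>) f" and "Linfty f"
    and "\<exists>t0>0. \<forall>t\<in>{0..<t0}. f t = 0"
    and "Cr_b r (L2_on \<Omega>) f"
    and "wave_solution \<Omega> f u"
    and "leapfrog_solution \<Omega> (FE_space \<Omega> \<T> k) \<tau> f U"
    and "u\<tau> = quad_reconstruction \<tau> U"
    and "w = quartic_reconstruction \<tau> U"
    and "f\<tau> = quad_reconstruction \<tau> (\<lambda>n. f (real n * \<tau>))"
    and "Linfty u\<tau>" and "Linfty (\<lambda>t. grad \<Omega> (u\<tau> t))"
    and "Linfty w" and "Linfty (\<lambda>t. grad \<Omega> (w t))"
    and "\<delta> = (\<lambda>t. u\<tau> t - w t)"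
    and "\<eta> = (\<lambda>t. f t - f\<tau> t)"
    and "e = (\<lambda>t. u t - w t)"
    and "\<R> = (\<lambda>t. dual_norm \<Omega> (residual \<Omega> f\<tau> w t))"
  shows "(\<integral>\<^sup>+t\<in>{0..}. ennreal (((norm (time_deriv 1 e t))\<^sup>2 + (norm (grad \<Omega> (e t)))\<^sup>2)
            * exp (- 2 * \<rho> * t)) \<partial>lborel)
       \<le> (\<integral>\<^sup>+t\<in>{0..}. ((\<R> t)\<^sup>2
            + ennreal (20 / \<rho>\<^sup>2 * (norm (grad \<Omega> (broken_deriv \<tau> \<delta> t)))\<^sup>2)
            + 40 * (approx_factor_cutoff \<Omega> \<T> k \<rho> \<omega>)\<^sup>2 * (\<R> t)\<^sup>2
            + ennreal (11 / \<rho>\<^sup>2 * (norm (\<eta> t))\<^sup>2)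
            + ennreal (8 / \<rho>\<^sup>2 * (1 / \<omega> ^ (2 * r)) * (norm (time_deriv r f t))\<^sup>2))
            * ennreal (exp (- 2 * \<rho> * t)) \<partial>lborel)"
proof -
  interpret polyhedral_domain \<Omega> by unfold_locales (rule assms(1))
  note tau = assms(4) and omega = assms(5) and rho = assms(6)
  let ?FE = "FE_space \<Omega> \<T> k :: (real^'n, real) L2 set"
  (* a real number standing for the approximation factor, which is finite *)
  define \<gamma> where "\<gamma> = enn2real (approx_factor_cutoff \<Omega> \<T> k \<rho> \<omega>)"
  have \<gamma>0: "0 \<le> \<gamma>" by (simp add: \<gamma>_def)
  have \<gamma>: "ennreal \<gamma> = approx_factor_cutoff \<Omega> \<T> k \<rho> \<omega>"
    unfolding \<gamma>_def by (rule ennreal_enn2real) (use approx_factor_cutoff_finite[OF rho] in \<open>simp add: less_top\<close>)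
  have approx: "approximable ?FE (Complex \<rho> \<nu>) \<gamma>" if "\<bar>\<nu>\<bar> \<le> \<omega>" for \<nu>
  proof (rule approximable_FE_space)
    have "\<nu> \<in> {-\<omega>..\<omega>}" using that by auto
    then show "approx_factor \<Omega> \<T> k (Complex \<rho> \<nu>) \<le> ennreal \<gamma>" unfolding \<gamma> approx_factor_cutoff_def by (rule SUP_upper)
  qed (use rho \<gamma>0 in simp_all)
  note W = subspace_FE_space[OF open_domain bounded_domain, where 'b = real and \<T> = \<T> and k = k] FE_space_subset[where 'b = real and \<Omega> = \<Omega> and \<T> = \<T> and k = k]
  have uC: "Cr 2 (L2_on \<Omega>) u" and init: "u 0 = 0" "time_deriv 1 u 0 = 0" and uV: "\<And>t. 0 \<le> t \<Longrightarrow> u t \<in> H10 \<Omega>"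
    and cDu: "continuous_on {0..} (\<lambda>t. grad \<Omega> (u t))"
    and eq: "\<And>t v. 0 \<le> t \<Longrightarrow> v \<in> H10 \<Omega> \<Longrightarrow> time_deriv 2 u t \<bullet> v + grad \<Omega> (u t) \<bullet> grad \<Omega> v = f t \<bullet> v"
    using assms(12) unfolding wave_solution_def by blast+
  have u1: "(u has_vector_derivative time_deriv 1 u t) (at t within {0..})"
    and u2: "(time_deriv 1 u has_vector_derivative time_deriv 2 u t) (at t within {0..})" if "0 \<le> t" for t
    using Cr_has_derivative[OF uC _ that, of 0] Cr_has_derivative[OF uC _ that, of 1]
    by (simp_all add: numeral_2_eq_2)
  have fC: "Cr r (L2_on \<Omega>) f" "Linfty (time_deriv r f)" using assms(11) unfolding Cr_b_def by blast+
  have cf: "continuous_on {0..} f" using Cr_continuous[OF fC(1), of 0] by simp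
  obtain F where F: "\<And>t. 0 \<le> t \<Longrightarrow> norm (f t) \<le> F" by (rule Linfty_bounded[OF assms(9) cf]) blast
  note cfd = Cr_continuous[OF fC(1) order_refl]
  obtain Fr where Fr: "\<And>t. 0 \<le> t \<Longrightarrow> norm (time_deriv r f t) \<le> Fr" by (rule Linfty_bounded[OF fC(2) cfd]) blast
  obtain t0 where t0: "0 < t0" "\<And>t. 0 \<le> t \<Longrightarrow> t < t0 \<Longrightarrow> f t = 0" using assms(10) by (metis atLeastLessThan_iff)
  have fd0: "time_deriv j f 0 = 0" for j by (rule time_deriv_zero_near_0[OF t0]) (use t0(1) in simp_all)
  have f0: "f 0 = 0" using fd0[of 0] by simp
  have UW: "\<And>n. U n \<in> ?FE" and U0: "U 0 = 0" "U (Suc 0) = 0"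
    using assms(13) unfolding leapfrog_solution_def by simp_all
  have leap: "(1 / \<tau>\<^sup>2) * ((U (n + 1) - 2 *\<^sub>R U n + U (n - 1)) \<bullet> v) + grad \<Omega> (U n) \<bullet> grad \<Omega> v = f (real n * \<tau>) \<bullet> v"
    if "1 \<le> n" "v \<in> ?FE" for n v
    using assms(13) that unfolding leapfrog_solution_def by blast
  define Z where "Z = zero_ext U"
  define c where "c = quartic_coeff \<tau> Z"
  have ZV: "Z n \<in> H10 \<Omega>" for n using UW W(2) subspace_0[OF V] by (auto simp: Z_def zero_ext_def)
  have cV: "c j n \<in> H10 \<Omega>" and qcV: "quad_coeff \<tau> Z j n \<in> H10 \<Omega>" for j n
    unfolding c_def by (rule coeff_in_subspace[OF V ZV])+
  have u\<tau>: "u\<tau> = broken_poly \<tau> (quad_coeff \<tau> Z)" unfolding assms(14) Z_def by (rule quad_reconstruction_eq)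
  have w: "w = broken_poly \<tau> c" unfolding assms(15) c_def Z_def by (rule quartic_reconstruction_eq)
  have Du\<tau>: "grad \<Omega> (u\<tau> t) = broken_poly \<tau> (quad_coeff \<tau> (\<lambda>n. grad \<Omega> (Z n))) t" for t
    unfolding u\<tau> by (simp add: D_broken_poly qcV) (simp add: D_coeff(1) ZV)
  have cu\<tau>: "continuous_on {0..} u\<tau>" and cDu\<tau>: "continuous_on {0..} (\<lambda>t. grad \<Omega> (u\<tau> t))"
    unfolding Du\<tau> unfolding u\<tau> by (rule broken_poly_continuous[OF tau], rule quad_coeff_match[OF tau])+
  obtain B where B: "\<And>t. 0 \<le> t \<Longrightarrow> norm (u\<tau> t) \<le> B" by (rule Linfty_bounded[OF assms(17) cu\<tau>]) blast
  obtain B' where B': "\<And>t. 0 \<le> t \<Longrightarrow> norm (grad \<Omega> (u\<tau> t)) \<le> B'" by (rule Linfty_bounded[OF assms(18) cDu\<tau>]) blast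
  (* the reconstruction interpolates the iterates, which inherit its boundedness *)
  have Un: "u\<tau> (real n * \<tau>) = U n" for n
    using broken_poly_at_node[OF tau, of "quad_coeff \<tau> Z" "int n"] by (simp add: u\<tau> quad_coeff_def Z_def zero_ext_def)
  have Ub: "bounded (range U)" "bounded (range (\<lambda>n. grad \<Omega> (U n)))"
    unfolding bounded_iff using B[of "real _ * \<tau>"] B'[of "real _ * \<tau>"] tau by (auto simp: Un)
  define dl1 where "dl1 = broken_poly \<tau> (shift_coeff (\<lambda>j n. grad \<Omega> (quad_coeff \<tau> (zero_ext U) j n - c j n)))"
  obtain q where tq: "transformable \<rho> q" "transformable \<rho> dl1" and qD: "\<And>t. q t \<in> grad \<Omega> ` H10 \<Omega>"
    and qv: "\<And>t v. v \<in> H10 \<Omega> \<Longrightarrow> q t \<bullet> grad \<Omega> v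
      = f\<tau> t \<bullet> v - broken_poly \<tau> (shift_coeff (shift_coeff c)) t \<bullet> v - grad \<Omega> (broken_poly \<tau> c t) \<bullet> grad \<Omega> v"
    and te: "transformable \<rho> (\<lambda>t. time_deriv 1 u t - broken_poly \<tau> (shift_coeff c) t)"
      "transformable \<rho> (\<lambda>t. grad \<Omega> (u t - broken_poly \<tau> c t))"
    and tf: "transformable \<rho> (\<lambda>t. f t - f\<tau> t)" "transformable \<rho> (time_deriv r f)"
    and main: "energy \<rho> (\<lambda>t. time_deriv 1 u t - broken_poly \<tau> (shift_coeff c) t) + energy \<rho> (\<lambda>t. grad \<Omega> (u t - broken_poly \<tau> c t))
      \<le> (1 + 40 * \<gamma>\<^sup>2) * energy \<rho> q + 20 / \<rho>\<^sup>2 * energy \<rho> dl1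
        + 11 / \<rho>\<^sup>2 * energy \<rho> (\<lambda>t. f t - f\<tau> t) + 8 / \<rho>\<^sup>2 * (1 / \<omega> ^ (2 * r)) * energy \<rho> (time_deriv r f)"
    by (rule leapfrog_error_estimate[where u = u and ?u1.0 = "time_deriv 1 u" and ?u2.0 = "time_deriv 2 u" and f = f and fd = "\<lambda>j. time_deriv j f"
        and F = F and Fr = Fr and r = r and U = U and W = ?FE and c = c and f\<tau> = f\<tau> and ?dl1.0 = dl1 and \<rho> = \<rho> and \<omega> = \<omega> and \<tau> = \<tau> and \<gamma> = \<gamma>,
        OF rho omega tau W \<gamma>0 approx u1 u2 init uV cDu Cr_continuous[OF uC order_refl] cf eq F f0 _ fd0
          Cr_has_derivative[OF fC(1)] cfd Fr UW U0 Ub leap c_def[unfolded Z_def] assms(16) dl1_def])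
      (assumption | simp only: time_deriv.simps(1) | blast)+
  have \<delta>: "grad \<Omega> (broken_deriv \<tau> \<delta> t) = dl1 t" for t
  proof -
    have "\<delta> = broken_poly \<tau> (\<lambda>j n. quad_coeff \<tau> Z j n - c j n)" unfolding assms(21) u\<tau> w by (simp add: broken_poly_diff)
    then have "broken_deriv \<tau> \<delta> t = broken_poly \<tau> (shift_coeff (\<lambda>j n. quad_coeff \<tau> Z j n - c j n)) t"
      by (simp add: broken_deriv_broken_poly[OF tau])
    moreover have "grad \<Omega> (shift_coeff k j n) = shift_coeff (\<lambda>j n. grad \<Omega> (k j n)) j n" for k :: "nat \<Rightarrow> int \<Rightarrow> (real^'n, real) L2" and j n
      by (simp add: shift_coeff_def D_zero)
    moreover have "shift_coeff (\<lambda>j n. quad_coeff \<tau> Z j n - c j n) j n \<in> H10 \<Omega>" for j n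
      by (rule shift_coeff_in_subspace[OF V subspace_diff[OF V qcV cV]])
    ultimately show ?thesis by (simp only: D_broken_poly dl1_def Z_def[symmetric])
  qed
  let ?e1 = "\<lambda>t. time_deriv 1 u t - broken_poly \<tau> (shift_coeff c) t" and ?De = "\<lambda>t. grad \<Omega> (u t - broken_poly \<tau> c t)"
  let ?X = "weighted_square \<rho> ?e1" and ?Y = "weighted_square \<rho> ?De"
  let ?Q = "weighted_square \<rho> q" and ?L = "weighted_square \<rho> dl1" and ?H = "weighted_square \<rho> (\<lambda>t. f t - f\<tau> t)"
    and ?G = "weighted_square \<rho> (time_deriv r f)"
  define c1 c2 c3 c4 where "c1 = 1 + 40 * \<gamma>\<^sup>2" and "c2 = 20 / \<rho>\<^sup>2" and "c3 = 11 / \<rho>\<^sup>2" and "c4 = 8 / \<rho>\<^sup>2 * (1 / \<omega> ^ (2 * r))"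
  have cpos: "0 \<le> c1" "0 \<le> c2" "0 \<le> c3" "0 \<le> c4" using omega by (simp_all add: c1_def c2_def c3_def c4_def)
  note ws = weighted_square_integrable[OF rho]
  have e1: "time_deriv 1 e t = ?e1 t" if "0 \<le> t" "t \<notin> time_nodes \<tau>" for t
  proof -
    have "(e has_vector_derivative ?e1 t) (at t within {0..})" unfolding assms(23) w
      by (intro has_vector_derivative_diff u1 that(1) has_vector_derivative_at_within[OF broken_poly_derivative[OF tau that(2)]])
    then show ?thesis using time_deriv_eq[of t 0 e] that(1) by simp
  qed
  (* the nodes form a null set, so derivatives of w are only compared away from them *)
  have "(\<integral>\<^sup>+t\<in>{0..}. ennreal (((norm (time_deriv 1 e t))\<^sup>2 + (norm (grad \<Omega> (e t)))\<^sup>2) * exp (- 2 * \<rho> * t)) \<partial>lborel)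
      = (\<integral>\<^sup>+t. ennreal (?X t + ?Y t) \<partial>lborel)"
  proof (rule nn_integral_cong_AE, use AE_not_time_node[of \<tau>] in eventually_elim)
    fix t assume t: "t \<notin> time_nodes \<tau>"
    have "grad \<Omega> (e t) = ?De t" by (simp only: assms(23) w)
    then show "ennreal (((norm (time_deriv 1 e t))\<^sup>2 + (norm (grad \<Omega> (e t)))\<^sup>2) * exp (- 2 * \<rho> * t)) * indicator {0..} t
      = ennreal (?X t + ?Y t)"
      using e1[OF _ t] by (cases "0 \<le> t") (simp_all add: weighted_square_def distrib_right)
  qed
  also have "\<dots> = ennreal (energy \<rho> ?e1 + energy \<rho> ?De)"
    unfolding energy_eq_integral
    by (subst Bochner_Integration.integral_add[symmetric, OF ws[OF te(1)] ws[OF te(2)]], rule nn_integral_eq_integral)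
      (intro Bochner_Integration.integrable_add ws te, simp add: weighted_square_nonneg)
  also have "\<dots> \<le> ennreal (c1 * energy \<rho> q + c2 * energy \<rho> dl1 + c3 * energy \<rho> (\<lambda>t. f t - f\<tau> t) + c4 * energy \<rho> (time_deriv r f))"
    using main unfolding c1_def c2_def c3_def c4_def by (rule ennreal_leI)
  also have "\<dots> = ennreal (\<integral>t. c1 * ?Q t + c2 * ?L t + c3 * ?H t + c4 * ?G t \<partial>lborel)"
    unfolding energy_eq_integral by (simp add: ws tq tf)
  also have "\<dots> = (\<integral>\<^sup>+t. ennreal (c1 * ?Q t + c2 * ?L t + c3 * ?H t + c4 * ?G t) \<partial>lborel)"
    by (rule nn_integral_eq_integral[symmetric])
      (intro Bochner_Integration.integrable_add integrable_mult_right ws tq tf, simp add: cpos weighted_square_nonneg)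
  also have "\<dots> \<le> (\<integral>\<^sup>+t\<in>{0..}. ((\<R> t)\<^sup>2
            + ennreal (20 / \<rho>\<^sup>2 * (norm (grad \<Omega> (broken_deriv \<tau> \<delta> t)))\<^sup>2)
            + 40 * (approx_factor_cutoff \<Omega> \<T> k \<rho> \<omega>)\<^sup>2 * (\<R> t)\<^sup>2
            + ennreal (11 / \<rho>\<^sup>2 * (norm (\<eta> t))\<^sup>2)
            + ennreal (8 / \<rho>\<^sup>2 * (1 / \<omega> ^ (2 * r)) * (norm (time_deriv r f t))\<^sup>2))
            * ennreal (exp (- 2 * \<rho> * t)) \<partial>lborel)"
  proof (rule nn_integral_mono_AE, use AE_not_time_node[of \<tau>] in eventually_elim)
    fix t assume t: "t \<notin> time_nodes \<tau>"
    show "ennreal (c1 * ?Q t + c2 * ?L t + c3 * ?H t + c4 * ?G t)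
      \<le> ((\<R> t)\<^sup>2
            + ennreal (20 / \<rho>\<^sup>2 * (norm (grad \<Omega> (broken_deriv \<tau> \<delta> t)))\<^sup>2)
            + 40 * (approx_factor_cutoff \<Omega> \<T> k \<rho> \<omega>)\<^sup>2 * (\<R> t)\<^sup>2
            + ennreal (11 / \<rho>\<^sup>2 * (norm (\<eta> t))\<^sup>2)
            + ennreal (8 / \<rho>\<^sup>2 * (1 / \<omega> ^ (2 * r)) * (norm (time_deriv r f t))\<^sup>2))
            * ennreal (exp (- 2 * \<rho> * t)) * indicator {0..} t"
    proof (cases "0 \<le> t")
      case True
      (* the representer of the residual bounds its dual norm from below *)
      have "ennreal (norm (q t)) \<le> \<R> t" unfolding assms(24)
      proof (rule norm_le_dual_norm[OF qD])
        fix v :: "(real^'n, real) L2" assume "v \<in> H10 \<Omega>"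
        then show "residual \<Omega> f\<tau> w t v = q t \<bullet> grad \<Omega> v"
          by (simp add: residual_def qv w time_deriv_broken_poly[OF tau True t])
      qed
      from residual_terms_le[OF norm_ge_zero \<gamma>0 _ _ _ _ this, of "c2 * (norm (dl1 t))\<^sup>2" "c3 * (norm (f t - f\<tau> t))\<^sup>2"
          "c4 * (norm (time_deriv r f t))\<^sup>2" "exp (- 2 * \<rho> * t)"] cpos
      show ?thesis unfolding \<gamma> \<delta> assms(22) c2_def[symmetric] c3_def[symmetric] c4_def[symmetric]
        using True by (simp add: weighted_square_def c1_def algebra_simps)
    qed (simp add: weighted_square_def)
  qed
  finally show ?thesis .
qed

end
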